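(* Let $u\in W^{2k+2,\infty}(\Omega)$ be the solution of $u_t=u_{xx}$, $u(x,0)=u_0(x)$, let $q=u_x$, and let $u_h,q_h$ be the solution of the LDG scheme with flux choice (I) or (II). Suppose the initial solution is $u_h(\cdot,0)=u_I^k(\cdot,0)$, with $u_I^k$ the interpolation function (with $l=k$) corresponding to the flux choice used. Then for both the periodic and mixed boundary conditions, $$e_{u,n}\lesssim(1+t)h^{2k+\frac12}\|u\|_{2k+2,\infty},\qquad e_{q,n}\lesssim(1+t^{\frac12})h^{2k+\frac12}\|u\|_{2k+2,\infty},$$ $$\|e_u\|_*\lesssim(1+t)h^{2k+1}\|u\|_{2k+2,\infty},\qquad \|e_q\|_*\lesssim(1+t^{\frac12})h^{2k+1}\|u\|_{2k+2,\infty},$$ where $$e_{u,n}=\max_{1\le j\le N+1}\left|(u-\hat u_h)(x_{j-\frac12},t)\right|,\qquad \|e_u\|_*=\left(\frac1{N+1}\sum_{j=1}^{N+1}(u-\hat u_h)^2(x_{j-\frac12},t)\right)^{\frac12},$$ $$e_{q,n}=\max_{1\le j\le N+1}\left|(q-\hat q_h)(x_{j-\frac12},t)\right|,\qquad \|e_q\|_*=\left(\frac1{N+1}\sum_{j=1}^{N+1}(q-\hat q_h)^2(x_{j-\frac12},t)\right)^{\frac12},$$ and $\hat u_h,\hat q_h$ are the numerical fluxes of the choice used.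
   Context: Equation: $u_t=u_{xx}$, $(x,t)\in[0,2\pi]\times(0,T]$, $u(x,0)=u_0(x)$, with $u_0$ sufficiently smooth; $\Omega=[0,2\pi]$. Boundary conditions: periodic, $u(0,t)=u(2\pi,t)$; or mixed, $u(0,t)=g_0(t),\,u_x(2\pi,t)=g_1(t)$, or $u_x(0,t)=g_0(t),\,u(2\pi,t)=g_1(t)$. Norms: $\|\cdot\|_{m,\infty}$ is the $W^{m,\infty}(\Omega)$ norm in $x$, with $\|u\|_{m,\infty}$ taken uniformly in time (supremum over $[0,T]$). $A\lesssim B$ means $A\le CB$ with $C$ independent of the mesh size $h$ (and of $t\in[0,T]$). Mesh: $0=x_{\frac12}<\cdots<x_{N+\frac12}=2\pi$, $\tau_j=(x_{j-\frac12},x_{j+\frac12})$, $x_j$ the midpoint, $h_j=x_{j+\frac12}-x_{j-\frac12}$, $\bar h_j=h_j/2$, $h=\max_jh_j$, quasi-uniform ($h\le ch_j$ for all $j$). $V_h=\{v: v|_{\tau_j}\in P_k(\tau_j),\ 1\le j\le N\}$, $P_k$ the polynomials in $x$ of degree at most $k$ with coefficients that may depend on $t$ (here $k\ge1$); $(u,v)_j=\int_{\tau_j}uv\,dx$; $v^\mp|_{j+\frac12}$ are the left/right limits at $x_{j+\frac12}$. LDG scheme: find $u_h,q_h\in V_h$ such that for all $v,w\in V_h$ and all $j$, $(u_{ht},v)_j=-(q_h,v_x)_j+\hat q_hv^-|_{j+\frac12}-\hat q_hv^+|_{j-\frac12}$, $\ (q_h,w)_j=-(u_h,w_x)_j+\hat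 u_hw^-|_{j+\frac12}-\hat u_hw^+|_{j-\frac12}$. Flux choice (I): $\hat u_h=u_h^-$, $\hat q_h=q_h^+$. Flux choice (II): $\hat u_h=u_h^+$, $\hat q_h=q_h^-$. Both are used for the periodic condition (with periodic identification of one-sided limits at $x_{\frac12}$ and $x_{N+\frac12}$); (I) is used for $u(0,t)=g_0,u_x(2\pi,t)=g_1$ (with $u_h^-|_{\frac12}=g_0$, $q_h^+|_{N+\frac12}=g_1$); (II) is used for $u_x(0,t)=g_0,u(2\pi,t)=g_1$ (with $q_h^-|_{\frac12}=g_0$, $u_h^+|_{N+\frac12}=g_1$). Legendre polynomials: $L_{j,m}(x)=L_m((x-x_j)/\bar h_j)$ on $\tau_j$, $L_m$ standard Legendre. Gauss-Radau projections onto $V_h$: $(P_h^\mp v,w)_j=(v,w)_j$ for all $w\in P_{k-1}(\tau_j)$, with $P_h^-v(x_{j+\frac12}^-)=v(x_{j+\frac12}^-)$ and $P_h^+v(x_{j-\frac12}^+)=v(x_{j-\frac12}^+)$. $D_s^{-1}v(x)=\frac1{\bar h_j}\int_{x_{j-\frac12}}^xv(x')\,dx'$, $x\in\tau_j$. On each $\tau_j$: $F_{1,1}=P_h^+D_s^{-1}L_{j,k}$, $F_{2,1}=P_h^-D_s^{-1}L_{j,k}$, $F_{1,i+1}=P_h^+D_s^{-1}P_h^-D_s^{-1}F_{1,i}$, $F_{2,i+1}=P_h^-D_s^{-1}P_h^+D_s^{-1}F_{2,i}$ ($i\ge1$), $\bar F_{1,i}=P_h^-D_s^{-1}F_{1,i}$,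 $\bar F_{2,i}=P_h^+D_s^{-1}F_{2,i}$ ($1\le i\le\lfloor k/2\rfloor$). Coefficients: $\bar v_{j,k}(t)=-v(x^-_{j+\frac12},t)+\frac1{h_j}\int_{\tau_j}v\sum_{m=0}^k(2m+1)L_{j,m}\,dx$, $\ \tilde v_{j,k}(t)=(-1)^{k+1}v(x^+_{j-\frac12},t)+\frac1{h_j}\int_{\tau_j}v\sum_{m=0}^k(-1)^{k+m}(2m+1)L_{j,m}\,dx$. Interpolation function $u_I^l$ ($1\le l\le k$) for choice (I): on $\tau_j$, $G_i=\frac{d^i}{dt^i}\bar u_{j,k}$, $Q_i=\frac{d^i}{dt^i}\tilde q_{j,k}$; $\bar w_{1,i}=\bar h_j^{2i}G_i\bar F_{1,i}$, $w_{2,i}=\bar h_j^{2i-1}Q_{i-1}F_{2,i}$; $W_2^l=\sum_{i=1}^{\lfloor l/2\rfloor}\bar w_{1,i}+\sum_{i=1}^{\lceil l/2\rceil}w_{2,i}$ in each $\tau_j$; $u_I^l=P_h^-u-W_2^l$. Interpolation function $u_I^l$ for choice (II): on $\tau_j$, $G_i=\frac{d^i}{dt^i}\tilde u_{j,k}$, $Q_i=\frac{d^i}{dt^i}\bar q_{j,k}$; $w_{1,i}=\bar h_j^{2i-1}Q_{i-1}F_{1,i}$, $\bar w_{2,i}=\bar h_j^{2i}G_i\bar F_{2,i}$; $W_2^l=\sum_{i=1}^{\lceil l/2\rceil}w_{1,i}+\sum_{i=1}^{\lfloor l/2\rfloor}\bar w_{2,i}$ in each $\tau_j$; $u_I^l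=P_h^+u-W_2^l$.
   Formalization: The periodic boundary condition is taken to include u_x(0,t)=u_x(2π,t) besides u(0,t)=u(2π,t); with the latter alone u=e^{-t/4}sin(x/2) is a counterexample, since the periodic flux of q_h is equal at both ends. *)

theory Defs
  imports
    "HOL-Analysis.Analysis"
    "HOL-Probability.Essential_Supremum"
    "HOL-Computational_Algebra.Polynomial"
begin

section \<open>The Sobolev space of order m and exponent infinity on (0, 2 pi)\<close>

abbreviation Omega_M :: "real measure" where
  "Omega_M \<equiv> lebesgue_on {0<..<2 * pi}"

definition Linf_norm :: "(real \<Rightarrow> real) \<Rightarrow> ereal" where
  "Linf_norm f = esssup Omega_M (\<lambda>x. ereal \<bar>f x\<bar>)"

text \<open>Measurability is demanded separately, since \<^const>\<open>Linf_norm\<close> only sees the absolute value.\<close>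

definition in_Linf :: "(real \<Rightarrow> real) \<Rightarrow> bool" where
  "in_Linf f \<longleftrightarrow> f \<in> borel_measurable Omega_M \<and> Linf_norm f < \<infinity>"

text \<open>Test functions for a weak derivative of order i: i times continuously differentiable,
  with compact support in (0, 2 pi).\<close>

definition test_function :: "nat \<Rightarrow> (real \<Rightarrow> real) \<Rightarrow> bool" where
  "test_function i \<phi> \<longleftrightarrow>
     (\<forall>m<i. \<forall>x. (deriv ^^ m) \<phi> differentiable (at x)) \<and>
     continuous_on UNIV ((deriv ^^ i) \<phi>) \<and>
     (\<exists>a b. 0 < a \<and> b < 2 * pi \<and> (\<forall>x. x \<notin> {a..b} \<longrightarrow> \<phi> x = 0))"

definition has_weak_deriv :: "nat \<Rightarrow> (real \<Rightarrow> real) \<Rightarrow> (real \<Rightarrow> real) \<Rightarrow> bool" where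
  "has_weak_deriv i f g \<longleftrightarrow>
     (\<forall>\<phi>. test_function i \<phi> \<longrightarrow>
        (\<integral>x. f x * (deriv ^^ i) \<phi> x \<partial>Omega_M) = (- 1) ^ i * (\<integral>x. g x * \<phi> x \<partial>Omega_M))"

definition in_Winf :: "nat \<Rightarrow> (real \<Rightarrow> real) \<Rightarrow> bool" where
  "in_Winf m f \<longleftrightarrow> in_Linf f \<and> (\<forall>i\<le>m. \<exists>g. in_Linf g \<and> has_weak_deriv i f g)"

text \<open>Unique up to null sets, so the choice does not affect the norm below.\<close>

definition weak_deriv :: "nat \<Rightarrow> (real \<Rightarrow> real) \<Rightarrow> real \<Rightarrow> real" where
  "weak_deriv i f = (SOME g. in_Linf g \<and> has_weak_deriv i f g)"

definition Winf_norm :: "nat \<Rightarrow> (real \<Rightarrow> real) \<Rightarrow> real" where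
  "Winf_norm m f = (MAX i\<in>{..m}. real_of_ereal (Linf_norm (weak_deriv i f)))"

text \<open>Functions of time and space are written \<open>u t x\<close>.\<close>

definition Winf_uniform :: "nat \<Rightarrow> real \<Rightarrow> (real \<Rightarrow> real \<Rightarrow> real) \<Rightarrow> bool" where
  "Winf_uniform m T u \<longleftrightarrow>
     (\<forall>t\<in>{0..T}. in_Winf m (u t)) \<and> bdd_above ((\<lambda>t. Winf_norm m (u t)) ` {0..T})"

definition Winf_sup_norm :: "nat \<Rightarrow> real \<Rightarrow> (real \<Rightarrow> real \<Rightarrow> real) \<Rightarrow> real" where
  "Winf_sup_norm m T u = (SUP t\<in>{0..T}. Winf_norm m (u t))"

section \<open>The heat equation\<close>

text \<open>Classical derivatives on the closed intervals; one-sided at the end points.\<close>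

definition dt :: "real \<Rightarrow> (real \<Rightarrow> real) \<Rightarrow> real \<Rightarrow> real" where
  "dt T f t = vector_derivative f (at t within {0..T})"

definition dx :: "(real \<Rightarrow> real) \<Rightarrow> real \<Rightarrow> real" where
  "dx f x = vector_derivative f (at x within {0..2 * pi})"

definition heat_solution :: "real \<Rightarrow> (real \<Rightarrow> real) \<Rightarrow> (real \<Rightarrow> real \<Rightarrow> real) \<Rightarrow> bool" where
  "heat_solution T u0 u \<longleftrightarrow>
     continuous_on ({0..T} \<times> {0..2 * pi}) (\<lambda>(t, x). u t x) \<and>
     (\<forall>x\<in>{0..2 * pi}. u 0 x = u0 x) \<and>
     (\<forall>t\<in>{0<..T}. \<forall>x\<in>{0..2 * pi}.
        u t differentiable (at x within {0..2 * pi}) \<and>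
        dx (u t) differentiable (at x within {0..2 * pi}) \<and>
        ((\<lambda>s. u s x) has_vector_derivative dx (dx (u t)) x) (at t within {0..T}))"

datatype flux = FluxI | FluxII

text \<open>The meaning of the mixed data \<open>g0\<close>, \<open>g1\<close> depends on the flux choice: the first one uses
  \<open>u(0,t) = g0\<close>, \<open>u_x(2 pi,t) = g1\<close>, the second one \<open>u_x(0,t) = g0\<close>, \<open>u(2 pi,t) = g1\<close>.\<close>

datatype bc = Periodic | Mixed "real \<Rightarrow> real" "real \<Rightarrow> real"

text \<open>Periodicity of \<open>u\<close> includes that of the flux \<open>u_x\<close>: equality of the values of \<open>u\<close> alone does
  not determine a solution of the second-order equation, and the periodic identification of the
  one-sided limits of \<open>q_h\<close> in the scheme is consistent only with \<open>u_x(0,t) = u_x(2 pi,t)\<close>.\<close>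

fun boundary_cond :: "real \<Rightarrow> flux \<Rightarrow> bc \<Rightarrow> (real \<Rightarrow> real \<Rightarrow> real) \<Rightarrow> bool" where
  "boundary_cond T fl Periodic u \<longleftrightarrow>
     (\<forall>t\<in>{0..T}. u t 0 = u t (2 * pi) \<and> dx (u t) 0 = dx (u t) (2 * pi))"
| "boundary_cond T FluxI (Mixed g0 g1) u \<longleftrightarrow>
     (\<forall>t\<in>{0..T}. u t 0 = g0 t \<and> dx (u t) (2 * pi) = g1 t)"
| "boundary_cond T FluxII (Mixed g0 g1) u \<longleftrightarrow>
     (\<forall>t\<in>{0..T}. dx (u t) 0 = g0 t \<and> u t (2 * pi) = g1 t)"

section \<open>Meshes and piecewise polynomials\<close>

text \<open>\<open>X i\<close> is the node \<open>x_{i+1/2}\<close> for \<open>i = 0, ..., N\<close>; the cell \<open>\<tau>_j\<close>, \<open>j = 1, ..., N\<close>, has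
  end points \<open>X (j - 1)\<close> and \<open>X j\<close>.\<close>

definition cell :: "(nat \<Rightarrow> real) \<Rightarrow> nat \<Rightarrow> real set" where
  "cell X j = {X (j - 1)..X j}"

definition hlen :: "(nat \<Rightarrow> real) \<Rightarrow> nat \<Rightarrow> real" where
  "hlen X j = X j - X (j - 1)"

definition hbar :: "(nat \<Rightarrow> real) \<Rightarrow> nat \<Rightarrow> real" where
  "hbar X j = hlen X j / 2"

definition midpt :: "(nat \<Rightarrow> real) \<Rightarrow> nat \<Rightarrow> real" where
  "midpt X j = (X (j - 1) + X j) / 2"

definition mesh_size :: "nat \<Rightarrow> (nat \<Rightarrow> real) \<Rightarrow> real" where
  "mesh_size N X = (MAX j\<in>{1..N}. hlen X j)"

definition quasi_uniform_mesh :: "real \<Rightarrow> nat \<Rightarrow> (nat \<Rightarrow> real) \<Rightarrow> bool" where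
  "quasi_uniform_mesh c N X \<longleftrightarrow>
     1 \<le> N \<and> X 0 = 0 \<and> X N = 2 * pi \<and> (\<forall>i<N. X i < X (Suc i)) \<and>
     (\<forall>j\<in>{1..N}. mesh_size N X \<le> c * hlen X j)"

text \<open>An element of \<open>V_h\<close> is the family of its polynomial pieces \<open>v j\<close>, \<open>j = 1, ..., N\<close>. Its
  one-sided limits are therefore values of the adjacent pieces: the left limit at \<open>x_{j+1/2}\<close> is
  \<open>poly (v j) (X j)\<close>, the right limit at \<open>x_{j-1/2}\<close> is \<open>poly (v j) (X (j - 1))\<close>.\<close>

definition Vh :: "nat \<Rightarrow> nat \<Rightarrow> (nat \<Rightarrow> real poly) set" where
  "Vh k N = {v. \<forall>j\<in>{1..N}. degree (v j) \<le> k}"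

definition ip :: "(nat \<Rightarrow> real) \<Rightarrow> nat \<Rightarrow> (real \<Rightarrow> real) \<Rightarrow> (real \<Rightarrow> real) \<Rightarrow> real" where
  "ip X j f g = integral (cell X j) (\<lambda>x. f x * g x)"

section \<open>The LDG scheme\<close>

text \<open>Left and right limits of \<open>v\<close> at the node \<open>X i\<close>, \<open>0 \<le> i \<le> N\<close>. The limit from outside the
  domain is the periodic one or the prescribed boundary value.\<close>

definition trace_minus :: "nat \<Rightarrow> (nat \<Rightarrow> real) \<Rightarrow> bc \<Rightarrow> real \<Rightarrow> (nat \<Rightarrow> real poly) \<Rightarrow> nat \<Rightarrow> real" where
  "trace_minus N X b t v i =
     (if i = 0 then (case b of Periodic \<Rightarrow> poly (v N) (X N) | Mixed g0 g1 \<Rightarrow> g0 t)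
      else poly (v i) (X i))"

definition trace_plus :: "nat \<Rightarrow> (nat \<Rightarrow> real) \<Rightarrow> bc \<Rightarrow> real \<Rightarrow> (nat \<Rightarrow> real poly) \<Rightarrow> nat \<Rightarrow> real" where
  "trace_plus N X b t v i =
     (if i = N then (case b of Periodic \<Rightarrow> poly (v 1) (X 0) | Mixed g0 g1 \<Rightarrow> g1 t)
      else poly (v (Suc i)) (X i))"

fun uhat :: "flux \<Rightarrow> nat \<Rightarrow> (nat \<Rightarrow> real) \<Rightarrow> bc \<Rightarrow> real \<Rightarrow> (nat \<Rightarrow> real poly) \<Rightarrow> nat \<Rightarrow> real" where
  "uhat FluxI = trace_minus"
| "uhat FluxII = trace_plus"

fun qhat :: "flux \<Rightarrow> nat \<Rightarrow> (nat \<Rightarrow> real) \<Rightarrow> bc \<Rightarrow> real \<Rightarrow> (nat \<Rightarrow> real poly) \<Rightarrow> nat \<Rightarrow> real" where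
  "qhat FluxI = trace_plus"
| "qhat FluxII = trace_minus"

definition ldg_solution ::
  "nat \<Rightarrow> real \<Rightarrow> flux \<Rightarrow> bc \<Rightarrow> nat \<Rightarrow> (nat \<Rightarrow> real) \<Rightarrow>
   (real \<Rightarrow> nat \<Rightarrow> real poly) \<Rightarrow> (real \<Rightarrow> nat \<Rightarrow> real poly) \<Rightarrow> bool" where
  "ldg_solution k T fl b N X uh qh \<longleftrightarrow>
     (\<forall>t\<in>{0..T}. uh t \<in> Vh k N \<and> qh t \<in> Vh k N) \<and>
     (\<forall>t\<in>{0..T}. \<forall>j\<in>{1..N}. \<forall>x\<in>cell X j.
        (\<lambda>s. poly (uh s j) x) differentiable (at t within {0..T})) \<and>
     (\<forall>t\<in>{0..T}. \<forall>v\<in>Vh k N. \<forall>w\<in>Vh k N. \<forall>j\<in>{1..N}.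
        ip X j (\<lambda>x. dt T (\<lambda>s. poly (uh s j) x) t) (poly (v j)) =
          - ip X j (poly (qh t j)) (poly (pderiv (v j)))
          + qhat fl N X b t (qh t) j * poly (v j) (X j)
          - qhat fl N X b t (qh t) (j - 1) * poly (v j) (X (j - 1)) \<and>
        ip X j (poly (qh t j)) (poly (w j)) =
          - ip X j (poly (uh t j)) (poly (pderiv (w j)))
          + uhat fl N X b t (uh t) j * poly (w j) (X j)
          - uhat fl N X b t (uh t) (j - 1) * poly (w j) (X (j - 1)))"

section \<open>Legendre polynomials and Gauss-Radau projections\<close>

text \<open>Rodrigues' formula.\<close>

definition legendre_poly :: "nat \<Rightarrow> real poly" where
  "legendre_poly m = smult (1 / (2 ^ m * fact m)) ((pderiv ^^ m) ([:- 1, 0, 1:] ^ m))"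

definition legendre_cell :: "(nat \<Rightarrow> real) \<Rightarrow> nat \<Rightarrow> nat \<Rightarrow> real \<Rightarrow> real" where
  "legendre_cell X j m x = poly (legendre_poly m) ((x - midpt X j) / hbar X j)"

definition radau_minus :: "nat \<Rightarrow> (nat \<Rightarrow> real) \<Rightarrow> nat \<Rightarrow> (real \<Rightarrow> real) \<Rightarrow> real poly" where
  "radau_minus k X j v = (THE p. degree p \<le> k \<and>
     (\<forall>w. degree w \<le> k - 1 \<longrightarrow> ip X j (poly p) (poly w) = ip X j v (poly w)) \<and>
     poly p (X j) = Lim (at_left (X j)) v)"

definition radau_plus :: "nat \<Rightarrow> (nat \<Rightarrow> real) \<Rightarrow> nat \<Rightarrow> (real \<Rightarrow> real) \<Rightarrow> real poly" where
  "radau_plus k X j v = (THE p. degree p \<le> k \<and>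
     (\<forall>w. degree w \<le> k - 1 \<longrightarrow> ip X j (poly p) (poly w) = ip X j v (poly w)) \<and>
     poly p (X (j - 1)) = Lim (at_right (X (j - 1))) v)"

definition Dsinv :: "(nat \<Rightarrow> real) \<Rightarrow> nat \<Rightarrow> (real \<Rightarrow> real) \<Rightarrow> real \<Rightarrow> real" where
  "Dsinv X j v x = 1 / hbar X j * integral {X (j - 1)..x} v"

section \<open>The interpolation function\<close>

text \<open>The sequences start at index 1; the value at 0 is a dummy and never used.\<close>

fun F1 :: "nat \<Rightarrow> (nat \<Rightarrow> real) \<Rightarrow> nat \<Rightarrow> nat \<Rightarrow> real poly" where
  "F1 k X j 0 = 0"
| "F1 k X j (Suc 0) = radau_plus k X j (Dsinv X j (legendre_cell X j k))"
| "F1 k X j (Suc (Suc i)) =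
     radau_plus k X j (Dsinv X j (poly (radau_minus k X j (Dsinv X j (poly (F1 k X j (Suc i)))))))"

fun F2 :: "nat \<Rightarrow> (nat \<Rightarrow> real) \<Rightarrow> nat \<Rightarrow> nat \<Rightarrow> real poly" where
  "F2 k X j 0 = 0"
| "F2 k X j (Suc 0) = radau_minus k X j (Dsinv X j (legendre_cell X j k))"
| "F2 k X j (Suc (Suc i)) =
     radau_minus k X j (Dsinv X j (poly (radau_plus k X j (Dsinv X j (poly (F2 k X j (Suc i)))))))"

definition F1bar :: "nat \<Rightarrow> (nat \<Rightarrow> real) \<Rightarrow> nat \<Rightarrow> nat \<Rightarrow> real poly" where
  "F1bar k X j i = radau_minus k X j (Dsinv X j (poly (F1 k X j i)))"

definition F2bar :: "nat \<Rightarrow> (nat \<Rightarrow> real) \<Rightarrow> nat \<Rightarrow> nat \<Rightarrow> real poly" where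
  "F2bar k X j i = radau_plus k X j (Dsinv X j (poly (F2 k X j i)))"

definition coeff_bar :: "nat \<Rightarrow> (nat \<Rightarrow> real) \<Rightarrow> nat \<Rightarrow> (real \<Rightarrow> real) \<Rightarrow> real" where
  "coeff_bar k X j v = - Lim (at_left (X j)) v
     + 1 / hlen X j *
       integral (cell X j) (\<lambda>x. v x * (\<Sum>m=0..k. (2 * real m + 1) * legendre_cell X j m x))"

definition coeff_tilde :: "nat \<Rightarrow> (nat \<Rightarrow> real) \<Rightarrow> nat \<Rightarrow> (real \<Rightarrow> real) \<Rightarrow> real" where
  "coeff_tilde k X j v = (- 1) ^ (k + 1) * Lim (at_right (X (j - 1))) v
     + 1 / hlen X j *
       integral (cell X j)
         (\<lambda>x. v x * (\<Sum>m=0..k. (- 1) ^ (k + m) * (2 * real m + 1) * legendre_cell X j m x))"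

text \<open>The correction \<open>W_2^l\<close>; \<open>l div 2\<close> and \<open>(l + 1) div 2\<close> are the floor and ceiling of \<open>l / 2\<close>,
  and \<open>q = u_x\<close>.\<close>

fun W2 :: "flux \<Rightarrow> nat \<Rightarrow> nat \<Rightarrow> real \<Rightarrow> (nat \<Rightarrow> real) \<Rightarrow> (real \<Rightarrow> real \<Rightarrow> real) \<Rightarrow> real \<Rightarrow> nat \<Rightarrow> real poly"
where
  "W2 FluxI k l T X u t j =
     (\<Sum>i=1..l div 2. smult (hbar X j ^ (2 * i) *
        (dt T ^^ i) (\<lambda>s. coeff_bar k X j (u s)) t) (F1bar k X j i)) +
     (\<Sum>i=1..(l + 1) div 2. smult (hbar X j ^ (2 * i - 1) *
        (dt T ^^ (i - 1)) (\<lambda>s. coeff_tilde k X j (dx (u s))) t) (F2 k X j i))"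
| "W2 FluxII k l T X u t j =
     (\<Sum>i=1..(l + 1) div 2. smult (hbar X j ^ (2 * i - 1) *
        (dt T ^^ (i - 1)) (\<lambda>s. coeff_bar k X j (dx (u s))) t) (F1 k X j i)) +
     (\<Sum>i=1..l div 2. smult (hbar X j ^ (2 * i) *
        (dt T ^^ i) (\<lambda>s. coeff_tilde k X j (u s)) t) (F2bar k X j i))"

fun uI :: "flux \<Rightarrow> nat \<Rightarrow> nat \<Rightarrow> real \<Rightarrow> (nat \<Rightarrow> real) \<Rightarrow> (real \<Rightarrow> real \<Rightarrow> real) \<Rightarrow> real \<Rightarrow> nat \<Rightarrow> real poly"
where
  "uI FluxI k l T X u t j = radau_minus k X j (u t) - W2 FluxI k l T X u t j"
| "uI FluxII k l T X u t j = radau_plus k X j (u t) - W2 FluxII k l T X u t j"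

section \<open>Errors at the nodes\<close>

text \<open>\<open>f\<close> is the exact function and \<open>fhat i\<close> the numerical flux at the node \<open>X i\<close>.\<close>

definition node_max_err :: "nat \<Rightarrow> (nat \<Rightarrow> real) \<Rightarrow> (real \<Rightarrow> real) \<Rightarrow> (nat \<Rightarrow> real) \<Rightarrow> real" where
  "node_max_err N X f fhat = (MAX j\<in>{1..N + 1}. \<bar>f (X (j - 1)) - fhat (j - 1)\<bar>)"

definition node_l2_err :: "nat \<Rightarrow> (nat \<Rightarrow> real) \<Rightarrow> (real \<Rightarrow> real) \<Rightarrow> (nat \<Rightarrow> real) \<Rightarrow> real" where
  "node_l2_err N X f fhat =
     sqrt (1 / real (N + 1) * (\<Sum>j=1..N + 1. (f (X (j - 1)) - fhat (j - 1))\<^sup>2))"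

end

(* Proof idea. The difference between the interpolation functions of (u, q) and the discrete solution
   satisfies the LDG equations up to residuals r and B' that come from the last correction term only;
   r involves D^(2k+2) u and B involves D^(2k+1) u, both with the factor h^(2k+1). Since B' would cost
   one more derivative, the error is tested with the solution of the discrete dual heat equation, and
   the time derivative is moved from B to the dual solution, whose smoothing is measured by a Lyapunov
   function. The singular kernels that arise are integrable because of the Hoelder continuity in time
   of r and B in the mesh-dependent L2 norm. That continuity follows from interior derivative bounds
   for D^(2k+1) u (Bernstein's method, applied to a mollification in x), which degenerate at the
   boundary and at t = 0 only in an integrable way, whatever the boundary data are. The interpolation
   functions agree with u and q at the nodes of the fluxes, so trace inequalities for the polynomial
   difference give the bounds at the nodes. *)

theory Submission
  imports Defs
begin

section \<open>Legendre polynomials\<close>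

text \<open>The obstacle is that no smoothness of the boundary data is assumed and u is controlled
  only up to order 2k+2, so the error equations cannot be differentiated in time. For u the dual
  kernels are (t-s)^(-1/2) for r and (t-s)^(-1) for B(s) - B(t), and a modulus (t-s)^(1/2) of B
  suffices. For q both kernels are worse by (t-s)^(-1/2); boundedness of r and the same modulus of B
  would leave (t-s)^(-1), which just fails to be integrable, so any gain of a positive power is
  enough. At distance d from the boundary, increments of the derivative of order 2k+2 over a time
  step \<tau> behave like min(1, \<tau>/d^2), hence are at most \<tau>^\<theta> d^(-2\<theta>).
  Square integrability in x requires \<theta> < 1/4. The choice \<theta> = 1/8 is the origin of the
  exponents 1/8, 5/8 = 1/2 + 1/8 and -1/4, and it leaves the integrable kernel (t-s)^(-7/8).\<close>

lemma poly_fun: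
  fixes p q :: "real poly"
  shows "poly (p * q) = (\<lambda>x. poly p x * poly q x)" "poly (p + q) = (\<lambda>x. poly p x + poly q x)"
    "poly (p - q) = (\<lambda>x. poly p x - poly q x)" "poly (smult c p) = (\<lambda>x. c * poly p x)"
    "poly (sum f I) = (\<lambda>x. \<Sum>i\<in>I. poly (f i) x)" "poly (0 :: real poly) = (\<lambda>x. 0)"
  by (auto simp: poly_sum)

declare poly_fun(6) [simp]

lemma poly_has_integral:
  fixes p :: "real poly"
  assumes "a \<le> b" shows "(poly (pderiv p) has_integral (poly p b - poly p a)) {a..b}"
  by (rule fundamental_theorem_of_calculus[OF assms])
    (metis poly_DERIV has_real_derivative_iff_has_vector_derivative DERIV_subset subset_UNIV)

lemma poly_integrable [simp]: "poly p integrable_on {a..b::real}"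
  by (intro integrable_continuous_real continuous_intros)

lemma integral_pderiv:
  fixes p :: "real poly"
  assumes "a \<le> b" shows "integral {a..b} (poly (pderiv p)) = poly p b - poly p a"
  using poly_has_integral[OF assms] by (rule integral_unique)

lemma integral_by_parts_poly:
  fixes p q :: "real poly"
  assumes "a \<le> b"
  shows "integral {a..b} (poly (pderiv p * q)) =
    poly p b * poly q b - poly p a * poly q a - integral {a..b} (poly (p * pderiv q))"
proof -
  have "integral {a..b} (poly (pderiv (p * q))) = poly (p * q) b - poly (p * q) a"
    by (rule integral_pderiv[OF assms])
  moreover have "poly (pderiv (p * q)) = (\<lambda>x. poly (pderiv p * q) x + poly (p * pderiv q) x)"
    by (auto simp: pderiv_mult algebra_simps)
  moreover have "integral {a..b} (\<lambda>x. poly (pderiv p * q) x + poly (p * pderiv q) x) =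
     integral {a..b} (poly (pderiv p * q)) + integral {a..b} (poly (p * pderiv q))"
    by (rule integral_add) (rule poly_integrable)+
  ultimately show ?thesis by simp
qed

text \<open>At \<open>a\<close> only the term in which all derivatives fall on the power survives.
  The cofactor \<open>g\<close> is arbitrary because one differentiation reproduces the same form
  with exponent \<open>n\<close> and a new cofactor.\<close>

lemma pderiv_funpow_linear_power:
  fixes g :: "real poly"
  shows "poly ((pderiv ^^ n) ([:- a, 1:] ^ n * g)) a = fact n * poly g a"
proof (induction n arbitrary: g)
  case (Suc n)
  have "pderiv ([:- a, 1:] ^ Suc n * g) =
      [:- a, 1:] ^ n * (smult (of_nat (Suc n)) g + [:- a, 1:] * pderiv g)"
    unfolding pderiv_mult pderiv_power_Suc
    by (simp add: algebra_simps pderiv_pCons smult_add_left)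
  then have "(pderiv ^^ Suc n) ([:- a, 1:] ^ Suc n * g) =
     (pderiv ^^ n) ([:- a, 1:] ^ n * (smult (of_nat (Suc n)) g + [:- a, 1:] * pderiv g))"
    by (simp del: funpow.simps add: funpow_Suc_right)
  then show ?case
    by (simp only: Suc) (simp add: algebra_simps)
qed simp

lemma pderiv_funpow_linear_power_root:
  fixes g :: "real poly"
  shows "m < n \<Longrightarrow> poly ((pderiv ^^ m) ([:- a, 1:] ^ n * g)) a = 0"
proof -
  assume mn: "m < n"
  have "[:- a, 1:] ^ n * g = [:- a, 1:] ^ m * ([:- a, 1:] ^ (n - m) * g)"
    using mn by (simp add: mult.assoc[symmetric] power_add[symmetric])
  then show ?thesis using mn
    by (simp only: pderiv_funpow_linear_power) simp
qed

lemma square_minus_one: "[:- 1, 0, 1:] = [:- 1, 1:] * [:- (- 1), 1::real:]"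
  by simp

lemma degree_pderiv_funpow: "degree ((pderiv ^^ m) (p :: real poly)) = degree p - m"
  by (induction m) (auto simp: degree_pderiv)

lemma degree_legendre [simp]: "degree (legendre_poly m) = m"
  by (simp add: legendre_poly_def degree_pderiv_funpow degree_power_eq)

lemma legendre_at_1 [simp]: "poly (legendre_poly m) 1 = 1"
proof -
  have "poly ((pderiv ^^ m) ([:- 1, 0, 1:] ^ m)) (1::real) = fact m * 2 ^ m"
    unfolding square_minus_one power_mult_distrib
    by (simp only: pderiv_funpow_linear_power) simp
  then show ?thesis by (simp add: legendre_poly_def)
qed

lemma legendre_at_minus_1 [simp]: "poly (legendre_poly m) (- 1) = (- 1) ^ m"
proof -
  have "[:- 1, 0, 1:] ^ m = [:- (- 1), 1:] ^ m * [:- 1, 1::real:] ^ m"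
    unfolding square_minus_one power_mult_distrib by (simp add: mult.commute)
  then have "poly ((pderiv ^^ m) ([:- 1, 0, 1:] ^ m)) (- 1::real) = fact m * (- 2) ^ m"
    by (simp only: pderiv_funpow_linear_power) simp
  then show ?thesis by (simp add: legendre_poly_def power_minus[of 2])
qed

text \<open>All derivatives of order below m of the m-th power in Rodrigues' formula vanish at both
  ends, so m integrations by parts have no boundary terms and move all m derivatives to
  \<open>p\<close>, where they give 0.\<close>

lemma legendre_orthogonal_poly:
  fixes p :: "real poly"
  assumes "degree p < m"
  shows "integral {-1..1} (poly (legendre_poly m * p)) = 0"
proof -
  define Q where "Q = [:- 1, 0, 1::real:] ^ m"
  have root: "poly ((pderiv ^^ i) Q) 1 = 0" "poly ((pderiv ^^ i) Q) (- 1) = 0" if "i < m" for i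
  proof -
    show "poly ((pderiv ^^ i) Q) 1 = 0"
      unfolding Q_def square_minus_one power_mult_distrib
      using pderiv_funpow_linear_power_root[OF that, of 1] by simp
    have "Q = [:- (- 1), 1:] ^ m * [:- 1, 1::real:] ^ m"
      unfolding Q_def square_minus_one power_mult_distrib by (simp add: mult.commute)
    then show "poly ((pderiv ^^ i) Q) (- 1) = 0"
      by (simp only: pderiv_funpow_linear_power_root[OF that, of "- 1"])
  qed
  have "i \<le> m \<Longrightarrow> integral {-1..1} (poly ((pderiv ^^ m) Q * p)) =
     (- 1) ^ i * integral {-1..1} (poly ((pderiv ^^ (m - i)) Q * (pderiv ^^ i) p))" for i
  proof (induction i)
    case (Suc i)
    have "(pderiv ^^ (m - i)) Q = pderiv ((pderiv ^^ (m - Suc i)) Q)"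
      using Suc.prems by (metis Suc_diff_Suc Suc_le_eq funpow.simps(2) o_apply)
    then have "integral {-1..1} (poly ((pderiv ^^ (m - i)) Q * (pderiv ^^ i) p)) =
       - integral {-1..1} (poly ((pderiv ^^ (m - Suc i)) Q * pderiv ((pderiv ^^ i) p)))"
      using Suc.prems root[of "m - Suc i"] by (simp add: integral_by_parts_poly del: poly_mult)
    then show ?case using Suc by (simp del: poly_mult)
  qed simp
  from this[of m] have "integral {-1..1} (poly ((pderiv ^^ m) Q * p)) =
     (- 1) ^ m * integral {-1..1} (poly (Q * (pderiv ^^ m) p))" by simp
  moreover have "(pderiv ^^ m) p = 0"
  proof -
    have "degree ((pderiv ^^ degree p) p) = 0" by (simp add: degree_pderiv_funpow)
    then have z: "pderiv ((pderiv ^^ degree p) p) = 0" by (metis pderiv_eq_0_iff)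
    have "(pderiv ^^ (n + Suc (degree p))) p = 0" for n
      by (induction n) (use z in auto)
    from this[of "m - Suc (degree p)"] show ?thesis using assms by simp
  qed
  ultimately have "integral {-1..1} (poly ((pderiv ^^ m) Q * p)) = 0"
    by (simp add: poly_fun(6))
  moreover have "poly (legendre_poly m * p) =
      (\<lambda>x. (1 / (2 ^ m * fact m)) * poly ((pderiv ^^ m) Q * p) x)"
    by (auto simp: legendre_poly_def Q_def)
  ultimately show ?thesis by (simp del: poly_mult)
qed

text \<open>In \<open>x L' - m L\<close> the leading terms cancel, so this polynomial is orthogonal
  to \<open>L\<close>. Integrating the derivative of x against the square of \<open>L\<close> by
  parts then gives \<open>J = 2 - 2 m J\<close>, where 2 is the boundary term.\<close>

lemma legendre_norm:
  "integral {-1..1} (poly (legendre_poly m * legendre_poly m)) = 2 / (2 * real m + 1)"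
proof -
  let ?L = "legendre_poly m"
  define J where "J = integral {-1..1} (poly (?L * ?L))"
  define r where "r = [:0, 1:] * pderiv ?L - smult (real m) ?L"
  have r0: "integral {-1..1} (poly (?L * r)) = 0"
  proof (cases "m = 0")
    case True
    then have "degree ?L = 0" by simp
    then have "pderiv ?L = 0" by (metis pderiv_eq_0_iff)
    then show ?thesis by (simp add: r_def True poly_fun)
  next
    case False
    have "degree r < m \<or> r = 0"
    proof -
      have le: "degree r \<le> m"
        unfolding r_def using False
        by (intro degree_diff_le) (auto intro!: order.trans[OF degree_mult_le] order.trans[OF degree_pCons_le] simp: degree_pderiv le_diff_conv)
      have "coeff r m = 0" unfolding r_def using False by (cases m) (auto simp: coeff_pderiv)
      then show ?thesis using le by (metis eq_zero_or_degree_less)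
    qed
    then show ?thesis by (auto intro: legendre_orthogonal_poly simp del: poly_mult)
  qed
  have "integral {-1..1} (poly (pderiv [:0, 1:] * (?L * ?L))) =
     2 - integral {-1..1} (poly ([:0, 1:] * pderiv (?L * ?L)))"
    by (subst integral_by_parts_poly) (auto simp: power_mult_distrib[symmetric])
  moreover have "pderiv [:0, 1::real:] * (?L * ?L) = ?L * ?L"
    by (simp add: pderiv_pCons)
  moreover have "poly ([:0, 1:] * pderiv (?L * ?L)) =
      (\<lambda>x. 2 * poly (?L * r) x + (2 * real m) * poly (?L * ?L) x)"
    unfolding r_def by (auto simp: pderiv_mult algebra_simps)
  moreover have "integral {-1..1} (\<lambda>x. 2 * poly (?L * r) x + (2 * real m) * poly (?L * ?L) x) =
     2 * integral {-1..1} (poly (?L * r)) + (2 * real m) * J"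
    unfolding J_def by (subst integral_add) (auto intro!: integrable_continuous_real continuous_intros simp del: poly_mult)
  ultimately have "J = 2 - 2 * real m * J" using r0 unfolding J_def by (simp del: poly_mult)
  then show ?thesis unfolding J_def[symmetric] by (simp add: field_simps)
qed

lemma legendre_bound: "\<exists>B\<ge>1. \<forall>m\<le>k. \<forall>y\<in>{-1..1}. \<bar>poly (legendre_poly m) y\<bar> \<le> B"
proof -
  have "\<exists>B. \<forall>y\<in>{-1..1}. \<bar>poly (legendre_poly m) y\<bar> \<le> B" for m
  proof -
    have "compact ((\<lambda>y. poly (legendre_poly m) y) ` {-1..1})"
      by (intro compact_continuous_image continuous_intros compact_Icc)
    then show ?thesis by (meson bounded_real compact_imp_bounded image_eqI)
  qed
  then obtain B where B: "\<And>m y. y \<in> {-1..1} \<Longrightarrow> \<bar>poly (legendre_poly m) y\<bar> \<le> B m" by metis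
  have "B m \<le> 1 + (\<Sum>m\<le>k. \<bar>B m\<bar>)" if "m \<le> k" for m
    using member_le_sum[of m "{..k}" "\<lambda>m. \<bar>B m\<bar>"] that by auto
  then have "\<forall>m\<le>k. \<forall>y\<in>{-1..1}. \<bar>poly (legendre_poly m) y\<bar> \<le> 1 + (\<Sum>m\<le>k. \<bar>B m\<bar>)"
    using B by (meson order_trans)
  moreover have "1 \<le> 1 + (\<Sum>m\<le>k. \<bar>B m\<bar>)" by (simp add: sum_nonneg)
  ultimately show ?thesis by blast
qed

subsection \<open>Transplantation to a cell\<close>

text \<open>A polynomial counterpart of the function \<open>legendre_cell\<close>, so that degrees
  and polynomial algebra are available.\<close>

definition Lcell :: "(nat \<Rightarrow> real) \<Rightarrow> nat \<Rightarrow> nat \<Rightarrow> real poly" where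
  "Lcell X j m = pcompose (legendre_poly m) [:- midpt X j / hbar X j, 1 / hbar X j:]"

lemma poly_Lcell: "poly (Lcell X j m) = legendre_cell X j m"
  by (auto simp: Lcell_def legendre_cell_def poly_pcompose diff_divide_distrib)

lemma cell_affine:
  assumes "X (j - 1) < X j"
  shows "0 < hlen X j" "0 < hbar X j" "(X j - midpt X j) / hbar X j = 1"
    "(X (j - 1) - midpt X j) / hbar X j = - 1" "hlen X j = 2 * hbar X j"
  using assms by (auto simp: hlen_def hbar_def midpt_def field_simps)

lemma degree_Lcell:
  assumes "X (j - 1) < X j" shows "degree (Lcell X j m) = m"
  using cell_affine(2)[OF assms] by (simp add: Lcell_def degree_pcompose)

lemma Lcell_ends:
  assumes "X (j - 1) < X j"
  shows "poly (Lcell X j m) (X j) = 1" "poly (Lcell X j m) (X (j - 1)) = (- 1) ^ m"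
  using cell_affine[OF assms] by (simp_all add: poly_Lcell legendre_cell_def)

lemma cell_arg:
  assumes "X (j - 1) < X j" "x \<in> cell X j" shows "(x - midpt X j) / hbar X j \<in> {-1..1}"
  using assms cell_affine(2)[OF assms(1)] by (auto simp: field_simps cell_def hbar_def hlen_def midpt_def)

text \<open>Integrals of polynomials are evaluated through a polynomial antiderivative; a change of
  variables then becomes a composition of polynomials.\<close>

lemma poly_antiderivative: "\<exists>P :: real poly. pderiv P = p \<and> degree P \<le> Suc (degree p)"
proof -
  define P where "P = (\<Sum>i\<le>degree p. monom (coeff p i / real (Suc i)) (Suc i))"
  have "pderiv P = (\<Sum>i\<le>degree p. monom (coeff p i) i)"
    unfolding P_def by (auto simp: higher_pderiv_sum[of 1, simplified] pderiv_monom simp del: of_nat_Suc intro!: sum.cong)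
  also have "\<dots> = p" by (rule poly_as_sum_of_monoms)
  finally show ?thesis unfolding P_def
    by (intro exI[of _ P] conjI) (auto simp: P_def intro!: degree_sum_le order.trans[OF degree_monom_le])
qed

lemma integral_cell_scale:
  fixes p :: "real poly"
  assumes "X (j - 1) < X j"
  shows "integral (cell X j) (poly (pcompose p [:- midpt X j / hbar X j, 1 / hbar X j:])) =
    hbar X j * integral {-1..1} (poly p)"
proof -
  let ?a = "[:- midpt X j / hbar X j, 1 / hbar X j:]"
  obtain P where P: "pderiv P = p" using poly_antiderivative by blast
  note h = cell_affine[OF assms]
  have "pderiv (smult (hbar X j) (pcompose P ?a)) = pcompose p ?a"
    using h P by (simp add: pderiv_smult pderiv_pcompose pderiv_pCons)
  then have "integral (cell X j) (poly (pcompose p ?a)) =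
     poly (smult (hbar X j) (pcompose P ?a)) (X j) - poly (smult (hbar X j) (pcompose P ?a)) (X (j - 1))"
    unfolding cell_def using integral_pderiv[of "X (j-1)" "X j" "smult (hbar X j) (pcompose P ?a)"] assms by simp
  also have "\<dots> = hbar X j * (poly P 1 - poly P (- 1))"
  proof -
    have "poly ?a (X j) = 1" "poly ?a (X (j - 1)) = - 1"
      using h by (auto simp: diff_divide_distrib)
    then show ?thesis by (simp only: poly_smult poly_pcompose right_diff_distrib)
  qed
  also have "poly P 1 - poly P (- 1) = integral {-1..1} (poly p)"
    using integral_pderiv[of "-1" 1 P] P by simp
  finally show ?thesis .
qed

lemma pcompose_inverse_affine:
  assumes "X (j - 1) < X j"
  shows "(w :: real poly) = pcompose (pcompose w [:midpt X j, hbar X j:]) [:- midpt X j / hbar X j, 1 / hbar X j:]"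
proof -
  have "pcompose [:midpt X j, hbar X j:] [:- midpt X j / hbar X j, 1 / hbar X j:] = [:0, 1:]"
    using cell_affine(2)[OF assms] by (simp add: pcompose_pCons)
  then show ?thesis by (metis pcompose_assoc pcompose_idR)
qed

lemma ip_poly: "ip X j (poly p) (poly q) = integral (cell X j) (poly (p * q))"
  by (simp add: ip_def poly_fun)

lemma ip_Lcell_poly:
  assumes "X (j - 1) < X j" "degree w < m"
  shows "ip X j (poly (Lcell X j m)) (poly w) = 0"
proof -
  let ?v = "pcompose w [:midpt X j, hbar X j:]"
  have "Lcell X j m * w = pcompose (legendre_poly m * ?v) [:- midpt X j / hbar X j, 1 / hbar X j:]"
    unfolding Lcell_def pcompose_mult using pcompose_inverse_affine[OF assms(1), of w] by metis
  moreover have "degree ?v < m"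
    using assms(2) degree_pcompose_le[of w "[:midpt X j, hbar X j:]"] by (auto split: if_splits)
  ultimately show ?thesis unfolding ip_poly
    using integral_cell_scale[OF assms(1)] legendre_orthogonal_poly by simp
qed

lemma ip_commute: "ip X j f g = ip X j g f"
  by (simp add: ip_def mult.commute)

lemma ip_Lcell:
  assumes "X (j - 1) < X j"
  shows "ip X j (poly (Lcell X j m)) (poly (Lcell X j n)) = (if m = n then hlen X j / (2 * real m + 1) else 0)"
proof (cases "m = n")
  case True
  have "Lcell X j m * Lcell X j m =
     pcompose (legendre_poly m * legendre_poly m) [:- midpt X j / hbar X j, 1 / hbar X j:]"
    by (simp add: Lcell_def pcompose_mult)
  then show ?thesis unfolding ip_poly
    using integral_cell_scale[OF assms] legendre_norm[of m] cell_affine[OF assms] True by simp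
next
  case False
  then show ?thesis
    using ip_Lcell_poly[OF assms, of "Lcell X j n" m] ip_Lcell_poly[OF assms, of "Lcell X j m" n]
    by (auto simp: degree_Lcell[OF assms] ip_commute neq_iff)
qed

lemma ip_add_left:
  assumes "continuous_on (cell X j) f" "continuous_on (cell X j) g" "continuous_on (cell X j) w"
  shows "ip X j (\<lambda>x. f x + g x) w = ip X j f w + ip X j g w"
  unfolding ip_def distrib_right
  by (rule integral_add) (use assms in \<open>auto simp: cell_def intro!: integrable_continuous_real continuous_intros\<close>)

lemma ip_scale_left: "ip X j (\<lambda>x. c * f x) w = c * ip X j f w"
  unfolding ip_def mult.assoc by simp

lemma ip_diff_left:
  assumes "continuous_on (cell X j) f" "continuous_on (cell X j) g" "continuous_on (cell X j) w"
  shows "ip X j (\<lambda>x. f x - g x) w = ip X j f w - ip X j g w"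
  unfolding ip_def left_diff_distrib
  by (rule integral_diff) (use assms in \<open>auto simp: cell_def intro!: integrable_continuous_real continuous_intros\<close>)

lemma ip_sum_left:
  assumes "\<And>i. i \<in> I \<Longrightarrow> continuous_on (cell X j) (f i)" "continuous_on (cell X j) w"
  shows "ip X j (\<lambda>x. \<Sum>i\<in>I. f i x) w = (\<Sum>i\<in>I. ip X j (f i) w)"
proof (cases "finite I")
  case True
  show ?thesis unfolding ip_def sum_distrib_right
    by (rule integral_sum[OF True]) (use assms in \<open>auto simp: cell_def intro!: integrable_continuous_real continuous_intros\<close>)
qed (simp add: ip_def)

lemma ip_poly_add: "ip X j (poly (p + q)) (poly w) = ip X j (poly p) (poly w) + ip X j (poly q) (poly w)"
  using ip_add_left[of X j "poly p" "poly q" "poly w"] by (simp add: continuous_on_poly poly_fun)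

lemma ip_poly_smult: "ip X j (poly (smult c p)) w = c * ip X j (poly p) w"
  using ip_scale_left[of X j c "poly p" w] by (simp add: poly_fun)

lemma ip_poly_diff: "ip X j (poly (p - q)) (poly w) = ip X j (poly p) (poly w) - ip X j (poly q) (poly w)"
  using ip_diff_left[of X j "poly p" "poly q" "poly w"] by (simp add: continuous_on_poly poly_fun)

lemma ip_poly_sum: "ip X j (poly (\<Sum>i\<in>I. p i)) (poly w) = (\<Sum>i\<in>I. ip X j (poly (p i)) (poly w))"
  using ip_sum_left[of I X j "\<lambda>i. poly (p i)" "poly w"] by (simp add: continuous_on_poly poly_fun)

text \<open>Subtracting the right multiple of the top Legendre polynomial lowers the degree; by
  orthogonality this changes none of the lower coefficients.\<close>

lemma poly_Lcell_expansion:
  assumes "X (j - 1) < X j" "degree p \<le> k"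
  shows "p = (\<Sum>m\<le>k. smult ((2 * real m + 1) / hlen X j * ip X j (poly p) (poly (Lcell X j m))) (Lcell X j m))"
  using assms(2)
proof (induction k arbitrary: p)
  case 0
  have "\<exists>a. p = [:a:]" using 0 by (metis degree_eq_zeroE le_zero_eq)
  then obtain a where a: "p = [:a:]" by blast
  have "\<exists>b. Lcell X j 0 = [:b:]" using degree_Lcell[OF assms(1), of 0] by (metis degree_eq_zeroE)
  moreover have "poly (Lcell X j 0) (X j) = 1" using Lcell_ends[OF assms(1)] by blast
  ultimately have L: "Lcell X j 0 = 1" by (auto simp: one_pCons)
  have p: "p = smult a (Lcell X j 0)" using a L by simp
  show ?case
    unfolding p ip_poly_smult ip_Lcell[OF assms(1)] using cell_affine(1)[OF assms(1)] by simp
next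
  case (Suc k)
  note h = cell_affine(1)[OF assms(1)]
  define L where "L = Lcell X j (Suc k)"
  have dL: "degree L = Suc k" by (simp add: L_def degree_Lcell[OF assms(1)])
  then have nz: "coeff L (Suc k) \<noteq> 0" by (metis leading_coeff_0_iff degree_0 nat.distinct(1))
  define a where "a = coeff p (Suc k) / coeff L (Suc k)"
  define q where "q = p - smult a L"
  have "degree q \<le> Suc k" unfolding q_def using dL Suc.prems by (intro degree_diff_le) (auto intro: order.trans[OF degree_smult_le])
  moreover have "coeff q (Suc k) = 0" using nz by (simp add: q_def a_def)
  ultimately have dq: "degree q \<le> k" by (metis eq_zero_or_degree_less degree_0 less_Suc_eq_le zero_le le_eq_less_or_eq)
  have p: "p = q + smult a L" by (simp add: q_def)
  have i1: "ip X j (poly p) (poly (Lcell X j m)) = ip X j (poly q) (poly (Lcell X j m))" if "m \<le> k" for m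
    unfolding p ip_poly_add ip_poly_smult L_def ip_Lcell[OF assms(1)] using that by simp
  have i2: "ip X j (poly p) (poly L) = a * (hlen X j / (2 * real (Suc k) + 1))"
    unfolding p ip_poly_add ip_poly_smult using ip_Lcell[OF assms(1), of "Suc k" "Suc k"]
      ip_Lcell_poly[OF assms(1), of q "Suc k"] dq by (simp add: L_def ip_commute)
  have "p = (\<Sum>m\<le>k. smult ((2 * real m + 1) / hlen X j * ip X j (poly p) (poly (Lcell X j m))) (Lcell X j m)) + smult a L"
    using Suc.IH[OF dq] i1 p by simp
  moreover have "(2 * real (Suc k) + 1) / hlen X j * ip X j (poly p) (poly L) = a"
    unfolding i2 using h by simp
  ultimately show ?case by (simp only: sum.atMost_Suc L_def)
qed

section \<open>Gauss-Radau projections on a cell\<close>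

text \<open>The tag \<^const>\<open>FluxI\<close> stands for the right end point of a cell, \<^const>\<open>FluxII\<close> for the left
  one. With flux choice \<open>e\<close> the variable u is projected at the end \<open>e\<close> and q at the end \<open>opp e\<close>, so
  that the two choices become one.\<close>

fun opp :: "flux \<Rightarrow> flux" where
  "opp FluxI = FluxII"
| "opp FluxII = FluxI"

lemma opp_opp [simp]: "opp (opp e) = e"
  by (cases e) auto

fun endpt :: "(nat \<Rightarrow> real) \<Rightarrow> nat \<Rightarrow> flux \<Rightarrow> real" where
  "endpt X j FluxI = X j"
| "endpt X j FluxII = X (j - 1)"

fun radau :: "nat \<Rightarrow> (nat \<Rightarrow> real) \<Rightarrow> nat \<Rightarrow> flux \<Rightarrow> (real \<Rightarrow> real) \<Rightarrow> real poly" where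
  "radau k X j FluxI = radau_minus k X j"
| "radau k X j FluxII = radau_plus k X j"

fun coef :: "nat \<Rightarrow> (nat \<Rightarrow> real) \<Rightarrow> nat \<Rightarrow> flux \<Rightarrow> (real \<Rightarrow> real) \<Rightarrow> real" where
  "coef k X j FluxI = coeff_bar k X j"
| "coef k X j FluxII = coeff_tilde k X j"

text \<open>The value of the m-th Legendre polynomial at the chosen end of the cell.\<close>

fun end_sign :: "flux \<Rightarrow> nat \<Rightarrow> real" where
  "end_sign FluxI m = 1"
| "end_sign FluxII m = (- 1) ^ m"

lemma end_sign_square [simp]: "end_sign e m * end_sign e m = 1"
  by (cases e) (auto simp: power_mult_distrib[symmetric])

lemma abs_end_sign [simp]: "\<bar>end_sign e m\<bar> = 1"
  by (cases e) auto

text \<open>By the heat equation the x-derivatives of even order of u are time derivatives of u, and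
  those of odd order are time derivatives of q. Since u and q are projected at opposite ends, the
  end belonging to the n-th x-derivative alternates with n.\<close>

fun alt :: "flux \<Rightarrow> nat \<Rightarrow> flux" where
  "alt e n = (if even n then e else opp e)"

text \<open>\<open>Zp FluxI\<close> runs through the polynomials \<open>L\<close>, \<open>F2_1\<close>, \<open>F1bar_1\<close>, \<open>F2_2\<close>, ... and \<open>Zp FluxII\<close> through
  \<open>L\<close>, \<open>F1_1\<close>, \<open>F2bar_1\<close>, \<open>F1_2\<close>, ... of the paper.\<close>

fun Zp :: "nat \<Rightarrow> (nat \<Rightarrow> real) \<Rightarrow> nat \<Rightarrow> flux \<Rightarrow> nat \<Rightarrow> real poly" where
  "Zp k X j e 0 = Lcell X j k"
| "Zp k X j e (Suc n) = radau k X j e (Dsinv X j (poly (Zp k X j (opp e) n)))"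

text \<open>For the chain \<open>D\<close> of x-derivatives of u this is the interpolation function
  of u with l = k, the time derivatives being written as x-derivatives. The chain shifted by one and
  the opposite end give the matching interpolation of q.\<close>

definition interp :: "nat \<Rightarrow> (nat \<Rightarrow> real) \<Rightarrow> nat \<Rightarrow> flux \<Rightarrow> (nat \<Rightarrow> real \<Rightarrow> real) \<Rightarrow> real poly" where
  "interp k X j e D = radau k X j e (D 0) -
     (\<Sum>n=1..k. smult (hbar X j ^ n * coef k X j (alt e n) (D n)) (Zp k X j e n))"

definition legb :: "nat \<Rightarrow> real" where
  "legb k = (SOME B. 1 \<le> B \<and> (\<forall>m\<le>k. \<forall>y\<in>{-1..1}. \<bar>poly (legendre_poly m) y\<bar> \<le> B))"

lemma legb: "1 \<le> legb k" "m \<le> k \<Longrightarrow> y \<in> {-1..1} \<Longrightarrow> \<bar>poly (legendre_poly m) y\<bar> \<le> legb k"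
  unfolding legb_def using someI_ex[of "\<lambda>B. 1 \<le> B \<and> (\<forall>m\<le>k. \<forall>y\<in>{-1..1}. \<bar>poly (legendre_poly m) y\<bar> \<le> B)"]
    legendre_bound[of k] by blast+

text \<open>\<open>coefC\<close> bounds the coefficient functional, and \<open>radauC\<close> below
  the projection, in the sup norm on a cell. Both depend on k alone, which is what makes the final
  constant independent of the mesh.\<close>

definition coefC :: "nat \<Rightarrow> real" where
  "coefC k = (real k + 1) * (2 * real k + 1) * legb k + 1"

definition radauC :: "nat \<Rightarrow> real" where
  "radauC k = (real k + 1) * (2 * real k + 1) * legb k * legb k + coefC k * legb k"

text \<open>Each step of the recursion for \<open>Zp\<close> costs a projection and a factor 2, the
  length of the cell divided by \<open>hbar\<close>.\<close>

definition zC :: "nat \<Rightarrow> nat \<Rightarrow> real" where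
  "zC k n = (2 * radauC k) ^ n * legb k"

lemma coefC_pos: "0 < coefC k" "0 < radauC k" "0 < zC k n"
proof -
  have l: "0 < legb k" using legb(1)[of k] by linarith
  show c: "0 < coefC k" unfolding coefC_def using l by (intro add_nonneg_pos mult_nonneg_nonneg) auto
  show r: "0 < radauC k" unfolding radauC_def using l c by (intro add_nonneg_pos mult_nonneg_nonneg mult_pos_pos) auto
  show "0 < zC k n" unfolding zC_def using l r by simp
qed

locale mesh_cell =
  fixes k :: nat and X :: "nat \<Rightarrow> real" and j :: nat
  assumes k: "1 \<le> k" and lt: "X (j - 1) < X j"
begin

abbreviation "L \<equiv> Lcell X j"
abbreviation "K \<equiv> cell X j"
abbreviation "hb \<equiv> hbar X j"
abbreviation "hh \<equiv> hlen X j"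
abbreviation "E \<equiv> endpt X j"
abbreviation "rad \<equiv> radau k X j"
abbreviation "co \<equiv> coef k X j"
abbreviation "Z \<equiv> Zp k X j"

lemma h_pos: "0 < hh" "0 < hb" "hh = 2 * hb" and h_eq: "hh = X j - X (j - 1)"
  using cell_affine[OF lt] by (auto simp: hlen_def)

lemma E_in: "E e \<in> K"
  using lt by (cases e) (auto simp: cell_def)

lemma L_end: "poly (L m) (E e) = end_sign e m"
  using Lcell_ends[OF lt] by (cases e) auto

lemma L_bound: "m \<le> k \<Longrightarrow> x \<in> K \<Longrightarrow> \<bar>poly (L m) x\<bar> \<le> legb k"
  using legb(2)[of m k] cell_arg[OF lt] by (simp add: poly_Lcell legendre_cell_def)

lemma K_cont_poly: "continuous_on K (poly p)"
  by (intro continuous_intros)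

lemma Lim_end:
  assumes "continuous_on K f"
  shows "Lim (at_left (X j)) f = f (X j)" "Lim (at_right (X (j - 1))) f = f (X (j - 1))"
  using assms lt unfolding cell_def
  by (auto intro!: tendsto_Lim continuous_on_Icc_at_leftD continuous_on_Icc_at_rightD)

lemma ip_cong: "(\<And>x. x \<in> K \<Longrightarrow> f x = g x) \<Longrightarrow> ip X j f w = ip X j g w"
  unfolding ip_def by (rule integral_cong) auto

lemma ip_bound:
  assumes "continuous_on K f" "continuous_on K g" "\<And>x. x \<in> K \<Longrightarrow> \<bar>f x\<bar> \<le> S" "\<And>x. x \<in> K \<Longrightarrow> \<bar>g x\<bar> \<le> S'"
  shows "\<bar>ip X j f g\<bar> \<le> hh * S * S'"
proof -
  have "norm (integral K (\<lambda>x. f x * g x)) \<le> (S * S') * (X j - X (j - 1))"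
    unfolding cell_def
  proof (rule integral_bound)
    show "X (j - 1) \<le> X j" using lt by simp
    show "continuous_on {X (j - 1)..X j} (\<lambda>x. f x * g x)"
      using assms(1,2) by (auto simp: cell_def intro: continuous_on_mult)
    fix x assume "x \<in> {X (j - 1)..X j}"
    then have "x \<in> K" by (simp add: cell_def)
    then show "norm (f x * g x) \<le> S * S'"
      using assms(3,4)[of x] by (auto simp: abs_mult intro!: mult_mono intro: order_trans[OF abs_ge_zero])
  qed
  then show ?thesis by (simp add: ip_def h_eq mult_ac)
qed

definition lc :: "(real \<Rightarrow> real) \<Rightarrow> nat \<Rightarrow> real" where
  "lc f m = (2 * real m + 1) / hh * ip X j f (poly (L m))"

lemma lc_bound:
  assumes "continuous_on K f" "\<And>x. x \<in> K \<Longrightarrow> \<bar>f x\<bar> \<le> S" "m \<le> k"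
  shows "\<bar>lc f m\<bar> \<le> (2 * real k + 1) * legb k * S"
proof -
  have S: "0 \<le> S" using assms(2)[OF E_in] abs_ge_zero by (meson order_trans)
  have "\<bar>ip X j f (poly (L m))\<bar> \<le> hh * S * legb k"
    by (rule ip_bound[OF assms(1) K_cont_poly assms(2) L_bound[OF assms(3)]])
  then have "\<bar>lc f m\<bar> \<le> (2 * real m + 1) / hh * (hh * S * legb k)"
    unfolding lc_def abs_mult using h_pos by (intro mult_mono) auto
  also have "\<dots> = (2 * real m + 1) * (legb k * S)" using h_pos by simp
  also have "\<dots> \<le> (2 * real k + 1) * (legb k * S)"
    using assms(3) S legb(1)[of k] by (intro mult_right_mono) auto
  finally show ?thesis by (simp add: mult.assoc)
qed

lemma poly_split:
  assumes "degree w \<le> k"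
  obtains q a where "degree q \<le> k - 1" "w = q + smult a (L k)"
proof -
  define c where "c m = (2 * real m + 1) / hh * ip X j (poly w) (poly (L m))" for m
  have "w = (\<Sum>m\<le>k. smult (c m) (L m))"
    using poly_Lcell_expansion[OF lt assms] by (simp add: c_def)
  also have "{..k} = insert k {..k - 1}" using k by auto
  finally have "w = (\<Sum>m\<le>k - 1. smult (c m) (L m)) + smult (c k) (L k)"
    using k by (simp add: add.commute)
  moreover have "degree (\<Sum>m\<le>k - 1. smult (c m) (L m)) \<le> k - 1"
    by (intro degree_sum_le) (auto intro!: order_trans[OF degree_smult_le] simp: degree_Lcell[OF lt])
  ultimately show ?thesis using that by blast
qed

lemma ip_Lk_low: "degree w \<le> k - 1 \<Longrightarrow> ip X j (poly (L k)) (poly w) = 0"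
  using ip_Lcell_poly[OF lt, of w k] k by simp

text \<open>The difference of two candidates is orthogonal to all polynomials of degree below k,
  hence a multiple of \<open>L k\<close>, and \<open>L k\<close> does not vanish at the
  ends.\<close>

lemma radau_unique:
  assumes "degree p \<le> k" "degree p' \<le> k"
    and "\<And>w. degree w \<le> k - 1 \<Longrightarrow> ip X j (poly p) (poly w) = ip X j (poly p') (poly w)"
    and "poly p (E e) = poly p' (E e)"
  shows "p = p'"
proof -
  have d: "degree (p - p') \<le> k" using assms by (intro degree_diff_le)
  obtain q a where qa: "degree q \<le> k - 1" "p - p' = q + smult a (L k)" using poly_split[OF d] .
  have "ip X j (poly (p - p')) (poly (L m)) = 0" if "m \<le> k - 1" for m
    using assms(3)[of "L m"] that by (simp add: ip_poly_diff degree_Lcell[OF lt])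
  moreover have "ip X j (poly q) (poly (L m)) = ip X j (poly (p - p')) (poly (L m))" if "m \<le> k - 1" for m
    using qa(2) ip_Lk_low[of "L m"] that by (simp add: ip_poly_add ip_poly_smult degree_Lcell[OF lt])
  ultimately have "q = 0"
    using poly_Lcell_expansion[OF lt qa(1)] by (simp add: degree_Lcell[OF lt])
  then have "p - p' = smult a (L k)" using qa by simp
  moreover have "poly (p - p') (E e) = 0" using assms(4) by simp
  ultimately have "a * end_sign e k = 0" by (simp add: L_end)
  moreover have "end_sign e k \<noteq> 0" by (cases e) auto
  ultimately have "a = 0" by simp
  then show ?thesis using \<open>p - p' = smult a (L k)\<close> by simp
qed

text \<open>The moments force the Legendre coefficients below k, and the end value forces the top
  one; \<open>end_sign e k\<close> occurs as its own inverse. This explicit form gives existence and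
  the sup bound.\<close>

definition radp :: "flux \<Rightarrow> (real \<Rightarrow> real) \<Rightarrow> real poly" where
  "radp e f = (\<Sum>m<k. smult (lc f m) (L m)) +
     smult ((f (E e) - (\<Sum>m<k. lc f m * end_sign e m)) * end_sign e k) (L k)"

lemma ip_radp_L:
  assumes "m \<le> k" shows "ip X j (poly (radp e f)) (poly (L m)) =
    (if m < k then ip X j f (poly (L m))
     else (f (E e) - (\<Sum>m<k. lc f m * end_sign e m)) * end_sign e k * (hh / (2 * real k + 1)))"
proof -
  have "(\<Sum>i<k. ip X j (poly (smult (lc f i) (L i))) (poly (L m))) =
      (\<Sum>i<k. if i = m then lc f m * (hh / (2 * real m + 1)) else 0)"
    by (intro sum.cong) (auto simp: ip_poly_smult ip_Lcell[OF lt])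
  then have *: "(\<Sum>i<k. ip X j (poly (smult (lc f i) (L i))) (poly (L m))) =
      (if m < k then lc f m * (hh / (2 * real m + 1)) else 0)" by (simp add: if_distrib)
  have "2 * real m + 1 \<noteq> 0" by (metis add_nonneg_pos less_irrefl mult_nonneg_nonneg of_nat_0_le_iff zero_le_numeral zero_less_one)
  then show ?thesis
    unfolding radp_def ip_poly_add ip_poly_sum * unfolding ip_poly_smult ip_Lcell[OF lt]
    using assms h_pos by (auto simp: lc_def)
qed

lemma degree_radp: "degree (radp e f) \<le> k"
  unfolding radp_def
  by (intro degree_add_le degree_sum_le) (auto intro!: order_trans[OF degree_smult_le] simp: degree_Lcell[OF lt])

lemma radp_end: "poly (radp e f) (E e) = f (E e)"
  unfolding radp_def by (simp add: poly_sum L_end mult.assoc)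

lemma ip_radp_low:
  assumes f: "continuous_on K f" and w: "degree w \<le> k - 1"
  shows "ip X j (poly (radp e f)) (poly w) = ip X j f (poly w)"
proof -
  define c where "c m = (2 * real m + 1) / hh * ip X j (poly w) (poly (L m))" for m
  have we: "poly w = (\<lambda>x. \<Sum>m\<le>k - 1. c m * poly (L m) x)"
    using arg_cong[OF poly_Lcell_expansion[OF lt w], of poly] by (simp add: c_def poly_fun)
  have "ip X j g (poly w) = (\<Sum>m\<le>k - 1. c m * ip X j g (poly (L m)))" if "continuous_on K g" for g
    unfolding we by (subst ip_commute, subst ip_sum_left)
      (auto simp: ip_scale_left intro!: sum.cong continuous_intros ip_commute that)
  from this[OF f] this[OF K_cont_poly, of "radp e f"] show ?thesis
    using k by (simp only:) (auto intro!: sum.cong simp: ip_radp_L)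
qed

lemma radau_eq_radp:
  assumes f: "continuous_on K f"
  shows "rad e f = radp e f"
proof -
  have "rad e f = (THE p. degree p \<le> k \<and>
     (\<forall>w. degree w \<le> k - 1 \<longrightarrow> ip X j (poly p) (poly w) = ip X j f (poly w)) \<and> poly p (E e) = f (E e))"
    by (cases e) (auto simp: radau_minus_def radau_plus_def Lim_end[OF f, simplified])
  also have "\<dots> = radp e f"
  proof (rule the_equality)
    show "degree (radp e f) \<le> k \<and> (\<forall>w. degree w \<le> k - 1 \<longrightarrow> ip X j (poly (radp e f)) (poly w) = ip X j f (poly w)) \<and>
      poly (radp e f) (E e) = f (E e)"
      using degree_radp radp_end ip_radp_low[OF f] by blast
    fix p assume "degree p \<le> k \<and> (\<forall>w. degree w \<le> k - 1 \<longrightarrow> ip X j (poly p) (poly w) = ip X j f (poly w)) \<and>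
      poly p (E e) = f (E e)"
    then show "p = radp e f"
      using radau_unique[of p "radp e f" e] degree_radp radp_end ip_radp_low[OF f] by simp
  qed
  finally show ?thesis .
qed

lemma degree_radau: "continuous_on K f \<Longrightarrow> degree (rad e f) \<le> k"
  by (simp add: radau_eq_radp degree_radp)

lemma radau_end: "continuous_on K f \<Longrightarrow> poly (rad e f) (E e) = f (E e)"
  by (simp add: radau_eq_radp radp_end)

lemma radau_low: "continuous_on K f \<Longrightarrow> degree w \<le> k - 1 \<Longrightarrow>
    ip X j (poly (rad e f)) (poly w) = ip X j f (poly w)"
  by (simp add: radau_eq_radp ip_radp_low)

lemma radau_poly: "degree p \<le> k \<Longrightarrow> rad e (poly p) = p"
  by (rule radau_unique[of _ _ e]) (auto simp: degree_radau radau_end radau_low K_cont_poly)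

text \<open>Up to sign both coefficients measure by how much the truncated Legendre series misses
  the value of \<open>f\<close> at the end \<open>e\<close>. The common form yields linearity,
  bounds and the residual for both ends at once.\<close>

lemma coef_eq:
  assumes f: "continuous_on K f"
  shows "co e f = end_sign e k * ((\<Sum>m\<le>k. end_sign e m * lc f m) - f (E e))"
proof -
  have *: "1 / hh * integral K (\<lambda>x. f x * (\<Sum>m=0..k. a m * legendre_cell X j m x)) =
     (\<Sum>m\<le>k. a m * (1 / hh * ip X j f (poly (L m))))" for a
  proof -
    have "integral K (\<lambda>x. f x * (\<Sum>m=0..k. a m * legendre_cell X j m x)) =
      ip X j (\<lambda>x. \<Sum>m\<le>k. a m * poly (L m) x) f"
      unfolding ip_def by (simp add: poly_Lcell atLeast0AtMost mult.commute)
    also have "\<dots> = (\<Sum>m\<le>k. a m * ip X j f (poly (L m)))"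
      by (subst ip_sum_left) (auto simp: ip_scale_left f intro!: sum.cong continuous_intros ip_commute)
    finally show ?thesis by (simp add: sum_distrib_left mult_ac)
  qed
  have **: "(\<Sum>m\<le>k. (- 1) ^ (k + m) * (2 * real m + 1) * (1 / hh * ip X j f (poly (L m)))) =
    (- 1) ^ k * (\<Sum>m\<le>k. (- 1) ^ m * ((2 * real m + 1) / hh * ip X j f (poly (L m))))"
    unfolding sum_distrib_left by (intro sum.cong) (auto simp: power_add)
  show ?thesis
  proof (cases e)
    case FluxI
    then show ?thesis
      using *[of "\<lambda>m. 2 * real m + 1"] by (simp add: coeff_bar_def Lim_end[OF f, simplified] lc_def)
  next
    case FluxII
    have "coeff_tilde k X j f = (- 1) ^ (k + 1) * f (X (j - 1)) +
       (- 1) ^ k * (\<Sum>m\<le>k. (- 1) ^ m * ((2 * real m + 1) / hh * ip X j f (poly (L m))))"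
      unfolding coeff_tilde_def * ** Lim_end[OF f] ..
    then show ?thesis using FluxII by (simp add: lc_def right_diff_distrib)
  qed
qed

lemma lc_linear:
  assumes "continuous_on K f" "continuous_on K g"
  shows "lc (\<lambda>x. f x - g x) m = lc f m - lc g m"
  using assms by (simp add: lc_def ip_diff_left[OF _ _ K_cont_poly] right_diff_distrib)

lemma lc_scale: "lc (\<lambda>x. c * f x) m = c * lc f m"
  by (simp add: lc_def ip_scale_left)

lemma coef_diff:
  assumes "continuous_on K f" "continuous_on K g"
  shows "co e (\<lambda>x. f x - g x) = co e f - co e g"
  using assms by (simp add: coef_eq continuous_on_diff lc_linear right_diff_distrib sum_subtractf algebra_simps)

lemma coef_scale:
  assumes "continuous_on K f"
  shows "co e (\<lambda>x. c * f x) = c * co e f"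
  using assms by (simp add: coef_eq continuous_on_mult_left lc_scale right_diff_distrib sum_distrib_left algebra_simps)

lemma coef_bound:
  assumes f: "continuous_on K f" and S: "\<And>x. x \<in> K \<Longrightarrow> \<bar>f x\<bar> \<le> S"
  shows "\<bar>co e f\<bar> \<le> coefC k * S"
proof -
  have "\<bar>co e f\<bar> \<le> \<bar>\<Sum>m\<le>k. end_sign e m * lc f m\<bar> + \<bar>f (E e)\<bar>"
    unfolding coef_eq[OF f] abs_mult by simp
  also have "\<bar>\<Sum>m\<le>k. end_sign e m * lc f m\<bar> \<le> (\<Sum>m\<le>k. (2 * real k + 1) * legb k * S)"
    by (intro order_trans[OF sum_abs] sum_mono) (auto simp: abs_mult lc_bound[OF f S])
  also have "\<bar>f (E e)\<bar> \<le> S" using S[OF E_in] .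
  finally show ?thesis by (simp add: coefC_def algebra_simps)
qed

lemma radau_bound:
  assumes f: "continuous_on K f" and S: "\<And>x. x \<in> K \<Longrightarrow> \<bar>f x\<bar> \<le> S" and x: "x \<in> K"
  shows "\<bar>poly (rad e f) x\<bar> \<le> radauC k * S"
proof -
  have S0: "0 \<le> S" using S[OF E_in] abs_ge_zero by (meson order_trans)
  have l: "1 \<le> legb k" by (rule legb)
  have 1: "(\<Sum>m<k. \<bar>lc f m\<bar>) \<le> (\<Sum>m<k. (2 * real k + 1) * legb k * S)"
    by (intro sum_mono) (auto simp: lc_bound[OF f S])
  have "\<bar>\<Sum>m<k. lc f m * poly (L m) x\<bar> \<le> (\<Sum>m<k. ((2 * real k + 1) * legb k * S) * legb k)"
  proof (intro order_trans[OF sum_abs] sum_mono)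
    fix m assume "m \<in> {..<k}"
    then show "\<bar>lc f m * poly (L m) x\<bar> \<le> ((2 * real k + 1) * legb k * S) * legb k"
      unfolding abs_mult using l S0 by (intro mult_mono lc_bound[OF f S] L_bound x) auto
  qed
  also have "\<dots> \<le> (real k + 1) * (2 * real k + 1) * legb k * legb k * S"
    using S0 l by (simp add: algebra_simps)
  finally have a: "\<bar>\<Sum>m<k. lc f m * poly (L m) x\<bar> \<le> (real k + 1) * (2 * real k + 1) * legb k * legb k * S" .
  have "\<bar>\<Sum>m<k. lc f m * end_sign e m\<bar> \<le> (\<Sum>m<k. \<bar>lc f m\<bar>)"
    by (intro order_trans[OF sum_abs]) (simp add: abs_mult)
  then have "\<bar>f (E e) - (\<Sum>m<k. lc f m * end_sign e m)\<bar> \<le> S + real k * ((2 * real k + 1) * legb k * S)"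
    using 1 S[OF E_in, of e] by simp
  also have "\<dots> \<le> coefC k * S" unfolding coefC_def using S0 l by (simp add: algebra_simps)
  finally have b: "\<bar>f (E e) - (\<Sum>m<k. lc f m * end_sign e m)\<bar> \<le> coefC k * S" .
  have "\<bar>(f (E e) - (\<Sum>m<k. lc f m * end_sign e m)) * end_sign e k * poly (L k) x\<bar> \<le> coefC k * S * legb k"
    unfolding abs_mult abs_end_sign using b L_bound[OF le_refl x] by (simp only: mult_1_right) (intro mult_mono, auto intro: order_trans[OF abs_ge_zero])
  then show ?thesis using a
    unfolding radau_eq_radp[OF f] radp_def radauC_def by (simp add: poly_sum algebra_simps)
qed

text \<open>The projection error is orthogonal to \<open>P_{k-1}\<close>, hence its \<open>L\<^sup>2\<close> projection to \<open>P_k\<close> is a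
  multiple of \<open>L k\<close>; the multiple is the coefficient of the paper.\<close>

lemma radau_residual:
  assumes f: "continuous_on K f" and w: "degree w \<le> k"
  shows "ip X j f (poly w) - ip X j (poly (rad e f)) (poly w) = co e f * ip X j (poly (L k)) (poly w)"
proof -
  have Lk: "ip X j f (poly (L k)) - ip X j (poly (rad e f)) (poly (L k)) = co e f * (hh / (2 * real k + 1))"
  proof -
    have "{..k} = insert k {..<k}" by auto
    then have "(\<Sum>m\<le>k. end_sign e m * lc f m) = (\<Sum>m<k. lc f m * end_sign e m) + end_sign e k * lc f k"
      by (simp add: mult.commute)
    then have "co e f = end_sign e k * ((\<Sum>m<k. lc f m * end_sign e m) - f (E e)) + lc f k"
      unfolding coef_eq[OF f] by (simp add: algebra_simps flip: mult.assoc)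
    moreover have "2 * real k + 1 \<noteq> 0" using k by linarith
    then have "lc f k * (hh / (2 * real k + 1)) = ip X j f (poly (L k))"
      using h_pos by (simp add: lc_def)
    moreover have "ip X j (poly (radp e f)) (poly (L k)) =
       (f (E e) - (\<Sum>m<k. lc f m * end_sign e m)) * end_sign e k * (hh / (2 * real k + 1))"
      using ip_radp_L[of k e f] by simp
    ultimately show ?thesis
      unfolding radau_eq_radp[OF f] by (simp only:) (simp only: algebra_simps)
  qed
  obtain q a where w: "degree q \<le> k - 1" "w = q + smult a (L k)" using poly_split[OF w] .
  have g: "ip X j g (poly w) = ip X j g (poly q) + a * ip X j g (poly (L k))" if "continuous_on K g" for g
  proof -
    have "ip X j (poly w) g = ip X j (poly q) g + ip X j (poly (smult a (L k))) g"
      unfolding w(2) poly_fun(2) by (rule ip_add_left[OF K_cont_poly K_cont_poly that])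
    then show ?thesis by (simp add: ip_commute[of X j g] ip_poly_smult)
  qed
  have *: "ip X j (poly (L k)) (poly (L k)) = hh / (2 * real k + 1)" using ip_Lcell[OF lt, of k k] by simp
  show ?thesis
    unfolding g[OF f] g[OF K_cont_poly] radau_low[OF f w(1)] ip_Lk_low[OF w(1)] *
    using Lk by (simp only: mult_zero_left add_0) (simp add: algebra_simps)
qed

text \<open>The projection reproduces the polynomial, so its residual vanishes; testing it with
  \<open>L k\<close> isolates the coefficient.\<close>

lemma coef_poly: "degree p \<le> k \<Longrightarrow> co e (poly p) = 0"
  using radau_residual[OF K_cont_poly, of "L k" p e] radau_poly[of p e] ip_Lcell[OF lt, of k k] h_pos(1) k
  by (auto simp: degree_Lcell[OF lt])

text \<open>Induction along the chain: an antiderivative of the polynomial for the next derivative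
  is adjusted to agree at the left end, and the mean value inequality contributes one factor
  \<open>hh\<close>.\<close>

lemma taylor_poly_exists:
  assumes "\<And>i x. i < n \<Longrightarrow> x \<in> K \<Longrightarrow> (D i has_real_derivative D (Suc i) x) (at x within K)"
    and "\<And>x y. x \<in> K \<Longrightarrow> y \<in> K \<Longrightarrow> \<bar>D n x - D n y\<bar> \<le> \<omega>"
  shows "\<exists>p. degree p \<le> n \<and> (\<forall>x\<in>K. \<bar>D 0 x - poly p x\<bar> \<le> hh ^ n * \<omega>)"
  using assms
proof (induction n arbitrary: D)
  case 0
  then show ?case using E_in[of FluxI] by (intro exI[of _ "[:D 0 (X j):]"]) auto
next
  case (Suc n)
  have "\<exists>p. degree p \<le> n \<and> (\<forall>x\<in>K. \<bar>D (Suc 0) x - poly p x\<bar> \<le> hh ^ n * \<omega>)"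
    by (rule Suc.IH[of "\<lambda>i. D (Suc i)"]) (use Suc.prems in auto)
  then obtain q where q: "degree q \<le> n" "\<And>x. x \<in> K \<Longrightarrow> \<bar>D (Suc 0) x - poly q x\<bar> \<le> hh ^ n * \<omega>" by blast
  obtain P where P: "pderiv P = q" "degree P \<le> Suc n" using poly_antiderivative[of q] q(1) by fastforce
  let ?a = "X (j - 1)"
  define p where "p = P + [:D 0 ?a - poly P ?a:]"
  have aK: "?a \<in> K" using lt by (simp add: cell_def)
  have der: "((\<lambda>x. D 0 x - poly p x) has_real_derivative D (Suc 0) x - poly q x) (at x within K)" if "x \<in> K" for x
    unfolding p_def by (auto intro!: derivative_eq_intros Suc.prems that poly_DERIV[THEN DERIV_subset] simp: P(1))
  have w0: "0 \<le> hh ^ n * \<omega>" using q(2)[OF aK] abs_ge_zero by (meson order_trans)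
  have "\<bar>D 0 x - poly p x\<bar> \<le> hh ^ Suc n * \<omega>" if x: "x \<in> K" for x
  proof -
    have "norm ((\<lambda>x. D 0 x - poly p x) x - (\<lambda>x. D 0 x - poly p x) ?a) \<le> (hh ^ n * \<omega>) * norm (x - ?a)"
      by (rule field_differentiable_bound[where S = K and f' = "\<lambda>x. D (Suc 0) x - poly q x"])
        (use der q(2) x aK in \<open>auto simp: cell_def\<close>)
    also have "\<dots> \<le> (hh ^ n * \<omega>) * hh"
      using x w0 by (intro mult_left_mono) (auto simp: cell_def h_eq)
    finally show ?thesis by (simp add: p_def mult_ac)
  qed
  moreover have "degree p \<le> Suc n" unfolding p_def using P(2) by (intro degree_add_le) auto
  ultimately show ?case by blast
qed

text \<open>A Bramble-Hilbert argument: the functional kills polynomials of degree at most k, so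
  only the remainder of a polynomial approximation counts. The bound keeps the oscillation of the
  last derivative because for the time increments estimated later one further derivative is
  unbounded near the boundary, while the oscillation is still controlled.\<close>

lemma coef_smooth_bound:
  assumes "n \<le> k"
    and "\<And>i x. i < n \<Longrightarrow> x \<in> K \<Longrightarrow> (D i has_real_derivative D (Suc i) x) (at x within K)"
    and "\<And>x y. x \<in> K \<Longrightarrow> y \<in> K \<Longrightarrow> \<bar>D n x - D n y\<bar> \<le> \<omega>"
    and c: "continuous_on K (D 0)"
  shows "\<bar>co e (D 0)\<bar> \<le> coefC k * (hh ^ n * \<omega>)"
proof -
  obtain p where p: "degree p \<le> n" "\<And>x. x \<in> K \<Longrightarrow> \<bar>D 0 x - poly p x\<bar> \<le> hh ^ n * \<omega>"
    using taylor_poly_exists[OF assms(2,3)] by blast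
  have "co e (\<lambda>x. D 0 x - poly p x) = co e (D 0)"
    using coef_diff[OF c K_cont_poly] coef_poly[of p] p(1) assms(1) by simp
  then show ?thesis
    using coef_bound[of "\<lambda>x. D 0 x - poly p x" _ e, OF _ p(2)] c K_cont_poly by (simp add: continuous_on_diff)
qed

subsection \<open>The correction polynomials\<close>

lemma Dsinv_poly:
  assumes "pderiv P = p" "x \<in> K"
  shows "Dsinv X j (poly p) x = (poly P x - poly P (X (j - 1))) / hb"
  using assms integral_pderiv[of "X (j - 1)" x P] by (simp add: Dsinv_def cell_def)

lemma Dsinv_continuous: "continuous_on K (Dsinv X j (poly p))"
proof -
  obtain P where "pderiv P = p" using poly_antiderivative by blast
  then have "continuous_on K (Dsinv X j (poly p)) \<longleftrightarrow> continuous_on K (\<lambda>x. (poly P x - poly P (X (j - 1))) / hb)"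
    by (intro continuous_on_cong) (auto simp: Dsinv_poly)
  moreover have "continuous_on K (\<lambda>x. (poly P x - poly P (X (j - 1))) / hb)"
    using h_pos by (intro continuous_intros) auto
  ultimately show ?thesis by blast
qed

lemma Dsinv_bound:
  assumes "\<And>x. x \<in> K \<Longrightarrow> \<bar>poly p x\<bar> \<le> S" "x \<in> K"
  shows "\<bar>Dsinv X j (poly p) x\<bar> \<le> 2 * S"
proof -
  have S: "0 \<le> S" using assms(1)[OF E_in] abs_ge_zero by (meson order_trans)
  have "norm (integral {X (j - 1)..x} (poly p)) \<le> S * (x - X (j - 1))"
    by (rule integral_bound) (use assms in \<open>auto simp: cell_def intro!: continuous_intros\<close>)
  also have "\<dots> \<le> S * hh" using S assms(2) by (intro mult_left_mono) (auto simp: cell_def h_eq)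
  finally show ?thesis using h_pos by (simp add: Dsinv_def field_simps)
qed

lemma Z_degree: "degree (Z e n) \<le> k"
  by (cases n) (auto simp: degree_Lcell[OF lt] degree_radau Dsinv_continuous)

lemma Z_bound: "x \<in> K \<Longrightarrow> \<bar>poly (Z e n) x\<bar> \<le> zC k n"
proof (induction n arbitrary: e x)
  case 0
  then show ?case by (simp add: zC_def L_bound)
next
  case (Suc n)
  have "\<bar>poly (Z e (Suc n)) x\<bar> \<le> radauC k * (2 * zC k n)"
    using radau_bound[OF Dsinv_continuous Dsinv_bound Suc.prems] Suc.IH by simp
  then show ?case by (simp add: zC_def mult_ac)
qed

text \<open>Mean value zero makes the antiderivative of \<open>Z (opp e) n\<close> vanish at both
  ends of the cell. Hence the integration by parts has no boundary terms and the projected end value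
  is 0. The projection itself may be dropped, as \<open>pderiv w\<close> has degree at most k -
  1.\<close>

lemma Z_parts_orth:
  assumes "n < k" "ip X j (poly (Z (opp e) n)) (poly 1) = 0" "degree w \<le> k"
  shows "ip X j (poly (Z e (Suc n))) (poly (pderiv w)) = - (1 / hb) * ip X j (poly (Z (opp e) n)) (poly w)"
    and "poly (Z e (Suc n)) (E e) = 0"
proof -
  obtain P where P: "pderiv P = Z (opp e) n" using poly_antiderivative by blast
  define R where "R = smult (1 / hb) (P - [:poly P (X (j - 1)):])"
  have R: "poly R x = Dsinv X j (poly (Z (opp e) n)) x" if "x \<in> K" for x
    using Dsinv_poly[OF P that] by (simp add: R_def)
  have dR: "pderiv R = smult (1 / hb) (Z (opp e) n)" by (simp add: R_def P pderiv_smult pderiv_diff pderiv_pCons)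
  have Rl: "poly R (X (j - 1)) = 0" by (simp add: R_def)
  have "ip X j (poly (Z (opp e) n)) (poly 1) = poly P (X j) - poly P (X (j - 1))"
    using integral_pderiv[of "X (j - 1)" "X j" P] lt P by (simp add: ip_def cell_def)
  then have Rr: "poly R (X j) = 0" using assms(2) by (simp add: R_def)
  show "poly (Z e (Suc n)) (E e) = 0"
    using radau_end[OF Dsinv_continuous, of e "Z (opp e) n"] R[OF E_in, of e] Rl Rr
    by (cases e) (simp_all del: radau.simps)
  have "degree (pderiv w) \<le> k - 1" using assms(3) by (simp add: degree_pderiv)
  then have "ip X j (poly (Z e (Suc n))) (poly (pderiv w)) = ip X j (Dsinv X j (poly (Z (opp e) n))) (poly (pderiv w))"
    using radau_low[OF Dsinv_continuous] by simp
  also have "\<dots> = ip X j (poly R) (poly (pderiv w))" using R by (intro ip_cong) auto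
  also have "\<dots> = - integral K (poly (pderiv R * w))"
    using integral_by_parts_poly[of "X (j - 1)" "X j" R w] lt Rl Rr by (simp add: ip_poly cell_def del: poly_mult)
  also have "\<dots> = - ip X j (poly (pderiv R)) (poly w)" by (simp add: ip_poly)
  finally show "ip X j (poly (Z e (Suc n))) (poly (pderiv w)) = - (1 / hb) * ip X j (poly (Z (opp e) n)) (poly w)"
    by (simp add: dR ip_poly_smult)
qed

text \<open>\<open>L k\<close> is orthogonal to degrees below k, and every step of the recursion
  costs one degree. As long as n < k the mean value is therefore zero, which keeps the integration
  by parts going.\<close>

lemma Z_orth: "n + degree w < k \<Longrightarrow> ip X j (poly (Z e n)) (poly w) = 0"
proof (induction n arbitrary: e w)
  case 0
  then show ?case using ip_Lk_low[of w] by simp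
next
  case (Suc n)
  obtain W where W: "pderiv W = w" "degree W \<le> Suc (degree w)" using poly_antiderivative by blast
  have "ip X j (poly (Z (opp e) n)) (poly 1) = 0" using Suc by simp
  moreover have "ip X j (poly (Z (opp e) n)) (poly W) = 0" using Suc W by simp
  ultimately show ?case using Z_parts_orth(1)[of n e W] Suc.prems W by simp
qed

lemma Z_parts:
  "n < k \<Longrightarrow> degree w \<le> k \<Longrightarrow>
     ip X j (poly (Z e (Suc n))) (poly (pderiv w)) = - (1 / hb) * ip X j (poly (Z (opp e) n)) (poly w)"
  and Z_end: "n < k \<Longrightarrow> poly (Z e (Suc n)) (E e) = 0"
  using Z_parts_orth[of n e] Z_orth[of n 1 "opp e"] by (simp_all del: Zp.simps add: Z_parts_orth(2)[where w = 0])

lemma degree_interp: "continuous_on K (D 0) \<Longrightarrow> degree (interp k X j e D) \<le> k"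
  unfolding interp_def
  by (intro degree_diff_le degree_sum_le) (auto intro!: order_trans[OF degree_smult_le] simp: Z_degree degree_radau)

lemma interp_end: 
  assumes "continuous_on K (D 0)" shows "poly (interp k X j e D) (E e) = D 0 (E e)"
proof -
  have "poly (Z e n) (E e) = 0" if "n \<in> {1..k}" for n
    using Z_end[of "n - 1" e] that by (cases n) (auto simp del: Zp.simps)
  then show ?thesis by (simp add: interp_def poly_sum radau_end assms)
qed

lemma interp_residual:
  assumes c: "\<And>n. n \<le> k \<Longrightarrow> continuous_on K (D n)" and w: "degree w \<le> k"
  shows "ip X j (D 0) (poly w) - ip X j (poly (interp k X j e D)) (poly w) =
    (\<Sum>n\<le>k. hb ^ n * co (alt e n) (D n) * ip X j (poly (Z e n)) (poly w))"
proof -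
  have "{..k} = insert 0 {1..k}" by auto
  then have "(\<Sum>n\<le>k. hb ^ n * co (alt e n) (D n) * ip X j (poly (Z e n)) (poly w)) =
     co e (D 0) * ip X j (poly (L k)) (poly w) + (\<Sum>n=1..k. hb ^ n * co (alt e n) (D n) * ip X j (poly (Z e n)) (poly w))"
    by simp
  then show ?thesis
    using radau_residual[OF c[of 0] w, of e] unfolding interp_def ip_poly_diff ip_poly_sum ip_poly_smult by simp
qed

text \<open>All terms of the residual but the last cancel between the two equations of the scheme.\<close>

lemma interp_consistency:
  assumes c: "\<And>n. n \<le> Suc k \<Longrightarrow> continuous_on K (D n)" and w: "degree w \<le> k"
  shows "ip X j (D 1) (poly w) - ip X j (poly (interp k X j (opp e) (\<lambda>n. D (Suc n)))) (poly w)
     + (ip X j (D 0) (poly (pderiv w)) - ip X j (poly (interp k X j e D)) (poly (pderiv w))) =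
     hb ^ k * co (alt (opp e) k) (D (Suc k)) * ip X j (poly (Z (opp e) k)) (poly w)"
proof -
  have w': "degree (pderiv w) \<le> k - 1" "degree (pderiv w) \<le> k" using w by (auto simp: degree_pderiv)
  let ?g = "\<lambda>n. hb ^ n * co (alt (opp e) n) (D (Suc n)) * ip X j (poly (Z (opp e) n)) (poly w)"
  have split: "{..k} = insert k {..<k}" "{..k} = insert 0 (Suc ` {..<k})"
    by (auto simp: lessThan_Suc_eq_insert_0[symmetric] lessThan_Suc_atMost[symmetric])
  have 1: "ip X j (D 1) (poly w) - ip X j (poly (interp k X j (opp e) (\<lambda>n. D (Suc n)))) (poly w) =
     ?g k + (\<Sum>n<k. ?g n)"
    using interp_residual[of "\<lambda>n. D (Suc n)" w "opp e"] c w by (simp add: split(1))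
  \<comment> \<open>The term n = 0 is missing because \<open>L k\<close> is orthogonal to
    \<open>pderiv w\<close>. After an index shift, the term \<open>Suc n\<close> of this sum is
    minus the term n of the first one.\<close>
  have 2: "ip X j (D 0) (poly (pderiv w)) - ip X j (poly (interp k X j e D)) (poly (pderiv w)) =
     (\<Sum>n\<in>Suc ` {..<k}. hb ^ n * co (alt e n) (D n) * ip X j (poly (Z e n)) (poly (pderiv w)))"
    using interp_residual[of D "pderiv w" e] c w' ip_Lk_low[OF w'(1)] by (simp add: split(2))
  also have "\<dots> = (\<Sum>n<k. hb ^ Suc n * co (alt e (Suc n)) (D (Suc n)) * ip X j (poly (Z e (Suc n))) (poly (pderiv w)))"
    by (subst sum.reindex) auto
  also have "\<dots> = (\<Sum>n<k. - ?g n)"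
  proof (intro sum.cong refl)
    fix n assume n: "n \<in> {..<k}"
    have "hb ^ Suc n * co (alt e (Suc n)) (D (Suc n)) * ip X j (poly (Z e (Suc n))) (poly (pderiv w)) =
       hb ^ Suc n * co (alt (opp e) n) (D (Suc n)) * (- (1 / hb) * ip X j (poly (Z (opp e) n)) (poly w))"
      using n Z_parts[of n w e] w by (simp del: Zp.simps)
    also have "hb ^ Suc n * co (alt (opp e) n) (D (Suc n)) * (- (1 / hb) * ip X j (poly (Z (opp e) n)) (poly w)) = - ?g n"
      using h_pos(2) by simp
    finally show "hb ^ Suc n * co (alt e (Suc n)) (D (Suc n)) * ip X j (poly (Z e (Suc n))) (poly (pderiv w)) = - ?g n"
      by simp
  qed
  finally show ?thesis using 1 by (simp add: sum_negf)
qed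

end

lemma F_eq_Z:
  "F1 k X j (Suc i) = Zp k X j FluxII (2 * i + 1)" "F2 k X j (Suc i) = Zp k X j FluxI (2 * i + 1)"
  by (induction i) (auto simp: poly_Lcell)

lemma Fbar_eq_Z:
  assumes "1 \<le> i" shows "F1bar k X j i = Zp k X j FluxI (2 * i)" "F2bar k X j i = Zp k X j FluxII (2 * i)"
  using assms F_eq_Z[of k X j "i - 1"] by (cases i; auto simp: F1bar_def F2bar_def)+

text \<open>Merges the two sums of the interpolation function, of lengths floor and ceiling of l/2,
  into one sum over the alternating sequence \<open>Zp\<close>.\<close>

lemma sum_even_odd:
  fixes g :: "nat \<Rightarrow> 'a :: cancel_comm_monoid_add"
  shows "(\<Sum>i=1..n div 2. g (2 * i)) + (\<Sum>i=1..(n + 1) div 2. g (2 * i - 1)) = (\<Sum>i=1..n. g i)"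
proof (induction n)
  case (Suc n)
  show ?case
  proof (cases "even n")
    case True
    then obtain m where "n = 2 * m" by blast
    then show ?thesis using Suc by (simp add: add_ac)
  next
    case False
    then obtain m where "n = 2 * m + 1" by (elim oddE)
    then show ?thesis using Suc by (simp add: add_ac)
  qed
qed simp

section \<open>The semi-discrete evolution\<close>

text \<open>Vectors and matrices are functions on an arbitrary index set, since the dimension
  depends on the mesh and so cannot be fixed by a type.\<close>

definition mv :: "'i set \<Rightarrow> ('i \<Rightarrow> 'i \<Rightarrow> real) \<Rightarrow> ('i \<Rightarrow> real) \<Rightarrow> 'i \<Rightarrow> real" where
  "mv I a x i = (\<Sum>l\<in>I. a i l * x l)"

definition trp :: "('i \<Rightarrow> 'i \<Rightarrow> real) \<Rightarrow> 'i \<Rightarrow> 'i \<Rightarrow> real" where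
  "trp a i l = a l i"

definition dot :: "'i set \<Rightarrow> ('i \<Rightarrow> real) \<Rightarrow> ('i \<Rightarrow> real) \<Rightarrow> real" where
  "dot I x y = (\<Sum>i\<in>I. x i * y i)"

lemma trp_trp [simp]: "trp (trp a) = a"
  by (simp add: trp_def fun_eq_iff)

lemma dot_mv: "dot I (mv I a x) z = dot I x (mv I (trp a) z)"
proof -
  have "dot I (mv I a x) z = (\<Sum>i\<in>I. \<Sum>l\<in>I. a i l * x l * z i)"
    by (simp add: dot_def mv_def sum_distrib_right)
  also have "\<dots> = (\<Sum>l\<in>I. \<Sum>i\<in>I. a i l * x l * z i)" by (rule sum.swap)
  finally show ?thesis by (simp add: dot_def mv_def trp_def sum_distrib_left mult_ac)
qed

lemma dot_commute: "dot I x y = dot I y x"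
  by (simp add: dot_def mult.commute)

lemma dot_cong: "(\<And>i. i \<in> I \<Longrightarrow> x i = x' i) \<Longrightarrow> (\<And>i. i \<in> I \<Longrightarrow> y i = y' i) \<Longrightarrow> dot I x y = dot I x' y'"
  by (simp add: dot_def)

lemma dot_self: "dot I x x = (L2_set x I)\<^sup>2"
  by (simp add: dot_def L2_set_def sum_nonneg power2_eq_square)

lemma dot_self_nonneg: "0 \<le> dot I x x"
  by (simp add: dot_self)

lemma dot_le: "\<bar>dot I x y\<bar> \<le> L2_set x I * L2_set y I"
proof -
  have "\<bar>dot I x y\<bar> \<le> (\<Sum>i\<in>I. \<bar>x i\<bar> * \<bar>y i\<bar>)"
    unfolding dot_def by (rule order_trans[OF sum_abs]) (simp add: abs_mult)
  also have "\<dots> \<le> L2_set x I * L2_set y I" by (rule L2_set_mult_ineq)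
  finally show ?thesis .
qed

lemma mv_sup_bound:
  assumes "finite I" "\<And>l. l \<in> I \<Longrightarrow> \<bar>x l\<bar> \<le> S" "i \<in> I"
  shows "\<bar>mv I a x i\<bar> \<le> (\<Sum>i\<in>I. \<Sum>l\<in>I. \<bar>a i l\<bar>) * S"
proof -
  have S: "0 \<le> S" using assms(2)[OF assms(3)] by linarith
  have "\<bar>mv I a x i\<bar> \<le> (\<Sum>l\<in>I. \<bar>a i l\<bar> * S)"
    unfolding mv_def by (intro order_trans[OF sum_abs] sum_mono) (simp add: abs_mult mult_left_mono assms(2))
  also have "\<dots> = (\<Sum>l\<in>I. \<bar>a i l\<bar>) * S" by (simp add: sum_distrib_right)
  also have "\<dots> \<le> (\<Sum>i\<in>I. \<Sum>l\<in>I. \<bar>a i l\<bar>) * S"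
    using S assms(1,3) member_le_sum[of i I "\<lambda>i. \<Sum>l\<in>I. \<bar>a i l\<bar>"] by (intro mult_right_mono) (auto simp: sum_nonneg)
  finally show ?thesis .
qed

text \<open>The solution is the power series of the exponential of \<open>- a^T a\<close> applied to
  \<open>y0\<close>. The iterates of the matrix grow at most geometrically, so the series converges
  at every time and may be differentiated term by term.\<close>

lemma semigroup_exists:
  fixes y0 :: "'i \<Rightarrow> real"
  assumes I: "finite I"
  shows "\<exists>y. (\<forall>i\<in>I. y 0 i = y0 i) \<and>
    (\<forall>\<tau>. \<forall>i\<in>I. ((\<lambda>\<tau>. y \<tau> i) has_real_derivative - mv I (trp a) (mv I a (y \<tau>)) i) (at \<tau>))"
proof -
  define G where "G x = mv I (trp a) (mv I a x)" for x
  define c where "c = (\<Sum>i\<in>I. \<Sum>l\<in>I. \<bar>a i l\<bar>) * (\<Sum>i\<in>I. \<Sum>l\<in>I. \<bar>trp a i l\<bar>)"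
  define S where "S = (\<Sum>i\<in>I. \<bar>y0 i\<bar>)"
  have c0: "0 \<le> c" unfolding c_def by (intro mult_nonneg_nonneg sum_nonneg) auto
  have Gn: "\<bar>(G ^^ n) y0 i\<bar> \<le> c ^ n * S" if "i \<in> I" for n i
    using that
  proof (induction n arbitrary: i)
    case 0
    then show ?case using member_le_sum[of i I "\<lambda>i. \<bar>y0 i\<bar>"] I by (simp add: S_def)
  next
    case (Suc n)
    have "\<bar>mv I (trp a) (mv I a ((G ^^ n) y0)) i\<bar> \<le>
        (\<Sum>i\<in>I. \<Sum>l\<in>I. \<bar>trp a i l\<bar>) * ((\<Sum>i\<in>I. \<Sum>l\<in>I. \<bar>a i l\<bar>) * (c ^ n * S))"
      by (intro mv_sup_bound I Suc) auto
    then show ?case by (simp add: G_def[symmetric] c_def mult_ac)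
  qed
  define b where "b i n = (- 1) ^ n * (G ^^ n) y0 i / fact n" for i n
  define y where "y \<tau> i = (\<Sum>n. b i n * \<tau> ^ n)" for \<tau> i
  have sm: "summable (\<lambda>n. b i n * \<tau> ^ n)" if i: "i \<in> I" for i and \<tau> :: real
  proof (rule summable_comparison_test')
    show "summable (\<lambda>n. S * (inverse (fact n) * (c * \<bar>\<tau>\<bar>) ^ n))"
      by (intro summable_mult summable_exp)
    fix n :: nat assume "0 \<le> n"
    have "norm (b i n * \<tau> ^ n) = \<bar>(G ^^ n) y0 i\<bar> * (inverse (fact n) * \<bar>\<tau>\<bar> ^ n)"
      by (simp add: b_def abs_mult power_abs divide_inverse)
    also have "\<dots> \<le> (c ^ n * S) * (inverse (fact n) * \<bar>\<tau>\<bar> ^ n)"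
      by (intro mult_right_mono Gn i) auto
    finally show "norm (b i n * \<tau> ^ n) \<le> S * (inverse (fact n) * (c * \<bar>\<tau>\<bar>) ^ n)"
      by (simp add: power_mult_distrib mult_ac)
  qed
  have sums_y: "(\<lambda>n. b i n * \<tau> ^ n) sums y \<tau> i" if "i \<in> I" for i \<tau>
    unfolding y_def by (rule summable_sums[OF sm[OF that]])
  have sums_mv: "(\<lambda>n. mv I m (x n) i) sums mv I m z i" if "\<And>l. l \<in> I \<Longrightarrow> (\<lambda>n. x n l) sums z l" for m x z i
    unfolding mv_def by (intro sums_sum sums_mult that)
  have mv_scale: "mv I m (\<lambda>l. z l * s) i = mv I m z i * s" for m z s i
    by (simp add: mv_def sum_distrib_right mult.assoc)
  have sG: "(\<lambda>n. (- 1) ^ n * (G ^^ Suc n) y0 i / fact n * \<tau> ^ n) sums G (y \<tau>) i" for i \<tau>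
  proof -
    have "(\<lambda>n. mv I (trp a) (mv I a (\<lambda>l. b l n * \<tau> ^ n)) i) sums G (y \<tau>) i"
      unfolding G_def by (intro sums_mv sums_y)
    moreover have "mv I (trp a) (mv I a (\<lambda>l. b l n * \<tau> ^ n)) i = (- 1) ^ n * (G ^^ Suc n) y0 i / fact n * \<tau> ^ n" for n
    proof -
      have "(\<lambda>l. b l n * \<tau> ^ n) = (\<lambda>l. (G ^^ n) y0 l * ((- 1) ^ n / fact n * \<tau> ^ n))"
        by (simp add: b_def fun_eq_iff)
      moreover have "mv I m (\<lambda>l. z l * s) = (\<lambda>i. mv I m z i * s)" for m z s
        using mv_scale by blast
      ultimately have "mv I (trp a) (mv I a (\<lambda>l. b l n * \<tau> ^ n)) i = G ((G ^^ n) y0) i * ((- 1) ^ n / fact n * \<tau> ^ n)"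
        by (simp only: G_def)
      then show ?thesis by simp
    qed
    ultimately show ?thesis by simp
  qed
  have "((\<lambda>\<tau>. y \<tau> i) has_real_derivative - G (y \<tau>) i) (at \<tau>)" if i: "i \<in> I" for i \<tau>
  proof -
    have "((\<lambda>\<tau>. y \<tau> i) has_real_derivative (\<Sum>n. diffs (b i) n * \<tau> ^ n)) (at \<tau>)"
      unfolding y_def by (rule termdiffs_strong_converges_everywhere[OF sm[OF i]])
    moreover have "diffs (b i) n * \<tau> ^ n = - ((- 1) ^ n * (G ^^ Suc n) y0 i / fact n * \<tau> ^ n)" for n
      by (simp add: diffs_def b_def fact_Suc del: funpow.simps of_nat_Suc)
    moreover have "(\<Sum>n. - ((- 1) ^ n * (G ^^ Suc n) y0 i / fact n * \<tau> ^ n)) = - G (y \<tau>) i"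
      by (rule sums_unique[symmetric], rule sums_minus, rule sG)
    ultimately show ?thesis by simp
  qed
  moreover have "y 0 i = y0 i" for i
    unfolding y_def using powser_zero[of "b i"] by (simp add: b_def)
  ultimately show ?thesis unfolding G_def by blast
qed

lemma DERIV_dot:
  assumes "\<And>i. i \<in> I \<Longrightarrow> ((\<lambda>s. x s i) has_real_derivative x' i) (at s within A)"
    and "\<And>i. i \<in> I \<Longrightarrow> ((\<lambda>s. y s i) has_real_derivative y' i) (at s within A)"
  shows "((\<lambda>s. dot I (x s) (y s)) has_real_derivative dot I x' (y s) + dot I (x s) y') (at s within A)"
proof -
  have "((\<lambda>s. \<Sum>i\<in>I. x s i * y s i) has_real_derivative (\<Sum>i\<in>I. x' i * y s i + y' i * x s i)) (at s within A)"
    by (intro DERIV_sum DERIV_mult assms)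
  then show ?thesis by (simp add: dot_def sum.distrib mult.commute)
qed

lemma DERIV_mv:
  assumes "\<And>i. i \<in> I \<Longrightarrow> ((\<lambda>s. x s i) has_real_derivative x' i) (at s within A)"
  shows "((\<lambda>s. mv I a (x s) i) has_real_derivative mv I a x' i) (at s within A)"
  unfolding mv_def by (intro DERIV_sum DERIV_cmult assms)

lemma dot_minus: "dot I x (\<lambda>i. - y i) = - dot I x y" "dot I (\<lambda>i. - x i) y = - dot I x y"
  by (simp_all add: dot_def sum_negf)

lemma mv_minus: "mv I a (\<lambda>i. - x i) = (\<lambda>i. - mv I a x i)"
  by (simp add: mv_def sum_negf fun_eq_iff)

text \<open>The smoothing bounds come from one Lyapunov function,
  \<open>|y|\<^sup>2 + 2 \<tau> |a y|\<^sup>2 + 2 \<tau>\<^sup>2 |a\<^sup>T a y|\<^sup>2 + (4/3) \<tau>\<^sup>3 |a a\<^sup>T a y|\<^sup>2\<close>, which decreases because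
  the derivative of each squared norm is minus twice the next one.\<close>

lemma semigroup_smoothing:
  fixes y0 :: "'i \<Rightarrow> real"
  assumes I: "finite I"
  obtains y where "\<And>i. i \<in> I \<Longrightarrow> y 0 i = y0 i"
    "\<And>\<tau> i. i \<in> I \<Longrightarrow> ((\<lambda>\<tau>. y \<tau> i) has_real_derivative - mv I (trp a) (mv I a (y \<tau>)) i) (at \<tau>)"
    "\<And>\<tau>. 0 \<le> \<tau> \<Longrightarrow> L2_set (y \<tau>) I \<le> L2_set y0 I"
    "\<And>\<tau>. 0 < \<tau> \<Longrightarrow> L2_set (mv I a (y \<tau>)) I \<le> L2_set y0 I / sqrt \<tau>"
    "\<And>\<tau>. 0 < \<tau> \<Longrightarrow> L2_set (mv I (trp a) (mv I a (y \<tau>))) I \<le> L2_set y0 I / \<tau>"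
    "\<And>\<tau>. 0 < \<tau> \<Longrightarrow> L2_set (mv I a (mv I (trp a) (mv I a (y \<tau>)))) I \<le> L2_set y0 I / (\<tau> * sqrt \<tau>)"
proof -
  obtain y where y: "\<And>i. i \<in> I \<Longrightarrow> y 0 i = y0 i"
    "\<And>\<tau> i. i \<in> I \<Longrightarrow> ((\<lambda>\<tau>. y \<tau> i) has_real_derivative - mv I (trp a) (mv I a (y \<tau>)) i) (at \<tau>)"
    using semigroup_exists[OF I, of y0 a] by blast
  define w1 where "w1 \<tau> = mv I a (y \<tau>)" for \<tau>
  define w2 where "w2 \<tau> = mv I (trp a) (w1 \<tau>)" for \<tau>
  define w3 where "w3 \<tau> = mv I a (w2 \<tau>)" for \<tau>
  define w4 where "w4 \<tau> = mv I (trp a) (w3 \<tau>)" for \<tau>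
  have d0: "((\<lambda>\<tau>. y \<tau> i) has_real_derivative - w2 \<tau> i) (at \<tau>)" if "i \<in> I" for \<tau> i
    using y(2)[OF that] by (simp add: w1_def w2_def)
  have d1: "((\<lambda>\<tau>. w1 \<tau> i) has_real_derivative - w3 \<tau> i) (at \<tau>)" for \<tau> i
    using DERIV_mv[of I y "\<lambda>i. - w2 \<tau> i" \<tau> UNIV a i] d0 by (simp add: w1_def w3_def mv_minus)
  have d2: "((\<lambda>\<tau>. w2 \<tau> i) has_real_derivative - w4 \<tau> i) (at \<tau>)" for \<tau> i
    using DERIV_mv[of I w1 "\<lambda>i. - w3 \<tau> i" \<tau> UNIV "trp a" i] d1 by (simp add: w2_def w4_def mv_minus)
  have d3: "((\<lambda>\<tau>. w3 \<tau> i) has_real_derivative - mv I a (w4 \<tau>) i) (at \<tau>)" for \<tau> i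
    using DERIV_mv[of I w2 "\<lambda>i. - w4 \<tau> i" \<tau> UNIV a i] d2 by (simp add: w3_def mv_minus)
  define N0 where "N0 \<tau> = dot I (y \<tau>) (y \<tau>)" for \<tau>
  define N1 where "N1 \<tau> = dot I (w1 \<tau>) (w1 \<tau>)" for \<tau>
  define N2 where "N2 \<tau> = dot I (w2 \<tau>) (w2 \<tau>)" for \<tau>
  define N3 where "N3 \<tau> = dot I (w3 \<tau>) (w3 \<tau>)" for \<tau>
  define N4 where "N4 \<tau> = dot I (w4 \<tau>) (w4 \<tau>)" for \<tau>
  have D0: "(N0 has_real_derivative - 2 * N1 \<tau>) (at \<tau>)" for \<tau>
  proof -
    have "dot I (y \<tau>) (w2 \<tau>) = N1 \<tau>" by (simp add: w2_def N1_def dot_mv[symmetric] w1_def)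
    then show ?thesis
      using DERIV_dot[of I y "\<lambda>i. - w2 \<tau> i" \<tau> UNIV y, OF d0 d0]
      by (simp add: N0_def[abs_def] dot_minus dot_commute[of I "w2 \<tau>"])
  qed
  have D1: "(N1 has_real_derivative - 2 * N2 \<tau>) (at \<tau>)" for \<tau>
  proof -
    have "dot I (w1 \<tau>) (w3 \<tau>) = N2 \<tau>"
      using dot_mv[of I a "w2 \<tau>" "w1 \<tau>"] by (simp add: w3_def N2_def dot_commute[of I "w1 \<tau>"] w2_def[symmetric])
    then show ?thesis
      using DERIV_dot[of I w1 "\<lambda>i. - w3 \<tau> i" \<tau> UNIV w1, OF d1 d1]
      by (simp add: N1_def[abs_def] dot_minus dot_commute[of I "w3 \<tau>"])
  qed
  have D2: "(N2 has_real_derivative - 2 * N3 \<tau>) (at \<tau>)" for \<tau>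
  proof -
    have "dot I (w2 \<tau>) (w4 \<tau>) = N3 \<tau>"
      using dot_mv[of I a "w2 \<tau>" "w3 \<tau>"] by (simp add: w4_def N3_def w3_def[symmetric])
    then show ?thesis
      using DERIV_dot[of I w2 "\<lambda>i. - w4 \<tau> i" \<tau> UNIV w2, OF d2 d2]
      by (simp add: N2_def[abs_def] dot_minus dot_commute[of I "w4 \<tau>"])
  qed
  have D3: "(N3 has_real_derivative - 2 * N4 \<tau>) (at \<tau>)" for \<tau>
  proof -
    have "dot I (w3 \<tau>) (mv I a (w4 \<tau>)) = N4 \<tau>"
      using dot_mv[of I a "w4 \<tau>" "w3 \<tau>"] by (simp add: N4_def w4_def[symmetric] dot_commute[of I "w3 \<tau>"])
    then show ?thesis
      using DERIV_dot[of I w3 "\<lambda>i. - mv I a (w4 \<tau>) i" \<tau> UNIV w3, OF d3 d3]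
      by (simp add: N3_def[abs_def] dot_minus dot_commute[of I "mv I a (w4 \<tau>)"])
  qed
  \<comment> \<open>The coefficients 1, 2, 2, 4/3 are 2^j / j!. With them the derivative telescopes
    and only the term containing \<open>N4\<close> remains.\<close>
  define F where "F \<tau> = N0 \<tau> + 2 * \<tau> * N1 \<tau> + 2 * \<tau>\<^sup>2 * N2 \<tau> + 4 / 3 * \<tau> ^ 3 * N3 \<tau>" for \<tau>
  have DF: "(F has_real_derivative - (8 / 3 * \<tau> ^ 3 * N4 \<tau>)) (at \<tau>)" for \<tau>
    unfolding F_def[abs_def]
    by (rule derivative_eq_intros D0 D1 D2 D3 refl)+ (simp add: power2_eq_square algebra_simps)
  have Fle: "F \<tau> \<le> (L2_set y0 I)\<^sup>2" if "0 \<le> \<tau>" for \<tau>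
  proof -
    have "F \<tau> \<le> F 0"
    proof (rule DERIV_nonpos_imp_nonincreasing[OF that])
      fix s assume "0 \<le> s" "s \<le> \<tau>"
      then show "\<exists>l. DERIV F s :> l \<and> l \<le> 0"
        using DF[of s] dot_self_nonneg[of I "w4 s"] by (intro exI conjI) (auto simp: N4_def)
    qed
    also have "F 0 = (L2_set y0 I)\<^sup>2"
      unfolding F_def N0_def dot_self[symmetric] by (simp, rule dot_cong) (auto simp: y)
    finally show ?thesis .
  qed
  have nn: "0 \<le> N0 \<tau>" "0 \<le> N1 \<tau>" "0 \<le> N2 \<tau>" "0 \<le> N3 \<tau>" for \<tau>
    by (simp_all add: N0_def N1_def N2_def N3_def dot_self_nonneg)
  have b: "L2_set v I \<le> L2_set y0 I / s" if "s\<^sup>2 * dot I v v \<le> (L2_set y0 I)\<^sup>2" "0 < s" for v s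
  proof -
    have "(s * L2_set v I)\<^sup>2 \<le> (L2_set y0 I)\<^sup>2" using that(1) by (simp add: dot_self power_mult_distrib)
    then have "s * L2_set v I \<le> L2_set y0 I" by (rule power2_le_imp_le) (simp add: L2_set_nonneg)
    then show ?thesis using that(2) by (simp add: field_simps)
  qed
  have Fge: "N0 \<tau> \<le> F \<tau>" "\<tau> * N1 \<tau> \<le> F \<tau>" "\<tau>\<^sup>2 * N2 \<tau> \<le> F \<tau>" "\<tau> ^ 3 * N3 \<tau> \<le> F \<tau>"
    if "0 \<le> \<tau>" for \<tau>
  proof -
    have "0 \<le> \<tau> * N1 \<tau>" "0 \<le> \<tau>\<^sup>2 * N2 \<tau>" "0 \<le> \<tau> ^ 3 * N3 \<tau>" using nn[of \<tau>] that by simp_all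
    moreover have "F \<tau> = N0 \<tau> + 2 * (\<tau> * N1 \<tau>) + 2 * (\<tau>\<^sup>2 * N2 \<tau>) + 4 / 3 * (\<tau> ^ 3 * N3 \<tau>)" by (simp add: F_def)
    ultimately show "N0 \<tau> \<le> F \<tau>" "\<tau> * N1 \<tau> \<le> F \<tau>" "\<tau>\<^sup>2 * N2 \<tau> \<le> F \<tau>" "\<tau> ^ 3 * N3 \<tau> \<le> F \<tau>"
      using nn[of \<tau>] by linarith+
  qed
  have "L2_set (y \<tau>) I \<le> L2_set y0 I" if "0 \<le> \<tau>" for \<tau>
    using b[of 1 "y \<tau>"] order_trans[OF Fge(1)[OF that] Fle[OF that]] by (simp add: N0_def[symmetric])
  moreover have "L2_set (w1 \<tau>) I \<le> L2_set y0 I / sqrt \<tau>" if t: "0 < \<tau>" for \<tau>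
  proof (rule b)
    show "(sqrt \<tau>)\<^sup>2 * dot I (w1 \<tau>) (w1 \<tau>) \<le> (L2_set y0 I)\<^sup>2" using Fle[of \<tau>] Fge(2)[of \<tau>] t by (simp add: N1_def)
  qed (use t in auto)
  moreover have "L2_set (w2 \<tau>) I \<le> L2_set y0 I / \<tau>" if t: "0 < \<tau>" for \<tau>
  proof (rule b)
    show "\<tau>\<^sup>2 * dot I (w2 \<tau>) (w2 \<tau>) \<le> (L2_set y0 I)\<^sup>2" using Fle[of \<tau>] Fge(3)[of \<tau>] t by (simp add: N2_def)
  qed (use t in auto)
  moreover have "L2_set (w3 \<tau>) I \<le> L2_set y0 I / (\<tau> * sqrt \<tau>)" if t: "0 < \<tau>" for \<tau>
  proof (rule b)
    have "(\<tau> * sqrt \<tau>)\<^sup>2 = \<tau> ^ 3" using t by (simp add: power_mult_distrib power2_eq_square power3_eq_cube)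
    then show "(\<tau> * sqrt \<tau>)\<^sup>2 * dot I (w3 \<tau>) (w3 \<tau>) \<le> (L2_set y0 I)\<^sup>2" using Fle[of \<tau>] Fge(4)[of \<tau>] t by (simp add: N3_def)
  qed (use t in auto)
  ultimately show thesis using that[of y] y unfolding w3_def w2_def w1_def by blast
qed

text \<open>Derivatives are demanded only in the open interval, since the comparison functions, such
  as \<open>sqrt (t - s)\<close>, have singular derivatives at an end point.\<close>

lemma nonincreasing_within:
  fixes f :: "real \<Rightarrow> real"
  assumes "a \<le> b" "continuous_on {a..b} f"
    and "\<And>x. a < x \<Longrightarrow> x < b \<Longrightarrow> \<exists>l. (f has_real_derivative l) (at x) \<and> l \<le> 0"
  shows "f b \<le> f a"
proof (cases "a = b")
  case False
  then have ab: "a < b" using assms(1) by simp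
  have "f b - f a \<le> 0 * (b - a)" if "\<not> f b \<le> f a"
  proof -
    obtain l z where z: "a < z" "z < b" "DERIV f z :> l" "f b - f a = (b - a) * l"
      using MVT[OF ab assms(2)] assms(3) by (meson real_differentiable_def)
    obtain l' where l': "DERIV f z :> l'" "l' \<le> 0" using assms(3)[OF z(1,2)] by blast
    then have "l \<le> 0" using DERIV_unique[OF z(3) l'(1)] by simp
    then show ?thesis using z(4) ab by (simp add: mult_nonneg_nonpos)
  qed
  then show ?thesis by force
qed simp

text \<open>The error equations in orthonormal coordinates. The discrete derivatives in the two
  equations are adjoint up to sign, hence the pair \<open>d\<close> and \<open>- trp d\<close>. The
  residual of the evolution equation is given as a time derivative \<open>B'\<close>, and bounds are
  assumed for increments of its primitive \<open>B\<close> only.\<close>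

locale ldg_ode =
  fixes I :: "'i set" and d :: "'i \<Rightarrow> 'i \<Rightarrow> real" and t K :: real
    and xu xq r B B' :: "real \<Rightarrow> 'i \<Rightarrow> real"
  assumes I: "finite I" and t: "0 < t" and K: "0 \<le> K"
    and xu: "\<And>s i. 0 \<le> s \<Longrightarrow> s \<le> t \<Longrightarrow> i \<in> I \<Longrightarrow>
      ((\<lambda>s. xu s i) has_real_derivative - mv I (trp d) (xq s) i + B' s i) (at s within {0..t})"
    and B: "\<And>s i. 0 \<le> s \<Longrightarrow> s \<le> t \<Longrightarrow> i \<in> I \<Longrightarrow>
      ((\<lambda>s. B s i) has_real_derivative B' s i) (at s within {0..t})"
    and xq: "\<And>s i. 0 \<le> s \<Longrightarrow> s \<le> t \<Longrightarrow> i \<in> I \<Longrightarrow> xq s i = mv I d (xu s) i + r s i"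
    and init: "\<And>i. i \<in> I \<Longrightarrow> xu 0 i = 0"
    and r_bound: "\<And>s. 0 \<le> s \<Longrightarrow> s \<le> t \<Longrightarrow> L2_set (r s) I \<le> K"
    and B_bound: "\<And>s. 0 \<le> s \<Longrightarrow> s \<le> t \<Longrightarrow> L2_set (\<lambda>i. B s i - B t i) I \<le> K * sqrt (t - s)"
begin

text \<open>Duality: \<open>w\<close> is a solution of the backward problem, and moving the derivative off \<open>B\<close>
  replaces \<open>B s\<close> by \<open>B s - B t\<close>, which compensates the singularity of the kernel at \<open>s = t\<close>.\<close>

lemma dual_derivative:
  assumes s: "0 < s" "s < t"
    and w: "\<And>i. i \<in> I \<Longrightarrow> ((\<lambda>s. w s i) has_real_derivative mv I (trp d) (mv I d (w s)) i) (at s)"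
  shows "((\<lambda>s. dot I (xu s) (w s) - dot I (\<lambda>i. B s i - B t i) (w s)) has_real_derivative
     - dot I (r s) (mv I d (w s)) - dot I (\<lambda>i. B s i - B t i) (mv I (trp d) (mv I d (w s)))) (at s)"
proof -
  let ?w2 = "mv I (trp d) (mv I d (w s))"
  have at: "at s within {0..t} = at s" using s by (intro at_within_interior) auto
  have 1: "((\<lambda>s. dot I (xu s) (w s)) has_real_derivative
      dot I (\<lambda>i. - mv I (trp d) (xq s) i + B' s i) (w s) + dot I (xu s) ?w2) (at s)"
    using xu[of s] s at by (intro DERIV_dot w) auto
  have 2: "((\<lambda>s. dot I (\<lambda>i. B s i - B t i) (w s)) has_real_derivative
      dot I (B' s) (w s) + dot I (\<lambda>i. B s i - B t i) ?w2) (at s)"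
    using B[of s] s at by (intro DERIV_dot w) (auto intro!: derivative_eq_intros)
  have "dot I (\<lambda>i. - mv I (trp d) (xq s) i + B' s i) (w s) = - dot I (mv I (trp d) (xq s)) (w s) + dot I (B' s) (w s)"
    by (simp add: dot_def algebra_simps sum.distrib sum_subtractf)
  moreover have "dot I (mv I (trp d) (xq s)) (w s) = dot I (xq s) (mv I d (w s))" by (simp add: dot_mv)
  moreover have "dot I (xq s) (mv I d (w s)) = dot I (mv I d (xu s)) (mv I d (w s)) + dot I (r s) (mv I d (w s))"
    using xq s by (simp add: dot_def algebra_simps sum.distrib)
  moreover have "dot I (mv I d (xu s)) (mv I d (w s)) = dot I (xu s) ?w2" by (simp add: dot_mv)
  ultimately show ?thesis
    by (intro DERIV_cong[OF DERIV_diff[OF 1 2]]) simp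
qed

lemma dual_continuous:
  assumes "\<And>s i. i \<in> I \<Longrightarrow> isCont (\<lambda>s. w s i) s"
  shows "continuous_on {0..t} (\<lambda>s. dot I (xu s) (w s) - dot I (\<lambda>i. B s i - B t i) (w s))"
proof -
  have "continuous_on {0..t} (\<lambda>s. xu s i)" "continuous_on {0..t} (\<lambda>s. B s i)" "continuous_on {0..t} (\<lambda>s. w s i)"
    if "i \<in> I" for i
  proof -
    show "continuous_on {0..t} (\<lambda>s. xu s i)"
      using xu[OF _ _ that] by (intro DERIV_continuous_on) auto
    show "continuous_on {0..t} (\<lambda>s. B s i)"
      using B[OF _ _ that] by (intro DERIV_continuous_on) auto
    show "continuous_on {0..t} (\<lambda>s. w s i)"
      using assms[OF that] by (simp add: continuous_at_imp_continuous_on)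
  qed
  then show ?thesis unfolding dot_def by (intro continuous_intros) auto
qed

lemma dot_init: "dot I (xu 0) z = 0"
  by (simp add: dot_def init)

text \<open>The dual solution starts from the error itself. Its smoothing gives
  \<open>n / sqrt (t - s)\<close> against r and \<open>n / (t - s)\<close> against an increment of B
  of size \<open>K * sqrt (t - s)\<close>, together 2 K n / sqrt (t - s). This integrates to 4 K n
  sqrt t, and the increment of B at s = 0 adds K n sqrt t.\<close>

lemma estimate_u: "L2_set (xu t) I \<le> 5 * K * sqrt t"
proof -
  let ?y0 = "xu t"
  obtain y where y0: "\<And>i. i \<in> I \<Longrightarrow> y 0 i = ?y0 i"
    and y: "\<And>\<tau> i. i \<in> I \<Longrightarrow> ((\<lambda>\<tau>. y \<tau> i) has_real_derivative - mv I (trp d) (mv I d (y \<tau>)) i) (at \<tau>)"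
    and n0: "\<And>\<tau>. 0 \<le> \<tau> \<Longrightarrow> L2_set (y \<tau>) I \<le> L2_set ?y0 I"
    and n1: "\<And>\<tau>. 0 < \<tau> \<Longrightarrow> L2_set (mv I d (y \<tau>)) I \<le> L2_set ?y0 I / sqrt \<tau>"
    and n2: "\<And>\<tau>. 0 < \<tau> \<Longrightarrow> L2_set (mv I (trp d) (mv I d (y \<tau>))) I \<le> L2_set ?y0 I / \<tau>"
    and "\<And>\<tau>. 0 < \<tau> \<Longrightarrow> L2_set (mv I d (mv I (trp d) (mv I d (y \<tau>)))) I \<le> L2_set ?y0 I / (\<tau> * sqrt \<tau>)"
    by (rule semigroup_smoothing[OF I, of ?y0 d], rule that)
  define w where "w s = y (t - s)" for s
  define n where "n = L2_set ?y0 I"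
  have n: "0 \<le> n" by (simp add: n_def L2_set_nonneg)
  have w: "((\<lambda>s. w s i) has_real_derivative mv I (trp d) (mv I d (w s)) i) (at s)" if "i \<in> I" for i s
  proof -
    have "((\<lambda>s. t - s) has_real_derivative - 1) (at s)" by (auto intro!: derivative_eq_intros)
    from DERIV_chain2[OF y[OF that] this] show ?thesis by (simp add: w_def)
  qed
  define E where "E s = dot I (xu s) (w s) - dot I (\<lambda>i. B s i - B t i) (w s)" for s
  \<comment> \<open>The added function is a primitive that cancels the bound on the derivative of
    \<open>E\<close>, so that monotonicity of \<open>H\<close> replaces an integral
    inequality.\<close>
  define H where "H s = E s + 4 * K * n * sqrt (t - s)" for s
  have "H t \<le> H 0"
  proof (rule nonincreasing_within[where f = H])
    have "continuous_on {0..t} E" unfolding E_def[abs_def]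
      by (rule dual_continuous) (use w in \<open>auto intro: DERIV_isCont\<close>)
    then show "continuous_on {0..t} H" unfolding H_def[abs_def] by (intro continuous_intros)
    fix s assume s: "0 < s" "s < t"
    define e where "e = - dot I (r s) (mv I d (w s)) - dot I (\<lambda>i. B s i - B t i) (mv I (trp d) (mv I d (w s)))"
    have "(E has_real_derivative e) (at s)"
      unfolding E_def[abs_def] e_def by (rule dual_derivative[OF s w])
    then have "(H has_real_derivative e + 4 * K * n * (- (inverse (sqrt (t - s)) / 2))) (at s)"
      unfolding H_def[abs_def] using s by (auto intro!: derivative_eq_intros)
    moreover have "e \<le> K * (n / sqrt (t - s)) + K * (n / sqrt (t - s))"
    proof -
      have "\<bar>dot I (r s) (mv I d (w s))\<bar> \<le> K * (n / sqrt (t - s))"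
        using n1[of "t - s"] r_bound[of s] s K
        by (intro order_trans[OF dot_le] mult_mono) (auto simp: n_def w_def L2_set_nonneg)
      moreover have "\<bar>dot I (\<lambda>i. B s i - B t i) (mv I (trp d) (mv I d (w s)))\<bar> \<le> (K * sqrt (t - s)) * (n / (t - s))"
        using n2[of "t - s"] B_bound[of s] s K
        by (intro order_trans[OF dot_le] mult_mono) (auto simp: n_def w_def L2_set_nonneg)
      moreover have "(K * sqrt (t - s)) * (n / (t - s)) = K * (n / sqrt (t - s))"
        using s real_sqrt_mult_self[of "t - s"] by (simp add: field_simps)
      ultimately show ?thesis unfolding e_def by linarith
    qed
    ultimately show "\<exists>l. DERIV H s :> l \<and> l \<le> 0"
      by (intro exI conjI) (assumption, simp add: field_simps)
  qed (use t in simp)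
  moreover have "H t = n\<^sup>2"
  proof -
    have "dot I (xu t) (w t) = dot I (xu t) (xu t)" by (rule dot_cong) (auto simp: w_def y0)
    moreover have "dot I (\<lambda>i. B t i - B t i) (w t) = 0" by (simp add: dot_def)
    ultimately show ?thesis by (simp add: H_def E_def n_def dot_self)
  qed
  moreover have "H 0 \<le> 5 * K * sqrt t * n"
  proof -
    have "\<bar>dot I (\<lambda>i. B 0 i - B t i) (w 0)\<bar> \<le> (K * sqrt t) * n"
      using B_bound[of 0] n0[of t] t K
      by (intro order_trans[OF dot_le] mult_mono) (auto simp: n_def w_def L2_set_nonneg)
    then show ?thesis by (simp add: H_def E_def dot_init algebra_simps)
  qed
  ultimately have "n * n \<le> 5 * K * sqrt t * n" by (simp add: power2_eq_square)
  then show ?thesis using n K t unfolding n_def[symmetric] by (cases "n = 0") auto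
qed

text \<open>The dual solution starts from \<open>xq t\<close>, and an additional factor
  \<open>trp d\<close> in \<open>w\<close> makes the kernels (t-s)^(-1) and (t-s)^(-3/2). The
  Hoelder hypotheses reduce the product of kernel and increment to (t-s)^(-7/8) plus terms that are
  harmless for s > t/2.\<close>

lemma estimate_q:
  assumes r_diff: "\<And>s. 0 < s \<Longrightarrow> s < t \<Longrightarrow>
      L2_set (\<lambda>i. r t i - r s i) I \<le> K * ((t - s) / s + (t - s) powr (1/8))"
    and B_diff: "\<And>s. 0 < s \<Longrightarrow> s < t \<Longrightarrow>
      L2_set (\<lambda>i. B s i - B t i) I \<le> K * ((t - s) / sqrt s + (t - s) powr (5/8))"
  shows "L2_set (xq t) I \<le> 30 * K * (1 + sqrt t)"
proof -
  let ?z0 = "xq t"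
  obtain y where y0: "\<And>i. i \<in> I \<Longrightarrow> y 0 i = ?z0 i"
    and y: "\<And>\<tau> i. i \<in> I \<Longrightarrow> ((\<lambda>\<tau>. y \<tau> i) has_real_derivative - mv I d (mv I (trp d) (y \<tau>)) i) (at \<tau>)"
    and n0: "\<And>\<tau>. 0 \<le> \<tau> \<Longrightarrow> L2_set (y \<tau>) I \<le> L2_set ?z0 I"
    and n1: "\<And>\<tau>. 0 < \<tau> \<Longrightarrow> L2_set (mv I (trp d) (y \<tau>)) I \<le> L2_set ?z0 I / sqrt \<tau>"
    and n2: "\<And>\<tau>. 0 < \<tau> \<Longrightarrow> L2_set (mv I d (mv I (trp d) (y \<tau>))) I \<le> L2_set ?z0 I / \<tau>"
    and n3: "\<And>\<tau>. 0 < \<tau> \<Longrightarrow> L2_set (mv I (trp d) (mv I d (mv I (trp d) (y \<tau>)))) I \<le> L2_set ?z0 I / (\<tau> * sqrt \<tau>)"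
    by (rule semigroup_smoothing[OF I, of ?z0 "trp d", unfolded trp_trp], rule that)
  define \<psi> where "\<psi> s = y (t - s)" for s
  define w where "w s = mv I (trp d) (\<psi> s)" for s
  define n where "n = L2_set ?z0 I"
  have n: "0 \<le> n" by (simp add: n_def L2_set_nonneg)
  have psi: "((\<lambda>s. \<psi> s i) has_real_derivative mv I d (w s) i) (at s)" if "i \<in> I" for i s
  proof -
    have "((\<lambda>s. t - s) has_real_derivative - 1) (at s)" by (auto intro!: derivative_eq_intros)
    from DERIV_chain2[OF y[OF that] this] show ?thesis by (simp add: \<psi>_def w_def)
  qed
  have w: "((\<lambda>s. w s i) has_real_derivative mv I (trp d) (mv I d (w s)) i) (at s)" for i s
    unfolding w_def[abs_def] by (rule DERIV_mv) (use psi in \<open>simp add: w_def\<close>)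
  \<comment> \<open>The term with \<open>r\<close> frozen at the final time serves twice: it turns
    \<open>r s\<close> into \<open>r t - r s\<close> in the derivative, and at s = t it completes
    \<open>mv I d (xu t)\<close> to \<open>xq t\<close>.\<close>
  define E where "E s = dot I (xu s) (w s) - dot I (\<lambda>i. B s i - B t i) (w s) + dot I (r t) (\<psi> s)" for s
  define e where "e s = dot I (\<lambda>i. r t i - r s i) (mv I d (w s)) -
     dot I (\<lambda>i. B s i - B t i) (mv I (trp d) (mv I d (w s)))" for s
  have E: "(E has_real_derivative e s) (at s)" if "0 < s" "s < t" for s
  proof -
    have 1: "((\<lambda>s. dot I (r t) (\<psi> s)) has_real_derivative dot I (\<lambda>i. 0) (\<psi> s) + dot I (r t) (mv I d (w s))) (at s)"
      by (intro DERIV_dot psi) auto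
    show ?thesis
      unfolding E_def[abs_def]
      by (rule DERIV_cong[OF DERIV_add[OF dual_derivative[OF that w] 1]])
        (simp add: e_def dot_def left_diff_distrib sum_subtractf)
  qed
  have cE: "continuous_on {0..t} E"
  proof -
    have "continuous_on {0..t} (\<lambda>s. dot I (r t) (\<psi> s))" unfolding dot_def
      using psi by (intro continuous_intros) (meson DERIV_isCont continuous_at_imp_continuous_on)
    then show ?thesis unfolding E_def[abs_def]
      by (intro continuous_on_add dual_continuous) (use w in \<open>auto intro: DERIV_isCont\<close>)
  qed
  have r2: "L2_set (\<lambda>i. r t i - r s i) I \<le> 2 * K" if "0 \<le> s" "s \<le> t" for s
  proof -
    have "L2_set (\<lambda>i. r t i + (- r s i)) I \<le> L2_set (r t) I + L2_set (\<lambda>i. - r s i) I" by (rule L2_set_triangle_ineq)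
    moreover have "L2_set (\<lambda>i. - r s i) I = L2_set (r s) I" by (simp add: L2_set_def)
    ultimately show ?thesis using r_bound[of t] r_bound[OF that] t by simp
  qed
  have bnd: "e s \<le> p * (n / (t - s)) + q * (n / ((t - s) * sqrt (t - s)))"
    if "L2_set (\<lambda>i. r t i - r s i) I \<le> p" "L2_set (\<lambda>i. B s i - B t i) I \<le> q" "s < t" for s p q
  proof -
    have "\<bar>dot I (\<lambda>i. r t i - r s i) (mv I d (w s))\<bar> \<le> p * (n / (t - s))"
      using n2[of "t - s"] that order_trans[OF L2_set_nonneg that(1)]
      by (intro order_trans[OF dot_le] mult_mono) (auto simp: n_def w_def \<psi>_def L2_set_nonneg)
    moreover have "\<bar>dot I (\<lambda>i. B s i - B t i) (mv I (trp d) (mv I d (w s)))\<bar> \<le> q * (n / ((t - s) * sqrt (t - s)))"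
      using n3[of "t - s"] that order_trans[OF L2_set_nonneg that(2)]
      by (intro order_trans[OF dot_le] mult_mono) (auto simp: n_def w_def \<psi>_def L2_set_nonneg)
    ultimately show ?thesis unfolding e_def by linarith
  qed
  \<comment> \<open>On the first half t - s is at least t/2, so the plain bounds suffice. The
    increment bounds, singular at s = 0, are applied on the second half only.\<close>
  have "E (t / 2) - 6 * K * n / t * (t / 2) \<le> E 0 - 6 * K * n / t * 0"
  proof (rule nonincreasing_within[where f = "\<lambda>s. E s - 6 * K * n / t * s"])
    show "continuous_on {0..t / 2} (\<lambda>s. E s - 6 * K * n / t * s)"
      using cE t by (intro continuous_intros continuous_on_subset[OF cE]) auto
    fix s assume s: "0 < s" "s < t / 2"
    have "e s \<le> 2 * K * (n / (t - s)) + K * sqrt (t - s) * (n / ((t - s) * sqrt (t - s)))"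
      using s t by (intro bnd r2 B_bound) auto
    also have "K * sqrt (t - s) * (n / ((t - s) * sqrt (t - s))) = K * (n / (t - s))" using s by simp
    also have "2 * K * (n / (t - s)) + K * (n / (t - s)) = 3 * K * n / (t - s)" by simp
    also have "\<dots> \<le> 3 * K * n / (t / 2)" using s K n by (intro divide_left_mono) auto
    finally have "e s \<le> 6 * K * n / t" by simp
    moreover have "((\<lambda>s. E s - 6 * K * n / t * s) has_real_derivative e s - 6 * K * n / t) (at s)"
      using E[of s] s by (auto intro!: derivative_eq_intros)
    ultimately show "\<exists>l. ((\<lambda>s. E s - 6 * K * n / t * s) has_real_derivative l) (at s) \<and> l \<le> 0"
      by (intro exI conjI) (assumption, simp)
  qed (use t in simp)
  then have step1: "E (t / 2) \<le> E 0 + 3 * K * n" using t by simp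
  \<comment> \<open>An antiderivative of the majorant \<open>h\<close> introduced below; the factor
    16 comes from integrating 2 (t-s)^(-7/8).\<close>
  define H where "H s = 2 * s / t - 16 * (t - s) powr (1/8) - 4 * sqrt (t - s) / sqrt t" for s
  have "E t - K * n * H t \<le> E (t / 2) - K * n * H (t / 2)"
  proof (rule nonincreasing_within[where f = "\<lambda>s. E s - K * n * H s"])
    show "continuous_on {t / 2..t} (\<lambda>s. E s - K * n * H s)"
      unfolding H_def using t by (intro continuous_intros continuous_on_subset[OF cE] continuous_on_powr') auto
    fix s assume s: "t / 2 < s" "s < t"
    define \<tau> where "\<tau> = t - s"
    have tau: "0 < \<tau>" using s by (simp add: \<tau>_def)
    define h where "h = 2 / t + 2 * \<tau> powr (- 7/8) + 2 / (sqrt \<tau> * sqrt t)"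
    have Hd: "(H has_real_derivative h) (at s)"
      unfolding H_def[abs_def] h_def \<tau>_def using s t
      by (auto intro!: derivative_eq_intros simp: divide_simps)
    have "e s \<le> K * (\<tau> / s + \<tau> powr (1/8)) * (n / \<tau>) + K * (\<tau> / sqrt s + \<tau> powr (5/8)) * (n / (\<tau> * sqrt \<tau>))"
      unfolding \<tau>_def using s t by (intro bnd r_diff B_diff) auto
    also have "\<dots> = K * n * ((\<tau> / s + \<tau> powr (1/8)) / \<tau> + (\<tau> / sqrt s + \<tau> powr (5/8)) / (\<tau> * sqrt \<tau>))"
    proof -
      have "K * A * (n / x) + K * B * (n / y) = K * n * (A / x + B / y)" for A B x y
        by (simp add: distrib_left mult_ac)
      then show ?thesis .
    qed
    also have "\<dots> \<le> K * n * h"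
    proof (intro mult_left_mono)
      have p1: "\<tau> powr (1/8) / \<tau> = \<tau> powr (- 7/8)"
        using powr_diff[of \<tau> "1/8" 1] tau by simp
      have "\<tau> * sqrt \<tau> = \<tau> powr 1 * \<tau> powr (1/2)" using tau by (simp add: powr_half_sqrt)
      also have "\<dots> = \<tau> powr (1 + 1/2)" by (rule powr_add[symmetric])
      finally have "\<tau> * sqrt \<tau> = \<tau> powr (3/2)" by simp
      then have p2: "\<tau> powr (5/8) / (\<tau> * sqrt \<tau>) = \<tau> powr (- 7/8)"
        using powr_diff[of \<tau> "5/8" "3/2"] by simp
      have "1 / s \<le> 2 / t" using s t by (simp add: field_simps)
      moreover have "1 / (sqrt \<tau> * sqrt s) \<le> 2 / (sqrt \<tau> * sqrt t)"
      proof -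
        have "sqrt t \<le> sqrt (4 * s)" using s t by (intro real_sqrt_le_mono) linarith
        then have "sqrt t \<le> 2 * sqrt s" by (simp add: real_sqrt_mult)
        then show ?thesis using s t tau by (simp add: field_simps)
      qed
      moreover have "(\<tau> / s + \<tau> powr (1/8)) / \<tau> + (\<tau> / sqrt s + \<tau> powr (5/8)) / (\<tau> * sqrt \<tau>) =
          1 / s + \<tau> powr (1/8) / \<tau> + 1 / (sqrt \<tau> * sqrt s) + \<tau> powr (5/8) / (\<tau> * sqrt \<tau>)"
        using tau s t by (simp add: add_divide_distrib)
      ultimately show "(\<tau> / s + \<tau> powr (1/8)) / \<tau> + (\<tau> / sqrt s + \<tau> powr (5/8)) / (\<tau> * sqrt \<tau>) \<le> h"
        unfolding h_def p1 p2 by linarith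
    qed (use K n in auto)
    finally have "e s \<le> K * n * h" .
    moreover have "((\<lambda>s. E s - K * n * H s) has_real_derivative e s - K * n * h) (at s)"
      using E[of s] Hd s t by (auto intro!: derivative_eq_intros)
    ultimately show "\<exists>l. ((\<lambda>s. E s - K * n * H s) has_real_derivative l) (at s) \<and> l \<le> 0"
      by (intro exI conjI) (assumption, simp)
  qed (use t in simp)
  then have step2: "E t \<le> E (t / 2) + K * n * (H t - H (t / 2))" by (simp add: algebra_simps)
  have "H t - H (t / 2) \<le> 5 + 16 * (1 + sqrt t)"
  proof -
    have "(t / 2) powr (1/8) \<le> t powr (1/8)" using t by (intro powr_mono2) auto
    also have "t powr (1/8) \<le> 1 + sqrt t"
    proof (cases "t \<le> 1")
      case True
      then have "t powr (1/8) \<le> 1" using t by (simp add: powr_le1)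
      then show ?thesis using real_sqrt_ge_zero[of t] t by linarith
    next
      case False
      then have "t powr (1/8) \<le> t powr (1/2)" by (intro powr_mono) auto
      then show ?thesis using t by (simp add: powr_half_sqrt)
    qed
    finally have "(t / 2) powr (1/8) \<le> 1 + sqrt t" .
    moreover have "sqrt (t / 2) / sqrt t \<le> 1" using t by simp
    moreover have "H t - H (t / 2) = 1 + 16 * (t / 2) powr (1/8) + 4 * (sqrt (t / 2) / sqrt t)"
      using t by (simp add: H_def)
    moreover have "h \<le> 5 + 16 * (1 + v)" if "p \<le> 1 + v" "q \<le> 1" "h = 1 + 16 * p + 4 * q" for h p q v :: real
      using that by simp
    ultimately show ?thesis by blast
  qed
  then have "K * n * (H t - H (t / 2)) \<le> K * n * (5 + 16 * (1 + sqrt t))"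
    using K n by (intro mult_left_mono) auto
  moreover have "E 0 \<le> 2 * K * n"
  proof -
    have "\<bar>dot I (\<lambda>i. B 0 i - B t i) (w 0)\<bar> \<le> (K * sqrt t) * (n / sqrt t)"
      using B_bound[of 0] n1[of t] t K
      by (intro order_trans[OF dot_le] mult_mono) (auto simp: n_def w_def \<psi>_def L2_set_nonneg)
    moreover have "\<bar>dot I (r t) (\<psi> 0)\<bar> \<le> K * n"
      using r_bound[of t] n0[of t] t K
      by (intro order_trans[OF dot_le] mult_mono) (auto simp: n_def \<psi>_def L2_set_nonneg)
    ultimately show ?thesis using t by (simp add: E_def dot_init)
  qed
  moreover have "E t = n\<^sup>2"
  proof -
    have "dot I (\<lambda>i. B t i - B t i) (w t) = 0" by (simp add: dot_def)
    moreover have "dot I (xu t) (w t) = dot I (mv I d (xu t)) (\<psi> t)" by (simp add: w_def dot_mv)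
    moreover have "dot I (mv I d (xu t)) (\<psi> t) + dot I (r t) (\<psi> t) = dot I (xq t) (\<psi> t)"
      using xq[of t] t by (simp add: dot_def algebra_simps sum.distrib)
    moreover have "dot I (xq t) (\<psi> t) = dot I (xq t) (xq t)" by (rule dot_cong) (auto simp: \<psi>_def y0)
    ultimately show ?thesis by (simp add: E_def n_def dot_self)
  qed
  ultimately have "n\<^sup>2 \<le> 2 * K * n + 3 * K * n + K * n * (5 + 16 * (1 + sqrt t))"
    using step1 step2 by linarith
  also have "\<dots> \<le> 30 * K * (1 + sqrt t) * n"
    using K n t by (simp add: algebra_simps mult_nonneg_nonneg)
  finally have "n * n \<le> 30 * K * (1 + sqrt t) * n" by (simp add: power2_eq_square)
  then show ?thesis using n K t unfolding n_def[symmetric] by (cases "n = 0") auto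
qed

end

section \<open>Polynomial bumps and mollification\<close>

lemma DERIV_pos_part_power:
  assumes "2 \<le> p"
  shows "((\<lambda>z::real. max 0 z ^ p) has_real_derivative real p * max 0 z ^ (p - 1)) (at z)"
  using assms
proof (induction p rule: nat_induct_at_least)
  case base
  consider "z < 0" | "z = 0" | "z > 0" by linarith
  then show ?case
  proof cases
    case 1
    have "((\<lambda>z::real. 0) has_real_derivative 0) (at z)" by simp
    then have "((\<lambda>z::real. max 0 z ^ 2) has_real_derivative 0) (at z)"
      by (rule has_field_derivative_transform_within_open[of _ _ _ "{..<0}"]) (use 1 in auto)
    then show ?thesis using 1 by simp
  next
    case 3
    have "((\<lambda>z::real. z ^ 2) has_real_derivative 2 * z) (at z)" by (auto intro!: derivative_eq_intros)
    then have "((\<lambda>z::real. max 0 z ^ 2) has_real_derivative 2 * z) (at z)"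
      by (rule has_field_derivative_transform_within_open[of _ _ _ "{0<..}"]) (use 3 in auto)
    then show ?thesis using 3 by simp
  next
    case 2
    have "((\<lambda>h::real. max 0 h ^ 2 / h) \<longlongrightarrow> 0) (at 0)"
    proof (rule Lim_null_comparison)
      show "\<forall>\<^sub>F h::real in at 0. norm (max 0 h ^ 2 / h) \<le> \<bar>h\<bar>"
        by (rule always_eventually) (auto simp: max_def power2_eq_square)
      show "((\<lambda>h::real. \<bar>h\<bar>) \<longlongrightarrow> 0) (at 0)" by (auto intro!: tendsto_eq_intros)
    qed
    then show ?thesis using 2 by (simp add: DERIV_def)
  qed
next
  case (Suc p)
  have "((\<lambda>z::real. z * max 0 z ^ p) has_real_derivative 1 * max 0 z ^ p + (real p * max 0 z ^ (p - 1)) * z) (at z)"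
    by (intro DERIV_mult Suc.IH) auto
  moreover have "(\<lambda>z::real. z * max 0 z ^ p) = (\<lambda>z. max 0 z ^ Suc p)"
    using Suc.hyps by (auto simp: max_def fun_eq_iff)
  moreover have "1 * max 0 z ^ p + (real p * max 0 z ^ (p - 1)) * z = real (Suc p) * max 0 z ^ (Suc p - 1)"
  proof -
    have "max 0 z ^ (p - 1) * z = max 0 z ^ p"
      using Suc.hyps by (cases p) (auto simp: max_def)
    then show ?thesis by (simp add: algebra_simps)
  qed
  ultimately show ?case by simp
qed

text \<open>The effect of one differentiation of \<open>max 0 (1 - y\<^sup>2) ^ p * q\<close> on the
  polynomial factor, the exponent dropping by one. Test functions of order i need only i continuous
  derivatives, so a bump with these explicit derivatives can take the place of a smooth one.\<close>

definition bump_step :: "nat \<Rightarrow> real poly \<Rightarrow> real poly" where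
  "bump_step p q = smult (- 2 * real p) ([:0, 1:] * q) + [:1, 0, - 1:] * pderiv q"

fun bump_poly :: "nat \<Rightarrow> nat \<Rightarrow> real poly" where
  "bump_poly p 0 = 1"
| "bump_poly p (Suc i) = bump_step (p - i) (bump_poly p i)"

text \<open>The \<open>i\<close>-th derivative of the bump \<open>max 0 (1 - y\<^sup>2) ^ p\<close>, for \<open>i < p\<close>.\<close>

definition bump :: "nat \<Rightarrow> nat \<Rightarrow> real \<Rightarrow> real" where
  "bump p i y = max 0 (1 - y\<^sup>2) ^ (p - i) * poly (bump_poly p i) y"

lemma bump_deriv:
  assumes "i + 2 \<le> p"
  shows "(bump p i has_real_derivative bump p (Suc i) y) (at y)"
proof -
  have 2: "2 \<le> p - i" using assms by simp
  have "((\<lambda>y. max 0 (1 - y\<^sup>2) ^ (p - i)) has_real_derivative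
      (real (p - i) * max 0 (1 - y\<^sup>2) ^ (p - i - 1)) * (- 2 * y)) (at y)"
    by (rule DERIV_chain2[OF DERIV_pos_part_power[OF 2]]) (auto intro!: derivative_eq_intros)
  from DERIV_mult[OF this poly_DERIV[of "bump_poly p i"]]
  have *: "(bump p i has_real_derivative
     (real (p - i) * max 0 (1 - y\<^sup>2) ^ (p - i - 1)) * (- 2 * y) * poly (bump_poly p i) y +
      poly (pderiv (bump_poly p i)) y * max 0 (1 - y\<^sup>2) ^ (p - i)) (at y)"
    by (simp add: bump_def[abs_def])
  define A where "A = max 0 (1 - y\<^sup>2) ^ (p - i - 1)"
  have A: "max 0 (1 - y\<^sup>2) ^ (p - i) = A * (1 - y\<^sup>2)"
    unfolding A_def using 2 by (cases "p - i") (auto simp: max_def)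
  have "bump p (Suc i) y = A * poly (bump_step (p - i) (bump_poly p i)) y"
    by (simp add: bump_def A_def)
  also have "\<dots> = (real (p - i) * A) * (- 2 * y) * poly (bump_poly p i) y +
      poly (pderiv (bump_poly p i)) y * (A * (1 - y\<^sup>2))"
    by (simp add: bump_step_def distrib_left right_diff_distrib power2_eq_square)
  finally show ?thesis using * unfolding A A_def[symmetric] by simp
qed

lemma bump_continuous [continuous_intros]: "continuous_on A f \<Longrightarrow> continuous_on A (\<lambda>x. bump p i (f x))"
  unfolding bump_def by (intro continuous_intros)

lemma bump_zero: "i < p \<Longrightarrow> 1 \<le> \<bar>y\<bar> \<Longrightarrow> bump p i y = 0"
  using one_le_power[of "\<bar>y\<bar>" 2] by (simp add: bump_def max_def zero_power)

lemma bump_0_nonneg: "0 \<le> bump p 0 y"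
  by (simp add: bump_def)

definition bump_mass :: "nat \<Rightarrow> real" where
  "bump_mass p = integral {-1..1} (poly ([:1, 0, - 1:] ^ p))"

lemma bump_mass_pos: "0 < bump_mass p"
proof -
  obtain P where P: "pderiv P = [:1, 0, - 1::real:] ^ p" using poly_antiderivative by blast
  have "poly P (- 1) < poly P 1"
  proof (rule DERIV_pos_imp_increasing_open[where f = "poly P"])
    fix x :: real assume x: "- 1 < x" "x < 1"
    have "x\<^sup>2 < 1" using x by (simp add: abs_square_less_1)
    then have "0 < poly (pderiv P) x" using P by (simp add: power2_eq_square)
    then show "\<exists>y. DERIV (poly P) x :> y \<and> 0 < y" using poly_DERIV by blast
  qed (auto intro!: continuous_intros)
  then show ?thesis unfolding bump_mass_def using integral_pderiv[of "-1" 1 P] P by simp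
qed

text \<open>Integrals are over \<open>[0, 2 pi]\<close>; \<open>moll\<close> is the usual mollification (with all its derivatives)
  only at distance at least \<open>\<epsilon>\<close> from the end points.\<close>

definition moll :: "nat \<Rightarrow> real \<Rightarrow> nat \<Rightarrow> (real \<Rightarrow> real) \<Rightarrow> real \<Rightarrow> real" where
  "moll p \<epsilon> i f x = integral {0..2 * pi} (\<lambda>y. f y * bump p i ((x - y) / \<epsilon>)) / (bump_mass p * \<epsilon> ^ Suc i)"

lemma moll_deriv:
  assumes "0 < \<epsilon>" "i + 2 \<le> p" "continuous_on {0..2 * pi} f"
  shows "(moll p \<epsilon> i f has_real_derivative moll p \<epsilon> (Suc i) f x) (at x)"
proof -
  have "((\<lambda>x. integral (cbox 0 (2 * pi)) (\<lambda>y. f y * bump p i ((x - y) / \<epsilon>))) has_real_derivative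
     integral (cbox 0 (2 * pi)) (\<lambda>y. f y * (bump p (Suc i) ((x - y) / \<epsilon>) * (1 / \<epsilon>)))) (at x within UNIV)"
  proof (rule leibniz_rule_field_derivative)
    fix x y :: real assume "y \<in> cbox 0 (2 * pi)"
    have "((\<lambda>x. bump p i ((x - y) / \<epsilon>)) has_real_derivative bump p (Suc i) ((x - y) / \<epsilon>) * (1 / \<epsilon>)) (at x)"
      by (rule DERIV_chain2[OF bump_deriv[OF assms(2)]]) (use assms(1) in \<open>auto intro!: derivative_eq_intros\<close>)
    then show "((\<lambda>x. f y * bump p i ((x - y) / \<epsilon>)) has_real_derivative f y * (bump p (Suc i) ((x - y) / \<epsilon>) * (1 / \<epsilon>))) (at x)"
      by (rule DERIV_cmult)
  next
    fix x :: real
    show "(\<lambda>y. f y * bump p i ((x - y) / \<epsilon>)) integrable_on cbox 0 (2 * pi)"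
      using assms by (intro integrable_continuous) (auto intro!: continuous_intros)
  next
    have "continuous_on (UNIV \<times> cbox 0 (2 * pi)) (\<lambda>z. f (snd z))"
      by (rule continuous_on_compose2[OF assms(3)]) (auto intro!: continuous_intros)
    then show "continuous_on (UNIV \<times> cbox 0 (2 * pi)) (\<lambda>(x, y). f y * (bump p (Suc i) ((x - y) / \<epsilon>) * (1 / \<epsilon>)))"
      unfolding split_beta using assms(1) by (intro continuous_intros) auto
  qed auto
  moreover have "integral {0..2 * pi} (\<lambda>y. f y * (bump p (Suc i) ((x - y) / \<epsilon>) * (1 / \<epsilon>))) =
     integral {0..2 * pi} (\<lambda>y. f y * bump p (Suc i) ((x - y) / \<epsilon>)) * (1 / \<epsilon>)"
    by (simp only: mult.assoc[symmetric]) (rule integral_mult_left)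
  ultimately have "((\<lambda>x. integral {0..2 * pi} (\<lambda>y. f y * bump p i ((x - y) / \<epsilon>))) has_real_derivative
     integral {0..2 * pi} (\<lambda>y. f y * bump p (Suc i) ((x - y) / \<epsilon>)) * (1 / \<epsilon>)) (at x)" by simp
  from DERIV_cdivide[OF this, of "bump_mass p * \<epsilon> ^ Suc i"] show ?thesis
    unfolding moll_def[abs_def] by (rule DERIV_cong) simp
qed

text \<open>For x at distance at least \<epsilon> from the ends the kernel vanishes at 0 and at 2
  pi, so a derivative passes from the kernel to \<open>f\<close> without boundary terms.\<close>

lemma moll_parts:
  assumes e: "0 < \<epsilon>" and i: "i + 2 \<le> p" and x: "\<epsilon> \<le> x" "x \<le> 2 * pi - \<epsilon>"
    and f: "\<And>y. y \<in> {0..2 * pi} \<Longrightarrow> (f has_real_derivative f' y) (at y within {0..2 * pi})"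
    and f': "continuous_on {0..2 * pi} f'"
  shows "moll p \<epsilon> (Suc i) f x = moll p \<epsilon> i f' x"
proof -
  let ?I = "{0..2 * pi}"
  have cf: "continuous_on ?I f" by (rule DERIV_continuous_on[OF f])
  let ?a = "\<lambda>y. f' y * bump p i ((x - y) / \<epsilon>)" and ?b = "\<lambda>y. f y * bump p (Suc i) ((x - y) / \<epsilon>)"
  have "((\<lambda>y. f y * bump p i ((x - y) / \<epsilon>)) has_real_derivative ?a y - ?b y / \<epsilon>) (at y within ?I)"
    if "y \<in> ?I" for y
  proof -
    have "((\<lambda>y. bump p i ((x - y) / \<epsilon>)) has_real_derivative bump p (Suc i) ((x - y) / \<epsilon>) * (- 1 / \<epsilon>)) (at y within ?I)"
      by (rule DERIV_chain2[OF bump_deriv[OF i]]) (use e in \<open>auto intro!: derivative_eq_intros\<close>)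
    from DERIV_mult[OF f[OF that] this] show ?thesis by (rule DERIV_cong) (simp add: algebra_simps)
  qed
  then have "((\<lambda>y. ?a y - ?b y / \<epsilon>) has_integral
     (f (2 * pi) * bump p i ((x - 2 * pi) / \<epsilon>) - f 0 * bump p i ((x - 0) / \<epsilon>))) ?I"
    by (intro fundamental_theorem_of_calculus) (auto simp: has_real_derivative_iff_has_vector_derivative[symmetric])
  moreover have "bump p i ((x - 2 * pi) / \<epsilon>) = 0" "bump p i ((x - 0) / \<epsilon>) = 0"
    using x e i by (auto intro!: bump_zero simp: field_simps)
  ultimately have "integral ?I (\<lambda>y. ?a y - ?b y / \<epsilon>) = 0" by (simp add: integral_unique)
  moreover have "integral ?I (\<lambda>y. ?a y - ?b y / \<epsilon>) = integral ?I ?a - integral ?I ?b / \<epsilon>"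
    using e cf f' by (subst integral_diff)
      (auto intro!: integrable_continuous_real continuous_intros)
  ultimately have "integral ?I ?a = integral ?I ?b / \<epsilon>" by simp
  then show ?thesis unfolding moll_def using e bump_mass_pos[of p] by (simp add: field_simps)
qed

lemma bump_integral:
  assumes e: "0 < \<epsilon>" and p: "0 < p" and x: "\<epsilon> \<le> x" "x \<le> 2 * pi - \<epsilon>"
  shows "((\<lambda>y. bump p 0 ((x - y) / \<epsilon>)) has_integral bump_mass p * \<epsilon>) {0..2 * pi}"
proof -
  obtain P where P: "pderiv P = [:1, 0, - 1::real:] ^ p" using poly_antiderivative by blast
  have "((\<lambda>y. bump p 0 ((x - y) / \<epsilon>)) has_integral (- \<epsilon> * poly P ((x - (x + \<epsilon>)) / \<epsilon>)) - (- \<epsilon> * poly P ((x - (x - \<epsilon>)) / \<epsilon>))) {x - \<epsilon>..x + \<epsilon>}"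
  proof (rule fundamental_theorem_of_calculus)
    fix y assume y: "y \<in> {x - \<epsilon>..x + \<epsilon>}"
    have "((\<lambda>y. poly P ((x - y) / \<epsilon>)) has_real_derivative poly (pderiv P) ((x - y) / \<epsilon>) * (- 1 / \<epsilon>)) (at y within {x - \<epsilon>..x + \<epsilon>})"
      by (rule DERIV_chain2[OF poly_DERIV]) (use e in \<open>auto intro!: derivative_eq_intros\<close>)
    from DERIV_cmult[OF this, of "- \<epsilon>"]
    have "((\<lambda>y. - \<epsilon> * poly P ((x - y) / \<epsilon>)) has_real_derivative poly (pderiv P) ((x - y) / \<epsilon>)) (at y within {x - \<epsilon>..x + \<epsilon>})"
      using e by simp
    moreover have "poly (pderiv P) ((x - y) / \<epsilon>) = bump p 0 ((x - y) / \<epsilon>)"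
    proof -
      have "\<bar>(x - y) / \<epsilon>\<bar> \<le> 1" using y e by (auto simp: abs_le_iff field_simps)
      then have "((x - y) / \<epsilon>)\<^sup>2 \<le> 1" by (simp add: abs_square_le_1)
      then show ?thesis by (simp add: P bump_def power2_eq_square max_def)
    qed
    ultimately show "((\<lambda>y. - \<epsilon> * poly P ((x - y) / \<epsilon>)) has_vector_derivative bump p 0 ((x - y) / \<epsilon>)) (at y within {x - \<epsilon>..x + \<epsilon>})"
      by (simp add: has_real_derivative_iff_has_vector_derivative)
  qed (use e in simp)
  moreover have "(- \<epsilon> * poly P ((x - (x + \<epsilon>)) / \<epsilon>)) - (- \<epsilon> * poly P ((x - (x - \<epsilon>)) / \<epsilon>)) = bump_mass p * \<epsilon>"
  proof -
    have "bump_mass p = poly P 1 - poly P (- 1)"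
      unfolding bump_mass_def using integral_pderiv[of "-1" 1 P] P by simp
    then show ?thesis using e by (simp only:) (simp add: algebra_simps)
  qed
  ultimately have "((\<lambda>y. bump p 0 ((x - y) / \<epsilon>)) has_integral bump_mass p * \<epsilon>) {x - \<epsilon>..x + \<epsilon>}" by simp
  then show ?thesis
  proof (rule has_integral_on_superset)
    fix y assume "y \<notin> {x - \<epsilon>..x + \<epsilon>}"
    then show "bump p 0 ((x - y) / \<epsilon>) = 0" using e p by (intro bump_zero) (auto simp: abs_if field_simps)
  qed (use x in auto)
qed

text \<open>At such a point the mollification is an average over radius \<epsilon> with a
  nonnegative kernel of mass one.\<close>

lemma moll_close:
  assumes e: "0 < \<epsilon>" and p: "0 < p" and x: "\<epsilon> \<le> x" "x \<le> 2 * pi - \<epsilon>" and f: "continuous_on {0..2 * pi} f"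
    and w: "\<And>y. y \<in> {0..2 * pi} \<Longrightarrow> \<bar>y - x\<bar> \<le> \<epsilon> \<Longrightarrow> \<bar>f y - c\<bar> \<le> \<omega>"
  shows "\<bar>moll p \<epsilon> 0 f x - c\<bar> \<le> \<omega>"
proof -
  let ?I = "{0..2 * pi}" and ?B = "\<lambda>y. bump p 0 ((x - y) / \<epsilon>)"
  note B = bump_integral[OF e p x]
  have cB: "continuous_on ?I ?B" using e by (intro continuous_intros) auto
  have "((\<lambda>y. f y * ?B y) has_integral integral ?I (\<lambda>y. f y * ?B y)) ?I"
    by (intro integrable_integral integrable_continuous_real continuous_on_mult f cB)
  from has_integral_diff[OF this has_integral_mult_right[OF B, of c]]
  have d: "((\<lambda>y. (f y - c) * ?B y) has_integral integral ?I (\<lambda>y. f y * ?B y) - c * (bump_mass p * \<epsilon>)) ?I"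
    by (simp add: left_diff_distrib)
  have "norm (integral ?I (\<lambda>y. f y * ?B y) - c * (bump_mass p * \<epsilon>)) \<le> \<omega> * (bump_mass p * \<epsilon>)"
    unfolding integral_unique[OF d, symmetric] integral_unique[OF has_integral_mult_right[OF B, of \<omega>], symmetric]
  proof (rule integral_norm_bound_integral)
    show "(\<lambda>y. (f y - c) * ?B y) integrable_on ?I" using d by blast
    show "(\<lambda>y. \<omega> * ?B y) integrable_on ?I" using has_integral_mult_right[OF B, of \<omega>] by blast
    fix y assume y: "y \<in> ?I"
    show "norm ((f y - c) * ?B y) \<le> \<omega> * ?B y"
    proof (cases "\<bar>y - x\<bar> \<le> \<epsilon>")
      case True
      then show ?thesis using w[OF y True] bump_0_nonneg[of p "(x - y) / \<epsilon>"] by (simp add: abs_mult mult_right_mono)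
    next
      case False
      then have "?B y = 0" using e p by (intro bump_zero) (auto simp: abs_if field_simps split: if_splits)
      then show ?thesis by simp
    qed
  qed
  moreover have "moll p \<epsilon> 0 f x - c = (integral ?I (\<lambda>y. f y * ?B y) - c * (bump_mass p * \<epsilon>)) / (bump_mass p * \<epsilon>)"
    unfolding moll_def using e bump_mass_pos[of p] by (simp add: field_simps)
  ultimately show ?thesis
    using e bump_mass_pos[of p] by (simp add: abs_divide pos_divide_le_eq)
qed

section \<open>Weak derivatives tested with bumps\<close>

lemma deriv_funpow_bump:
  assumes e: "0 < \<epsilon>" and "m < p"
  shows "(deriv ^^ m) (\<lambda>y. bump p 0 ((x - y) / \<epsilon>)) = (\<lambda>y. (- 1 / \<epsilon>) ^ m * bump p m ((x - y) / \<epsilon>))"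
  using assms(2)
proof (induction m)
  case (Suc m)
  have "((\<lambda>y. (- 1 / \<epsilon>) ^ m * bump p m ((x - y) / \<epsilon>)) has_real_derivative
     (- 1 / \<epsilon>) ^ m * (bump p (Suc m) ((x - y) / \<epsilon>) * (- 1 / \<epsilon>))) (at y)" for y
    by (intro DERIV_cmult DERIV_chain2[OF bump_deriv]) (use e Suc.prems in \<open>auto intro!: derivative_eq_intros\<close>)
  then have "deriv (\<lambda>y. (- 1 / \<epsilon>) ^ m * bump p m ((x - y) / \<epsilon>)) = (\<lambda>y. (- 1 / \<epsilon>) ^ Suc m * bump p (Suc m) ((x - y) / \<epsilon>))"
    by (intro ext DERIV_imp_deriv) (auto intro: DERIV_cong)
  then show ?case using Suc by simp
qed simp

lemma bump_test_function:
  assumes e: "0 < \<epsilon>" and p: "i < p" and x: "\<epsilon> < x" "x < 2 * pi - \<epsilon>"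
  shows "test_function i (\<lambda>y. bump p 0 ((x - y) / \<epsilon>))"
  unfolding test_function_def
proof (intro conjI allI impI)
  fix m assume m: "m < i"
  fix y
  have "((\<lambda>y. (- 1 / \<epsilon>) ^ m * bump p m ((x - y) / \<epsilon>)) has_real_derivative
     (- 1 / \<epsilon>) ^ m * (bump p (Suc m) ((x - y) / \<epsilon>) * (- 1 / \<epsilon>))) (at y)"
    by (intro DERIV_cmult DERIV_chain2[OF bump_deriv]) (use e p m in \<open>auto intro!: derivative_eq_intros\<close>)
  then show "(deriv ^^ m) (\<lambda>y. bump p 0 ((x - y) / \<epsilon>)) differentiable (at y)"
    using m p by (subst deriv_funpow_bump[OF e]) (auto simp: real_differentiable_def)
next
  show "continuous_on UNIV ((deriv ^^ i) (\<lambda>y. bump p 0 ((x - y) / \<epsilon>)))"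
    unfolding deriv_funpow_bump[OF e p] using e by (intro continuous_intros) auto
  show "\<exists>a b. 0 < a \<and> b < 2 * pi \<and> (\<forall>y. y \<notin> {a..b} \<longrightarrow> bump p 0 ((x - y) / \<epsilon>) = 0)"
  proof (rule exI[of _ "x - \<epsilon>"], rule exI[of _ "x + \<epsilon>"], intro conjI allI impI)
    fix y assume "y \<notin> {x - \<epsilon>..x + \<epsilon>}"
    then show "bump p 0 ((x - y) / \<epsilon>) = 0" using e p by (intro bump_zero) (auto simp: abs_if field_simps)
  qed (use x in auto)
qed

lemma Omega_integral:
  assumes "continuous_on {0..2 * pi} (F :: real \<Rightarrow> real)"
  shows "integrable Omega_M F" "(\<integral>x. F x \<partial>Omega_M) = integral {0..2 * pi} F"
proof -
  have "set_integrable lebesgue {0..2 * pi} F"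
    using absolutely_integrable_continuous_real[OF assms] .
  then have "set_integrable lebesgue {0<..<2 * pi} F"
    by (rule set_integrable_subset) auto
  then show i: "integrable Omega_M F" by (simp add: integrable_restrict_space set_integrable_def)
  show "(\<integral>x. F x \<partial>Omega_M) = integral {0..2 * pi} F"
    using lebesgue_integral_eq_integral[OF i] by (simp add: integral_open_interval_real)
qed

text \<open>The bump is an admissible test function, so the i-th derivative of the mollification is
  an average of the weak derivative and inherits its essential bound, with constant 1 and
  independently of \<epsilon>.\<close>

lemma moll_weak_bound:
  assumes e: "0 < \<epsilon>" and p: "i < p" and x: "\<epsilon> < x" "x < 2 * pi - \<epsilon>" and f: "continuous_on {0..2 * pi} f"
    and g: "in_Linf g" "has_weak_deriv i f g" and W: "real_of_ereal (Linf_norm g) \<le> W"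
  shows "\<bar>moll p \<epsilon> i f x\<bar> \<le> W"
proof -
  let ?B = "\<lambda>y. bump p 0 ((x - y) / \<epsilon>)"
  let ?c = "bump_mass p * \<epsilon>"
  have p0: "0 < p" using p by simp
  have c: "0 < ?c" using e bump_mass_pos[of p] by simp
  have cB: "continuous_on {0..2 * pi} ?B" using e by (intro continuous_intros) auto
  have intB: "integrable Omega_M ?B" "(\<integral>y. ?B y \<partial>Omega_M) = ?c"
    using Omega_integral[OF cB] integral_unique[OF bump_integral[OF e p0]] x by auto
  have fin: "Linf_norm g < \<infinity>" and meas: "g \<in> borel_measurable Omega_M" using g(1) by (auto simp: in_Linf_def)
  have ae: "AE y in Omega_M. \<bar>g y\<bar> \<le> W"
  proof -
    have "AE y in Omega_M. ereal \<bar>g y\<bar> \<le> Linf_norm g" unfolding Linf_norm_def by (rule esssup_AE)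
    then show ?thesis
    proof (eventually_elim)
      fix y assume a: "ereal \<bar>g y\<bar> \<le> Linf_norm g"
      then have "\<bar>g y\<bar> \<le> real_of_ereal (Linf_norm g)" using fin by (cases "Linf_norm g") auto
      then show "\<bar>g y\<bar> \<le> W" using W by simp
    qed
  qed
  have intW: "integrable Omega_M (\<lambda>y. W * ?B y)" using intB(1) by simp
  have "integrable Omega_M (\<lambda>y. g y * ?B y)"
  proof (rule Bochner_Integration.integrable_bound[OF intW])
    show "(\<lambda>y. g y * ?B y) \<in> borel_measurable Omega_M"
      using meas intB(1) by (intro borel_measurable_times) (auto dest: borel_measurable_integrable)
    show "AE y in Omega_M. norm (g y * ?B y) \<le> norm (W * ?B y)"
      using ae by eventually_elim (auto simp: abs_mult intro!: mult_right_mono)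
  qed
  then have "\<bar>\<integral>y. g y * ?B y \<partial>Omega_M\<bar> \<le> (\<integral>y. W * ?B y \<partial>Omega_M)"
  proof (intro order_trans[OF integral_abs_bound] integral_mono_AE intW)
    show "AE y in Omega_M. \<bar>g y * ?B y\<bar> \<le> W * ?B y"
      using ae by eventually_elim (auto simp: abs_mult bump_0_nonneg intro!: mult_right_mono)
  qed auto
  also have "\<dots> = W * ?c" using intB(2) by simp
  finally have b: "\<bar>\<integral>y. g y * ?B y \<partial>Omega_M\<bar> \<le> W * ?c" .
  have "(\<integral>y. f y * (deriv ^^ i) ?B y \<partial>Omega_M) = (- 1) ^ i * (\<integral>y. g y * ?B y \<partial>Omega_M)"
    using g(2) bump_test_function[OF e p x] unfolding has_weak_deriv_def by blast
  moreover have "(\<integral>y. f y * (deriv ^^ i) ?B y \<partial>Omega_M) = (- 1 / \<epsilon>) ^ i * integral {0..2 * pi} (\<lambda>y. f y * bump p i ((x - y) / \<epsilon>))"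
  proof -
    have "(\<integral>y. f y * (deriv ^^ i) ?B y \<partial>Omega_M) = (\<integral>y. (- 1 / \<epsilon>) ^ i * (f y * bump p i ((x - y) / \<epsilon>)) \<partial>Omega_M)"
      unfolding deriv_funpow_bump[OF e p] by (simp add: mult_ac)
    also have "\<dots> = (- 1 / \<epsilon>) ^ i * (\<integral>y. f y * bump p i ((x - y) / \<epsilon>) \<partial>Omega_M)" by simp
    also have "(\<integral>y. f y * bump p i ((x - y) / \<epsilon>) \<partial>Omega_M) = integral {0..2 * pi} (\<lambda>y. f y * bump p i ((x - y) / \<epsilon>))"
      using f e by (intro Omega_integral continuous_intros) auto
    finally show ?thesis .
  qed
  moreover have "(- 1 / \<epsilon>) ^ i = (- 1) ^ i / \<epsilon> ^ i" by (simp only: power_divide)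
  ultimately have "(- 1) ^ i * (\<integral>y. g y * ?B y \<partial>Omega_M) =
      (- 1) ^ i / \<epsilon> ^ i * integral {0..2 * pi} (\<lambda>y. f y * bump p i ((x - y) / \<epsilon>))" by (simp only:)
  then have "integral {0..2 * pi} (\<lambda>y. f y * bump p i ((x - y) / \<epsilon>)) = \<epsilon> ^ i * (\<integral>y. g y * ?B y \<partial>Omega_M)"
    using e by (cases "even i") (simp_all add: field_simps)
  then have "moll p \<epsilon> i f x = (\<integral>y. g y * ?B y \<partial>Omega_M) / ?c"
    unfolding moll_def using e by (simp add: field_simps)
  then show ?thesis using b c by (simp add: abs_divide pos_divide_le_eq)
qed

lemma Winf_norm_bound:
  assumes "in_Winf m f" "i \<le> m"
  obtains g where "in_Linf g" "has_weak_deriv i f g" "real_of_ereal (Linf_norm g) \<le> Winf_norm m f"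
proof -
  have "\<exists>g. in_Linf g \<and> has_weak_deriv i f g" using assms by (auto simp: in_Winf_def)
  then have "in_Linf (weak_deriv i f) \<and> has_weak_deriv i f (weak_deriv i f)"
    unfolding weak_deriv_def by (rule someI_ex)
  moreover have "real_of_ereal (Linf_norm (weak_deriv i f)) \<le> Winf_norm m f"
    unfolding Winf_norm_def using assms(2) by (intro Max_ge) auto
  ultimately show thesis using that by blast
qed

lemma moll_Winf_bound:
  assumes "0 < \<epsilon>" "i < p" "\<epsilon> < x" "x < 2 * pi - \<epsilon>" "continuous_on {0..2 * pi} f" "in_Winf m f" "i \<le> m"
  shows "\<bar>moll p \<epsilon> i f x\<bar> \<le> Winf_norm m f"
  using Winf_norm_bound[OF assms(6,7)] moll_weak_bound[OF assms(1-5)] by metis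

section \<open>Smooth representatives\<close>

text \<open>The last member is merely Lipschitz: this stands for a bounded derivative of order n +
  1, which exists only in the weak sense.\<close>

definition smooth_chain :: "nat \<Rightarrow> real \<Rightarrow> (nat \<Rightarrow> real \<Rightarrow> real) \<Rightarrow> bool" where
  "smooth_chain n W D \<longleftrightarrow>
     (\<forall>i<n. \<forall>x\<in>{0..2 * pi}. (D i has_real_derivative D (Suc i) x) (at x within {0..2 * pi})) \<and>
     (\<forall>i\<le>n. \<forall>x\<in>{0..2 * pi}. \<bar>D i x\<bar> \<le> W) \<and>
     (\<forall>i\<le>n. \<forall>x\<in>{0..2 * pi}. \<forall>y\<in>{0..2 * pi}. \<bar>D i x - D i y\<bar> \<le> W * \<bar>x - y\<bar>)"

lemma smooth_chainD:
  assumes "smooth_chain n W D"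
  shows "i < n \<Longrightarrow> x \<in> {0..2 * pi} \<Longrightarrow> (D i has_real_derivative D (Suc i) x) (at x within {0..2 * pi})"
    "i \<le> n \<Longrightarrow> x \<in> {0..2 * pi} \<Longrightarrow> \<bar>D i x\<bar> \<le> W"
    "i \<le> n \<Longrightarrow> x \<in> {0..2 * pi} \<Longrightarrow> y \<in> {0..2 * pi} \<Longrightarrow> \<bar>D i x - D i y\<bar> \<le> W * \<bar>x - y\<bar>"
  using assms by (auto simp: smooth_chain_def)

lemma smooth_chain_continuous:
  assumes "smooth_chain n W D" "i \<le> n" shows "continuous_on {0..2 * pi} (D i)"
proof -
  have "0 \<le> W" using smooth_chainD(2)[OF assms(1), of 0 0] abs_ge_zero[of "D 0 0"] by simp
  then have "W-lipschitz_on {0..2 * pi} (D i)"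
    using smooth_chainD(3)[OF assms] by (intro lipschitz_onI) (auto simp: dist_real_def)
  then show ?thesis by (rule lipschitz_on_continuous_on)
qed

lemma smooth_chain_diff:
  assumes "smooth_chain n W D" "smooth_chain n W' D'"
  shows "smooth_chain n (W + W') (\<lambda>i x. D i x - D' i x)"
  unfolding smooth_chain_def
proof (intro conjI allI impI ballI)
  fix i x y assume i: "i \<le> n" and x: "x \<in> {0..2 * pi}" "y \<in> {0..2 * pi}"
  show "\<bar>D i x - D' i x\<bar> \<le> W + W'"
    using smooth_chainD(2)[OF assms(1) i x(1)] smooth_chainD(2)[OF assms(2) i x(1)] by linarith
  show "\<bar>D i x - D' i x - (D i y - D' i y)\<bar> \<le> (W + W') * \<bar>x - y\<bar>"
    using smooth_chainD(3)[OF assms(1) i x] smooth_chainD(3)[OF assms(2) i x] by (simp add: distrib_right)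
qed (intro DERIV_diff smooth_chainD(1)[OF assms(1)] smooth_chainD(1)[OF assms(2)])

lemma MVT_within:
  assumes "\<And>z. z \<in> {a..b} \<Longrightarrow> (g has_real_derivative g' z) (at z within {a..b})" "x \<in> {a..b}" "y \<in> {a..b}"
  shows "\<exists>z\<in>{min x y..max x y}. g y - g x = (y - x) * g' (z::real)"
proof -
  have *: "\<exists>z\<in>{x..y}. g y - g x = (y - x) * g' z" if xy: "x < y" "x \<in> {a..b}" "y \<in> {a..b}" for x y
  proof -
    have "(g has_derivative (*) (g' z)) (at z within {x..y})" if "z \<in> {x..y}" for z
      using has_field_derivative_subset[OF assms(1)[of z], of "{x..y}"] that xy
      by (auto simp: has_field_derivative_def)
    then obtain z where "z \<in> {x<..<y}" "g y - g x = g' z * (y - x)"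
      using mvt_simple[OF xy(1), of g "\<lambda>z. (*) (g' z)"] by auto
    then show ?thesis by (intro bexI[of _ z]) (auto simp: mult.commute)
  qed
  consider "x < y" | "x = y" | "y < x" by linarith
  then show ?thesis
  proof cases
    case 3
    then obtain z where "z \<in> {y..x}" "g x - g y = (x - y) * g' z" using *[of y x] assms(2,3) by auto
    then show ?thesis using 3 by (intro bexI[of _ z]) (auto simp: algebra_simps)
  qed (use *[of x y] assms(2,3) in auto)
qed

text \<open>Unlike differentiability, a quadratic remainder bound with a fixed constant survives
  pointwise limits; \<open>quad_deriv\<close> recovers the derivative from it afterwards.\<close>

lemma taylor_quad:
  assumes g: "\<And>z. z \<in> {0..2 * pi} \<Longrightarrow> (g has_real_derivative g' z) (at z within {0..2 * pi})"
    and L: "\<And>x y. x \<in> {0..2 * pi} \<Longrightarrow> y \<in> {0..2 * pi} \<Longrightarrow> \<bar>g' x - g' y\<bar> \<le> W * \<bar>x - y\<bar>"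
    and xy: "x \<in> {0..2 * pi}" "y \<in> {0..2 * pi}"
  shows "\<bar>g y - g x - (y - x) * g' x\<bar> \<le> W * (y - x)\<^sup>2"
proof -
  obtain z where z: "z \<in> {min x y..max x y}" "g y - g x = (y - x) * g' z" using MVT_within[OF g xy] by blast
  have zI: "z \<in> {0..2 * pi}" using z(1) xy by auto
  have W: "0 \<le> W * \<bar>0 - 2 * pi\<bar>" using L[of 0 "2 * pi"] by (meson abs_ge_zero atLeastAtMost_iff dual_order.trans mult_nonneg_nonneg order_refl pi_ge_zero zero_le_numeral)
  have W: "0 \<le> W" using W pi_gt_zero by (simp add: zero_le_mult_iff)
  have "g y - g x - (y - x) * g' x = (y - x) * (g' z - g' x)" using z(2) by (simp add: right_diff_distrib)
  then have "\<bar>g y - g x - (y - x) * g' x\<bar> = \<bar>y - x\<bar> * \<bar>g' z - g' x\<bar>" by (simp add: abs_mult)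
  also have "\<dots> \<le> \<bar>y - x\<bar> * (W * \<bar>y - x\<bar>)"
  proof (intro mult_left_mono)
    have "\<bar>z - x\<bar> \<le> \<bar>y - x\<bar>" using z(1) by (auto simp: min_def max_def split: if_splits)
    then show "\<bar>g' z - g' x\<bar> \<le> W * \<bar>y - x\<bar>"
      using L[OF zI xy(1)] mult_left_mono[of "\<bar>z - x\<bar>" "\<bar>y - x\<bar>" W] W by linarith
  qed simp
  finally show ?thesis by (simp add: power2_eq_square mult_ac flip: abs_mult)
qed

lemma quad_deriv:
  assumes "\<And>y. y \<in> S \<Longrightarrow> \<bar>g y - g x - (y - x) * d\<bar> \<le> W * (y - x)\<^sup>2"
  shows "(g has_real_derivative d) (at x within S)"
  unfolding has_field_derivative_iff
proof (rule LIM_zero_cancel, rule Lim_null_comparison)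
  show "\<forall>\<^sub>F y in at x within S. norm ((g y - g x) / (y - x) - d) \<le> W * \<bar>y - x\<bar>"
    unfolding eventually_at_filter
  proof (intro always_eventually allI impI)
    fix y assume y: "y \<noteq> x" "y \<in> S"
    have aa: "W * (a * a) / a = W * a" if "a \<noteq> 0" for a :: real using that by simp
    have "(g y - g x) / (y - x) - d = (g y - g x - (y - x) * d) / (y - x)" using y by (simp add: field_simps)
    then have "norm ((g y - g x) / (y - x) - d) = \<bar>g y - g x - (y - x) * d\<bar> / \<bar>y - x\<bar>" by (simp add: abs_divide)
    also have "\<dots> \<le> W * (y - x)\<^sup>2 / \<bar>y - x\<bar>" by (rule divide_right_mono[OF assms[OF y(2)]]) simp
    also have "(y - x)\<^sup>2 = \<bar>y - x\<bar> * \<bar>y - x\<bar>" by (simp add: power2_eq_square)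
    also have "W * (\<bar>y - x\<bar> * \<bar>y - x\<bar>) / \<bar>y - x\<bar> = W * \<bar>y - x\<bar>" by (rule aa) (use y in simp)
    finally show "norm ((g y - g x) / (y - x) - d) \<le> W * \<bar>y - x\<bar>" .
  qed
  have "((\<lambda>y. W * \<bar>y - x\<bar>) \<longlongrightarrow> W * \<bar>x - x\<bar>) (at x within S)" by (intro tendsto_intros)
  then show "((\<lambda>y. W * \<bar>y - x\<bar>) \<longlongrightarrow> 0) (at x within S)" by simp
qed

text \<open>Landau's interpolation inequality, qualitatively: a chain of derivatives is small as soon as
  its first member is.\<close>

lemma chain_small:
  assumes "0 \<le> W" "0 < \<eta>"
  shows "\<exists>\<delta>>0. \<forall>E. smooth_chain n W E \<longrightarrow> (\<forall>x\<in>{0..2 * pi}. \<bar>E 0 x\<bar> \<le> \<delta>) \<longrightarrow>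
    (\<forall>i\<le>n. \<forall>x\<in>{0..2 * pi}. \<bar>E i x\<bar> \<le> \<eta>)"
  using assms(2)
proof (induction n arbitrary: \<eta>)
  case 0
  then show ?case by (intro exI[of _ \<eta>]) auto
next
  case (Suc n)
  \<comment> \<open>The step of a difference quotient: small enough for the Taylor remainder divided
    by s to be at most \<eta>/2, and at most pi so that \<open>x + s\<close> or \<open>x - s\<close>
    stays in the interval.\<close>
  define s where "s = min pi (\<eta> / (2 * (W + 1)))"
  have s: "0 < s" "s \<le> pi" "s * W \<le> \<eta> / 2"
  proof -
    show "0 < s" "s \<le> pi" using Suc.prems assms(1) by (auto simp: s_def)
    have "s * W \<le> (\<eta> / (2 * (W + 1))) * (W + 1)"
      using assms(1) Suc.prems by (intro mult_mono) (auto simp: s_def)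
    also have "\<dots> = \<eta> / 2" using assms(1) by (simp add: field_simps)
    finally show "s * W \<le> \<eta> / 2" .
  qed
  \<comment> \<open>Two values of size \<eta> s / 4 contribute at most \<eta>/2 after division by
    s.\<close>
  define \<eta>' where "\<eta>' = min \<eta> (\<eta> * s / 4)"
  have "0 < \<eta>'" using Suc.prems s by (simp add: \<eta>'_def)
  from Suc.IH[OF this] obtain \<delta> where d: "0 < \<delta>"
    "\<And>E i x. smooth_chain n W E \<Longrightarrow> \<forall>x\<in>{0..2 * pi}. \<bar>E 0 x\<bar> \<le> \<delta> \<Longrightarrow> i \<le> n \<Longrightarrow> x \<in> {0..2 * pi} \<Longrightarrow> \<bar>E i x\<bar> \<le> \<eta>'"
    by blast
  have "\<bar>E i x\<bar> \<le> \<eta>" if E: "smooth_chain (Suc n) W E" "\<forall>x\<in>{0..2 * pi}. \<bar>E 0 x\<bar> \<le> \<delta>"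
    and i: "i \<le> Suc n" and x: "x \<in> {0..2 * pi}" for E i x
  proof -
    have En: "smooth_chain n W E" using E(1) by (auto simp: smooth_chain_def)
    have low: "\<bar>E i x\<bar> \<le> \<eta>'" if "i \<le> n" "x \<in> {0..2 * pi}" for i x using d(2)[OF En E(2) that] .
    show ?thesis
    proof (cases "i \<le> n")
      case True
      then show ?thesis using low[OF True x] by (simp add: \<eta>'_def)
    next
      case False
      then have i: "i = Suc n" using i by simp
      define y where "y = (if x \<le> pi then x + s else x - s)"
      have y: "y \<in> {0..2 * pi}" "\<bar>y - x\<bar> = s" using x s by (auto simp: y_def)
      have "\<bar>E n y - E n x - (y - x) * E (Suc n) x\<bar> \<le> W * (y - x)\<^sup>2"
        by (rule taylor_quad) (use smooth_chainD[OF E(1)] x y in auto)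
      moreover have "(y - x)\<^sup>2 = s * s" using y(2) by (metis power2_abs power2_eq_square)
      ultimately have "\<bar>E n y - E n x - (y - x) * E (Suc n) x\<bar> \<le> W * (s * s)" by (simp only:)
      moreover have "\<bar>v\<bar> \<le> w + 2 * \<eta>'" if "\<bar>p - q - v\<bar> \<le> w" "\<bar>p\<bar> \<le> \<eta>'" "\<bar>q\<bar> \<le> \<eta>'" for p q v w :: real
        using that by linarith
      ultimately have "\<bar>(y - x) * E (Suc n) x\<bar> \<le> W * (s * s) + 2 * \<eta>'"
        using low[OF le_refl x] low[OF le_refl y(1)] by blast
      then have "s * \<bar>E (Suc n) x\<bar> \<le> (s * W) * s + 2 * \<eta>'" by (simp add: abs_mult y(2) mult_ac)
      also have "\<dots> \<le> \<eta> / 2 * s + 2 * (\<eta> * s / 4)"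
        using s by (intro add_mono mult_right_mono) (auto simp: \<eta>'_def)
      finally have "s * \<bar>E (Suc n) x\<bar> \<le> s * \<eta>" by (simp add: algebra_simps)
      then show ?thesis using s(1) i by simp
    qed
  qed
  then show ?case using d(1) by blast
qed

text \<open>Mollification is harmless only away from the ends, so the interval is first contracted
  about its midpoint. The contraction multiplies the i-th derivative by \<open>a ^ i\<close>, at
  most 1, hence the Sobolev norm still serves as the bound.\<close>

lemma smooth_chain_approx:
  assumes f: "continuous_on {0..2 * pi} f" "in_Winf (Suc n) f" and \<delta>: "0 < \<delta>"
  shows "\<exists>E. smooth_chain n (Winf_norm (Suc n) f) E \<and> (\<forall>x\<in>{0..2 * pi}. \<bar>E 0 x - f x\<bar> \<le> \<delta>)"
proof -
  let ?I = "{0..2 * pi}" and ?W = "Winf_norm (Suc n) f" and ?p = "n + 4"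
  have "uniformly_continuous_on ?I f" by (rule compact_uniformly_continuous[OF f(1)]) simp
  then obtain d where d: "0 < d" "\<And>x y. x \<in> ?I \<Longrightarrow> y \<in> ?I \<Longrightarrow> dist y x < d \<Longrightarrow> dist (f y) (f x) < \<delta>"
    unfolding uniformly_continuous_on_def using \<delta> by meson
  define \<epsilon> where "\<epsilon> = min (1/2) (d / 4)"
  have e: "0 < \<epsilon>" "\<epsilon> \<le> 1/2" "\<epsilon> \<le> d / 4" using d by (auto simp: \<epsilon>_def)
  \<comment> \<open>With this factor \<open>S\<close> maps the whole interval onto the points at
    distance at least 2\<epsilon> from its ends and moves no point by more than 2\<epsilon>.\<close>
  define a where "a = 1 - 2 * \<epsilon> / pi"
  have a: "0 \<le> a" "a \<le> 1" using e pi_gt3 by (auto simp: a_def field_simps)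
  define S where "S x = pi + a * (x - pi)" for x :: real
  have S: "\<epsilon> < S x" "S x < 2 * pi - \<epsilon>" "\<bar>S x - x\<bar> \<le> 2 * \<epsilon>" if x: "x \<in> ?I" for x
  proof -
    have r: "\<bar>x - pi\<bar> \<le> pi" using x by auto
    have "\<bar>a * (x - pi)\<bar> \<le> a * pi" unfolding abs_mult using a r by (intro mult_mono) auto
    moreover have "a * pi = pi - 2 * \<epsilon>" using pi_gt_zero by (simp add: a_def field_simps)
    ultimately show "\<epsilon> < S x" "S x < 2 * pi - \<epsilon>" unfolding S_def using e by linarith+
    have "S x - x = - (2 * \<epsilon>) * ((x - pi) / pi)" using pi_gt_zero by (simp add: S_def a_def field_simps)
    then have "\<bar>S x - x\<bar> = (2 * \<epsilon>) * (\<bar>x - pi\<bar> / pi)" using e by (simp add: abs_mult)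
    also have "\<dots> \<le> (2 * \<epsilon>) * 1" using r e by (intro mult_left_mono) auto
    finally show "\<bar>S x - x\<bar> \<le> 2 * \<epsilon>" by simp
  qed
  define E where "E i x = a ^ i * moll ?p \<epsilon> i f (S x)" for i x
  have W: "0 \<le> ?W"
    using moll_Winf_bound[OF e(1) _ _ _ f, of 0 1 "S 0"] S[of 0] abs_ge_zero[of "moll 1 \<epsilon> 0 f (S 0)"] by simp
  have dE: "(E i has_real_derivative E (Suc i) x) (at x)" if "i \<le> Suc n" for i x
  proof -
    have "((\<lambda>x. moll ?p \<epsilon> i f (S x)) has_real_derivative moll ?p \<epsilon> (Suc i) f (S x) * a) (at x)"
      by (rule DERIV_chain2[OF moll_deriv[OF e(1) _ f(1)]]) (use that in \<open>auto simp: S_def intro!: derivative_eq_intros\<close>)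
    from DERIV_cmult[OF this, of "a ^ i"] show ?thesis by (simp add: E_def[abs_def] mult_ac)
  qed
  have bE: "\<bar>E i x\<bar> \<le> ?W" if "i \<le> Suc n" "x \<in> ?I" for i x
  proof -
    have "\<bar>E i x\<bar> \<le> 1 * ?W" unfolding E_def abs_mult
      using moll_Winf_bound[OF e(1) _ _ _ f, of i ?p "S x"] S[OF that(2)] that a
      by (intro mult_mono) (auto simp: power_le_one)
    then show ?thesis by simp
  qed
  have "smooth_chain n ?W E"
    unfolding smooth_chain_def
  proof (intro conjI allI impI ballI)
    fix i x y assume i: "i \<le> n" and xy: "x \<in> ?I" "y \<in> ?I"
    obtain z where z: "z \<in> {min x y..max x y}" "E i y - E i x = (y - x) * E (Suc i) z"
      using MVT_within[of 0 "2 * pi" "E i" "E (Suc i)" x y] dE[of i] i xy has_field_derivative_at_within by (metis le_SucI)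
    have "\<bar>E (Suc i) z\<bar> \<le> ?W" using z(1) xy i by (intro bE) auto
    then have "\<bar>E i y - E i x\<bar> \<le> \<bar>y - x\<bar> * ?W" unfolding z(2) abs_mult by (rule mult_left_mono) simp
    then show "\<bar>E i x - E i y\<bar> \<le> ?W * \<bar>x - y\<bar>" by (simp add: abs_minus_commute mult.commute)
  qed (use dE bE in \<open>auto intro: has_field_derivative_at_within\<close>)
  moreover have "\<bar>E 0 x - f x\<bar> \<le> \<delta>" if x: "x \<in> ?I" for x
  proof -
    have "\<bar>moll ?p \<epsilon> 0 f (S x) - f x\<bar> \<le> \<delta>"
    proof (rule moll_close[OF e(1)])
      fix y assume y: "y \<in> ?I" "\<bar>y - S x\<bar> \<le> \<epsilon>"
      have "dist y x < d" using y(2) S(3)[OF x] e d(1) by (auto simp: dist_real_def)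
      then show "\<bar>f y - f x\<bar> \<le> \<delta>" using d(2)[OF x y(1)] by (simp add: dist_real_def)
    qed (use S[OF x] f in auto)
    then show ?thesis by (simp add: E_def)
  qed
  ultimately show ?thesis by blast
qed

text \<open>By \<open>chain_small\<close>, uniform convergence of the approximations forces the
  Cauchy property of all derivatives up to order n. The limits satisfy the quadratic Taylor bound
  and are therefore derivatives of each other up to the boundary.\<close>

lemma Winf_smooth_chain:
  assumes f: "continuous_on {0..2 * pi} f" "in_Winf (Suc n) f"
  shows "\<exists>D. smooth_chain n (Winf_norm (Suc n) f) D \<and> (\<forall>x\<in>{0..2 * pi}. D 0 x = f x)"
proof -
  let ?I = "{0..2 * pi}" and ?W = "Winf_norm (Suc n) f"
  have "\<forall>j::nat. \<exists>E. smooth_chain n ?W E \<and> (\<forall>x\<in>?I. \<bar>E 0 x - f x\<bar> \<le> 1 / Suc j)"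
    using smooth_chain_approx[OF f] by simp
  then obtain E where E: "\<And>j. smooth_chain n ?W (E j)" "\<And>j x. x \<in> ?I \<Longrightarrow> \<bar>E j 0 x - f x\<bar> \<le> 1 / Suc j" by metis
  have W: "0 \<le> ?W" using smooth_chainD(2)[OF E(1), of 0 0] abs_ge_zero by (meson atLeastAtMost_iff le0 order_trans order_refl pi_ge_zero zero_le_mult_iff zero_le_numeral)
  have "Cauchy (\<lambda>j. E j i x)" if i: "i \<le> n" and x: "x \<in> ?I" for i x
  proof (rule metric_CauchyI)
    fix e :: real assume e: "0 < e"
    obtain \<delta> where d: "0 < \<delta>" "\<And>F. smooth_chain n (?W + ?W) F \<Longrightarrow> (\<forall>x\<in>?I. \<bar>F 0 x\<bar> \<le> \<delta>) \<Longrightarrow> \<bar>F i x\<bar> \<le> e / 2"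
      using chain_small[of "?W + ?W" "e / 2" n] W e i x by (auto; blast)
    obtain J where J: "inverse (real (Suc J)) < \<delta> / 2" using reals_Archimedean[of "\<delta> / 2"] d(1) by auto
    have "dist (E j i x) (E l i x) < e" if "J \<le> j" "J \<le> l" for j l
    proof -
      have "\<bar>E j 0 y - E l 0 y\<bar> \<le> \<delta>" if y: "y \<in> ?I" for y
      proof -
        have "1 / real (Suc j) \<le> 1 / Suc J" "1 / real (Suc l) \<le> 1 / Suc J"
          using \<open>J \<le> j\<close> \<open>J \<le> l\<close> by (auto intro!: divide_left_mono)
        then show ?thesis using E(2)[OF y, of j] E(2)[OF y, of l] J by (simp add: inverse_eq_divide)
      qed
      then have "\<bar>E j i x - E l i x\<bar> \<le> e / 2" using d(2)[OF smooth_chain_diff[OF E(1) E(1)]] by blast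
      then show ?thesis using e by (simp add: dist_real_def)
    qed
    then show "\<exists>M. \<forall>m\<ge>M. \<forall>l\<ge>M. dist (E m i x) (E l i x) < e" by blast
  qed
  then have "\<exists>L. (\<lambda>j. E j i x) \<longlonglongrightarrow> L" if "i \<le> n" "x \<in> ?I" for i x
    using that Cauchy_convergent convergent_def by blast
  then obtain D where D: "\<And>i x. i \<le> n \<Longrightarrow> x \<in> ?I \<Longrightarrow> (\<lambda>j. E j i x) \<longlonglongrightarrow> D i x" by metis
  have "smooth_chain n ?W D" unfolding smooth_chain_def
  proof (intro conjI allI impI ballI)
    fix i x y assume i: "i \<le> n" and xy: "x \<in> ?I" "y \<in> ?I"
    show "\<bar>D i x\<bar> \<le> ?W"
      using smooth_chainD(2)[OF E(1) i xy(1)] by (intro LIMSEQ_le_const2[OF tendsto_rabs[OF D[OF i xy(1)]]]) auto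
    show "\<bar>D i x - D i y\<bar> \<le> ?W * \<bar>x - y\<bar>"
      using smooth_chainD(3)[OF E(1) i xy]
      by (intro LIMSEQ_le_const2[OF tendsto_rabs[OF tendsto_diff[OF D[OF i xy(1)] D[OF i xy(2)]]]]) auto
  next
    fix i x assume i: "i < n" and x: "x \<in> ?I"
    show "(D i has_real_derivative D (Suc i) x) (at x within ?I)"
    proof (rule quad_deriv[where W = ?W])
      fix y assume y: "y \<in> ?I"
      have "\<bar>E j i y - E j i x - (y - x) * E j (Suc i) x\<bar> \<le> ?W * (y - x)\<^sup>2" for j
        by (rule taylor_quad) (use smooth_chainD[OF E(1)[of j]] x y i in auto)
      moreover have "(\<lambda>j. \<bar>E j i y - E j i x - (y - x) * E j (Suc i) x\<bar>) \<longlonglongrightarrow> \<bar>D i y - D i x - (y - x) * D (Suc i) x\<bar>"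
        using i x y by (intro tendsto_intros D) auto
      ultimately show "\<bar>D i y - D i x - (y - x) * D (Suc i) x\<bar> \<le> ?W * (y - x)\<^sup>2"
        by (intro LIMSEQ_le_const2) auto
    qed
  qed
  moreover have "D 0 x = f x" if x: "x \<in> ?I" for x
  proof (rule LIMSEQ_unique[OF D[OF _ x]])
    have "(\<lambda>j. E j 0 x - f x) \<longlonglongrightarrow> 0"
    proof (rule Lim_null_comparison)
      show "\<forall>\<^sub>F j in sequentially. norm (E j 0 x - f x) \<le> 1 / Suc j" using E(2)[OF x] by simp
      show "(\<lambda>j. 1 / real (Suc j)) \<longlonglongrightarrow> 0" using LIMSEQ_inverse_real_of_nat by (simp add: inverse_eq_divide)
    qed
    then show "(\<lambda>j. E j 0 x) \<longlonglongrightarrow> f x" by (rule LIM_zero_cancel)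
  qed simp
  ultimately show ?thesis by blast
qed

section \<open>Regularity in time\<close>

lemma real_vector_derivative_within:
  assumes "(a::real) < b" "x \<in> {a..b}" "(f has_real_derivative f') (at x within {a..b})"
  shows "vector_derivative f (at x within {a..b}) = f'"
  using assms by (intro vector_derivative_within_closed_interval) (auto simp: has_real_derivative_iff_has_vector_derivative)

lemma derivative_unique_within:
  assumes "(a::real) < b" "x \<in> {a..b}" "(f has_real_derivative f') (at x within {a..b})"
    "(g has_real_derivative g') (at x within {a..b})" "\<And>y. y \<in> {a..b} \<Longrightarrow> f y = g y"
  shows "f' = g'"
proof -
  have "(f has_real_derivative g') (at x within {a..b})"
    by (rule has_field_derivative_transform_within[OF assms(4) zero_less_one assms(2)]) (use assms(5) in auto)
  then show ?thesis using real_vector_derivative_within assms by metis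
qed

text \<open>\<open>D i t\<close> is the i-th x-derivative of the solution at time t. The bound on
  the weak derivative of order n + 1 enters twice: as a Lipschitz constant in \<open>chain\<close>,
  and in \<open>moll_bound\<close> at i = Suc n as a bound on mollified derivatives, to which the
  interior estimates apply.\<close>

locale heat_family =
  fixes n :: nat and M T :: real and D :: "nat \<Rightarrow> real \<Rightarrow> real \<Rightarrow> real"
  assumes n: "2 \<le> n" and T: "0 < T"
    and chain: "\<And>t. t \<in> {0..T} \<Longrightarrow> smooth_chain n M (\<lambda>i. D i t)"
    and moll_bound: "\<And>t \<epsilon> x i p. t \<in> {0..T} \<Longrightarrow> 0 < \<epsilon> \<Longrightarrow> \<epsilon> < x \<Longrightarrow> x < 2 * pi - \<epsilon> \<Longrightarrow> i \<le> Suc n \<Longrightarrow> i < p \<Longrightarrow>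
      \<bar>moll p \<epsilon> i (D 0 t) x\<bar> \<le> M"
    and cont0: "continuous_on ({0..T} \<times> {0..2 * pi}) (\<lambda>(t, x). D 0 t x)"
    and heat0: "\<And>t x. 0 < t \<Longrightarrow> t \<le> T \<Longrightarrow> x \<in> {0..2 * pi} \<Longrightarrow>
      ((\<lambda>s. D 0 s x) has_real_derivative D 2 t x) (at t within {0..T})"
begin

abbreviation "I \<equiv> {0..2 * pi}"

lemma M_nonneg: "0 \<le> M"
  using smooth_chainD(2)[OF chain[of 0], of 0 0] T abs_ge_zero[of "D 0 0 0"] by auto

lemma D_deriv: "t \<in> {0..T} \<Longrightarrow> i < n \<Longrightarrow> x \<in> I \<Longrightarrow> (D i t has_real_derivative D (Suc i) t x) (at x within I)"
  using smooth_chainD(1)[OF chain] by auto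

lemma D_bound: "t \<in> {0..T} \<Longrightarrow> i \<le> n \<Longrightarrow> x \<in> I \<Longrightarrow> \<bar>D i t x\<bar> \<le> M"
  using smooth_chainD(2)[OF chain] by auto

lemma D_lip: "t \<in> {0..T} \<Longrightarrow> i \<le> n \<Longrightarrow> x \<in> I \<Longrightarrow> y \<in> I \<Longrightarrow> \<bar>D i t x - D i t y\<bar> \<le> M * \<bar>x - y\<bar>"
  using smooth_chainD(3)[OF chain] by auto

lemma D_cont: "t \<in> {0..T} \<Longrightarrow> i \<le> n \<Longrightarrow> continuous_on I (D i t)"
  using smooth_chain_continuous[OF chain] by blast

text \<open>The difference of the chains at two times is again a chain. Once its first member is
  small, which is uniform continuity of u, \<open>chain_small\<close> makes every member
  small.\<close>

lemma D_time_cont: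
  assumes "0 < \<eta>"
  shows "\<exists>d>0. \<forall>s\<in>{0..T}. \<forall>t\<in>{0..T}. \<bar>s - t\<bar> < d \<longrightarrow> (\<forall>i\<le>n. \<forall>x\<in>I. \<bar>D i s x - D i t x\<bar> \<le> \<eta>)"
proof -
  obtain \<delta> where d: "0 < \<delta>" "\<And>E i x. smooth_chain n (M + M) E \<Longrightarrow> \<forall>x\<in>I. \<bar>E 0 x\<bar> \<le> \<delta> \<Longrightarrow> i \<le> n \<Longrightarrow> x \<in> I \<Longrightarrow> \<bar>E i x\<bar> \<le> \<eta>"
    using chain_small[of "M + M" \<eta> n] M_nonneg assms by (auto; blast)
  have "uniformly_continuous_on ({0..T} \<times> I) (\<lambda>(t, x). D 0 t x)"
    by (rule compact_uniformly_continuous[OF cont0]) (intro compact_Times compact_Icc)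
  then obtain e where e: "0 < e" "\<And>z z'. z \<in> {0..T} \<times> I \<Longrightarrow> z' \<in> {0..T} \<times> I \<Longrightarrow> dist z' z < e \<Longrightarrow>
      dist (case z' of (t, x) \<Rightarrow> D 0 t x) (case z of (t, x) \<Rightarrow> D 0 t x) < \<delta>"
    unfolding uniformly_continuous_on_def using d(1) by meson
  have "\<bar>D i s x - D i t x\<bar> \<le> \<eta>" if st: "s \<in> {0..T}" "t \<in> {0..T}" "\<bar>s - t\<bar> < e" and i: "i \<le> n" "x \<in> I" for s t i x
  proof (rule d(2)[OF smooth_chain_diff[OF chain[OF st(1)] chain[OF st(2)]] _ i])
    show "\<forall>x\<in>I. \<bar>D 0 s x - D 0 t x\<bar> \<le> \<delta>"
    proof
      fix x assume "x \<in> I"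
      then show "\<bar>D 0 s x - D 0 t x\<bar> \<le> \<delta>"
        using e(2)[of "(t, x)" "(s, x)"] st by (auto simp: dist_Pair_Pair dist_real_def)
    qed
  qed
  then show ?thesis using e(1) by blast
qed

lemma D_joint_cont:
  assumes i: "i \<le> n"
  shows "continuous_on ({0..T} \<times> I) (\<lambda>z. D i (fst z) (snd z))"
proof (rule continuous_on_iff[THEN iffD2], intro ballI allI impI)
  fix z and e :: real assume z: "z \<in> {0..T} \<times> I" and e: "0 < e"
  obtain d where d: "0 < d" "\<And>s t x. s \<in> {0..T} \<Longrightarrow> t \<in> {0..T} \<Longrightarrow> \<bar>s - t\<bar> < d \<Longrightarrow> x \<in> I \<Longrightarrow> \<bar>D i s x - D i t x\<bar> \<le> e / 3"
    using D_time_cont[of "e / 3"] e i by (metis divide_pos_pos zero_less_numeral)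
  define d' where "d' = min d (e / (3 * (M + 1)))"
  have d': "0 < d'" using d e M_nonneg by (simp add: d'_def)
  have "dist (D i (fst z') (snd z')) (D i (fst z) (snd z)) < e" if z': "z' \<in> {0..T} \<times> I" and ds: "dist z' z < d'" for z'
  proof -
    have "dist (fst z') (fst z) < d'" "dist (snd z') (snd z) < d'"
      using ds dist_fst_le[of z' z] dist_snd_le[of z' z] by linarith+
    then have a: "\<bar>fst z' - fst z\<bar> < d" "\<bar>snd z' - snd z\<bar> \<le> e / (3 * (M + 1))"
      by (auto simp: dist_real_def d'_def)
    have "\<bar>D i (fst z') (snd z') - D i (fst z) (snd z')\<bar> \<le> e / 3" using z z' a by (intro d(2)) auto
    moreover have "\<bar>D i (fst z) (snd z') - D i (fst z) (snd z)\<bar> \<le> M * \<bar>snd z' - snd z\<bar>"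
      using z z' i by (intro D_lip) auto
    moreover have "M * \<bar>snd z' - snd z\<bar> \<le> (M + 1) * (e / (3 * (M + 1)))"
      using a M_nonneg by (intro mult_mono) auto
    moreover have "(M + 1) * (e / (3 * (M + 1))) = e / 3" using M_nonneg by (simp add: field_simps)
    ultimately show ?thesis using e unfolding dist_real_def by linarith
  qed
  then show "\<exists>d>0. \<forall>z'\<in>{0..T} \<times> I. dist z' z < d \<longrightarrow> dist (D i (fst z') (snd z')) (D i (fst z) (snd z)) < e"
    using d' by blast
qed

lemma D_cont_time: 
  assumes "i \<le> n" "x \<in> I" shows "continuous_on {0..T} (\<lambda>t. D i t x)"
proof -
  have "continuous_on {0..T} (\<lambda>t. (t, x))" by (intro continuous_intros)
  moreover have "(\<lambda>t. (t, x)) ` {0..T} \<subseteq> {0..T} \<times> I" using assms(2) by auto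
  ultimately show ?thesis using continuous_on_compose2[OF D_joint_cont[OF assms(1)], of "{0..T}" "\<lambda>t. (t, x)"] by simp
qed

text \<open>Up to the boundary and down to \<open>t = 0\<close>, the x-derivatives inherit the heat equation in
  integrated form, since both sides of it have the same x-derivatives.\<close>

lemma heat_integral:
  assumes st: "0 \<le> s" "s \<le> t" "t \<le> T" and i: "i + 2 \<le> n" and x: "x \<in> I"
  shows "D i t x - D i s x = integral {s..t} (\<lambda>\<sigma>. D (i + 2) \<sigma> x)"
  using i x
proof (induction i arbitrary: x)
  case 0
  have "((\<lambda>\<sigma>. D 2 \<sigma> x) has_integral D 0 t x - D 0 s x) {s..t}"
  proof (rule fundamental_theorem_of_calculus_interior[OF st(2)])
    show "continuous_on {s..t} (\<lambda>t. D 0 t x)"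
      using st by (intro continuous_on_subset[OF D_cont_time[OF _ 0(2)]]) auto
    fix \<sigma> assume \<sigma>: "\<sigma> \<in> {s<..<t}"
    have "at \<sigma> within {0..T} = at \<sigma>" using \<sigma> st by (intro at_within_interior) auto
    then show "((\<lambda>t. D 0 t x) has_vector_derivative D 2 \<sigma> x) (at \<sigma>)"
      using heat0[of \<sigma> x] \<sigma> st 0 by (simp add: has_real_derivative_iff_has_vector_derivative)
  qed
  then show ?case by (simp add: integral_unique numeral_2_eq_2)
next
  case (Suc i)
  have t: "t \<in> {0..T}" "s \<in> {0..T}" using st by auto
  have 1: "((\<lambda>x. D i t x - D i s x) has_real_derivative D (Suc i) t x - D (Suc i) s x) (at x within I)"
    using Suc.prems t by (intro DERIV_diff D_deriv) auto
  have "((\<lambda>x. integral (cbox s t) (\<lambda>\<sigma>. D (i + 2) \<sigma> x)) has_real_derivative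
      integral (cbox s t) (\<lambda>\<sigma>. D (Suc i + 2) \<sigma> x)) (at x within I)"
  proof (rule leibniz_rule_field_derivative)
    fix x \<sigma> assume "x \<in> I" "\<sigma> \<in> cbox s t"
    then show "((\<lambda>x. D (i + 2) \<sigma> x) has_real_derivative D (Suc i + 2) \<sigma> x) (at x within I)"
      using D_deriv[of \<sigma> "i + 2" x] Suc.prems st by auto
  next
    fix x assume "x \<in> I"
    then show "(\<lambda>\<sigma>. D (i + 2) \<sigma> x) integrable_on cbox s t"
      using Suc.prems st by (auto intro!: integrable_continuous_real continuous_on_subset[OF D_cont_time])
  next
    have sw: "continuous_on (I \<times> {s..t}) prod.swap" by (rule continuous_on_swap)
    have "continuous_on (I \<times> {s..t}) (\<lambda>z. D (Suc i + 2) (fst (prod.swap z)) (snd (prod.swap z)))"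
      by (rule continuous_on_compose2[OF D_joint_cont sw]) (use Suc.prems st in auto)
    then show "continuous_on (I \<times> cbox s t) (\<lambda>(x, \<sigma>). D (Suc i + 2) \<sigma> x)"
      by (simp add: split_beta)
  qed (use Suc.prems in auto)
  then have 2: "((\<lambda>x. integral {s..t} (\<lambda>\<sigma>. D (i + 2) \<sigma> x)) has_real_derivative
      integral {s..t} (\<lambda>\<sigma>. D (Suc i + 2) \<sigma> x)) (at x within I)" by simp
  show ?case
    by (rule derivative_unique_within[OF _ Suc.prems(2) 1 2]) (use Suc.IH Suc.prems(1) pi_gt_zero in auto)
qed

text \<open>Uniformity in x is the point: it lets any functional that is bounded in the sup norm be
  differentiated in time.\<close>

lemma heat_udiff:
  assumes t: "t \<in> {0..T}" and i: "i + 2 \<le> n" and e: "0 < e"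
  shows "\<exists>d>0. \<forall>s\<in>{0..T}. \<bar>s - t\<bar> < d \<longrightarrow>
    (\<forall>x\<in>I. \<bar>D i s x - D i t x - (s - t) * D (i + 2) t x\<bar> \<le> e * \<bar>s - t\<bar>)"
proof -
  obtain d where d: "0 < d" "\<And>s t x. s \<in> {0..T} \<Longrightarrow> t \<in> {0..T} \<Longrightarrow> \<bar>s - t\<bar> < d \<Longrightarrow> x \<in> I \<Longrightarrow> \<bar>D (i + 2) s x - D (i + 2) t x\<bar> \<le> e"
    using D_time_cont[OF e] i by metis
  have *: "\<bar>D i b x - D i a x - (b - a) * D (i + 2) t x\<bar> \<le> e * (b - a)"
    if ab: "0 \<le> a" "a \<le> b" "b \<le> T" "\<And>\<sigma>. \<sigma> \<in> {a..b} \<Longrightarrow> \<bar>\<sigma> - t\<bar> < d" and x: "x \<in> I" for a b x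
  proof -
    have int: "(\<lambda>\<sigma>. D (i + 2) \<sigma> x) integrable_on {a..b}"
      using i x ab by (auto intro!: integrable_continuous_real continuous_on_subset[OF D_cont_time])
    have "D i b x - D i a x - (b - a) * D (i + 2) t x = integral {a..b} (\<lambda>\<sigma>. D (i + 2) \<sigma> x - D (i + 2) t x)"
      using heat_integral[OF ab(1-3) i x] ab(2) by (subst integral_diff[OF int]) auto
    moreover have "norm (integral {a..b} (\<lambda>\<sigma>. D (i + 2) \<sigma> x - D (i + 2) t x)) \<le> e * (b - a)"
    proof (rule integral_bound[OF ab(2)])
      show "continuous_on {a..b} (\<lambda>\<sigma>. D (i + 2) \<sigma> x - D (i + 2) t x)"
        using i x ab by (intro continuous_on_diff continuous_on_const continuous_on_subset[OF D_cont_time]) auto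
      fix \<sigma> assume "\<sigma> \<in> {a..b}"
      then show "norm (D (i + 2) \<sigma> x - D (i + 2) t x) \<le> e"
        using d(2)[of \<sigma> t x] ab t x by auto
    qed
    ultimately show ?thesis by simp
  qed
  have "\<bar>D i s x - D i t x - (s - t) * D (i + 2) t x\<bar> \<le> e * \<bar>s - t\<bar>" if s: "s \<in> {0..T}" "\<bar>s - t\<bar> < d" and x: "x \<in> I" for s x
  proof (cases "t \<le> s")
    case True
    then show ?thesis using *[of t s x] s t x by auto
  next
    case False
    have "\<bar>D i t x - D i s x - (t - s) * D (i + 2) t x\<bar> \<le> e * (t - s)"
      using *[of s t x] s t x False by auto
    moreover have "D i s x - D i t x - (s - t) * D (i + 2) t x = - (D i t x - D i s x - (t - s) * D (i + 2) t x)"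
      by (simp add: algebra_simps)
    ultimately show ?thesis using False by (simp only: abs_minus_cancel) simp
  qed
  then show ?thesis using d(1) by blast
qed

text \<open>The difference quotients converge uniformly in x, so a bounded linear functional
  commutes with the time derivative. It is applied to coefficients, inner products on a cell and
  mollifications, which would otherwise each need a differentiation under the integral.\<close>

lemma functional_time_derivative:
  assumes t: "t \<in> {0..T}" and i: "i + 2 \<le> n"
    and diff: "\<And>f g. continuous_on I f \<Longrightarrow> continuous_on I g \<Longrightarrow> \<Lambda> (\<lambda>x. f x - g x) = \<Lambda> f - \<Lambda> g"
    and scale: "\<And>c f. continuous_on I f \<Longrightarrow> \<Lambda> (\<lambda>x. c * f x) = c * \<Lambda> f"
    and bnd: "\<And>f S. continuous_on I f \<Longrightarrow> (\<And>x. x \<in> I \<Longrightarrow> \<bar>f x\<bar> \<le> S) \<Longrightarrow> \<bar>\<Lambda> f\<bar> \<le> C * S"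
  shows "((\<lambda>s. \<Lambda> (D i s)) has_real_derivative (\<Lambda> (D (i + 2) t) :: real)) (at t within {0..T})"
proof -
  have C: "0 \<le> C" using bnd[of "\<lambda>x. 0" 1] abs_ge_zero[of "\<Lambda> (\<lambda>x. 0)"] by auto
  show ?thesis
    unfolding has_field_derivative_iff
  proof (rule LIM_zero_cancel, rule tendstoI)
    fix r :: real assume r: "0 < r"
    define e where "e = r / (2 * (C + 1))"
    have e: "0 < e" "C * e < r"
    proof -
      show "0 < e" using r C by (simp add: e_def)
      have "C * e \<le> (C + 1) * e" using \<open>0 < e\<close> by (simp add: mult_right_mono)
      also have "\<dots> = r / 2" using C by (simp add: e_def field_simps)
      finally show "C * e < r" using r by simp
    qed
    obtain d where d: "0 < d" "\<And>s x. s \<in> {0..T} \<Longrightarrow> \<bar>s - t\<bar> < d \<Longrightarrow> x \<in> I \<Longrightarrow>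
        \<bar>D i s x - D i t x - (s - t) * D (i + 2) t x\<bar> \<le> e * \<bar>s - t\<bar>"
      using heat_udiff[OF t i e(1)] by blast
    have "dist ((\<Lambda> (D i s) - \<Lambda> (D i t)) / (s - t) - \<Lambda> (D (i + 2) t)) 0 < r" if s: "s \<in> {0..T}" "s \<noteq> t" "\<bar>s - t\<bar> < d" for s
    proof -
      have c: "continuous_on I (D i s)" "continuous_on I (D i t)" "continuous_on I (D (i + 2) t)"
        using i s t by (auto intro!: D_cont)
      have "\<Lambda> (\<lambda>x. (D i s x - D i t x) - (s - t) * D (i + 2) t x) = \<Lambda> (D i s) - \<Lambda> (D i t) - (s - t) * \<Lambda> (D (i + 2) t)"
        using c by (simp add: diff scale continuous_on_diff continuous_on_mult_left)
      moreover have "\<bar>\<Lambda> (\<lambda>x. (D i s x - D i t x) - (s - t) * D (i + 2) t x)\<bar> \<le> C * (e * \<bar>s - t\<bar>)"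
        using c d(2)[OF s(1,3)] by (intro bnd continuous_on_diff continuous_on_mult_left) auto
      ultimately have "\<bar>\<Lambda> (D i s) - \<Lambda> (D i t) - (s - t) * \<Lambda> (D (i + 2) t)\<bar> \<le> (C * e) * \<bar>s - t\<bar>" by simp
      moreover have "(\<Lambda> (D i s) - \<Lambda> (D i t)) / (s - t) - \<Lambda> (D (i + 2) t) =
          (\<Lambda> (D i s) - \<Lambda> (D i t) - (s - t) * \<Lambda> (D (i + 2) t)) / (s - t)" using s by (simp add: field_simps)
      ultimately have "\<bar>(\<Lambda> (D i s) - \<Lambda> (D i t)) / (s - t) - \<Lambda> (D (i + 2) t)\<bar> \<le> C * e"
        using s by (simp add: abs_divide pos_divide_le_eq)
      then show ?thesis using e(2) by (simp add: dist_real_def)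
    qed
    then show "\<forall>\<^sub>F s in at t within {0..T}. dist ((\<Lambda> (D i s) - \<Lambda> (D i t)) / (s - t) - \<Lambda> (D (i + 2) t)) 0 < r"
      unfolding eventually_at using d(1) by (intro exI[of _ d]) (auto simp: dist_real_def)
  qed
qed

end

section \<open>Interior gradient estimates\<close>

lemma local_max_second_derivative:
  fixes f :: "real \<Rightarrow> real"
  assumes d: "0 < d" and f': "\<And>y. \<bar>y - x\<bar> < d \<Longrightarrow> (f has_real_derivative f' y) (at y)"
    and f'': "(f' has_real_derivative f'') (at x)" and max: "\<And>y. \<bar>y - x\<bar> < d \<Longrightarrow> f y \<le> f x"
  shows "f'' \<le> 0"
proof (rule ccontr)
  assume "\<not> f'' \<le> 0"
  then obtain e where e: "0 < e" "\<And>h. 0 < h \<Longrightarrow> h < e \<Longrightarrow> f' x < f' (x + h)"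
    using DERIV_pos_inc_right[OF f''] by auto
  have "f' x = 0" using DERIV_local_max[OF f'[of x] d] d max by (auto simp: abs_minus_commute)
  define h where "h = min d e / 2"
  have h: "0 < h" "h < d" "h < e" using d e(1) by (auto simp: h_def)
  obtain z where z: "x < z" "z < x + h" "f (x + h) - f x = (x + h - x) * f' z"
    using MVT2[of x "x + h" f f'] f' h by (auto simp: abs_if)
  have "0 < f' z" using e(2)[of "z - x"] z h \<open>f' x = 0\<close> by simp
  then have "0 < h * f' z" using h by simp
  then have "f x < f (x + h)" using z(3) by simp
  then show False using max[of "x + h"] h by simp
qed

text \<open>Bernstein's method: \<open>\<eta> w\<^sup>2 + 29 v\<^sup>2 / R\<^sup>2\<close>, where \<open>w = v\<^sub>x\<close> and the cut-off \<open>\<eta>\<close> vanishes on the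
  parabolic boundary of the cylinder, is a subsolution of the heat equation.\<close>

lemma bernstein_gradient_estimate:
  fixes v w w1 w2 :: "real \<Rightarrow> real \<Rightarrow> real"
  assumes R: "0 < R"
    and cv: "continuous_on ({t0 - R\<^sup>2..t0} \<times> {x0 - R..x0 + R}) (\<lambda>z. v (fst z) (snd z))"
    and cw: "continuous_on ({t0 - R\<^sup>2..t0} \<times> {x0 - R..x0 + R}) (\<lambda>z. w (fst z) (snd z))"
    and vx: "\<And>t x. t \<in> {t0 - R\<^sup>2..t0} \<Longrightarrow> x \<in> {x0 - R<..<x0 + R} \<Longrightarrow> (v t has_real_derivative w t x) (at x)"
    and wx: "\<And>t x. t \<in> {t0 - R\<^sup>2..t0} \<Longrightarrow> x \<in> {x0 - R<..<x0 + R} \<Longrightarrow> (w t has_real_derivative w1 t x) (at x)"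
    and wxx: "\<And>t x. t \<in> {t0 - R\<^sup>2..t0} \<Longrightarrow> x \<in> {x0 - R<..<x0 + R} \<Longrightarrow> (w1 t has_real_derivative w2 t x) (at x)"
    and vt: "\<And>t x. t \<in> {t0 - R\<^sup>2..t0} \<Longrightarrow> x \<in> {x0 - R<..<x0 + R} \<Longrightarrow>
      ((\<lambda>t. v t x) has_real_derivative w1 t x) (at t within {t0 - R\<^sup>2..t0})"
    and wt: "\<And>t x. t \<in> {t0 - R\<^sup>2..t0} \<Longrightarrow> x \<in> {x0 - R<..<x0 + R} \<Longrightarrow>
      ((\<lambda>t. w t x) has_real_derivative w2 t x) (at t within {t0 - R\<^sup>2..t0})"
    and M: "\<And>t x. t \<in> {t0 - R\<^sup>2..t0} \<Longrightarrow> x \<in> {x0 - R..x0 + R} \<Longrightarrow> \<bar>v t x\<bar> \<le> M"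
  shows "\<bar>w t0 x0\<bar> \<le> 6 * M / R"
proof -
  let ?Q = "{t0 - R\<^sup>2..t0} \<times> {x0 - R..x0 + R}"
  \<comment> \<open>29 = 1 + 24 + 4 collects the coefficients of \<open>w\<^sup>2\<close> left by
    the cut-off: its time derivative, the completed square and its second x-derivative, each over
    \<open>R\<^sup>2\<close>. The zero-order term contributes -2A, so that -A remains. The final
    factor 6 comes from 29 < 36.\<close>
  define A where "A = 29 / R\<^sup>2"
  define \<zeta> where "\<zeta> x = 1 - ((x - x0) / R)\<^sup>2" for x
  define \<zeta>1 where "\<zeta>1 x = - 2 * (x - x0) / R\<^sup>2" for x
  define s where "s t = (t - t0) / R\<^sup>2 + 1" for t
  define \<Phi> where "\<Phi> t x = s t * (\<zeta> x)\<^sup>2 * (w t x)\<^sup>2 + A * (v t x)\<^sup>2" for t x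
  have R2: "0 < R\<^sup>2" using R by simp
  have M0: "0 \<le> M" using M[of t0 x0] R by force
  have s: "0 \<le> s t" "s t \<le> 1" if "t \<in> {t0 - R\<^sup>2..t0}" for t using that R2 by (auto simp: s_def field_simps)
  have \<zeta>: "0 \<le> \<zeta> x" "\<zeta> x \<le> 1" "(\<zeta>1 x)\<^sup>2 \<le> 4 / R\<^sup>2" if "x \<in> {x0 - R..x0 + R}" for x
  proof -
    have "\<bar>(x - x0) / R\<bar> \<le> 1" using that R by (auto simp: abs_le_iff field_simps)
    then have q: "((x - x0) / R)\<^sup>2 \<le> 1" by (simp add: abs_square_le_1)
    then show "0 \<le> \<zeta> x" "\<zeta> x \<le> 1" by (auto simp: \<zeta>_def)
    have "(\<zeta>1 x)\<^sup>2 = 4 / R\<^sup>2 * ((x - x0) / R)\<^sup>2"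
    proof -
      have "(- 2 * y / R\<^sup>2)\<^sup>2 = 4 / R\<^sup>2 * (y / R)\<^sup>2" for y by (simp add: power2_eq_square)
      then show ?thesis unfolding \<zeta>1_def .
    qed
    also have "\<dots> \<le> 4 / R\<^sup>2 * 1" using q by (intro mult_left_mono) auto
    finally show "(\<zeta>1 x)\<^sup>2 \<le> 4 / R\<^sup>2" by simp
  qed
  have "continuous_on ?Q (\<lambda>z. \<Phi> (fst z) (snd z))"
    unfolding \<Phi>_def s_def \<zeta>_def using R2 R by (intro continuous_intros cv cw) auto
  moreover have "compact ?Q" "?Q \<noteq> {}" using R by (auto intro: compact_Times)
  ultimately obtain z where z: "z \<in> ?Q" "\<And>y. y \<in> ?Q \<Longrightarrow> \<Phi> (fst y) (snd y) \<le> \<Phi> (fst z) (snd z)"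
    using continuous_attains_sup[of ?Q "\<lambda>z. \<Phi> (fst z) (snd z)"] by blast
  obtain t x where tx: "z = (t, x)" by force
  have t: "t \<in> {t0 - R\<^sup>2..t0}" and x: "x \<in> {x0 - R..x0 + R}" using z(1) tx by auto
  have max: "\<Phi> t' x' \<le> \<Phi> t x" if "t' \<in> {t0 - R\<^sup>2..t0}" "x' \<in> {x0 - R..x0 + R}" for t' x'
    using z(2)[of "(t', x')"] that tx by simp
  have Av: "A * (v t x)\<^sup>2 \<le> A * M\<^sup>2"
    using M[OF t x] by (intro mult_left_mono) (auto simp: A_def abs_le_square_iff[symmetric])
  have "\<Phi> t x \<le> A * M\<^sup>2"
  proof (cases "t = t0 - R\<^sup>2 \<or> x = x0 - R \<or> x = x0 + R")
    case True
    then have "s t * (\<zeta> x)\<^sup>2 = 0" using R by (auto simp: s_def \<zeta>_def)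
    then show ?thesis using Av by (auto simp: \<Phi>_def)
  next
    case False
    then have t': "t0 - R\<^sup>2 < t" and x': "x \<in> {x0 - R<..<x0 + R}" using t x by auto
    define W V W1 W2 Z Z1 S where "W = w t x" "V = v t x" "W1 = w1 t x" "W2 = w2 t x" "Z = \<zeta> x" "Z1 = \<zeta>1 x" "S = s t"
    note defs = W_V_W1_W2_Z_Z1_S_def
    define \<Phi>t where "\<Phi>t = Z\<^sup>2 / R\<^sup>2 * W\<^sup>2 + S * Z\<^sup>2 * (2 * W * W2) + A * (2 * V * W1)"
    define \<Phi>x where "\<Phi>x y = s t * (2 * \<zeta> y * \<zeta>1 y) * (w t y)\<^sup>2 + s t * (\<zeta> y)\<^sup>2 * (2 * w t y * w1 t y) + A * (2 * v t y * w t y)" for y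
    define \<Phi>xx where "\<Phi>xx = S * (2 * Z1\<^sup>2 - 4 * Z / R\<^sup>2) * W\<^sup>2 + 8 * S * Z * Z1 * W * W1
       + 2 * S * Z\<^sup>2 * (W1\<^sup>2 + W * W2) + 2 * A * (W\<^sup>2 + V * W1)"
    have dz: "(\<zeta> has_real_derivative \<zeta>1 y) (at y)" for y
      unfolding \<zeta>_def[abs_def] \<zeta>1_def using R by (auto intro!: derivative_eq_intros simp: power2_eq_square field_simps)
    have dz1: "(\<zeta>1 has_real_derivative - 2 / R\<^sup>2) (at y)" for y
      unfolding \<zeta>1_def[abs_def]
      by (rule DERIV_cong[OF DERIV_cdivide[OF DERIV_cmult[OF DERIV_diff[OF DERIV_ident DERIV_const]]]]) simp
    have dt: "((\<lambda>t. \<Phi> t x) has_real_derivative \<Phi>t) (at t within {t0 - R\<^sup>2..t0})"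
    proof -
      have ds: "(s has_real_derivative 1 / R\<^sup>2) (at t within {t0 - R\<^sup>2..t0})"
        unfolding s_def[abs_def]
        by (rule DERIV_cong[OF DERIV_add[OF DERIV_cdivide[OF DERIV_diff[OF DERIV_ident DERIV_const]] DERIV_const]]) simp
      show ?thesis
        unfolding \<Phi>_def \<Phi>t_def defs
        by (rule derivative_eq_intros ds vt[OF t x'] wt[OF t x'] refl)+ (simp add: power2_eq_square algebra_simps)
    qed
    \<comment> \<open>The maximum may lie at the final time, so only times before t can be compared,
      and only a sign of the time derivative results.\<close>
    have "0 \<le> \<Phi>t"
    proof (rule ccontr)
      assume "\<not> 0 \<le> \<Phi>t"
      then obtain e where e: "0 < e" "\<And>h. 0 < h \<Longrightarrow> t - h \<in> {t0 - R\<^sup>2..t0} \<Longrightarrow> h < e \<Longrightarrow> \<Phi> t x < \<Phi> (t - h) x"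
        using has_real_derivative_neg_dec_left[OF dt] by auto
      define h where "h = min (e / 2) (t - (t0 - R\<^sup>2))"
      have "0 < h" "h < e" "t - h \<in> {t0 - R\<^sup>2..t0}" using e(1) t' t by (auto simp: h_def)
      then show False using e(2)[of h] max[of "t - h" x] x by auto
    qed
    moreover have "\<Phi>xx \<le> 0"
    proof (rule local_max_second_derivative[where f = "\<Phi> t" and f' = \<Phi>x])
      show "0 < min (x - (x0 - R)) (x0 + R - x)" using x' by auto
      fix y assume y: "\<bar>y - x\<bar> < min (x - (x0 - R)) (x0 + R - x)"
      then have y': "y \<in> {x0 - R<..<x0 + R}" by (auto simp: abs_less_iff)
      show "\<Phi> t y \<le> \<Phi> t x" using max[OF t, of y] y' by auto
      show "(\<Phi> t has_real_derivative \<Phi>x y) (at y)"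
        unfolding \<Phi>_def[abs_def] \<Phi>x_def
        by (rule derivative_eq_intros dz vx[OF t y'] wx[OF t y'] refl)+ (simp add: power2_eq_square algebra_simps)
    next
      show "(\<Phi>x has_real_derivative \<Phi>xx) (at x)"
        unfolding \<Phi>x_def[abs_def] \<Phi>xx_def defs
        by (rule derivative_eq_intros dz dz1 vx[OF t x'] wx[OF t x'] wxx[OF t x'] refl)+
          (simp add: power2_eq_square algebra_simps)
    qed
    ultimately have ge: "0 \<le> \<Phi>t - \<Phi>xx" by simp
    have Z: "0 \<le> Z" "Z \<le> 1" "Z1\<^sup>2 \<le> 4 / R\<^sup>2" and S: "0 \<le> S" "S \<le> 1"
      using \<zeta>[OF x] s[OF t] by (auto simp: defs)
    \<comment> \<open>The terms with \<open>W2\<close> and with \<open>V * W1\<close> cancel by the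
      two heat equations. Completing the square absorbs the mixed term
      \<open>Z * Z1 * W * W1\<close>, raising the coefficient of \<open>S * Z1\<^sup>2\<close> from
      -2 to 6.\<close>
    have "\<Phi>t - \<Phi>xx = (Z\<^sup>2 / R\<^sup>2 + 6 * S * Z1\<^sup>2 + 4 * S * Z / R\<^sup>2 - 2 * A) * W\<^sup>2 - 2 * S * (Z * W1 + 2 * Z1 * W)\<^sup>2"
      unfolding \<Phi>t_def \<Phi>xx_def by (simp add: power2_eq_square algebra_simps)
    also have "\<dots> \<le> (Z\<^sup>2 / R\<^sup>2 + 6 * S * Z1\<^sup>2 + 4 * S * Z / R\<^sup>2 - 2 * A) * W\<^sup>2" using S by simp
    also have "\<dots> \<le> (1 / R\<^sup>2 + 24 / R\<^sup>2 + 4 / R\<^sup>2 - 2 * A) * W\<^sup>2"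
    proof -
      have "Z\<^sup>2 / R\<^sup>2 \<le> 1 / R\<^sup>2" using Z R2 by (intro divide_right_mono) (auto simp: power_le_one)
      moreover have "6 * S * Z1\<^sup>2 \<le> 6 * 1 * (4 / R\<^sup>2)" using Z S by (intro mult_mono) auto
      moreover have "4 * S * Z / R\<^sup>2 \<le> 4 * 1 * 1 / R\<^sup>2" using Z S R2 by (intro divide_right_mono mult_mono) auto
      ultimately show ?thesis by (intro mult_right_mono) auto
    qed
    also have "1 / R\<^sup>2 + 24 / R\<^sup>2 + 4 / R\<^sup>2 - 2 * A = - A" by (simp add: A_def)
    finally have "A * W\<^sup>2 \<le> 0" using ge by simp
    moreover have "0 < A" using R2 by (simp add: A_def)
    ultimately have "W = 0" by (simp add: mult_le_0_iff)
    then show ?thesis using Av by (simp add: \<Phi>_def defs)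
  qed
  moreover have "\<Phi> t0 x0 \<le> \<Phi> t x" using max R by auto
  moreover have "(w t0 x0)\<^sup>2 \<le> \<Phi> t0 x0" by (simp add: \<Phi>_def s_def \<zeta>_def A_def)
  ultimately have "(w t0 x0)\<^sup>2 \<le> A * M\<^sup>2" by linarith
  also have "\<dots> \<le> (6 * M / R)\<^sup>2"
    unfolding A_def by (simp add: power_divide power_mult_distrib divide_right_mono mult_right_mono)
  finally show ?thesis using M0 R by (simp add: abs_le_square_iff[symmetric])
qed

text \<open>A mean value inequality with a majorant in place of a constant. It suits majorants such
  as \<open>Af\<close>, whose derivative is infinite at the ends of the interval.\<close>

lemma increment_bound:
  fixes f H :: "real \<Rightarrow> real"
  assumes "a \<le> b" "continuous_on {a..b} f" "continuous_on {a..b} H"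
    and "\<And>x. a < x \<Longrightarrow> x < b \<Longrightarrow> (f has_real_derivative f' x) (at x)"
    and "\<And>x. a < x \<Longrightarrow> x < b \<Longrightarrow> (H has_real_derivative H' x) (at x)"
    and "\<And>x. a < x \<Longrightarrow> x < b \<Longrightarrow> \<bar>f' x\<bar> \<le> H' x"
  shows "\<bar>f b - f a\<bar> \<le> H b - H a"
proof -
  have "f b - H b \<le> f a - H a"
  proof (rule nonincreasing_within[OF assms(1), where f = "\<lambda>x. f x - H x"])
    fix x assume x: "a < x" "x < b"
    show "\<exists>l. ((\<lambda>x. f x - H x) has_real_derivative l) (at x) \<and> l \<le> 0"
      using assms(6)[OF x] DERIV_diff[OF assms(4)[OF x] assms(5)[OF x]] by (intro exI[of _ "f' x - H' x"]) auto
  qed (intro continuous_on_diff assms)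
  moreover have "- f b - H b \<le> - f a - H a"
  proof (rule nonincreasing_within[OF assms(1), where f = "\<lambda>x. - f x - H x"])
    fix x assume x: "a < x" "x < b"
    show "\<exists>l. ((\<lambda>x. - f x - H x) has_real_derivative l) (at x) \<and> l \<le> 0"
      using assms(6)[OF x] DERIV_diff[OF DERIV_minus[OF assms(4)[OF x]] assms(5)[OF x]]
      by (intro exI[of _ "- f' x - H' x"]) auto
  qed (intro continuous_on_diff continuous_on_minus assms)
  ultimately show ?thesis by linarith
qed

text \<open>The boundary layer enters through the weight \<open>d(x) powr (-1/4)\<close>, \<open>d\<close> the distance to the
  boundary; \<open>Af\<close> is an antiderivative of it, and the weight is square integrable.\<close>

definition Af :: "real \<Rightarrow> real \<Rightarrow> real \<Rightarrow> real" where
  "Af \<alpha> \<beta> x = \<alpha> * x + 4 / 3 * \<beta> * (x powr (3/4) - (2 * pi - x) powr (3/4))"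

lemma Af_deriv:
  assumes "0 < x" "x < 2 * pi"
  shows "(Af \<alpha> \<beta> has_real_derivative \<alpha> + \<beta> * (x powr (- 1/4) + (2 * pi - x) powr (- 1/4))) (at x)"
  unfolding Af_def[abs_def] using assms by (auto intro!: derivative_eq_intros simp: algebra_simps)

lemma Af_continuous: "continuous_on {0..2 * pi} (Af \<alpha> \<beta>)"
  unfolding Af_def[abs_def] by (intro continuous_intros continuous_on_powr') auto

text \<open>A primitive of a majorant of the squared derivative of \<open>Af\<close>; the factor 3
  comes from the inequality \<open>(a + b + c)\<^sup>2 \<le> 3 * (a\<^sup>2 + b\<^sup>2 +
  c\<^sup>2)\<close>.\<close>

definition Asq :: "real \<Rightarrow> real \<Rightarrow> real \<Rightarrow> real" where
  "Asq \<alpha> \<beta> x = 3 * (\<alpha>\<^sup>2 * x + \<beta>\<^sup>2 * (2 * sqrt x - 2 * sqrt (2 * pi - x)))"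

text \<open>Cauchy-Schwarz for the mean slope p, in the pointwise form
  \<open>2 * p * f - p\<^sup>2 \<le> f\<^sup>2\<close> with f the derivative of \<open>Af\<close>.
  Integrating through monotonicity avoids integrals of functions that are singular at the boundary.
  The right-hand side telescopes over the cells.\<close>

lemma Af_increment_square:
  assumes ab: "0 \<le> a" "a < b" "b \<le> 2 * pi"
  shows "(Af \<alpha> \<beta> b - Af \<alpha> \<beta> a)\<^sup>2 / (b - a) \<le> Asq \<alpha> \<beta> b - Asq \<alpha> \<beta> a"
proof -
  define p where "p = (Af \<alpha> \<beta> b - Af \<alpha> \<beta> a) / (b - a)"
  have "2 * p * Af \<alpha> \<beta> b - p\<^sup>2 * b - Asq \<alpha> \<beta> b \<le> 2 * p * Af \<alpha> \<beta> a - p\<^sup>2 * a - Asq \<alpha> \<beta> a"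
  proof (rule nonincreasing_within[where f = "\<lambda>x. 2 * p * Af \<alpha> \<beta> x - p\<^sup>2 * x - Asq \<alpha> \<beta> x"])
    have "continuous_on {a..b} (Af \<alpha> \<beta>)" using ab by (intro continuous_on_subset[OF Af_continuous]) auto
    then show "continuous_on {a..b} (\<lambda>x. 2 * p * Af \<alpha> \<beta> x - p\<^sup>2 * x - Asq \<alpha> \<beta> x)"
      unfolding Asq_def by (intro continuous_intros)
    fix x assume "a < x" "x < b"
    then have x: "0 < x" "x < 2 * pi" using ab by auto
    define u where "u = x powr (- 1/4)"
    define w where "w = (2 * pi - x) powr (- 1/4)"
    have sq: "(y powr (- 1/4))\<^sup>2 = inverse (sqrt y)" if "0 < y" for y :: real
    proof -
      have "(y powr (- 1/4))\<^sup>2 = y powr (- 1/4 + - 1/4)" unfolding power2_eq_square by (rule powr_add[symmetric])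
      also have "\<dots> = y powr (- (1/2))" by simp
      also have "\<dots> = inverse (sqrt y)" using that by (simp only: powr_minus powr_half_sqrt[OF less_imp_le])
      finally show ?thesis .
    qed
    have u2: "u\<^sup>2 = inverse (sqrt x)" "w\<^sup>2 = inverse (sqrt (2 * pi - x))"
      using x by (simp_all only: u_def w_def sq diff_gt_0_iff_gt)
    have 1: "(Asq \<alpha> \<beta> has_real_derivative 3 * (\<alpha>\<^sup>2 + \<beta>\<^sup>2 * (u\<^sup>2 + w\<^sup>2))) (at x)"
      unfolding Asq_def[abs_def] u2 using x by (auto intro!: derivative_eq_intros)
    have dH: "((\<lambda>x. 2 * p * Af \<alpha> \<beta> x - p\<^sup>2 * x - Asq \<alpha> \<beta> x) has_real_derivative
      2 * p * (\<alpha> + \<beta> * (u + w)) - p\<^sup>2 * 1 - 3 * (\<alpha>\<^sup>2 + \<beta>\<^sup>2 * (u\<^sup>2 + w\<^sup>2))) (at x)"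
      unfolding u_def w_def by (intro DERIV_diff DERIV_cmult Af_deriv x 1[unfolded u_def w_def] DERIV_ident)
    \<comment> \<open>The derivative is minus a sum of squares: one for p against the slope, three
      for the inequality between the square of a sum and three times the sum of squares.\<close>
    have eq: "2 * p * (\<alpha> + \<beta> * (u + w)) - p\<^sup>2 * 1 - 3 * (\<alpha>\<^sup>2 + \<beta>\<^sup>2 * (u\<^sup>2 + w\<^sup>2)) =
      - (p - (\<alpha> + \<beta> * (u + w)))\<^sup>2 - ((\<alpha> - \<beta> * u)\<^sup>2 + (\<alpha> - \<beta> * w)\<^sup>2 + (\<beta> * u - \<beta> * w)\<^sup>2)"
      by (simp add: power2_eq_square algebra_simps)
    have le: "- a\<^sup>2 - (b\<^sup>2 + c\<^sup>2 + d\<^sup>2) \<le> 0" for a b c d :: real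
      using zero_le_power2[of a] zero_le_power2[of b] zero_le_power2[of c] zero_le_power2[of d] by linarith
    show "\<exists>l. ((\<lambda>x. 2 * p * Af \<alpha> \<beta> x - p\<^sup>2 * x - Asq \<alpha> \<beta> x) has_real_derivative l) (at x) \<and> l \<le> 0"
      by (rule exI, rule conjI[OF dH], unfold eq, rule le)
  qed (use ab in simp)
  then have "2 * p * (Af \<alpha> \<beta> b - Af \<alpha> \<beta> a) - p\<^sup>2 * (b - a) \<le> Asq \<alpha> \<beta> b - Asq \<alpha> \<beta> a" by (simp add: algebra_simps)
  moreover have f2: "2 * (r / q) * r - (r / q)\<^sup>2 * q = r\<^sup>2 / q" if "0 < q" for r q :: real
    using that by (simp add: power2_eq_square)
  have "2 * p * (Af \<alpha> \<beta> b - Af \<alpha> \<beta> a) - p\<^sup>2 * (b - a) = (Af \<alpha> \<beta> b - Af \<alpha> \<beta> a)\<^sup>2 / (b - a)"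
    unfolding p_def by (rule f2) (use ab in simp)
  ultimately show ?thesis by (simp only:)
qed

lemma Asq_total: "Asq \<alpha> \<beta> (2 * pi) - Asq \<alpha> \<beta> 0 \<le> 36 * (\<alpha>\<^sup>2 + \<beta>\<^sup>2)"
proof -
  have "sqrt (2 * pi) \<le> sqrt 9" using pi_less_4 by (intro real_sqrt_le_mono) simp
  then have s: "sqrt (2 * pi) \<le> 3" by simp
  have "Asq \<alpha> \<beta> (2 * pi) - Asq \<alpha> \<beta> 0 = (6 * pi) * \<alpha>\<^sup>2 + (12 * sqrt (2 * pi)) * \<beta>\<^sup>2"
    by (simp add: Asq_def algebra_simps)
  also have "\<dots> \<le> 36 * \<alpha>\<^sup>2 + 36 * \<beta>\<^sup>2"
    using s pi_less_4 by (intro add_mono mult_right_mono) auto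
  finally show ?thesis by (simp add: algebra_simps)
qed

lemma moll_functional:
  assumes "0 < \<epsilon>" "continuous_on {0..2 * pi} f" "continuous_on {0..2 * pi} g"
  shows "moll p \<epsilon> i (\<lambda>x. f x - g x) x = moll p \<epsilon> i f x - moll p \<epsilon> i g x"
    and "moll p \<epsilon> i (\<lambda>x. c * f x) x = c * moll p \<epsilon> i f x"
proof -
  have cB: "continuous_on {0..2 * pi} (\<lambda>y. bump p i ((x - y) / \<epsilon>))" using assms(1) by (intro continuous_intros) auto
  have "integral {0..2 * pi} (\<lambda>y. (f y - g y) * bump p i ((x - y) / \<epsilon>)) =
     integral {0..2 * pi} (\<lambda>y. f y * bump p i ((x - y) / \<epsilon>)) - integral {0..2 * pi} (\<lambda>y. g y * bump p i ((x - y) / \<epsilon>))"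
    unfolding left_diff_distrib
    by (intro integral_diff integrable_continuous_real continuous_on_mult assms cB)
  then show "moll p \<epsilon> i (\<lambda>x. f x - g x) x = moll p \<epsilon> i f x - moll p \<epsilon> i g x"
    by (simp add: moll_def diff_divide_distrib)
  show "moll p \<epsilon> i (\<lambda>x. c * f x) x = c * moll p \<epsilon> i f x"
    by (simp add: moll_def mult.assoc)
qed

lemma moll_sup_bound:
  assumes "0 < \<epsilon>"
  shows "\<exists>C. \<forall>f S. continuous_on {0..2 * pi} f \<longrightarrow> (\<forall>y\<in>{0..2 * pi}. \<bar>f y\<bar> \<le> S) \<longrightarrow> \<bar>moll p \<epsilon> i f x\<bar> \<le> C * S"
proof -
  let ?B = "\<lambda>y. bump p i ((x - y) / \<epsilon>)"
  have cB: "continuous_on {0..2 * pi} ?B" using assms(1) by (intro continuous_intros) auto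
  obtain b where b: "\<And>y. y \<in> {0..2 * pi} \<Longrightarrow> \<bar>?B y\<bar> \<le> b"
  proof -
    have "bounded (?B ` {0..2 * pi})" by (intro compact_imp_bounded compact_continuous_image cB compact_Icc)
    then obtain b where "\<forall>z\<in>?B ` {0..2 * pi}. norm z \<le> b" unfolding bounded_iff by blast
    then show thesis using that[of b] by auto
  qed
  let ?c = "bump_mass p * \<epsilon> ^ Suc i"
  have c: "0 < ?c" using assms bump_mass_pos[of p] by simp
  have "\<bar>moll p \<epsilon> i f x\<bar> \<le> (b * (2 * pi) / ?c) * S"
    if f: "continuous_on {0..2 * pi} f" "\<forall>y\<in>{0..2 * pi}. \<bar>f y\<bar> \<le> S" for f S
  proof -
    have "norm (integral {0..2 * pi} (\<lambda>y. f y * ?B y)) \<le> (S * b) * (2 * pi - 0)"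
    proof (rule integral_bound)
      fix y assume y: "y \<in> {0..2 * pi}"
      then show "norm (f y * ?B y) \<le> S * b"
        using f(2) b[OF y] by (auto simp: abs_mult intro!: mult_mono intro: order_trans[OF abs_ge_zero])
    qed (use f cB in \<open>auto intro: continuous_on_mult\<close>)
    then show ?thesis unfolding moll_def using c by (simp add: abs_divide divide_right_mono mult_ac)
  qed
  then show ?thesis by blast
qed

section \<open>Interior estimates for the mollified solution\<close>

context heat_family
begin

text \<open>Mollified in x only, \<open>V\<close> is smooth enough for the gradient estimate to be
  applied to derivatives beyond order n + 1. The exponent n + 10 leaves more derivatives than two
  such applications consume.\<close>

definition V :: "real \<Rightarrow> nat \<Rightarrow> real \<Rightarrow> real \<Rightarrow> real" where
  "V \<epsilon> i t x = moll (n + 10) \<epsilon> i (D 0 t) x"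

lemma V_x: "0 < \<epsilon> \<Longrightarrow> i \<le> n + 8 \<Longrightarrow> t \<in> {0..T} \<Longrightarrow> (V \<epsilon> i t has_real_derivative V \<epsilon> (Suc i) t x) (at x)"
  unfolding V_def[abs_def] by (rule moll_deriv) (auto intro: D_cont)

lemma moll_shift:
  assumes "0 < \<epsilon>" "\<epsilon> \<le> x" "x \<le> 2 * pi - \<epsilon>" "t \<in> {0..T}" "i + j + 1 \<le> n + 10" "l + j \<le> n"
  shows "moll (n + 10) \<epsilon> (i + j) (D l t) x = moll (n + 10) \<epsilon> i (D (l + j) t) x"
  using assms(5,6)
proof (induction j arbitrary: l)
  case (Suc j)
  have "moll (n + 10) \<epsilon> (Suc (i + j)) (D l t) x = moll (n + 10) \<epsilon> (i + j) (D (Suc l) t) x"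
    using Suc.prems by (intro moll_parts assms(1-3) D_deriv D_cont assms(4)) auto
  then show ?case using Suc by simp
qed simp

text \<open>The time derivative falls on \<open>D 0\<close> and produces \<open>D 2\<close>, and
  both x-derivatives are then moved back to the kernel. Hence every \<open>V \<epsilon> i\<close>
  solves the heat equation away from the ends.\<close>

lemma V_t:
  assumes "0 < \<epsilon>" "\<epsilon> \<le> x" "x \<le> 2 * pi - \<epsilon>" "t \<in> {0..T}" "i \<le> n + 7"
  shows "((\<lambda>s. V \<epsilon> i s x) has_real_derivative V \<epsilon> (i + 2) t x) (at t within {0..T})"
proof -
  obtain C where C: "\<And>f S. continuous_on I f \<Longrightarrow> (\<And>y. y \<in> I \<Longrightarrow> \<bar>f y\<bar> \<le> S) \<Longrightarrow> \<bar>moll (n + 10) \<epsilon> i f x\<bar> \<le> C * S"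
    using moll_sup_bound[OF assms(1), of "n + 10" i x] by blast
  have "((\<lambda>s. moll (n + 10) \<epsilon> i (D 0 s) x) has_real_derivative moll (n + 10) \<epsilon> i (D (0 + 2) t) x) (at t within {0..T})"
    by (rule functional_time_derivative[OF assms(4)]) (use n C moll_functional[OF assms(1)] in auto)
  moreover have "moll (n + 10) \<epsilon> i (D (0 + 2) t) x = V \<epsilon> (i + 2) t x"
    unfolding V_def by (rule moll_shift[symmetric]) (use assms n in auto)
  ultimately show ?thesis by (simp add: V_def)
qed

lemma V_joint_cont:
  assumes "0 < \<epsilon>" shows "continuous_on ({0..T} \<times> UNIV) (\<lambda>z. V \<epsilon> i (fst z) (snd z))"
proof -
  let ?f = "\<lambda>z y. D 0 (fst z) y * bump (n + 10) i ((snd z - y) / \<epsilon>)"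
  have "continuous_on (({0..T} \<times> (UNIV :: real set)) \<times> cbox 0 (2 * pi)) (\<lambda>z. D 0 (fst (fst z)) (snd z))"
  proof -
    have c: "continuous_on (({0..T} \<times> (UNIV :: real set)) \<times> cbox 0 (2 * pi)) (\<lambda>z. (fst (fst z), snd z))"
      by (intro continuous_intros)
    have im: "(\<lambda>z. (fst (fst z), snd z)) ` (({0..T} \<times> (UNIV :: real set)) \<times> cbox 0 (2 * pi)) \<subseteq> {0..T} \<times> I" by auto
    show ?thesis using continuous_on_compose2[OF D_joint_cont[of 0] c im] by simp
  qed
  then have "continuous_on (({0..T} \<times> UNIV) \<times> cbox 0 (2 * pi)) (\<lambda>(z, y). ?f z y)"
    unfolding split_beta using assms by (intro continuous_intros) auto
  from integral_continuous_on_param[OF this]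
  have "continuous_on ({0..T} \<times> UNIV) (\<lambda>z. integral I (?f z))" by simp
  then show ?thesis
    unfolding V_def moll_def using assms bump_mass_pos[of "n + 10"] by (intro continuous_intros) auto
qed

lemma V_close:
  assumes "0 < \<epsilon>" "\<epsilon> \<le> x" "x \<le> 2 * pi - \<epsilon>" "t \<in> {0..T}"
  shows "\<bar>V \<epsilon> n t x - D n t x\<bar> \<le> M * \<epsilon>"
proof -
  have "V \<epsilon> n t x = moll (n + 10) \<epsilon> 0 (D n t) x"
    unfolding V_def using moll_shift[OF assms, of 0 n 0] by simp
  moreover have "\<bar>moll (n + 10) \<epsilon> 0 (D n t) x - D n t x\<bar> \<le> M * \<epsilon>"
  proof (rule moll_close[OF assms(1) _ assms(2,3) D_cont[OF assms(4)]])
    fix y assume y: "y \<in> I" "\<bar>y - x\<bar> \<le> \<epsilon>"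
    have "\<bar>D n t y - D n t x\<bar> \<le> M * \<bar>y - x\<bar>" using assms y by (intro D_lip) auto
    also have "\<dots> \<le> M * \<epsilon>" using y M_nonneg by (intro mult_left_mono) auto
    finally show "\<bar>D n t y - D n t x\<bar> \<le> M * \<epsilon>" .
  qed auto
  ultimately show ?thesis by simp
qed

lemma V_bernstein:
  assumes e: "0 < \<epsilon>" and R: "0 < R" "R\<^sup>2 \<le> t0" and t0: "t0 \<le> T" and x0: "\<epsilon> < x0 - R" "x0 + R < 2 * pi - \<epsilon>"
    and i: "i \<le> n + 5"
    and bnd: "\<And>t x. t \<in> {t0 - R\<^sup>2..t0} \<Longrightarrow> x \<in> {x0 - R..x0 + R} \<Longrightarrow> \<bar>V \<epsilon> i t x\<bar> \<le> M'"
  shows "\<bar>V \<epsilon> (Suc i) t0 x0\<bar> \<le> 6 * M' / R"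
proof (rule bernstein_gradient_estimate[where v = "V \<epsilon> i" and w = "V \<epsilon> (Suc i)" and ?t0.0 = t0 and ?x0.0 = x0 and ?w1.0 = "V \<epsilon> (i + 2)" and ?w2.0 = "V \<epsilon> (i + 3)"])
  have sub: "{t0 - R\<^sup>2..t0} \<subseteq> {0..T}" using R t0 by auto
  then have sub2: "{t0 - R\<^sup>2..t0} \<times> {x0 - R..x0 + R} \<subseteq> {0..T} \<times> UNIV" by auto
  show "continuous_on ({t0 - R\<^sup>2..t0} \<times> {x0 - R..x0 + R}) (\<lambda>z. V \<epsilon> i (fst z) (snd z))"
    "continuous_on ({t0 - R\<^sup>2..t0} \<times> {x0 - R..x0 + R}) (\<lambda>z. V \<epsilon> (Suc i) (fst z) (snd z))"
    by (rule continuous_on_subset[OF V_joint_cont[OF e] sub2])+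
  fix t x assume t: "t \<in> {t0 - R\<^sup>2..t0}" and x: "x \<in> {x0 - R<..<x0 + R}"
  have t': "t \<in> {0..T}" using t sub by auto
  show "(V \<epsilon> i t has_real_derivative V \<epsilon> (Suc i) t x) (at x)"
    using V_x[OF e _ t', of i] i by simp
  show "(V \<epsilon> (Suc i) t has_real_derivative V \<epsilon> (i + 2) t x) (at x)"
    using V_x[OF e _ t', of "Suc i"] i by simp
  show "(V \<epsilon> (i + 2) t has_real_derivative V \<epsilon> (i + 3) t x) (at x)"
    using V_x[OF e _ t', of "i + 2"] i by (simp add: numeral_3_eq_3)
  have xx: "\<epsilon> \<le> x" "x \<le> 2 * pi - \<epsilon>" using x x0 by auto
  show "((\<lambda>t. V \<epsilon> i t x) has_real_derivative V \<epsilon> (i + 2) t x) (at t within {t0 - R\<^sup>2..t0})"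
    using V_t[OF e xx t', of i] i by (intro has_field_derivative_subset[OF _ sub]) auto
  show "((\<lambda>t. V \<epsilon> (Suc i) t x) has_real_derivative V \<epsilon> (i + 3) t x) (at t within {t0 - R\<^sup>2..t0})"
    using V_t[OF e xx t', of "Suc i"] i by (intro has_field_derivative_subset[OF _ sub]) (auto simp: numeral_3_eq_3)
qed (use assms in auto)

lemma V_second:
  assumes e: "0 < \<epsilon>" and R: "0 < R" "R\<^sup>2 \<le> t0" and t0: "t0 \<le> T" and x0: "\<epsilon> < x0 - R" "x0 + R < 2 * pi - \<epsilon>"
  shows "\<bar>V \<epsilon> (n + 2) t0 x0\<bar> \<le> 6 * M / R"
proof -
  have "\<bar>V \<epsilon> (Suc (n + 1)) t0 x0\<bar> \<le> 6 * M / R"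
  proof (rule V_bernstein[OF assms])
    fix t x assume "t \<in> {t0 - R\<^sup>2..t0}" "x \<in> {x0 - R..x0 + R}"
    then show "\<bar>V \<epsilon> (n + 1) t x\<bar> \<le> M" unfolding V_def using e R t0 x0 by (intro moll_bound) auto
  qed auto
  then show ?thesis by simp
qed

text \<open>Two gradient estimates on cylinders of half the radius, the first being applied at every
  point of the cylinder of the second: 144 = (6 / (1/2)) squared.\<close>

lemma V_third:
  assumes e: "0 < \<epsilon>" and R: "0 < R" "R\<^sup>2 \<le> t0" and t0: "t0 \<le> T" and x0: "\<epsilon> < x0 - R" "x0 + R < 2 * pi - \<epsilon>"
  shows "\<bar>V \<epsilon> (n + 3) t0 x0\<bar> \<le> 144 * M / R\<^sup>2"
proof -
  have R4: "(R / 2)\<^sup>2 = R\<^sup>2 / 4" by (simp add: power_divide)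
  have R2: "0 < R / 2" "(R / 2)\<^sup>2 \<le> t0" using R zero_le_power2[of R] unfolding R4 by linarith+
  have "\<bar>V \<epsilon> (Suc (n + 2)) t0 x0\<bar> \<le> 6 * (6 * M / (R / 2)) / (R / 2)"
  proof (rule V_bernstein[OF e R2 t0])
    fix t x assume t: "t \<in> {t0 - (R / 2)\<^sup>2..t0}" and x: "x \<in> {x0 - R / 2..x0 + R / 2}"
    have "(R / 2)\<^sup>2 \<le> t" using t R by (auto simp: power_divide)
    then show "\<bar>V \<epsilon> (n + 2) t x\<bar> \<le> 6 * M / (R / 2)"
      using t x x0 t0 R by (intro V_second e) auto
  qed (use x0 R in auto)
  then show ?thesis using R by (simp add: power2_eq_square numeral_3_eq_3)
qed

lemma V_interior:
  assumes e: "0 < \<epsilon>" "\<epsilon> \<le> d / 3" and t: "0 < t" "t \<le> T" and d: "0 < d" "d \<le> x" "d \<le> 2 * pi - x"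
  shows "\<bar>V \<epsilon> (n + 2) t x\<bar> \<le> 6 * M * (1 / sqrt t + 3 / d)"
    "\<bar>V \<epsilon> (n + 3) t x\<bar> \<le> 144 * M * (1 / t + 9 / d\<^sup>2)"
proof -
  \<comment> \<open>The largest radius whose cylinder starts no earlier than time 0 and, with
    \<epsilon> at most d/3, keeps distance more than \<epsilon> from the boundary. The minimum is
    resolved by adding the two reciprocals.\<close>
  define R where "R = min (sqrt t) (d / 3)"
  have R: "0 < R" "R\<^sup>2 \<le> t" "R \<le> d / 3"
  proof -
    show "0 < R" "R \<le> d / 3" using t d by (auto simp: R_def)
    have "R\<^sup>2 \<le> (sqrt t)\<^sup>2" using \<open>0 < R\<close> by (intro power_mono) (auto simp: R_def)
    then show "R\<^sup>2 \<le> t" using t by simp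
  qed
  have x: "\<epsilon> < x - R" "x + R < 2 * pi - \<epsilon>" using R e d by auto
  have "1 / R \<le> 1 / sqrt t + 3 / d" using t d by (auto simp: R_def min_def)
  moreover have "1 / R\<^sup>2 \<le> 1 / t + 9 / d\<^sup>2" using t d by (auto simp: R_def min_def power_divide)
  moreover have "\<bar>V \<epsilon> (n + 2) t x\<bar> \<le> 6 * M * (1 / R)" "\<bar>V \<epsilon> (n + 3) t x\<bar> \<le> 144 * M * (1 / R\<^sup>2)"
    using V_second[OF e(1) R(1,2) t(2) x] V_third[OF e(1) R(1,2) t(2) x] by auto
  moreover have "6 * M * a \<le> 6 * M * b" "144 * M * a \<le> 144 * M * b" if "a \<le> b" for a b
    using that M_nonneg by (auto intro: mult_left_mono)
  ultimately show "\<bar>V \<epsilon> (n + 2) t x\<bar> \<le> 6 * M * (1 / sqrt t + 3 / d)"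
    "\<bar>V \<epsilon> (n + 3) t x\<bar> \<le> 144 * M * (1 / t + 9 / d\<^sup>2)"
    using order_trans by blast+
qed

text \<open>Lets \<epsilon> tend to 0 after values of \<open>D\<close> have been replaced by
  \<open>V\<close>, each at cost \<open>M * \<epsilon>\<close>; the factor 4 covers the four values
  in a mixed increment in t and x.\<close>

lemma V_limit:
  assumes "0 < e0" and "\<And>\<epsilon>. 0 < \<epsilon> \<Longrightarrow> \<epsilon> \<le> e0 \<Longrightarrow> a \<le> b + 4 * (M * \<epsilon>)"
  shows "a \<le> b"
proof (rule field_le_epsilon)
  fix e :: real assume e: "0 < e"
  define \<epsilon> where "\<epsilon> = min e0 (e / (4 * (M + 1)))"
  have "0 < \<epsilon>" "\<epsilon> \<le> e0" using e assms(1) M_nonneg by (auto simp: \<epsilon>_def)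
  then have "a \<le> b + 4 * (M * \<epsilon>)" by (rule assms(2))
  also have "M * \<epsilon> \<le> (M + 1) * (e / (4 * (M + 1)))"
    using M_nonneg \<open>0 < \<epsilon>\<close> by (intro mult_mono) (auto simp: \<epsilon>_def)
  also have "\<dots> = e / 4" using M_nonneg by (simp add: field_simps)
  finally show "a \<le> b + e" by simp
qed

lemma V_cont_time: "0 < \<epsilon> \<Longrightarrow> continuous_on {0..T} (\<lambda>s. V \<epsilon> i s x)"
proof -
  assume e: "0 < \<epsilon>"
  have c: "continuous_on {0..T} (\<lambda>s. (s, x))" by (intro continuous_intros)
  show ?thesis using continuous_on_compose2[OF V_joint_cont[OF e] c, of i] by auto
qed

lemma D_time_interior:
  assumes st: "0 \<le> s" "s \<le> t" "t \<le> T" and d: "0 < d" "d \<le> x" "d \<le> 2 * pi - x"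
  shows "\<bar>D n t x - D n s x\<bar> \<le> 6 * M * (2 * (sqrt t - sqrt s) + 3 * (t - s) / d)"
proof (rule V_limit)
  show "0 < d / 3" using d by simp
  fix \<epsilon> assume e: "0 < \<epsilon>" "\<epsilon> \<le> d / 3"
  have x: "\<epsilon> \<le> x" "x \<le> 2 * pi - \<epsilon>" using e d by auto
  have "\<bar>V \<epsilon> n t x - V \<epsilon> n s x\<bar> \<le> 6 * M * (2 * sqrt t + 3 * t / d) - 6 * M * (2 * sqrt s + 3 * s / d)"
  proof (rule increment_bound[OF st(2), where f = "\<lambda>t. V \<epsilon> n t x" and f' = "\<lambda>t. V \<epsilon> (n + 2) t x"
        and H' = "\<lambda>t. 6 * M * (1 / sqrt t + 3 / d)"])
    show "continuous_on {s..t} (\<lambda>t. V \<epsilon> n t x)"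
      using st by (intro continuous_on_subset[OF V_cont_time[OF e(1)]]) auto
    show "continuous_on {s..t} (\<lambda>t. 6 * M * (2 * sqrt t + 3 * t / d))" using d by (intro continuous_intros) auto
    fix \<sigma> assume \<sigma>: "s < \<sigma>" "\<sigma> < t"
    have "at \<sigma> within {0..T} = at \<sigma>" using \<sigma> st by (intro at_within_interior) auto
    then show "((\<lambda>t. V \<epsilon> n t x) has_real_derivative V \<epsilon> (n + 2) \<sigma> x) (at \<sigma>)"
      using V_t[OF e(1) x, of \<sigma> n] \<sigma> st by auto
    show "((\<lambda>t. 6 * M * (2 * sqrt t + 3 * t / d)) has_real_derivative 6 * M * (1 / sqrt \<sigma> + 3 / d)) (at \<sigma>)"
      using \<sigma> st d by (auto intro!: derivative_eq_intros simp: inverse_eq_divide)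
    show "\<bar>V \<epsilon> (n + 2) \<sigma> x\<bar> \<le> 6 * M * (1 / sqrt \<sigma> + 3 / d)"
      using \<sigma> st by (intro V_interior(1) e d) auto
  qed
  moreover have "6 * M * (2 * sqrt t + 3 * t / d) - 6 * M * (2 * sqrt s + 3 * s / d) =
      6 * M * (2 * (sqrt t - sqrt s) + 3 * (t - s) / d)" by (simp add: algebra_simps diff_divide_distrib)
  moreover have "\<bar>V \<epsilon> n t x - D n t x\<bar> \<le> M * \<epsilon>" "\<bar>V \<epsilon> n s x - D n s x\<bar> \<le> M * \<epsilon>" "0 \<le> M * \<epsilon>"
    using st M_nonneg e by (auto intro!: V_close e x)
  ultimately show "\<bar>D n t x - D n s x\<bar> \<le> 6 * M * (2 * (sqrt t - sqrt s) + 3 * (t - s) / d) + 4 * (M * \<epsilon>)"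
    by linarith
qed

lemma sqrt_diff_le:
  assumes "0 \<le> s" "s \<le> t" shows "sqrt t - sqrt s \<le> sqrt (t - s)"
  using sqrt_add_le_add_sqrt[of s "t - s"] assms by simp

text \<open>Parabolic scaling: x is moved inwards by r = sqrt (t - s). At the new point the interior
  bound is of order r, giving 30 M r, and the Lipschitz bound at the two times costs M r each, hence
  32.\<close>

lemma D_time_sqrt:
  assumes st: "0 \<le> s" "s \<le> t" "t \<le> T" and x: "x \<in> I"
  shows "\<bar>D n t x - D n s x\<bar> \<le> 32 * M * sqrt (t - s)"
proof -
  let ?r = "sqrt (t - s)"
  have t: "t \<in> {0..T}" "s \<in> {0..T}" using st by auto
  consider "s = t" | "s < t" "?r \<le> pi / 2" | "pi / 2 < ?r" using st by linarith
  then show ?thesis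
  proof cases
    case 1 then show ?thesis by simp
  next
    case 3
    have "\<bar>D n t x - D n s x\<bar> \<le> 2 * M * 1" using D_bound[OF t(1) le_refl x] D_bound[OF t(2) le_refl x] by linarith
    also have "\<dots> \<le> 32 * M * ?r"
    proof (intro mult_mono)
      show "1 \<le> ?r" using 3 pi_gt3 by linarith
    qed (use M_nonneg in auto)
    finally show ?thesis .
  next
    case 2
    define r where "r = ?r"
    have r: "0 < r" "r \<le> pi / 2" using 2 by (simp_all add: r_def)
    \<comment> \<open>Since r is at most pi/2, moving towards the far end keeps the point at
      distance at least r from both ends.\<close>
    define y where "y = (if x \<le> pi then x + r else x - r)"
    have y: "y \<in> I" "\<bar>y - x\<bar> = r" "r \<le> y" "r \<le> 2 * pi - y"
      using x r by (auto simp: y_def)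
    have "3 * (t - s) / r = 3 * ((t - s) / r)" by simp
    also have "(t - s) / r = r" using st by (simp add: r_def real_div_sqrt)
    finally have q: "3 * (t - s) / r = 3 * r" .
    have "\<bar>D n t y - D n s y\<bar> \<le> 6 * M * (2 * (sqrt t - sqrt s) + 3 * r)"
      using D_time_interior[OF st r(1) y(3,4)] unfolding q .
    also have "\<dots> \<le> 6 * M * (2 * r + 3 * r)"
      using sqrt_diff_le[OF st(1,2)] M_nonneg by (intro mult_left_mono add_mono) (auto simp: r_def)
    also have "\<dots> = 30 * (M * r)" by simp
    finally have "\<bar>D n t y - D n s y\<bar> \<le> 30 * (M * r)" .
    moreover have "\<bar>D n t y - D n t x\<bar> \<le> M * r" "\<bar>D n s y - D n s x\<bar> \<le> M * r"
      using D_lip[OF _ le_refl y(1) x] t y(2) by auto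
    ultimately show ?thesis unfolding r_def[symmetric] by linarith
  qed
qed

end

text \<open>\<open>min 1 z\<close> is at most any power of z with exponent in [0, 1]. Here z is
  \<tau> over the squared distance with exponent 1/8, or sqrt \<tau> over the distance with exponent
  1/4; both leave the same weight, distance to the power -1/4.\<close>

lemma weight_bound:
  assumes tau: "0 < \<tau>" and d: "0 < x" "x < 2 * pi"
  shows "min 1 (\<tau> / (min x (2 * pi - x))\<^sup>2) \<le> \<tau> powr (1/8) * (x powr (- 1/4) + (2 * pi - x) powr (- 1/4))"
    and "min (sqrt \<tau>) (\<tau> / min x (2 * pi - x)) \<le> \<tau> powr (5/8) * (x powr (- 1/4) + (2 * pi - x) powr (- 1/4))"
proof -
  define m where "m = min x (2 * pi - x)"
  have m: "0 < m" using d by (simp add: m_def)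
  have mle: "m powr (- 1/4) \<le> x powr (- 1/4) + (2 * pi - x) powr (- 1/4)"
    by (auto simp: m_def min_def)
  have mm: "m powr (- 1/4) = inverse (m powr (1/4))"
    using powr_minus[of m "1/4"] by (simp only: minus_divide_left)
  have 1: "\<tau> powr (1/8) * m powr (- 1/4) = (\<tau> / m\<^sup>2) powr (1/8)"
  proof -
    have "(\<tau> / m\<^sup>2) powr (1/8) = \<tau> powr (1/8) / (m powr 2) powr (1/8)"
      using tau m by (simp add: powr_divide)
    also have "(m powr 2) powr (1/8) = m powr (1/4)" using m by (simp only: powr_powr) simp
    finally have e: "(\<tau> / m\<^sup>2) powr (1/8) = \<tau> powr (1/8) / m powr (1/4)" .
    show ?thesis unfolding e mm by (rule divide_inverse[symmetric])
  qed
  have "min 1 (\<tau> / m\<^sup>2) \<le> (\<tau> / m\<^sup>2) powr (1/8)"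
  proof (cases "\<tau> / m\<^sup>2 \<le> 1")
    case True
    have "(\<tau> / m\<^sup>2) powr 1 \<le> (\<tau> / m\<^sup>2) powr (1/8)"
      by (rule powr_mono') (use True tau m in auto)
    then show ?thesis using tau m by simp
  next
    case False
    then have "1 \<le> (\<tau> / m\<^sup>2) powr (1/8)" by (intro ge_one_powr_ge_zero) auto
    then show ?thesis by linarith
  qed
  also have "\<dots> = \<tau> powr (1/8) * m powr (- 1/4)" by (rule 1[symmetric])
  also have "\<dots> \<le> \<tau> powr (1/8) * (x powr (- 1/4) + (2 * pi - x) powr (- 1/4))"
    using mle by (rule mult_left_mono) simp
  finally show "min 1 (\<tau> / (min x (2 * pi - x))\<^sup>2) \<le> \<tau> powr (1/8) * (x powr (- 1/4) + (2 * pi - x) powr (- 1/4))"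
    by (simp only: m_def)
  have sq: "sqrt \<tau> = \<tau> powr (1/2)" using tau by (simp add: powr_half_sqrt)
  have 2: "\<tau> powr (5/8) * m powr (- 1/4) = \<tau> powr (1/2) * (sqrt \<tau> / m) powr (1/4)"
  proof -
    have "(sqrt \<tau> / m) powr (1/4) = (\<tau> powr (1/2)) powr (1/4) / m powr (1/4)"
      using tau m by (simp add: powr_divide sq)
    also have "(\<tau> powr (1/2)) powr (1/4) = \<tau> powr (1/8)" by (simp only: powr_powr) simp
    finally have "\<tau> powr (1/2) * (sqrt \<tau> / m) powr (1/4) = (\<tau> powr (1/2) * \<tau> powr (1/8)) / m powr (1/4)" by simp
    also have "\<tau> powr (1/2) * \<tau> powr (1/8) = \<tau> powr (1/2 + 1/8)" by (rule powr_add[symmetric])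
    also have "(1/2 + 1/8 :: real) = 5/8" by simp
    finally have e: "\<tau> powr (1/2) * (sqrt \<tau> / m) powr (1/4) = \<tau> powr (5/8) / m powr (1/4)" .
    show ?thesis unfolding e mm by (rule divide_inverse[symmetric])
  qed
  have "min (sqrt \<tau>) (\<tau> / m) = \<tau> powr (1/2) * min 1 (sqrt \<tau> / m)"
  proof -
    have "\<tau> / m = sqrt \<tau> * (sqrt \<tau> / m)" using tau by simp
    then have "min (sqrt \<tau>) (\<tau> / m) = sqrt \<tau> * min 1 (sqrt \<tau> / m)" using tau by (simp add: min_mult_distrib_left)
    then show ?thesis by (simp add: sq)
  qed
  also have "\<dots> \<le> \<tau> powr (1/2) * (sqrt \<tau> / m) powr (1/4)"
  proof (intro mult_left_mono)
    show "min 1 (sqrt \<tau> / m) \<le> (sqrt \<tau> / m) powr (1/4)"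
    proof (cases "sqrt \<tau> / m \<le> 1")
      case True
      have "(sqrt \<tau> / m) powr 1 \<le> (sqrt \<tau> / m) powr (1/4)"
        by (rule powr_mono') (use True tau m in auto)
      then show ?thesis using tau m by simp
    next
      case False
      then have "1 \<le> (sqrt \<tau> / m) powr (1/4)" by (intro ge_one_powr_ge_zero) auto
      then show ?thesis by linarith
    qed
  qed simp
  also have "\<dots> = \<tau> powr (5/8) * m powr (- 1/4)" by (rule 2[symmetric])
  also have "\<dots> \<le> \<tau> powr (5/8) * (x powr (- 1/4) + (2 * pi - x) powr (- 1/4))"
    using mle by (rule mult_left_mono) simp
  finally show "min (sqrt \<tau>) (\<tau> / min x (2 * pi - x)) \<le> \<tau> powr (5/8) * (x powr (- 1/4) + (2 * pi - x) powr (- 1/4))"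
    by (simp only: m_def)
qed

text \<open>Both points are pulled towards the midpoint with the same weight, which preserves their
  order and brings them into the open interval; the limit follows by continuity.\<close>

lemma increment_le_closure:
  fixes F G :: "real \<Rightarrow> real"
  assumes "a < b" "continuous_on {a..b} F" "continuous_on {a..b} G"
    and le: "\<And>x y. a < y \<Longrightarrow> y \<le> x \<Longrightarrow> x < b \<Longrightarrow> \<bar>F x - F y\<bar> \<le> G x - G y"
    and xy: "a \<le> y" "y \<le> x" "x \<le> b"
  shows "\<bar>F x - F y\<bar> \<le> G x - G y"
proof -
  define c where "c = (a + b) / 2"
  define q where "q z j = z + (c - z) * inverse (real (Suc (Suc j)))" for z j
  have q: "q z \<longlonglongrightarrow> z" "\<And>j. a < q z j \<and> q z j < b" if z: "a \<le> z" "z \<le> b" for z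
  proof -
    have "(\<lambda>j. inverse (real (Suc (Suc j)))) \<longlonglongrightarrow> 0" using LIMSEQ_Suc[OF LIMSEQ_inverse_real_of_nat] .
    then have "q z \<longlonglongrightarrow> z + (c - z) * 0" unfolding q_def by (intro tendsto_intros)
    then show "q z \<longlonglongrightarrow> z" by simp
    fix j
    define r where "r = inverse (real (Suc (Suc j)))"
    have r: "0 < r" "r < 1" by (auto simp: r_def inverse_less_1_iff)
    have e: "q z j = (1 - r) * z + r * c" by (simp add: q_def r_def algebra_simps)
    have c: "a < c" "c < b" using assms(1) by (auto simp: c_def)
    have "(1 - r) * a + r * a < (1 - r) * z + r * c"
      using r z c by (intro add_le_less_mono mult_left_mono mult_strict_left_mono) auto
    moreover have "(1 - r) * z + r * c < (1 - r) * b + r * b"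
      using r z c by (intro add_le_less_mono mult_left_mono mult_strict_left_mono) auto
    ultimately show "a < q z j \<and> q z j < b" unfolding e by (simp add: algebra_simps)
  qed
  have qm: "q y j \<le> q x j" for j
  proof -
    have "(1 - r) * y + r * c \<le> (1 - r) * x + r * c" if "r \<le> 1" for r using xy that by (simp add: mult_left_mono)
    moreover have "q z j = (1 - inverse (real (Suc (Suc j)))) * z + inverse (real (Suc (Suc j))) * c" for z
      by (simp add: q_def algebra_simps)
    ultimately show ?thesis by (simp add: inverse_le_1_iff)
  qed
  have lim: "(\<lambda>j. H (q z j)) \<longlonglongrightarrow> H z" if "continuous_on {a..b} H" "a \<le> z" "z \<le> b" for H :: "real \<Rightarrow> real" and z
    by (rule continuous_on_tendsto_compose[OF that(1) q(1)[OF that(2,3)]])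
      (use q(2)[OF that(2,3)] that in \<open>auto intro!: always_eventually less_imp_le\<close>)
  have x: "a \<le> x" and y: "y \<le> b" using xy by auto
  show ?thesis
  proof (rule LIMSEQ_le)
    show "(\<lambda>j. \<bar>F (q x j) - F (q y j)\<bar>) \<longlonglongrightarrow> \<bar>F x - F y\<bar>"
      by (intro tendsto_intros lim assms(2) x y xy)
    show "(\<lambda>j. G (q x j) - G (q y j)) \<longlonglongrightarrow> G x - G y"
      by (intro tendsto_intros lim assms(3) x y xy)
    show "\<exists>N. \<forall>j\<ge>N. \<bar>F (q x j) - F (q y j)\<bar> \<le> G (q x j) - G (q y j)"
      using le[OF _ qm] q(2)[OF x xy(3)] q(2)[OF xy(1) y] by blast
  qed
qed

section \<open>Increments in time, measured with the boundary weight\<close>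

context heat_family
begin

text \<open>Order n - 1 is the one that the primitive B depends on. This modulus has no singularity
  at s = 0 and suffices for the bound on u.\<close>

lemma D_pred_sqrt:
  assumes st: "0 \<le> s" "s \<le> t" "t \<le> T" and xy: "0 \<le> y" "y \<le> x" "x \<le> 2 * pi"
  shows "\<bar>(D (n - 1) t x - D (n - 1) s x) - (D (n - 1) t y - D (n - 1) s y)\<bar> \<le>
    Af (32 * M * sqrt (t - s)) 0 x - Af (32 * M * sqrt (t - s)) 0 y"
proof -
  have t: "t \<in> {0..T}" "s \<in> {0..T}" using st by auto
  have n1: "Suc (n - 1) = n" "n - 1 < n" using n by auto
  have "((\<lambda>x. D (n - 1) t x - D (n - 1) s x) has_real_derivative D n t z - D n s z) (at z within I)" if "z \<in> I" for z
    using D_deriv[OF t(1) n1(2) that] D_deriv[OF t(2) n1(2) that] unfolding n1(1) by (rule DERIV_diff)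
  from MVT_within[OF this, of y x]
  obtain z where z: "z \<in> {min y x..max y x}" "(D (n - 1) t x - D (n - 1) s x) - (D (n - 1) t y - D (n - 1) s y) = (x - y) * (D n t z - D n s z)"
    using xy by auto
  have "\<bar>D n t z - D n s z\<bar> \<le> 32 * M * sqrt (t - s)" using z(1) xy by (intro D_time_sqrt st) auto
  then have "(x - y) * \<bar>D n t z - D n s z\<bar> \<le> (x - y) * (32 * M * sqrt (t - s))"
    using xy by (intro mult_left_mono) auto
  also have "\<dots> = Af (32 * M * sqrt (t - s)) 0 x - Af (32 * M * sqrt (t - s)) 0 y"
    by (simp add: Af_def algebra_simps)
  finally show ?thesis unfolding z(2) using xy by (simp add: abs_mult)
qed

lemma sqrt_diff_le_div:
  assumes "0 < s" "s \<le> t" shows "2 * (sqrt t - sqrt s) \<le> (t - s) / sqrt s * 2"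
proof -
  have "(sqrt t - sqrt s) * sqrt s \<le> (sqrt t - sqrt s) * (sqrt t + sqrt s)"
    using assms by (intro mult_left_mono) auto
  also have "\<dots> = t - s" using assms by (simp add: algebra_simps)
  finally have "sqrt t - sqrt s \<le> (t - s) / sqrt s"
    using assms by (simp only: pos_le_divide_eq real_sqrt_gt_0_iff)
  then have "2 * (sqrt t - sqrt s) \<le> 2 * ((t - s) / sqrt s)" by (rule mult_left_mono) simp
  then show ?thesis by (simp only: mult.commute)
qed

text \<open>In the interior bound the part \<open>sqrt t - sqrt s\<close> does not depend on the
  distance to the boundary and becomes the constant slope. The part (t-s)/d is first capped by
  \<open>D_time_sqrt\<close> and then converted into the weight.\<close>

lemma D_pred_increment:
  assumes st: "0 < s" "s < t" "t \<le> T" and xy: "0 \<le> y" "y \<le> x" "x \<le> 2 * pi"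
  shows "\<bar>(D (n - 1) t x - D (n - 1) s x) - (D (n - 1) t y - D (n - 1) s y)\<bar> \<le>
    Af (32 * M * ((t - s) / sqrt s)) (32 * M * (t - s) powr (5/8)) x -
    Af (32 * M * ((t - s) / sqrt s)) (32 * M * (t - s) powr (5/8)) y"
proof (rule increment_bound[OF xy(2), where f = "\<lambda>x. D (n - 1) t x - D (n - 1) s x" and f' = "\<lambda>x. D n t x - D n s x"])
  have t: "t \<in> {0..T}" "s \<in> {0..T}" using st by auto
  have n1: "Suc (n - 1) = n" "n - 1 < n" "n - 1 \<le> n" using n by auto
  have sub: "{y..x} \<subseteq> I" using xy by auto
  show "continuous_on {y..x} (\<lambda>x. D (n - 1) t x - D (n - 1) s x)"
    by (intro continuous_on_diff continuous_on_subset[OF D_cont sub] t n1)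
  show "continuous_on {y..x} (Af (32 * M * ((t - s) / sqrt s)) (32 * M * (t - s) powr (5/8)))"
    by (rule continuous_on_subset[OF Af_continuous sub])
  fix z assume "y < z" "z < x"
  then have z: "0 < z" "z < 2 * pi" "z \<in> I" using xy by auto
  have at: "at z within I = at z" using z by (intro at_within_interior) auto
  show "((\<lambda>x. D (n - 1) t x - D (n - 1) s x) has_real_derivative D n t z - D n s z) (at z)"
    using D_deriv[OF t(1) n1(2) z(3)] D_deriv[OF t(2) n1(2) z(3)] unfolding n1(1) at by (rule DERIV_diff)
  let ?w = "z powr (- 1/4) + (2 * pi - z) powr (- 1/4)"
  show "(Af (32 * M * ((t - s) / sqrt s)) (32 * M * (t - s) powr (5/8)) has_real_derivative
    32 * M * ((t - s) / sqrt s) + 32 * M * (t - s) powr (5/8) * ?w) (at z)"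
    by (rule Af_deriv[OF z(1,2)])
  define m where "m = min z (2 * pi - z)"
  have m: "0 < m" "m \<le> z" "m \<le> 2 * pi - z" using z by (auto simp: m_def)
  define \<tau> where "\<tau> = t - s"
  have tau: "0 < \<tau>" using st by (simp add: \<tau>_def)
  have a: "\<bar>D n t z - D n s z\<bar> \<le> 32 * M * sqrt \<tau>" unfolding \<tau>_def using st z by (intro D_time_sqrt) auto
  have "\<bar>D n t z - D n s z\<bar> \<le> 6 * M * (2 * (sqrt t - sqrt s) + 3 * (t - s) / m)"
    using st by (intro D_time_interior m) auto
  also have "\<dots> \<le> 6 * M * (\<tau> / sqrt s * 2 + 3 * (\<tau> / m))"
    using sqrt_diff_le_div[of s t] st M_nonneg by (intro mult_left_mono add_mono) (auto simp: \<tau>_def)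
  also have "\<dots> = 12 * (M * (\<tau> / sqrt s)) + 18 * (M * (\<tau> / m))" by (simp add: algebra_simps)
  finally have b: "\<bar>D n t z - D n s z\<bar> \<le> 12 * (M * (\<tau> / sqrt s)) + 18 * (M * (\<tau> / m))" .
  have nn: "0 \<le> M * (\<tau> / sqrt s)" using M_nonneg tau st by simp
  have "\<bar>D n t z - D n s z\<bar> \<le> 32 * (M * (\<tau> / sqrt s)) + 32 * (M * min (sqrt \<tau>) (\<tau> / m))"
  proof (cases "sqrt \<tau> \<le> \<tau> / m")
    case True
    then show ?thesis using a nn by (simp add: min_absorb1)
  next
    case False
    moreover have "0 \<le> M * (\<tau> / m)" using M_nonneg tau m by simp
    ultimately show ?thesis using b nn by (simp add: min_absorb2)
  qed
  also have "\<dots> \<le> 32 * (M * (\<tau> / sqrt s)) + 32 * (M * (\<tau> powr (5/8) * ?w))"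
    using weight_bound(2)[OF tau z(1,2)] M_nonneg unfolding m_def
    by (intro add_left_mono mult_left_mono) auto
  finally show "\<bar>D n t z - D n s z\<bar> \<le> 32 * M * ((t - s) / sqrt s) + 32 * M * (t - s) powr (5/8) * ?w"
    by (simp add: \<tau>_def mult.assoc)
qed

text \<open>The slope in x is the derivative of order n + 1, available only after mollification. It
  is capped by 2M, while integrating the interior bound for order n + 3 in time gives 144 M (t-s)
  (1/s + 9/d^2), and 1296 = 144 times 9. The cap and this bound are combined into the weight, and
  \<epsilon> tends to 0 for fixed interior points.\<close>

lemma D_increment:
  assumes st: "0 < s" "s < t" "t \<le> T" and xy: "0 \<le> y" "y \<le> x" "x \<le> 2 * pi"
  shows "\<bar>(D n t x - D n s x) - (D n t y - D n s y)\<bar> \<le>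
    Af (1296 * M * ((t - s) / s)) (1296 * M * (t - s) powr (1/8)) x -
    Af (1296 * M * ((t - s) / s)) (1296 * M * (t - s) powr (1/8)) y"
proof (rule increment_le_closure[where a = 0 and b = "2 * pi" and F = "\<lambda>x. D n t x - D n s x"])
  let ?A = "Af (1296 * M * ((t - s) / s)) (1296 * M * (t - s) powr (1/8))"
  have t: "t \<in> {0..T}" "s \<in> {0..T}" using st by auto
  show "continuous_on I (\<lambda>x. D n t x - D n s x)" by (intro continuous_on_diff D_cont t order_refl)
  show "continuous_on I ?A" by (rule Af_continuous)
  fix x y :: real assume xy: "0 < y" "y \<le> x" "x < 2 * pi"
  show "\<bar>(D n t x - D n s x) - (D n t y - D n s y)\<bar> \<le> ?A x - ?A y"
  proof (rule V_limit)
    define a where "a = min y (2 * pi - x)"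
    show "0 < a / 3" using xy by (simp add: a_def)
    fix \<epsilon> assume e: "0 < \<epsilon>" "\<epsilon> \<le> a / 3"
    have a: "0 < a" "a \<le> y" "a \<le> 2 * pi - x" using xy by (auto simp: a_def)
    define \<tau> where "\<tau> = t - s"
    have tau: "0 < \<tau>" using st by (simp add: \<tau>_def)
    have "\<bar>(V \<epsilon> n t x - V \<epsilon> n s x) - (V \<epsilon> n t y - V \<epsilon> n s y)\<bar> \<le> ?A x - ?A y"
    proof (rule increment_bound[OF xy(2), where f = "\<lambda>x. V \<epsilon> n t x - V \<epsilon> n s x" and f' = "\<lambda>x. V \<epsilon> (Suc n) t x - V \<epsilon> (Suc n) s x"])
      show "continuous_on {y..x} (\<lambda>x. V \<epsilon> n t x - V \<epsilon> n s x)"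
        using V_x[OF e(1) _ t(1), of n] V_x[OF e(1) _ t(2), of n]
        by (intro continuous_on_diff continuous_at_imp_continuous_on ballI) (auto intro: DERIV_isCont)
      show "continuous_on {y..x} ?A" using xy by (intro continuous_on_subset[OF Af_continuous]) auto
      fix z assume yz: "y < z" "z < x"
      then have z: "0 < z" "z < 2 * pi" using xy by auto
      show "((\<lambda>x. V \<epsilon> n t x - V \<epsilon> n s x) has_real_derivative V \<epsilon> (Suc n) t z - V \<epsilon> (Suc n) s z) (at z)"
        by (intro DERIV_diff V_x e t) auto
      let ?w = "z powr (- 1/4) + (2 * pi - z) powr (- 1/4)"
      show "(?A has_real_derivative 1296 * M * ((t - s) / s) + 1296 * M * (t - s) powr (1/8) * ?w) (at z)"
        by (rule Af_deriv[OF z])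
      define m where "m = min z (2 * pi - z)"
      have m: "0 < m" "m \<le> z" "m \<le> 2 * pi - z" "a \<le> m" using z a yz by (auto simp: m_def)
      have e': "\<epsilon> \<le> m / 3" using e m by simp
      have zz: "\<epsilon> < z" "z < 2 * pi - \<epsilon>" using e' m e by auto
      have p: "\<bar>V \<epsilon> (Suc n) t z - V \<epsilon> (Suc n) s z\<bar> \<le> 2 * M"
      proof -
        have "\<bar>V \<epsilon> (Suc n) t z\<bar> \<le> M" "\<bar>V \<epsilon> (Suc n) s z\<bar> \<le> M"
          unfolding V_def by (intro moll_bound t e zz; simp)+
        then show ?thesis by linarith
      qed
      have "\<bar>V \<epsilon> (Suc n) t z - V \<epsilon> (Suc n) s z\<bar> \<le> 144 * M * (1 / s + 9 / m\<^sup>2) * t - 144 * M * (1 / s + 9 / m\<^sup>2) * s"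
      proof (rule increment_bound[where f = "\<lambda>t. V \<epsilon> (Suc n) t z" and f' = "\<lambda>t. V \<epsilon> (n + 3) t z"])
        show "continuous_on {s..t} (\<lambda>t. V \<epsilon> (Suc n) t z)"
          using st by (intro continuous_on_subset[OF V_cont_time[OF e(1)]]) auto
        fix \<sigma> assume \<sigma>: "s < \<sigma>" "\<sigma> < t"
        have "at \<sigma> within {0..T} = at \<sigma>" using \<sigma> st by (intro at_within_interior) auto
        then show "((\<lambda>t. V \<epsilon> (Suc n) t z) has_real_derivative V \<epsilon> (n + 3) \<sigma> z) (at \<sigma>)"
          using V_t[OF e(1), of z \<sigma> "Suc n"] zz \<sigma> st by (auto simp: numeral_3_eq_3)
        show "((\<lambda>t. 144 * M * (1 / s + 9 / m\<^sup>2) * t) has_real_derivative 144 * M * (1 / s + 9 / m\<^sup>2)) (at \<sigma>)"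
          by (auto intro!: derivative_eq_intros)
        have "\<bar>V \<epsilon> (n + 3) \<sigma> z\<bar> \<le> 144 * M * (1 / \<sigma> + 9 / m\<^sup>2)"
          using \<sigma> st by (intro V_interior(2) e(1) e' m) auto
        also have "\<dots> \<le> 144 * M * (1 / s + 9 / m\<^sup>2)"
          using \<sigma> st M_nonneg by (intro mult_left_mono add_right_mono divide_left_mono) auto
        finally show "\<bar>V \<epsilon> (n + 3) \<sigma> z\<bar> \<le> 144 * M * (1 / s + 9 / m\<^sup>2)" .
      qed (use st in \<open>auto intro!: continuous_intros\<close>)
      also have "\<dots> = 144 * (M * (\<tau> / s)) + 1296 * (M * (\<tau> / m\<^sup>2))"
        by (simp add: \<tau>_def algebra_simps diff_divide_distrib)
      finally have q: "\<bar>V \<epsilon> (Suc n) t z - V \<epsilon> (Suc n) s z\<bar> \<le> 144 * (M * (\<tau> / s)) + 1296 * (M * (\<tau> / m\<^sup>2))" .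
      have nn: "0 \<le> M * (\<tau> / s)" using M_nonneg tau st by simp
      have "\<bar>V \<epsilon> (Suc n) t z - V \<epsilon> (Suc n) s z\<bar> \<le> 1296 * (M * (\<tau> / s)) + 1296 * (M * min 1 (\<tau> / m\<^sup>2))"
      proof (cases "1 \<le> \<tau> / m\<^sup>2")
        case True
        then show ?thesis using p nn M_nonneg by (simp add: min_absorb1)
      next
        case False
        then show ?thesis using q nn by (simp add: min_absorb2)
      qed
      also have "\<dots> \<le> 1296 * (M * (\<tau> / s)) + 1296 * (M * (\<tau> powr (1/8) * ?w))"
        using weight_bound(1)[OF tau z] M_nonneg unfolding m_def
        by (intro add_left_mono mult_left_mono) auto
      finally show "\<bar>V \<epsilon> (Suc n) t z - V \<epsilon> (Suc n) s z\<bar> \<le> 1296 * M * ((t - s) / s) + 1296 * M * (t - s) powr (1/8) * ?w"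
        by (simp add: \<tau>_def mult.assoc)
    qed
    moreover have "\<bar>V \<epsilon> n t' x' - D n t' x'\<bar> \<le> M * \<epsilon>" if "t' \<in> {0..T}" "x' \<in> {y..x}" for t' x'
      using that a e by (intro V_close e) auto
    from this[OF t(1), of x] this[OF t(2), of x] this[OF t(1), of y] this[OF t(2), of y]
    have "\<bar>V \<epsilon> n t x - D n t x\<bar> \<le> M * \<epsilon>" "\<bar>V \<epsilon> n s x - D n s x\<bar> \<le> M * \<epsilon>"
      "\<bar>V \<epsilon> n t y - D n t y\<bar> \<le> M * \<epsilon>" "\<bar>V \<epsilon> n s y - D n s y\<bar> \<le> M * \<epsilon>" using xy by auto
    ultimately show "\<bar>(D n t x - D n s x) - (D n t y - D n s y)\<bar> \<le> ?A x - ?A y + 4 * (M * \<epsilon>)" by linarith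
  qed
qed (use xy pi_gt_zero in auto)

end

section \<open>The discrete operator\<close>

text \<open>The prescribed data cancel in the difference between the exact and the discrete
  solution, so the exterior traces of the errors are zero or periodic.\<close>

fun hom_bc :: "bc \<Rightarrow> bc" where
  "hom_bc Periodic = Periodic"
| "hom_bc (Mixed g0 g1) = Mixed (\<lambda>_. 0) (\<lambda>_. 0)"

lemma qhat_eq_uhat: "qhat fl = uhat (opp fl)"
  by (cases fl) auto

lemma uhat_linear:
  "uhat e N X (hom_bc b) t (\<lambda>j. \<Sum>i\<in>A. smult (x i) (U i j)) i0 = (\<Sum>i\<in>A. x i * uhat e N X (hom_bc b) t (U i) i0)"
  by (cases e; cases b) (auto simp: trace_minus_def trace_plus_def poly_sum)

lemma uhat_interior:
  "1 \<le> i \<Longrightarrow> uhat FluxI N X b t v i = poly (v i) (X i)"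
  "i < N \<Longrightarrow> uhat FluxII N X b t v i = poly (v (Suc i)) (X i)"
  by (auto simp: trace_minus_def trace_plus_def)

text \<open>The right-hand side shared by both equations of the scheme, with homogeneous data. The
  time 0 is a dummy, as homogeneous traces do not depend on it.\<close>

definition dform :: "nat \<Rightarrow> (nat \<Rightarrow> real) \<Rightarrow> bc \<Rightarrow> flux \<Rightarrow> (nat \<Rightarrow> real poly) \<Rightarrow> nat \<Rightarrow> real poly \<Rightarrow> real" where
  "dform N X b e p j w = - ip X j (poly (p j)) (poly (pderiv w))
     + uhat e N X (hom_bc b) 0 p j * poly w (X j) - uhat e N X (hom_bc b) 0 p (j - 1) * poly w (X (j - 1))"

lemma sum_L2_square: "finite A \<Longrightarrow> (L2_set f A)\<^sup>2 = (\<Sum>i\<in>A. (f i)\<^sup>2)"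
  by (simp add: L2_set_def sum_nonneg)

lemma sum_telescope_1: "(\<Sum>j=1..n. f j - f (j - 1)) = (f n - f 0 :: real)" for n :: nat
  by (induction n) auto

locale dg_mesh =
  fixes k N :: nat and X :: "nat \<Rightarrow> real" and c :: real
  assumes k: "1 \<le> k" and mesh: "quasi_uniform_mesh c N X"
begin

abbreviation "h \<equiv> mesh_size N X"

lemma N1: "1 \<le> N" and X0: "X 0 = 0" and XN: "X N = 2 * pi" and X_Suc: "i < N \<Longrightarrow> X i < X (Suc i)"
  and quasi: "j \<in> {1..N} \<Longrightarrow> h \<le> c * hlen X j"
  using mesh by (auto simp: quasi_uniform_mesh_def)

lemma lt: "j \<in> {1..N} \<Longrightarrow> X (j - 1) < X j"
  using X_Suc[of "j - 1"] by auto

lemma mc: "j \<in> {1..N} \<Longrightarrow> mesh_cell k X j"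
  by (intro mesh_cell.intro k lt)

lemma X_mono: "i \<le> i' \<Longrightarrow> i' \<le> N \<Longrightarrow> X i \<le> X i'"
proof (induction i' rule: dec_induct)
  case (step n)
  then show ?case using X_Suc[of n] by simp
qed simp

lemma X_in: "i \<le> N \<Longrightarrow> X i \<in> {0..2 * pi}"
  using X_mono[of 0 i] X_mono[of i N] by (simp add: X0 XN)

lemma cell_sub: "j \<in> {1..N} \<Longrightarrow> cell X j \<subseteq> {0..2 * pi}"
  using X_in[of "j - 1"] X_in[of j] by (auto simp: cell_def)

lemma hlen_pos: "j \<in> {1..N} \<Longrightarrow> 0 < hlen X j"
  using lt by (simp add: hlen_def)

lemma hlen_le: "j \<in> {1..N} \<Longrightarrow> hlen X j \<le> h"
  unfolding mesh_size_def by (intro Max_ge) auto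

lemma h_pos: "0 < h"
  using hlen_pos[of 1] hlen_le[of 1] N1 by simp

lemma c_pos: "0 < c"
proof -
  have "0 < c * hlen X 1" using quasi[of 1] h_pos N1 by simp
  then show ?thesis using hlen_pos[of 1] N1 by (simp add: zero_less_mult_iff)
qed

lemma inverse_hlen: "j \<in> {1..N} \<Longrightarrow> 1 / hlen X j \<le> c / h"
  using quasi[of j] hlen_pos[of j] h_pos by (simp add: field_simps)

lemma hlen_sum: "(\<Sum>j=1..N. hlen X j) = 2 * pi"
proof -
  have "(\<Sum>j=1..N. X j - X (j - 1)) = X N - X 0" by (rule sum_telescope_1)
  then show ?thesis by (simp add: hlen_def X0 XN)
qed

lemma Nh_ge: "1 / real (N + 1) \<le> h / (2 * pi)"
proof -
  have "(\<Sum>j=1..N. hlen X j) \<le> (\<Sum>j=1..N. h)" by (intro sum_mono hlen_le)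
  then have "2 * pi \<le> real N * h" unfolding hlen_sum by simp
  also have "\<dots> \<le> real (N + 1) * h" using h_pos by (simp add: mult_right_mono)
  finally show ?thesis using pi_gt_zero by (simp add: field_simps)
qed

definition idx :: "(nat \<times> nat) set" where
  "idx = {1..N} \<times> {..k}"

lemma finite_idx [simp]: "finite idx"
  by (simp add: idx_def)

lemma idxD: "i \<in> idx \<Longrightarrow> fst i \<in> {1..N}" "i \<in> idx \<Longrightarrow> snd i \<le> k"
  by (auto simp: idx_def)

text \<open>The normalisation makes the basis orthonormal: \<open>L2_set\<close> of the coordinates
  is the mesh L2 norm, and transposing a matrix corresponds to taking the adjoint.\<close>

definition phi :: "nat \<times> nat \<Rightarrow> real poly" where
  "phi i = smult (sqrt ((2 * real (snd i) + 1) / hlen X (fst i))) (Lcell X (fst i) (snd i))"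

definition unit :: "nat \<times> nat \<Rightarrow> nat \<Rightarrow> real poly" where
  "unit i j = (if j = fst i then phi i else 0)"

definition pol :: "(nat \<times> nat \<Rightarrow> real) \<Rightarrow> nat \<Rightarrow> real poly" where
  "pol x j = (\<Sum>i\<in>idx. smult (x i) (unit i j))"

definition crd :: "(nat \<Rightarrow> real poly) \<Rightarrow> nat \<times> nat \<Rightarrow> real" where
  "crd p i = ip X (fst i) (poly (p (fst i))) (poly (phi i))"

lemma degree_phi: "i \<in> idx \<Longrightarrow> degree (phi i) \<le> k"
  unfolding phi_def using degree_Lcell[OF lt[OF idxD(1)]] idxD(2)[of i]
  by (intro order_trans[OF degree_smult_le]) auto

lemma idx_sum: "(\<Sum>i\<in>idx. f i) = (\<Sum>j=1..N. \<Sum>m\<le>k. f (j, m))"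
  by (simp add: idx_def sum.cartesian_product)

lemma pol_cell: "j \<in> {1..N} \<Longrightarrow> pol x j = (\<Sum>m\<le>k. smult (x (j, m)) (phi (j, m)))"
proof -
  assume j: "j \<in> {1..N}"
  have "pol x j = (\<Sum>j'=1..N. if j = j' then (\<Sum>m\<le>k. smult (x (j', m)) (phi (j', m))) else 0)"
    unfolding pol_def idx_sum by (intro sum.cong) (auto simp: unit_def)
  then show ?thesis using j by simp
qed

lemma pol_crd:
  assumes j: "j \<in> {1..N}" and p: "degree (p j) \<le> k"
  shows "pol (crd p) j = p j"
proof -
  have "smult (crd p (j, m)) (phi (j, m)) =
     smult ((2 * real m + 1) / hlen X j * ip X j (poly (p j)) (poly (Lcell X j m))) (Lcell X j m)" for m
  proof -
    let ?q = "(2 * real m + 1) / hlen X j"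
    have "0 \<le> ?q" using hlen_pos[OF j] by simp
    then have "sqrt ?q * sqrt ?q = ?q" by (simp only: real_sqrt_mult_self abs_of_nonneg)
    moreover have "crd p (j, m) = sqrt ?q * ip X j (poly (p j)) (poly (Lcell X j m))"
      by (simp add: crd_def phi_def ip_commute[of X j "poly (p j)"] ip_poly_smult)
    ultimately have "crd p (j, m) * sqrt ?q = ?q * ip X j (poly (p j)) (poly (Lcell X j m))"
      by (simp only: mult.assoc mult.left_commute mult.commute)
    then show ?thesis unfolding phi_def fst_conv snd_conv smult_smult by (rule arg_cong)
  qed
  then show ?thesis using poly_Lcell_expansion[OF lt[OF j] p] by (simp add: pol_cell[OF j])
qed

lemma dform_cong:
  assumes "\<And>j. j \<in> {1..N} \<Longrightarrow> p j = q j" "j \<in> {1..N}"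
  shows "dform N X b e p j w = dform N X b e q j w"
proof -
  have "uhat e N X (hom_bc b) 0 p i = uhat e N X (hom_bc b) 0 q i" if "i \<le> N" for i
    using that assms(1) N1 by (cases e; cases b) (auto simp: trace_minus_def trace_plus_def)
  moreover have "j \<le> N" "j - 1 \<le> N" using assms(2) by auto
  ultimately show ?thesis unfolding dform_def assms(1)[OF assms(2)] by simp
qed

lemma dform_pol: "dform N X b e (pol x) j w = (\<Sum>i\<in>idx. x i * dform N X b e (unit i) j w)"
proof -
  have "uhat e N X (hom_bc b) 0 (pol x) i0 = (\<Sum>i\<in>idx. x i * uhat e N X (hom_bc b) 0 (unit i) i0)" for i0
    unfolding pol_def[abs_def] by (rule uhat_linear)
  moreover have "ip X j (poly (pol x j)) (poly (pderiv w)) = (\<Sum>i\<in>idx. x i * ip X j (poly (unit i j)) (poly (pderiv w)))"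
    by (simp add: pol_def ip_poly_sum ip_poly_smult)
  moreover have "(\<Sum>i\<in>idx. x i * (- a i + b i * p - d i * q)) =
      - (\<Sum>i\<in>idx. x i * a i) + (\<Sum>i\<in>idx. x i * b i) * p - (\<Sum>i\<in>idx. x i * d i) * q" for a b d p q
    by (simp add: sum_distrib_right distrib_left right_diff_distrib sum.distrib sum_subtractf sum_negf mult.assoc)
  ultimately show ?thesis by (simp only: dform_def)
qed

lemma dform_0 [simp]: "dform N X b e p j 0 = 0"
  by (simp add: dform_def ip_def)

text \<open>After integration by parts on each cell, the opposite choices of one-sided limits reduce
  all node terms to differences of the product of the two fluxes, which telescope. The two remaining
  end terms agree in the periodic case, and each has a zero factor in the mixed case.\<close>

lemma dform_adjoint_FluxI:
  "(\<Sum>j=1..N. dform N X b FluxII p j (v j) + dform N X b FluxI v j (p j)) = 0"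
proof -
  let ?p = "uhat FluxII N X (hom_bc b) 0 p" and ?v = "uhat FluxI N X (hom_bc b) 0 v"
  have "dform N X b FluxII p j (v j) + dform N X b FluxI v j (p j) = ?p j * ?v j - ?p (j - 1) * ?v (j - 1)"
    if j: "j \<in> {1..N}" for j
  proof -
    have "integral (cell X j) (poly (pderiv (p j) * v j)) = poly (p j) (X j) * poly (v j) (X j)
       - poly (p j) (X (j - 1)) * poly (v j) (X (j - 1)) - integral (cell X j) (poly (p j * pderiv (v j)))"
      unfolding cell_def by (rule integral_by_parts_poly) (use lt[OF j] in simp)
    then have "ip X j (poly (p j)) (poly (pderiv (v j))) + ip X j (poly (v j)) (poly (pderiv (p j))) =
       poly (p j) (X j) * poly (v j) (X j) - poly (p j) (X (j - 1)) * poly (v j) (X (j - 1))"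
      by (simp add: ip_poly mult.commute[of "v j"])
    moreover have "?v j = poly (v j) (X j)" "?p (j - 1) = poly (p j) (X (j - 1))"
      using j uhat_interior(1)[of j] uhat_interior(2)[of "j - 1" N] by auto
    ultimately show ?thesis by (simp add: dform_def algebra_simps)
  qed
  then have "(\<Sum>j=1..N. dform N X b FluxII p j (v j) + dform N X b FluxI v j (p j)) =
     (\<Sum>j=1..N. ?p j * ?v j - ?p (j - 1) * ?v (j - 1))" by (intro sum.cong) auto
  also have "\<dots> = ?p N * ?v N - ?p 0 * ?v 0"
    by (rule sum_telescope_1)
  also have "\<dots> = 0" using N1 by (cases b) (auto simp: trace_minus_def trace_plus_def X0)
  finally show ?thesis .
qed

lemma dform_adjoint: "(\<Sum>j=1..N. dform N X b (opp e) p j (v j) + dform N X b e v j (p j)) = 0"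
  using dform_adjoint_FluxI[of b p v] dform_adjoint_FluxI[of b v p] by (cases e) (simp_all add: add.commute)

definition dmat :: "bc \<Rightarrow> flux \<Rightarrow> nat \<times> nat \<Rightarrow> nat \<times> nat \<Rightarrow> real" where
  "dmat b e i i' = dform N X b e (unit i') (fst i) (phi i)"

lemma mv_dmat:
  assumes "\<And>j. j \<in> {1..N} \<Longrightarrow> degree (p j) \<le> k" "i \<in> idx"
  shows "mv idx (dmat b e) (crd p) i = dform N X b e p (fst i) (phi i)"
proof -
  have "mv idx (dmat b e) (crd p) i = dform N X b e (pol (crd p)) (fst i) (phi i)"
    by (simp add: mv_def dmat_def dform_pol mult.commute)
  also have "\<dots> = dform N X b e p (fst i) (phi i)"
    by (rule dform_cong) (use pol_crd assms idxD(1)[OF assms(2)] in auto)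
  finally show ?thesis .
qed

lemma dmat_adjoint:
  assumes "i \<in> idx" "i' \<in> idx"
  shows "dmat b (opp e) i i' = - trp (dmat b e) i i'"
proof -
  have *: "(\<Sum>j=1..N. dform N X b e' p j (unit l j)) = dform N X b e' p (fst l) (phi l)" if "l \<in> idx" for e' p l
  proof -
    have "(\<Sum>j=1..N. dform N X b e' p j (unit l j)) = (\<Sum>j=1..N. if j = fst l then dform N X b e' p (fst l) (phi l) else 0)"
      by (intro sum.cong) (auto simp: unit_def)
    then show ?thesis using idxD(1)[OF that] by simp
  qed
  have "dform N X b (opp e) (unit i') (fst i) (phi i) + dform N X b e (unit i) (fst i') (phi i') = 0"
    using dform_adjoint[of b e "unit i'" "unit i"] by (simp add: sum.distrib * assms del: One_nat_def)
  then show ?thesis by (simp add: dmat_def trp_def)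
qed

lemma mv_dmat_opp:
  assumes "\<And>j. j \<in> {1..N} \<Longrightarrow> degree (p j) \<le> k" "i \<in> idx"
  shows "- mv idx (trp (dmat b e)) (crd p) i = dform N X b (opp e) p (fst i) (phi i)"
proof -
  have "- mv idx (trp (dmat b e)) (crd p) i = mv idx (dmat b (opp e)) (crd p) i"
    unfolding mv_def using assms(2) by (simp add: dmat_adjoint flip: sum_negf)
  then show ?thesis using mv_dmat[OF assms] by simp
qed

subsection \<open>Errors at the nodes\<close>

definition traceC :: real where
  "traceC = (2 * real k + 1) * (real k + 1)"

lemma traceC_nonneg: "0 \<le> traceC"
  by (simp add: traceC_def)

text \<open>Cauchy-Schwarz over the k + 1 coordinates of one cell, the basis functions being of size
  \<open>1 / sqrt hlen\<close> at the ends; quasi-uniformity replaces the length of the cell by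
  h.\<close>

lemma trace_bound:
  assumes j: "j \<in> {1..N}"
  shows "(poly (pol x j) (endpt X j e))\<^sup>2 \<le> traceC * c / h * (\<Sum>m\<le>k. (x (j, m))\<^sup>2)"
proof -
  let ?s = "\<lambda>m. sqrt ((2 * real m + 1) / hlen X j) * end_sign e m"
  have hp: "0 < hlen X j" by (rule hlen_pos[OF j])
  have "poly (pol x j) (endpt X j e) = (\<Sum>m\<le>k. x (j, m) * ?s m)"
    using mesh_cell.L_end[OF mc[OF j]] by (simp add: pol_cell[OF j] poly_sum phi_def mult.assoc)
  then have "(poly (pol x j) (endpt X j e))\<^sup>2 \<le> (\<Sum>m\<le>k. (x (j, m))\<^sup>2) * (\<Sum>m\<le>k. (?s m)\<^sup>2)"
    using Cauchy_Schwarz_ineq_sum[of "\<lambda>m. x (j, m)" ?s "{..k}"] by simp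
  also have "\<dots> \<le> (\<Sum>m\<le>k. (x (j, m))\<^sup>2) * (traceC * c / h)"
  proof (intro mult_left_mono sum_nonneg)
    have "(?s m)\<^sup>2 = (2 * real m + 1) * (1 / hlen X j)" for m
      using hp by (simp add: power_mult_distrib) (simp add: power2_eq_square)
    then have "(\<Sum>m\<le>k. (?s m)\<^sup>2) = (\<Sum>m\<le>k. (2 * real m + 1) * (1 / hlen X j))" by (simp only:)
    also have "\<dots> \<le> (\<Sum>m\<le>k. (2 * real k + 1) * (c / h))"
      using inverse_hlen[OF j] hp by (intro sum_mono mult_mono) auto
    also have "\<dots> = traceC * c / h" by (simp add: traceC_def mult_ac add.commute)
    finally show "(\<Sum>m\<le>k. (?s m)\<^sup>2) \<le> traceC * c / h" .
  qed auto
  finally show ?thesis by (simp add: mult.commute)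
qed

text \<open>The case distinction names the cell whose piece supplies the trace, with the periodic
  wrap at the outer node. In the mixed case the trace at that node is zero, so any cell will
  do.\<close>

lemma node_error_piece:
  assumes "i \<le> N"
  shows "(uhat e N X (hom_bc b) 0 (pol x) i)\<^sup>2 \<le> traceC * c / h *
    (\<Sum>m\<le>k. (x (case e of FluxI \<Rightarrow> (if i = 0 then N else i) | FluxII \<Rightarrow> (if i = N then 1 else Suc i), m))\<^sup>2)"
proof -
  have nn: "0 \<le> traceC * c / h * (\<Sum>m\<le>k. (x (j, m))\<^sup>2)" for j
    using traceC_nonneg c_pos h_pos by (auto intro!: mult_nonneg_nonneg divide_nonneg_nonneg sum_nonneg)
  show ?thesis
  proof (cases e)
    case FluxI
    show ?thesis
      using trace_bound[of N x FluxI] trace_bound[of i x FluxI] nn[of N] N1 assms FluxI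
      by (cases b) (auto simp: trace_minus_def)
  next
    case FluxII
    show ?thesis
      using trace_bound[of 1 x FluxII] trace_bound[of "Suc i" x FluxII] nn[of 1] N1 assms FluxII X0
      by (cases b) (auto simp: trace_plus_def)
  qed
qed

lemma cell_norm_le: "j \<in> {1..N} \<Longrightarrow> (\<Sum>m\<le>k. (x (j, m))\<^sup>2) \<le> (L2_set x idx)\<^sup>2"
  unfolding sum_L2_square[OF finite_idx] idx_sum
  using member_le_sum[of j "{1..N}" "\<lambda>j. \<Sum>m\<le>k. (x (j, m))\<^sup>2"] by (auto simp: sum_nonneg)

lemma node_error_max:
  assumes "i \<le> N"
  shows "\<bar>uhat e N X (hom_bc b) 0 (pol x) i\<bar> \<le> sqrt (traceC * c) / sqrt h * L2_set x idx"
proof (rule power2_le_imp_le)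
  have "(uhat e N X (hom_bc b) 0 (pol x) i)\<^sup>2 \<le> traceC * c / h * (L2_set x idx)\<^sup>2"
  proof (rule order_trans[OF node_error_piece[OF assms] mult_left_mono])
    show "0 \<le> traceC * c / h" using traceC_nonneg c_pos h_pos by simp
  qed (use cell_norm_le N1 assms in \<open>auto split: flux.split\<close>)
  also have "\<dots> = (sqrt (traceC * c) / sqrt h * L2_set x idx)\<^sup>2"
    using traceC_nonneg c_pos h_pos by (simp add: power_mult_distrib power_divide)
  finally show "\<bar>uhat e N X (hom_bc b) 0 (pol x) i\<bar>\<^sup>2 \<le> (sqrt (traceC * c) / sqrt h * L2_set x idx)\<^sup>2" by simp
qed (use traceC_nonneg c_pos h_pos in \<open>auto intro!: mult_nonneg_nonneg divide_nonneg_nonneg L2_set_nonneg\<close>)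

text \<open>Each node uses one cell and only one cell is used twice, so the sum is at most twice the
  full norm. The average contributes \<open>1 / (N + 1)\<close>, at most h / (2 pi), which
  compensates the 1/h of the trace inequality; thus no half power is lost.\<close>

lemma node_error_l2:
  "sqrt (1 / real (N + 1) * (\<Sum>j=1..N + 1. (uhat e N X (hom_bc b) 0 (pol x) (j - 1))\<^sup>2)) \<le> sqrt (traceC * c) * L2_set x idx"
proof -
  let ?S = "\<lambda>j. \<Sum>m\<le>k. (x (j, m))\<^sup>2"
  let ?q = "traceC * c / h"
  define \<sigma> where "\<sigma> i = (case e of FluxI \<Rightarrow> (if i = 0 then N else i) | FluxII \<Rightarrow> (if i = N then 1 else Suc i))" for i
  have q: "0 \<le> ?q" using traceC_nonneg c_pos h_pos by simp
  have tot: "(\<Sum>j=1..N. ?S j) = (L2_set x idx)\<^sup>2" unfolding sum_L2_square[OF finite_idx] idx_sum ..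
  have "(\<Sum>i\<le>N. ?S (\<sigma> i)) \<le> 2 * (L2_set x idx)\<^sup>2"
  proof (cases e)
    case FluxI
    have "{..N} = insert 0 {1..N}" by auto
    then have "(\<Sum>i\<le>N. ?S (\<sigma> i)) = ?S N + (\<Sum>j=1..N. ?S j)" by (simp add: \<sigma>_def FluxI)
    then show ?thesis using cell_norm_le[of N x] N1 tot by simp
  next
    case FluxII
    have "(\<Sum>i<N. ?S (\<sigma> i)) = (\<Sum>j=1..N. ?S j)"
      by (rule sum.reindex_bij_witness[of _ "\<lambda>j. j - 1" Suc]) (auto simp: \<sigma>_def FluxII)
    moreover have "{..N} = insert N {..<N}" by auto
    ultimately have "(\<Sum>i\<le>N. ?S (\<sigma> i)) = ?S 1 + (\<Sum>j=1..N. ?S j)" by (simp add: \<sigma>_def FluxII)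
    then show ?thesis using cell_norm_le[of 1 x] N1 tot by simp
  qed
  have "(\<Sum>j=1..N + 1. (uhat e N X (hom_bc b) 0 (pol x) (j - 1))\<^sup>2) = (\<Sum>i\<le>N. (uhat e N X (hom_bc b) 0 (pol x) i)\<^sup>2)"
    by (rule sum.reindex_bij_witness[of _ Suc "\<lambda>j. j - 1"]) auto
  also have "\<dots> \<le> (\<Sum>i\<le>N. ?q * ?S (\<sigma> i))"
    unfolding \<sigma>_def by (intro sum_mono node_error_piece) auto
  also have "\<dots> = ?q * (\<Sum>i\<le>N. ?S (\<sigma> i))" by (simp add: sum_distrib_left)
  also have "\<dots> \<le> ?q * (2 * (L2_set x idx)\<^sup>2)" using q \<open>(\<Sum>i\<le>N. ?S (\<sigma> i)) \<le> _\<close> by (rule mult_left_mono[rotated])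
  finally have "1 / real (N + 1) * (\<Sum>j=1..N + 1. (uhat e N X (hom_bc b) 0 (pol x) (j - 1))\<^sup>2) \<le>
      h / (2 * pi) * (?q * (2 * (L2_set x idx)\<^sup>2))"
    using Nh_ge h_pos by (intro mult_mono) (auto intro!: sum_nonneg simp del: sum.cl_ivl_Suc One_nat_def)
  also have "\<dots> = traceC * c * (L2_set x idx)\<^sup>2 / pi" using h_pos by (simp add: field_simps)
  also have "\<dots> \<le> traceC * c * (L2_set x idx)\<^sup>2 / 1"
    using traceC_nonneg c_pos pi_gt3 by (intro divide_left_mono) auto
  also have "\<dots> = (sqrt (traceC * c) * L2_set x idx)\<^sup>2"
    using traceC_nonneg c_pos by (simp add: power_mult_distrib)
  finally show ?thesis
    using traceC_nonneg c_pos by (intro real_le_lsqrt) (auto intro!: mult_nonneg_nonneg sum_nonneg)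
qed

subsection \<open>Residuals\<close>

text \<open>Squaring yields \<open>hlen ^ (4 * k + 1)\<close> times the squared increment of
  \<open>Af\<close>. One power of the length is spent on dividing that square, and
  \<open>Af_increment_square\<close> then makes the sum over the cells telescope to a
  constant.\<close>

lemma L2_cells:
  assumes C: "0 \<le> C" and ab: "0 \<le> \<alpha>" "0 \<le> \<beta>"
    and x: "\<And>j m. j \<in> {1..N} \<Longrightarrow> m \<le> k \<Longrightarrow>
      \<bar>x (j, m)\<bar> \<le> C * hlen X j ^ (2 * k) * sqrt (hlen X j) * (Af \<alpha> \<beta> (X j) - Af \<alpha> \<beta> (X (j - 1)))"
  shows "L2_set x idx \<le> 6 * sqrt (real k + 1) * C * h ^ (2 * k + 1) * (\<alpha> + \<beta>)"
proof (rule power2_le_imp_le)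
  let ?d = "\<lambda>j. Af \<alpha> \<beta> (X j) - Af \<alpha> \<beta> (X (j - 1))"
  have sq: "(x (j, m))\<^sup>2 \<le> C\<^sup>2 * h ^ (4 * k + 2) * ((?d j)\<^sup>2 / hlen X j)" if j: "j \<in> {1..N}" and m: "m \<le> k" for j m
  proof -
    have hp: "0 < hlen X j" by (rule hlen_pos[OF j])
    have "(x (j, m))\<^sup>2 = \<bar>x (j, m)\<bar>\<^sup>2" by simp
    also have "\<dots> \<le> (C * hlen X j ^ (2 * k) * sqrt (hlen X j) * ?d j)\<^sup>2" by (rule power_mono[OF x[OF j m]]) simp
    also have "\<dots> = C\<^sup>2 * (hlen X j ^ (4 * k) * hlen X j) * (?d j)\<^sup>2"
      using hp by (simp add: power_mult_distrib flip: power_mult)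
    also have "hlen X j ^ (4 * k) * hlen X j = hlen X j ^ (4 * k + 2) / hlen X j"
      using hp by (simp add: power_add power2_eq_square)
    also have "C\<^sup>2 * (hlen X j ^ (4 * k + 2) / hlen X j) * (?d j)\<^sup>2 = C\<^sup>2 * hlen X j ^ (4 * k + 2) * ((?d j)\<^sup>2 / hlen X j)"
      by simp
    also have "\<dots> \<le> C\<^sup>2 * h ^ (4 * k + 2) * ((?d j)\<^sup>2 / hlen X j)"
      using hp hlen_le[OF j] by (intro mult_right_mono mult_left_mono power_mono) auto
    finally show ?thesis .
  qed
  have "(L2_set x idx)\<^sup>2 = (\<Sum>j=1..N. \<Sum>m\<le>k. (x (j, m))\<^sup>2)" unfolding sum_L2_square[OF finite_idx] idx_sum ..
  also have "\<dots> \<le> (\<Sum>j=1..N. \<Sum>m\<le>k. C\<^sup>2 * h ^ (4 * k + 2) * ((?d j)\<^sup>2 / hlen X j))"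
    by (intro sum_mono sq) auto
  also have "\<dots> = (real k + 1) * (C\<^sup>2 * h ^ (4 * k + 2)) * (\<Sum>j=1..N. (?d j)\<^sup>2 / hlen X j)"
    by (simp add: sum_distrib_left mult.assoc add.commute)
  also have "\<dots> \<le> (real k + 1) * (C\<^sup>2 * h ^ (4 * k + 2)) * (36 * (\<alpha>\<^sup>2 + \<beta>\<^sup>2))"
  proof (intro mult_left_mono)
    have "(\<Sum>j=1..N. (?d j)\<^sup>2 / hlen X j) \<le> (\<Sum>j=1..N. Asq \<alpha> \<beta> (X j) - Asq \<alpha> \<beta> (X (j - 1)))"
    proof (intro sum_mono)
      fix j assume j: "j \<in> {1..N}"
      show "(?d j)\<^sup>2 / hlen X j \<le> Asq \<alpha> \<beta> (X j) - Asq \<alpha> \<beta> (X (j - 1))"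
        unfolding hlen_def using lt[OF j] X_in[of j] X_in[of "j - 1"] j by (intro Af_increment_square) auto
    qed
    also have "\<dots> = Asq \<alpha> \<beta> (X N) - Asq \<alpha> \<beta> (X 0)" by (rule sum_telescope_1)
    also have "\<dots> \<le> 36 * (\<alpha>\<^sup>2 + \<beta>\<^sup>2)" unfolding X0 XN by (rule Asq_total)
    finally show "(\<Sum>j=1..N. (?d j)\<^sup>2 / hlen X j) \<le> 36 * (\<alpha>\<^sup>2 + \<beta>\<^sup>2)" .
  qed (use h_pos in auto)
  also have "\<dots> \<le> (real k + 1) * (C\<^sup>2 * h ^ (4 * k + 2)) * (36 * (\<alpha> + \<beta>)\<^sup>2)"
    using ab h_pos by (intro mult_left_mono) (auto simp: power2_sum)
  also have "\<dots> = (6 * sqrt (real k + 1) * C * h ^ (2 * k + 1) * (\<alpha> + \<beta>))\<^sup>2"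
  proof -
    have "(h ^ (2 * k + 1))\<^sup>2 = h ^ ((2 * k + 1) * 2)" by (rule power_mult[symmetric])
    also have "(2 * k + 1) * 2 = 4 * k + 2" by simp
    finally show ?thesis by (simp add: power_mult_distrib)
  qed
  finally show "(L2_set x idx)\<^sup>2 \<le> (6 * sqrt (real k + 1) * C * h ^ (2 * k + 1) * (\<alpha> + \<beta>))\<^sup>2" .
qed (use C ab h_pos in auto)

end

subsection \<open>Differentiation of the discrete solution in time\<close>

text \<open>The scheme grants differentiability in time only of point values of the discrete
  solution; k + 1 values inside the cell determine the whole piece.\<close>

lemma lagrange_interpolation:
  fixes a b :: real
  assumes ab: "a < b" and k: "1 \<le> k"
  shows "\<exists>y l. (\<forall>n\<le>k. y n \<in> {a..b}) \<and> (\<forall>p. degree p \<le> k \<longrightarrow> p = (\<Sum>n\<le>k. smult (poly p (y n)) (l n :: real poly)))"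
proof -
  define y where "y n = a + (b - a) * (real n / real k)" for n
  define l where "l n = (\<Prod>m\<in>{..k} - {n}. smult (1 / (y n - y m)) [:- y m, 1:])" for n
  have yI: "y n \<in> {a..b}" if "n \<le> k" for n
  proof -
    have "(b - a) * (real n / real k) \<le> (b - a) * 1" using that k ab by (intro mult_left_mono) auto
    then show ?thesis using ab by (auto simp: y_def)
  qed
  have inj: "inj y" using ab k by (auto simp: inj_def y_def)
  have deg: "degree (l n) \<le> k" if "n \<le> k" for n
  proof -
    have "degree (l n) \<le> (\<Sum>m\<in>{..k} - {n}. degree (smult (1 / (y n - y m)) [:- y m, 1:]))"
      unfolding l_def by (rule order_trans[OF degree_prod_sum_le]) (auto simp: o_def)
    also have "\<dots> \<le> (\<Sum>m\<in>{..k} - {n}. 1)" by (intro sum_mono) (auto intro: order_trans[OF degree_smult_le])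
    also have "\<dots> = k" using that by simp
    finally show ?thesis .
  qed
  have val: "poly (l n) (y m) = (if m = n then 1 else 0)" if "n \<le> k" "m \<le> k" for n m
  proof (cases "m = n")
    case True
    have "poly (smult (1 / (y n - y i)) [:- y i, 1:]) (y n) = 1" if "i \<noteq> n" for i
    proof -
      have "y n - y i \<noteq> 0" using inj that by (simp add: inj_eq)
      moreover have "1 / d * d = 1" if "d \<noteq> 0" for d :: real using that by simp
      moreover have "poly [:- y i, 1:] (y n) = y n - y i" by simp
      ultimately show ?thesis by (simp only: poly_smult)
    qed
    then show ?thesis using True by (simp add: l_def poly_prod del: poly_smult)
  next
    case False
    have "\<exists>i\<in>{..k} - {n}. poly (smult (1 / (y n - y i)) [:- y i, 1:]) (y m) = 0"
      using that False by (intro bexI[of _ m]) auto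
    then show ?thesis using False by (simp add: l_def poly_prod del: poly_smult)
  qed
  have "p = (\<Sum>n\<le>k. smult (poly p (y n)) (l n))" if p: "degree p \<le> k" for p
  proof (rule poly_eqI_degree[where A = "y ` {..k}"])
    have card: "card (y ` {..k}) = Suc k" using card_image[of y "{..k}"] inj_on_subset[OF inj] by simp
    show "degree p < card (y ` {..k})" using p card by simp
    have "degree (\<Sum>n\<le>k. smult (poly p (y n)) (l n)) \<le> k"
      by (intro degree_sum_le) (auto intro: order_trans[OF degree_smult_le] deg)
    then show "degree (\<Sum>n\<le>k. smult (poly p (y n)) (l n)) < card (y ` {..k})" using card by simp
    fix x assume "x \<in> y ` {..k}"
    then obtain m where m: "m \<le> k" "x = y m" by auto
    have "poly (\<Sum>n\<le>k. smult (poly p (y n)) (l n)) x = (\<Sum>n\<le>k. if m = n then poly p (y n) else 0)"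
      unfolding poly_sum poly_smult m(2) by (intro sum.cong) (auto simp: val m)
    then show "poly p x = poly (\<Sum>n\<le>k. smult (poly p (y n)) (l n)) x" using m by simp
  qed
  then show ?thesis using yI by blast
qed

text \<open>By interpolation at fixed nodes the moment is a fixed finite linear combination of point
  values, so no differentiation under the integral is required.\<close>

lemma ip_time_derivative:
  assumes T: "0 < T" and t: "t \<in> {0..T}" and lt: "X (j - 1) < X j" and k: "1 \<le> k"
    and deg: "\<And>s. s \<in> {0..T} \<Longrightarrow> degree (p s) \<le> k"
    and diff: "\<And>x. x \<in> cell X j \<Longrightarrow> (\<lambda>s. poly (p s) x) differentiable (at t within {0..T})"
  shows "((\<lambda>s. ip X j (poly (p s)) (poly w)) has_real_derivative
     ip X j (\<lambda>x. dt T (\<lambda>s. poly (p s) x) t) (poly w)) (at t within {0..T})"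
proof -
  obtain y l where y: "\<And>n. n \<le> k \<Longrightarrow> y n \<in> cell X j"
    and l: "\<And>p. degree p \<le> k \<Longrightarrow> p = (\<Sum>n\<le>k. smult (poly p (y n)) (l n :: real poly))"
    using lagrange_interpolation[OF lt k] unfolding cell_def by blast
  define d where "d n = dt T (\<lambda>s. poly (p s) (y n)) t" for n
  have d: "((\<lambda>s. poly (p s) (y n)) has_real_derivative d n) (at t within {0..T})" if "n \<le> k" for n
    using diff[OF y[OF that]] unfolding d_def dt_def
    by (simp add: vector_derivative_works has_real_derivative_iff_has_vector_derivative)
  have tr: "(f has_real_derivative f') (at t within {0..T})"
    if "(g has_real_derivative f') (at t within {0..T})" "\<And>s. s \<in> {0..T} \<Longrightarrow> g s = f s" for f g f'
    by (rule has_field_derivative_transform_within[OF that(1) zero_less_one t]) (use that(2) in auto)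
  have "((\<lambda>s. poly (p s) x) has_real_derivative (\<Sum>n\<le>k. d n * poly (l n) x)) (at t within {0..T})" for x
  proof (rule tr)
    show "((\<lambda>s. \<Sum>n\<le>k. poly (p s) (y n) * poly (l n) x) has_real_derivative (\<Sum>n\<le>k. d n * poly (l n) x)) (at t within {0..T})"
      by (intro DERIV_sum DERIV_cmult_right d) auto
    fix s assume "s \<in> {0..T}"
    from arg_cong[OF l[OF deg[OF this]], of "\<lambda>q. poly q x"]
    show "(\<Sum>n\<le>k. poly (p s) (y n) * poly (l n) x) = poly (p s) x" by (simp add: poly_sum)
  qed
  then have dtx: "dt T (\<lambda>s. poly (p s) x) t = poly (\<Sum>n\<le>k. smult (d n) (l n)) x" for x
    unfolding dt_def using real_vector_derivative_within[OF T t] by (simp add: poly_sum)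
  show ?thesis
  proof (rule tr)
    show "((\<lambda>s. \<Sum>n\<le>k. poly (p s) (y n) * ip X j (poly (l n)) (poly w)) has_real_derivative
      ip X j (\<lambda>x. dt T (\<lambda>s. poly (p s) x) t) (poly w)) (at t within {0..T})"
      unfolding dtx ip_poly_sum ip_poly_smult by (intro DERIV_sum DERIV_cmult_right d) auto
    fix s assume "s \<in> {0..T}"
    from arg_cong[OF l[OF deg[OF this]], of "\<lambda>q. ip X j (poly q) (poly w)"]
    show "(\<Sum>n\<le>k. poly (p s) (y n) * ip X j (poly (l n)) (poly w)) = ip X j (poly (p s)) (poly w)"
      by (simp only: ip_poly_sum ip_poly_smult)
  qed
qed

context mesh_cell
begin

lemma lc_cong: "(\<And>x. x \<in> K \<Longrightarrow> f x = g x) \<Longrightarrow> lc f m = lc g m"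
  unfolding lc_def using ip_cong[of f g] by simp

lemma coef_cong:
  assumes "continuous_on K f" "\<And>x. x \<in> K \<Longrightarrow> f x = g x"
  shows "co e f = co e g"
proof -
  have "continuous_on K g" using assms continuous_on_cong by metis
  then show ?thesis
    using coef_eq[OF assms(1), of e] coef_eq[of g e] lc_cong[OF assms(2)] assms(2)[OF E_in] by simp
qed

lemma radau_cong:
  assumes "continuous_on K f" "\<And>x. x \<in> K \<Longrightarrow> f x = g x"
  shows "rad e f = rad e g"
proof -
  have "continuous_on K g" using assms continuous_on_cong by metis
  then show ?thesis
    using assms lc_cong[OF assms(2)] E_in[of e] by (simp add: radau_eq_radp radp_def)
qed

end

section \<open>The error equations\<close>

definition residC :: "nat \<Rightarrow> real" where
  "residC k = zC k k * legb k * sqrt (2 * real k + 1) * coefC k"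

lemma residC_nonneg: "0 \<le> residC k"
  unfolding residC_def using coefC_pos[of k] legb(1)[of k] by (simp add: less_imp_le)

lemma Af_mono:
  assumes "0 \<le> \<alpha>" "0 \<le> \<beta>" "0 \<le> y" "y \<le> x" "x \<le> 2 * pi"
  shows "Af \<alpha> \<beta> y \<le> Af \<alpha> \<beta> x"
  unfolding Af_def using assms by (intro add_mono mult_left_mono diff_mono powr_mono2) auto

text \<open>2k + 1 is the order of the last classical derivative; the hypothesis of order 2k + 2
  enters through the Lipschitz and mollification bounds of \<open>heat_family\<close>.\<close>

locale ldg_error = dg_mesh k N X c + heat_family "2 * k + 1" M T D
  for k N :: nat and X :: "nat \<Rightarrow> real" and c M T :: real and D :: "nat \<Rightarrow> real \<Rightarrow> real \<Rightarrow> real" +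
  fixes fl :: flux and b :: bc and u :: "real \<Rightarrow> real \<Rightarrow> real" and uh qh :: "real \<Rightarrow> nat \<Rightarrow> real poly"
  assumes u_eq: "\<And>t x. t \<in> {0..T} \<Longrightarrow> x \<in> {0..2 * pi} \<Longrightarrow> u t x = D 0 t x"
    and dx_eq: "\<And>t x. t \<in> {0..T} \<Longrightarrow> x \<in> {0..2 * pi} \<Longrightarrow> dx (u t) x = D 1 t x"
    and bcond: "boundary_cond T fl b u"
    and sol: "ldg_solution k T fl b N X uh qh"
    and init: "\<And>j. j \<in> {1..N} \<Longrightarrow> uh 0 j = uI fl k k T X u 0 j"
begin

lemma D_cell: "t \<in> {0..T} \<Longrightarrow> j \<in> {1..N} \<Longrightarrow> i \<le> 2 * k + 1 \<Longrightarrow> continuous_on (cell X j) (D i t)"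
  using continuous_on_subset[OF D_cont cell_sub] by blast

lemma coef_time_derivative:
  assumes j: "j \<in> {1..N}" and t: "t \<in> {0..T}" and i: "i + 2 \<le> 2 * k + 1"
  shows "((\<lambda>s. coef k X j e (D i s)) has_real_derivative coef k X j e (D (i + 2) t)) (at t within {0..T})"
proof (rule functional_time_derivative[OF t i])
  note [intro] = continuous_on_subset[OF _ cell_sub[OF j]]
  fix f g :: "real \<Rightarrow> real" and S c :: real assume f: "continuous_on I f"
  { assume g: "continuous_on I g"
    show "coef k X j e (\<lambda>x. f x - g x) = coef k X j e f - coef k X j e g"
      by (rule mesh_cell.coef_diff[OF mc[OF j]]) (use f g in auto) }
  show "coef k X j e (\<lambda>x. c * f x) = c * coef k X j e f"
    by (rule mesh_cell.coef_scale[OF mc[OF j]]) (use f in auto)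
  assume S: "\<And>x. x \<in> I \<Longrightarrow> \<bar>f x\<bar> \<le> S"
  show "\<bar>coef k X j e f\<bar> \<le> coefC k * S"
    by (rule mesh_cell.coef_bound[OF mc[OF j]]) (use f S cell_sub[OF j] in auto)
qed

text \<open>The coefficient is a bounded linear functional, so every time derivative raises the
  x-order by two. This converts the time derivatives in the definition of the interpolation function
  into x-derivatives.\<close>

lemma dt_funpow_coef:
  assumes j: "j \<in> {1..N}" and t: "t \<in> {0..T}" and i: "l + 2 * i \<le> 2 * k + 1"
    and f: "\<And>s x. s \<in> {0..T} \<Longrightarrow> x \<in> cell X j \<Longrightarrow> f s x = D l s x"
  shows "(dt T ^^ i) (\<lambda>s. coef k X j e (f s)) t = coef k X j e (D (l + 2 * i) t)"
  using t i
proof (induction i arbitrary: t)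
  case 0
  then show ?case using mesh_cell.coef_cong[OF mc[OF j] D_cell[OF _ j], of t l "f t" e] f by simp
next
  case (Suc i)
  have "((dt T ^^ i) (\<lambda>s. coef k X j e (f s)) has_real_derivative coef k X j e (D (l + 2 * i + 2) t)) (at t within {0..T})"
    by (rule has_field_derivative_transform_within[OF coef_time_derivative[OF j] zero_less_one])
      (use Suc in auto)
  from real_vector_derivative_within[OF T Suc.prems(1) this]
  have "dt T ((dt T ^^ i) (\<lambda>s. coef k X j e (f s))) t = coef k X j e (D (l + 2 * i + 2) t)"
    by (simp only: dt_def)
  then show ?case by simp
qed

definition Pu :: "real \<Rightarrow> nat \<Rightarrow> real poly" where
  "Pu t j = interp k X j fl (\<lambda>i. D i t)"

text \<open>Built from the chain of q at the opposite end, so that its corrections cancel against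
  those of \<open>Pu\<close> in the scheme.\<close>

definition Pq :: "real \<Rightarrow> nat \<Rightarrow> real poly" where
  "Pq t j = interp k X j (opp fl) (\<lambda>i. D (Suc i) t)"

text \<open>The even members of the alternating sum are the corrections with time derivatives of u,
  the odd ones those with time derivatives of q; hence the initial error vanishes.\<close>

lemma uI_eq_Pu:
  assumes j: "j \<in> {1..N}" and t: "t \<in> {0..T}"
  shows "uI fl k k T X u t j = Pu t j"
proof -
  define g where "g n = smult (hbar X j ^ n * coef k X j (alt fl n) (D n t)) (Zp k X j fl n)" for n
  have cell: "x \<in> I" if "x \<in> cell X j" for x using cell_sub[OF j] that by auto
  have even: "(dt T ^^ i) (\<lambda>s. coef k X j e (u s)) t = coef k X j e (D (2 * i) t)" if "2 * i \<le> 2 * k + 1" for i e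
    using dt_funpow_coef[OF j t, of 0 i u e] that u_eq cell by simp
  have half: "2 * i \<le> 2 * k + 1" if "i \<in> {1..k div 2}" for i using that by auto
  have half': "1 \<le> i" "2 * i - 1 \<le> 2 * k + 1" if "i \<in> {1..(k + 1) div 2}" for i using that by auto
  have odd: "(dt T ^^ (i - 1)) (\<lambda>s. coef k X j e (dx (u s))) t = coef k X j e (D (2 * i - 1) t)"
    if "1 \<le> i" "2 * i - 1 \<le> 2 * k + 1" for i e
  proof -
    have "1 + 2 * (i - 1) = 2 * i - 1" using that by simp
    then show ?thesis using dt_funpow_coef[OF j t, of 1 "i - 1" "\<lambda>s. dx (u s)" e] that dx_eq cell by simp
  qed
  have r: "radau k X j fl (u t) = radau k X j fl (D 0 t)"
    using mesh_cell.radau_cong[OF mc[OF j] D_cell[OF t j], of 0 "u t" fl] u_eq[OF t] cell by simp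
  have "W2 fl k k T X u t j = (\<Sum>i=1..k div 2. g (2 * i)) + (\<Sum>i=1..(k + 1) div 2. g (2 * i - 1))"
  proof (cases fl)
    case FluxI
    have "smult (hbar X j ^ (2 * i) * (dt T ^^ i) (\<lambda>s. coeff_bar k X j (u s)) t) (F1bar k X j i) = g (2 * i)"
      if "i \<in> {1..k div 2}" for i
      using even[OF half[OF that], of FluxI] that Fbar_eq_Z[of i k X j] FluxI by (simp add: g_def)
    moreover have "smult (hbar X j ^ (2 * i - 1) * (dt T ^^ (i - 1)) (\<lambda>s. coeff_tilde k X j (dx (u s))) t) (F2 k X j i) = g (2 * i - 1)"
      if "i \<in> {1..(k + 1) div 2}" for i
    proof -
      have "2 * (i - 1) + 1 = 2 * i - 1" "odd (2 * i - 1)" using that by auto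
      then show ?thesis using odd[OF half'[OF that], of FluxII] that F_eq_Z(2)[of k X j "i - 1"] FluxI by (simp add: g_def)
    qed
    ultimately show ?thesis using FluxI by simp
  next
    case FluxII
    have "smult (hbar X j ^ (2 * i) * (dt T ^^ i) (\<lambda>s. coeff_tilde k X j (u s)) t) (F2bar k X j i) = g (2 * i)"
      if "i \<in> {1..k div 2}" for i
      using even[OF half[OF that], of FluxII] that Fbar_eq_Z[of i k X j] FluxII by (simp add: g_def)
    moreover have "smult (hbar X j ^ (2 * i - 1) * (dt T ^^ (i - 1)) (\<lambda>s. coeff_bar k X j (dx (u s))) t) (F1 k X j i) = g (2 * i - 1)"
      if "i \<in> {1..(k + 1) div 2}" for i
    proof -
      have "2 * (i - 1) + 1 = 2 * i - 1" "odd (2 * i - 1)" using that by auto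
      then show ?thesis using odd[OF half'[OF that], of FluxI] that F_eq_Z(1)[of k X j "i - 1"] FluxII by (simp add: g_def)
    qed
    ultimately show ?thesis using FluxII by (simp add: add.commute)
  qed
  then have W: "W2 fl k k T X u t j = (\<Sum>n=1..k. g n)" by (simp only: sum_even_odd)
  have "uI fl k k T X u t j = radau k X j fl (u t) - W2 fl k k T X u t j" by (cases fl) auto
  then show ?thesis by (simp add: Pu_def interp_def W r g_def)
qed

lemma degree_P:
  assumes "t \<in> {0..T}" "j \<in> {1..N}"
  shows "degree (Pu t j) \<le> k" "degree (Pq t j) \<le> k" "degree (uh t j) \<le> k" "degree (qh t j) \<le> k"
  using mesh_cell.degree_interp[OF mc[OF assms(2)]] D_cell[OF assms, of 0] D_cell[OF assms, of 1] sol assms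
  by (auto simp: Pu_def Pq_def ldg_solution_def Vh_def)

lemma P_ends:
  assumes "t \<in> {0..T}" "j \<in> {1..N}"
  shows "poly (Pu t j) (endpt X j fl) = D 0 t (endpt X j fl)"
    "poly (Pq t j) (endpt X j (opp fl)) = D 1 t (endpt X j (opp fl))"
  using mesh_cell.interp_end[OF mc[OF assms(2)]] D_cell[OF assms, of 0] D_cell[OF assms, of 1]
  by (simp_all add: Pu_def Pq_def)

lemma scheme:
  assumes "t \<in> {0..T}" "j \<in> {1..N}" "degree w \<le> k"
  shows "ip X j (\<lambda>x. dt T (\<lambda>s. poly (uh s j) x) t) (poly w) = - ip X j (poly (qh t j)) (poly (pderiv w))
      + uhat (opp fl) N X b t (qh t) j * poly w (X j) - uhat (opp fl) N X b t (qh t) (j - 1) * poly w (X (j - 1))"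
    "ip X j (poly (qh t j)) (poly w) = - ip X j (poly (uh t j)) (poly (pderiv w))
      + uhat fl N X b t (uh t) j * poly w (X j) - uhat fl N X b t (uh t) (j - 1) * poly w (X (j - 1))"
proof -
  have V: "(\<lambda>_. w) \<in> Vh k N" using assms(3) by (simp add: Vh_def)
  note s = sol[unfolded ldg_solution_def qhat_eq_uhat, THEN conjunct2, THEN conjunct2, THEN bspec, OF assms(1),
      THEN bspec, OF V, THEN bspec, OF V, THEN bspec, OF assms(2)]
  show "ip X j (\<lambda>x. dt T (\<lambda>s. poly (uh s j) x) t) (poly w) = - ip X j (poly (qh t j)) (poly (pderiv w))
      + uhat (opp fl) N X b t (qh t) j * poly w (X j) - uhat (opp fl) N X b t (qh t) (j - 1) * poly w (X (j - 1))"
    by (rule conjunct1[OF s])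
  show "ip X j (poly (qh t j)) (poly w) = - ip X j (poly (uh t j)) (poly (pderiv w))
      + uhat fl N X b t (uh t) j * poly w (X j) - uhat fl N X b t (uh t) (j - 1) * poly w (X (j - 1))"
    by (rule conjunct2[OF s])
qed

lemma exact_by_parts:
  assumes t: "t \<in> {0..T}" and j: "j \<in> {1..N}" and i: "i < 2 * k + 1"
  shows "ip X j (D (Suc i) t) (poly w) = - ip X j (D i t) (poly (pderiv w))
      + D i t (X j) * poly w (X j) - D i t (X (j - 1)) * poly w (X (j - 1))"
proof -
  let ?K = "{X (j - 1)..X j}"
  have c: "continuous_on ?K (D i t)" "continuous_on ?K (D (Suc i) t)"
    using D_cell[OF t j] i by (auto simp: cell_def)
  have "((\<lambda>x. D (Suc i) t x * poly w x + D i t x * poly (pderiv w) x) has_integral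
     (D i t (X j) * poly w (X j) - D i t (X (j - 1)) * poly w (X (j - 1)))) ?K"
  proof (rule fundamental_theorem_of_calculus)
    show "X (j - 1) \<le> X j" using lt[OF j] by simp
    fix x assume x: "x \<in> ?K"
    have K: "?K \<subseteq> I" using cell_sub[OF j] by (simp add: cell_def)
    have d: "(D i t has_real_derivative D (Suc i) t x) (at x within ?K)"
      using D_deriv[OF t i, of x] x K by (intro has_field_derivative_subset[OF _ K]) auto
    have "((\<lambda>x. D i t x * poly w x) has_real_derivative D (Suc i) t x * poly w x + D i t x * poly (pderiv w) x) (at x within ?K)"
      by (rule DERIV_cong[OF DERIV_mult[OF d poly_DERIV[THEN DERIV_subset]]]) (auto simp: mult.commute)
    then show "((\<lambda>x. D i t x * poly w x) has_vector_derivative D (Suc i) t x * poly w x + D i t x * poly (pderiv w) x) (at x within ?K)"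
      by (simp add: has_real_derivative_iff_has_vector_derivative)
  qed
  then have "integral ?K (\<lambda>x. D (Suc i) t x * poly w x + D i t x * poly (pderiv w) x) =
      D i t (X j) * poly w (X j) - D i t (X (j - 1)) * poly w (X (j - 1))" by (rule integral_unique)
  moreover have "integral ?K (\<lambda>x. D (Suc i) t x * poly w x + D i t x * poly (pderiv w) x) =
     integral ?K (\<lambda>x. D (Suc i) t x * poly w x) + integral ?K (\<lambda>x. D i t x * poly (pderiv w) x)"
    by (intro integral_add integrable_continuous_real continuous_on_mult c continuous_intros)
  ultimately show ?thesis by (simp add: ip_def cell_def)
qed

text \<open>At interior nodes the interpolation takes the exact value on the side from which the
  flux is read. At the outer node periodicity or the prescribed value plays this role.\<close>

lemma node_trace:
  assumes P: "\<And>j. j \<in> {1..N} \<Longrightarrow> poly (P j) (endpt X j e) = f (endpt X j e)"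
    and per: "b = Periodic \<Longrightarrow> f 0 = f (2 * pi)"
    and mix: "\<And>g0 g1. b = Mixed g0 g1 \<Longrightarrow> (case e of FluxI \<Rightarrow> f 0 = g0 t | FluxII \<Rightarrow> f (2 * pi) = g1 t)"
    and i: "i \<le> N"
  shows "f (X i) - uhat e N X b t v i = uhat e N X (hom_bc b) 0 (\<lambda>j. P j - v j) i"
proof (cases e)
  case FluxI
  show ?thesis
    using P[of i] P[of N] per mix i N1 FluxI X0 XN by (cases b) (auto simp: trace_minus_def)
next
  case FluxII
  show ?thesis
    using P[of "Suc i"] P[of 1] per mix i N1 FluxII X0 XN by (cases b) (auto simp: trace_plus_def)
qed

lemma D_boundary:
  assumes t: "t \<in> {0..T}"
  shows "b = Periodic \<Longrightarrow> D 0 t 0 = D 0 t (2 * pi)" "b = Periodic \<Longrightarrow> D 1 t 0 = D 1 t (2 * pi)"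
    "b = Mixed g0 g1 \<Longrightarrow> (case fl of FluxI \<Rightarrow> D 0 t 0 = g0 t | FluxII \<Rightarrow> D 0 t (2 * pi) = g1 t)"
    "b = Mixed g0 g1 \<Longrightarrow> (case opp fl of FluxI \<Rightarrow> D 1 t 0 = g0 t | FluxII \<Rightarrow> D 1 t (2 * pi) = g1 t)"
  using bcond u_eq[OF t, of 0] u_eq[OF t, of "2 * pi"] dx_eq[OF t, of 0] dx_eq[OF t, of "2 * pi"] t
  by (cases fl; force)+

definition err_u :: "real \<Rightarrow> nat \<Rightarrow> real poly" where
  "err_u t j = Pu t j - uh t j"

definition err_q :: "real \<Rightarrow> nat \<Rightarrow> real poly" where
  "err_q t j = Pq t j - qh t j"

lemma degree_err: "t \<in> {0..T} \<Longrightarrow> j \<in> {1..N} \<Longrightarrow> degree (err_u t j) \<le> k"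
  "t \<in> {0..T} \<Longrightarrow> j \<in> {1..N} \<Longrightarrow> degree (err_q t j) \<le> k"
  unfolding err_u_def err_q_def by (intro degree_diff_le degree_P; assumption)+

lemma node_err:
  assumes "t \<in> {0..T}" "i \<le> N"
  shows "D 0 t (X i) - uhat fl N X b t (uh t) i = uhat fl N X (hom_bc b) 0 (err_u t) i"
    "D 1 t (X i) - uhat (opp fl) N X b t (qh t) i = uhat (opp fl) N X (hom_bc b) 0 (err_q t) i"
proof -
  show "D 0 t (X i) - uhat fl N X b t (uh t) i = uhat fl N X (hom_bc b) 0 (err_u t) i"
    unfolding err_u_def[abs_def]
    by (rule node_trace) (use P_ends(1) D_boundary(1,3) assms in auto)
  show "D 1 t (X i) - uhat (opp fl) N X b t (qh t) i = uhat (opp fl) N X (hom_bc b) 0 (err_q t) i"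
    unfolding err_q_def[abs_def]
    by (rule node_trace) (use P_ends(2) D_boundary(2,4) assms in auto)
qed

text \<open>Coordinates, up to sign, of the one correction term that
  \<open>interp_consistency\<close> leaves. It is used at the end \<open>opp fl\<close> with order k
  + 1 in the equation for q, and at the end \<open>fl\<close> with order k + 2 in the equation for
  u.\<close>

definition resid :: "flux \<Rightarrow> (real \<Rightarrow> real) \<Rightarrow> nat \<times> nat \<Rightarrow> real" where
  "resid e f i = - (hbar X (fst i) ^ k * coef k X (fst i) (alt e k) f *
     ip X (fst i) (poly (Zp k X (fst i) e k)) (poly (phi i)))"

lemma err_q_eq:
  assumes t: "t \<in> {0..T}" and i: "i \<in> idx"
  shows "crd (err_q t) i = mv idx (dmat b fl) (crd (err_u t)) i + resid (opp fl) (D (Suc k) t) i"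
proof -
  let ?j = "fst i" and ?w = "phi i"
  note j = idxD(1)[OF i] and w = degree_phi[OF i]
  have nodes: "D 0 t (X ?j) - uhat fl N X b t (uh t) ?j = uhat fl N X (hom_bc b) 0 (err_u t) ?j"
    "D 0 t (X (?j - 1)) - uhat fl N X b t (uh t) (?j - 1) = uhat fl N X (hom_bc b) 0 (err_u t) (?j - 1)"
    using node_err(1)[OF t, of ?j] node_err(1)[OF t, of "?j - 1"] j by auto
  have cons: "ip X ?j (D 1 t) (poly ?w) - ip X ?j (poly (Pq t ?j)) (poly ?w)
     + (ip X ?j (D 0 t) (poly (pderiv ?w)) - ip X ?j (poly (Pu t ?j)) (poly (pderiv ?w))) =
     hbar X ?j ^ k * coef k X ?j (alt (opp fl) k) (D (Suc k) t) * ip X ?j (poly (Zp k X ?j (opp fl) k)) (poly ?w)"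
    unfolding Pu_def Pq_def
    by (rule mesh_cell.interp_consistency[OF mc[OF j], where D = "\<lambda>i. D i t"]) (use D_cell[OF t j] w k in auto)
  have "mv idx (dmat b fl) (crd (err_u t)) i = dform N X b fl (err_u t) ?j ?w"
    by (rule mv_dmat) (use degree_err t i in auto)
  moreover have "crd (err_q t) i = ip X ?j (poly (Pq t ?j)) (poly ?w) - ip X ?j (poly (qh t ?j)) (poly ?w)"
    by (simp add: crd_def err_q_def ip_poly_diff)
  moreover have "ip X ?j (poly (err_u t ?j)) (poly (pderiv ?w)) =
      ip X ?j (poly (Pu t ?j)) (poly (pderiv ?w)) - ip X ?j (poly (uh t ?j)) (poly (pderiv ?w))"
    by (simp add: err_u_def ip_poly_diff)
  ultimately show ?thesis
    using cons scheme(2)[OF t j w] exact_by_parts[OF t j, of 0 ?w]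
    unfolding dform_def nodes[symmetric] resid_def by (simp add: algebra_simps)
qed

lemma phi_bound:
  assumes i: "i \<in> idx" and x: "x \<in> cell X (fst i)"
  shows "\<bar>poly (phi i) x\<bar> \<le> sqrt ((2 * real k + 1) / hlen X (fst i)) * legb k"
proof -
  note j = idxD(1)[OF i] and m = idxD(2)[OF i]
  have hp: "0 < hlen X (fst i)" by (rule hlen_pos[OF j])
  have "\<bar>poly (phi i) x\<bar> = sqrt ((2 * real (snd i) + 1) / hlen X (fst i)) * \<bar>poly (Lcell X (fst i) (snd i)) x\<bar>"
    using hp by (simp add: phi_def abs_mult)
  also have "\<dots> \<le> sqrt ((2 * real k + 1) / hlen X (fst i)) * legb k"
    using hp m mesh_cell.L_bound[OF mc[OF j] m x] by (intro mult_mono real_sqrt_le_mono divide_right_mono) auto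
  finally show ?thesis .
qed

lemma ip_time_derivative_D:
  assumes i: "i \<in> idx" and t: "t \<in> {0..T}" and l: "l + 2 \<le> 2 * k + 1"
  shows "((\<lambda>s. ip X (fst i) (D l s) (poly (phi i))) has_real_derivative ip X (fst i) (D (l + 2) t) (poly (phi i))) (at t within {0..T})"
proof (rule functional_time_derivative[OF t l])
  note j = idxD(1)[OF i]
  note [intro] = continuous_on_subset[OF _ cell_sub[OF j]]
  have cp: "continuous_on (cell X (fst i)) (poly (phi i))" by (intro continuous_intros)
  fix f g :: "real \<Rightarrow> real" and S c :: real assume f: "continuous_on I f"
  { assume g: "continuous_on I g"
    show "ip X (fst i) (\<lambda>x. f x - g x) (poly (phi i)) = ip X (fst i) f (poly (phi i)) - ip X (fst i) g (poly (phi i))"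
      by (rule ip_diff_left) (use f g cp in auto) }
  show "ip X (fst i) (\<lambda>x. c * f x) (poly (phi i)) = c * ip X (fst i) f (poly (phi i))"
    by (rule ip_scale_left)
  assume S: "\<And>x. x \<in> I \<Longrightarrow> \<bar>f x\<bar> \<le> S"
  have "\<bar>ip X (fst i) f (poly (phi i))\<bar> \<le> hlen X (fst i) * S * (sqrt ((2 * real k + 1) / hlen X (fst i)) * legb k)"
    by (rule mesh_cell.ip_bound[OF mc[OF j]]) (use f S cp cell_sub[OF j] phi_bound[OF i] in auto)
  then show "\<bar>ip X (fst i) f (poly (phi i))\<bar> \<le> hlen X (fst i) * (sqrt ((2 * real k + 1) / hlen X (fst i)) * legb k) * S"
    by (simp add: mult_ac)
qed

text \<open>\<open>interp_residual\<close> writes the moments of the interpolation through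
  functionals of x-derivatives of order at most k, so their time derivatives have order at most k +
  2, which \<open>1 \<le> k\<close> keeps within 2k + 1. The result is the interpolation of the
  chain shifted by two.\<close>

lemma Pu_time_derivative:
  assumes i: "i \<in> idx" and t: "t \<in> {0..T}"
  shows "((\<lambda>s. ip X (fst i) (poly (Pu s (fst i))) (poly (phi i))) has_real_derivative
     ip X (fst i) (poly (interp k X (fst i) fl (\<lambda>l. D (l + 2) t))) (poly (phi i))) (at t within {0..T})"
proof -
  let ?j = "fst i" and ?w = "phi i"
  note j = idxD(1)[OF i] and w = degree_phi[OF i]
  let ?S = "\<lambda>s a. \<Sum>l\<le>k. hbar X ?j ^ l * coef k X ?j (alt fl l) (D (l + a) s) * ip X ?j (poly (Zp k X ?j fl l)) (poly ?w)"
  have res: "ip X ?j (poly (interp k X ?j fl (\<lambda>l. D (l + a) s))) (poly ?w) = ip X ?j (D a s) (poly ?w) - ?S s a"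
    if "s \<in> {0..T}" "k + a \<le> 2 * k + 1" for s a
    using mesh_cell.interp_residual[OF mc[OF j], of "\<lambda>l. D (l + a) s" ?w fl] D_cell[OF that(1) j] that w by simp
  have "((\<lambda>s. ip X ?j (D 0 s) (poly ?w) - ?S s 0) has_real_derivative ip X ?j (D 2 t) (poly ?w) - ?S t 2) (at t within {0..T})"
  proof (intro DERIV_diff DERIV_sum DERIV_cmult_right DERIV_cmult)
    show "((\<lambda>s. ip X ?j (D 0 s) (poly ?w)) has_real_derivative ip X ?j (D 2 t) (poly ?w)) (at t within {0..T})"
      using ip_time_derivative_D[OF i t, of 0] k by (simp add: numeral_2_eq_2)
    fix l assume "l \<in> {..k}"
    then show "((\<lambda>s. coef k X ?j (alt fl l) (D (l + 0) s)) has_real_derivative coef k X ?j (alt fl l) (D (l + 2) t)) (at t within {0..T})"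
      using coef_time_derivative[OF j t, of l "alt fl l"] k by simp
  qed
  then have "((\<lambda>s. ip X ?j (D 0 s) (poly ?w) - ?S s 0) has_real_derivative
     ip X ?j (poly (interp k X ?j fl (\<lambda>l. D (l + 2) t))) (poly ?w)) (at t within {0..T})"
    using res[OF t, of 2] k by (simp only:)
  then show ?thesis
    by (rule has_field_derivative_transform_within[OF _ zero_less_one t]) (use res[of _ 0] in \<open>simp add: Pu_def\<close>)
qed

text \<open>Consistency is now applied to the chain starting at q and to the end
  \<open>opp fl\<close>: its first derivative is u_t, and its companion interpolation is the time
  derivative of \<open>Pu\<close>.\<close>

lemma err_u_derivative:
  assumes i: "i \<in> idx" and t: "t \<in> {0..T}"
  shows "((\<lambda>s. crd (err_u s) i) has_real_derivative
     - mv idx (trp (dmat b fl)) (crd (err_q t)) i + resid fl (D (k + 2) t) i) (at t within {0..T})"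
proof -
  let ?j = "fst i" and ?w = "phi i"
  note j = idxD(1)[OF i] and w = degree_phi[OF i]
  let ?P2 = "interp k X ?j fl (\<lambda>l. D (l + 2) t)"
  have nodes: "D 1 t (X ?j) - uhat (opp fl) N X b t (qh t) ?j = uhat (opp fl) N X (hom_bc b) 0 (err_q t) ?j"
    "D 1 t (X (?j - 1)) - uhat (opp fl) N X b t (qh t) (?j - 1) = uhat (opp fl) N X (hom_bc b) 0 (err_q t) (?j - 1)"
    using node_err(2)[OF t, of ?j] node_err(2)[OF t, of "?j - 1"] j by auto
  have cons: "ip X ?j (D 2 t) (poly ?w) - ip X ?j (poly ?P2) (poly ?w)
     + (ip X ?j (D 1 t) (poly (pderiv ?w)) - ip X ?j (poly (Pq t ?j)) (poly (pderiv ?w))) =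
     hbar X ?j ^ k * coef k X ?j (alt fl k) (D (k + 2) t) * ip X ?j (poly (Zp k X ?j fl k)) (poly ?w)"
    using mesh_cell.interp_consistency[OF mc[OF j], of "\<lambda>i. D (Suc i) t" ?w "opp fl"] D_cell[OF t j] w k
    by (simp add: Pq_def numeral_2_eq_2)
  have diff: "(\<lambda>s. poly (uh s ?j) x) differentiable (at t within {0..T})" if "x \<in> cell X ?j" for x
    using sol t j that unfolding ldg_solution_def by blast
  have du: "((\<lambda>s. ip X ?j (poly (uh s ?j)) (poly ?w)) has_real_derivative
      ip X ?j (\<lambda>x. dt T (\<lambda>s. poly (uh s ?j) x) t) (poly ?w)) (at t within {0..T})"
    by (rule ip_time_derivative[OF T t lt[OF j] k degree_P(3)[OF _ j] diff])
  have "((\<lambda>s. crd (err_u s) i) has_real_derivative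
      ip X ?j (poly ?P2) (poly ?w) - ip X ?j (\<lambda>x. dt T (\<lambda>s. poly (uh s ?j) x) t) (poly ?w)) (at t within {0..T})"
    using DERIV_diff[OF Pu_time_derivative[OF i t] du] by (simp add: crd_def err_u_def ip_poly_diff)
  moreover have "- mv idx (trp (dmat b fl)) (crd (err_q t)) i = dform N X b (opp fl) (err_q t) ?j ?w"
    by (rule mv_dmat_opp) (use degree_err t i in auto)
  moreover have "ip X ?j (poly (err_q t ?j)) (poly (pderiv ?w)) =
      ip X ?j (poly (Pq t ?j)) (poly (pderiv ?w)) - ip X ?j (poly (qh t ?j)) (poly (pderiv ?w))"
    by (simp add: err_q_def ip_poly_diff)
  moreover have "ip X ?j (D 2 t) (poly ?w) = - ip X ?j (D 1 t) (poly (pderiv ?w))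
      + D 1 t (X ?j) * poly ?w (X ?j) - D 1 t (X (?j - 1)) * poly ?w (X (?j - 1))"
    using exact_by_parts[OF t j, of 1 ?w] k by (simp add: numeral_2_eq_2)
  ultimately show ?thesis
    using cons scheme(1)[OF t j w]
    unfolding dform_def nodes[symmetric] resid_def by (elim DERIV_cong) (simp add: algebra_simps)
qed

text \<open>This provides the primitive B. With order k in place of k + 2, the smooth bound for the
  coefficient asks for two x-derivatives fewer.\<close>

lemma resid_derivative:
  assumes i: "i \<in> idx" and t: "t \<in> {0..T}"
  shows "((\<lambda>s. resid fl (D k s) i) has_real_derivative resid fl (D (k + 2) t) i) (at t within {0..T})"
  unfolding resid_def
  by (intro DERIV_minus DERIV_cmult_right DERIV_cmult coef_time_derivative idxD(1)[OF i] t) (use k in simp)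

section \<open>Estimates\<close>

lemma resid_diff:
  assumes "i \<in> idx" "s \<in> {0..T}" "t \<in> {0..T}" "l \<le> 2 * k + 1"
  shows "resid e (\<lambda>x. D l t x - D l s x) i = resid e (D l t) i - resid e (D l s) i"
  unfolding resid_def
    mesh_cell.coef_diff[OF mc[OF idxD(1)[OF assms(1)]] D_cell[OF assms(3) idxD(1)[OF assms(1)] assms(4)]
      D_cell[OF assms(2) idxD(1)[OF assms(1)] assms(4)]]
  by (simp add: algebra_simps)

text \<open>The correction carries \<open>hbar ^ k\<close>, the coefficient gains another k powers
  of the length with the oscillation of \<open>F k\<close>, and the normalised basis function
  contributes a square root of the length; \<open>L2_cells\<close> sums these bounds.\<close>

lemma resid_L2:
  assumes ab: "0 \<le> \<alpha>" "0 \<le> \<beta>"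
    and F: "\<And>l x. l < k \<Longrightarrow> x \<in> I \<Longrightarrow> (F l has_real_derivative F (Suc l) x) (at x within I)"
    and cF: "continuous_on I (F 0)"
    and inc: "\<And>x y. 0 \<le> y \<Longrightarrow> y \<le> x \<Longrightarrow> x \<le> 2 * pi \<Longrightarrow> \<bar>F k x - F k y\<bar> \<le> Af \<alpha> \<beta> x - Af \<alpha> \<beta> y"
  shows "L2_set (resid e (F 0)) idx \<le> 6 * sqrt (real k + 1) * residC k * h ^ (2 * k + 1) * (\<alpha> + \<beta>)"
proof (rule L2_cells[OF residC_nonneg ab])
  fix j m assume j: "j \<in> {1..N}" and m: "m \<le> k"
  let ?i = "(j, m)" and ?d = "Af \<alpha> \<beta> (X j) - Af \<alpha> \<beta> (X (j - 1))"
  have i: "?i \<in> idx" using j m by (simp add: idx_def)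
  have hp: "0 < hlen X j" by (rule hlen_pos[OF j])
  have cI: "cell X j \<subseteq> I" by (rule cell_sub[OF j])
  have osc': "\<bar>F k x - F k y\<bar> \<le> ?d" if xy: "x \<in> cell X j" "y \<in> cell X j" "y \<le> x" for x y
  proof -
    have b: "0 \<le> X (j - 1)" "X (j - 1) \<le> y" "x \<le> X j" "X j \<le> 2 * pi"
      using xy X_in[of "j - 1"] X_in[of j] j by (auto simp: cell_def)
    have "\<bar>F k x - F k y\<bar> \<le> Af \<alpha> \<beta> x - Af \<alpha> \<beta> y" using b xy by (intro inc) auto
    moreover have "Af \<alpha> \<beta> x \<le> Af \<alpha> \<beta> (X j)" "Af \<alpha> \<beta> (X (j - 1)) \<le> Af \<alpha> \<beta> y"
      using b xy by (auto intro!: Af_mono ab)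
    ultimately show ?thesis by linarith
  qed
  have osc: "\<bar>F k x - F k y\<bar> \<le> ?d" if "x \<in> cell X j" "y \<in> cell X j" for x y
    using osc'[of x y] osc'[of y x] that by (cases "y \<le> x") (auto simp: abs_minus_commute)
  have co: "\<bar>coef k X j (alt e k) (F 0)\<bar> \<le> coefC k * (hlen X j ^ k * ?d)"
  proof (rule mesh_cell.coef_smooth_bound[OF mc[OF j], where D = F and n = k])
    fix l x assume "l < k" "x \<in> cell X j"
    then show "(F l has_real_derivative F (Suc l) x) (at x within cell X j)"
      using cI by (intro has_field_derivative_subset[OF F cI]) auto
  qed (use continuous_on_subset[OF cF cI] osc in auto)
  have "\<bar>ip X j (poly (Zp k X j e k)) (poly (phi ?i))\<bar> \<le> hlen X j * zC k k * (sqrt ((2 * real k + 1) / hlen X j) * legb k)"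
    using phi_bound[OF i] mesh_cell.Z_bound[OF mc[OF j]]
    by (intro mesh_cell.ip_bound[OF mc[OF j]] mesh_cell.K_cont_poly[OF mc[OF j]]) auto
  also have "\<dots> = zC k k * legb k * sqrt (2 * real k + 1) * sqrt (hlen X j)"
  proof -
    have "hlen X j * sqrt ((2 * real k + 1) / hlen X j) = sqrt (2 * real k + 1) * (hlen X j / sqrt (hlen X j))"
      by (simp add: real_sqrt_divide)
    also have "hlen X j / sqrt (hlen X j) = sqrt (hlen X j)" using hp by (simp add: real_div_sqrt)
    finally show ?thesis by (simp add: mult_ac)
  qed
  finally have z: "\<bar>ip X j (poly (Zp k X j e k)) (poly (phi ?i))\<bar> \<le> zC k k * legb k * sqrt (2 * real k + 1) * sqrt (hlen X j)" .
  have hb: "\<bar>hbar X j ^ k\<bar> \<le> hlen X j ^ k"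
    using hp by (simp add: hbar_def power_mono)
  have d0: "0 \<le> ?d" using osc[of "X j" "X j"] lt[OF j] by (simp add: cell_def)
  have "\<bar>resid e (F 0) ?i\<bar> = \<bar>hbar X j ^ k\<bar> * \<bar>coef k X j (alt e k) (F 0)\<bar> * \<bar>ip X j (poly (Zp k X j e k)) (poly (phi ?i))\<bar>"
    by (simp add: resid_def abs_mult)
  also have "\<dots> \<le> hlen X j ^ k * (coefC k * (hlen X j ^ k * ?d)) * (zC k k * legb k * sqrt (2 * real k + 1) * sqrt (hlen X j))"
    using hp d0 coefC_pos[of k] by (intro mult_mono hb co z) auto
  also have "\<dots> = residC k * hlen X j ^ (2 * k) * sqrt (hlen X j) * ?d"
    unfolding residC_def mult_2 power_add by (simp only: mult_ac)
  finally show "\<bar>resid e (F 0) ?i\<bar> \<le> residC k * hlen X j ^ (2 * k) * sqrt (hlen X j) * ?d" .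
qed

definition KC :: real where
  "KC = 6 * sqrt (real k + 1) * residC k * h ^ (2 * k + 1)"

lemma KC_nonneg: "0 \<le> KC"
  unfolding KC_def using residC_nonneg h_pos by simp

lemma resid_q_bound:
  assumes t: "t \<in> {0..T}"
  shows "L2_set (resid e (D (Suc k) t)) idx \<le> KC * M"
proof -
  have "L2_set (resid e (D (Suc k + 0) t)) idx \<le> KC * (M + 0)"
    unfolding KC_def
  proof (rule resid_L2[where F = "\<lambda>l. D (Suc k + l) t"])
    fix x y :: real assume xy: "0 \<le> y" "y \<le> x" "x \<le> 2 * pi"
    have "\<bar>D (2 * k + 1) t x - D (2 * k + 1) t y\<bar> \<le> M * \<bar>x - y\<bar>"
      using xy by (intro D_lip t order_refl) auto
    moreover have "\<bar>x - y\<bar> = x - y" using xy by simp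
    moreover have "Suc k + k = 2 * k + 1" by simp
    ultimately show "\<bar>D (Suc k + k) t x - D (Suc k + k) t y\<bar> \<le> Af M 0 x - Af M 0 y"
      by (simp only:) (simp add: Af_def algebra_simps)
  qed (use M_nonneg D_deriv[OF t] D_cont[OF t] in auto)
  then show ?thesis by simp
qed

lemma resid_diff_L2:
  assumes st: "s \<in> {0..T}" "t \<in> {0..T}" and ab: "0 \<le> \<alpha>" "0 \<le> \<beta>" and a: "a + k \<le> 2 * k + 1"
    and inc: "\<And>x y. 0 \<le> y \<Longrightarrow> y \<le> x \<Longrightarrow> x \<le> 2 * pi \<Longrightarrow>
      \<bar>(D (a + k) t x - D (a + k) s x) - (D (a + k) t y - D (a + k) s y)\<bar> \<le> Af \<alpha> \<beta> x - Af \<alpha> \<beta> y"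
  shows "L2_set (\<lambda>i. resid e (D a t) i - resid e (D a s) i) idx \<le> KC * (\<alpha> + \<beta>)"
proof -
  have "L2_set (resid e (\<lambda>x. D (a + 0) t x - D (a + 0) s x)) idx \<le> KC * (\<alpha> + \<beta>)"
    unfolding KC_def
    by (rule resid_L2[OF ab, where F = "\<lambda>l x. D (a + l) t x - D (a + l) s x"])
      (use inc a D_deriv[OF st(1)] D_deriv[OF st(2)] D_cont[OF st(1)] D_cont[OF st(2)] in \<open>auto intro!: DERIV_diff continuous_on_diff\<close>)
  moreover have "L2_set (resid e (\<lambda>x. D (a + 0) t x - D (a + 0) s x)) idx = L2_set (\<lambda>i. resid e (D a t) i - resid e (D a s) i) idx"
    by (rule L2_set_cong) (use resid_diff st a in auto)
  ultimately show ?thesis by simp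
qed

lemma L2_set_minus_commute: "L2_set (\<lambda>i. f i - g i) A = L2_set (\<lambda>i. g i - f i) A"
  by (simp add: L2_set_def power2_commute)

text \<open>The residual bounds hold with factors 1, 32 and 1296. The largest is taken as K, so that
  one instance serves both estimates.\<close>

lemma ode:
  assumes t: "0 < t" "t \<le> T"
  shows "ldg_ode idx (dmat b fl) t (1296 * (KC * M)) (\<lambda>s. crd (err_u s)) (\<lambda>s. crd (err_q s))
    (\<lambda>s. resid (opp fl) (D (Suc k) s)) (\<lambda>s. resid fl (D k s)) (\<lambda>s. resid fl (D (k + 2) s))"
proof
  have KM: "0 \<le> KC * M" using KC_nonneg M_nonneg by simp
  show "finite idx" "0 < t" "0 \<le> 1296 * (KC * M)" using t KM by auto
  have sub: "{0..t} \<subseteq> {0..T}" using t by auto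
  show "crd (err_u 0) i = 0" if "i \<in> idx" for i
    using init[OF idxD(1)[OF that]] uI_eq_Pu[OF idxD(1)[OF that], of 0] T by (simp add: crd_def err_u_def ip_def)
  fix s assume s: "0 \<le> s" "s \<le> t"
  then have s': "s \<in> {0..T}" using t by auto
  show "((\<lambda>s. crd (err_u s) i) has_real_derivative - mv idx (trp (dmat b fl)) (crd (err_q s)) i + resid fl (D (k + 2) s) i) (at s within {0..t})"
    if "i \<in> idx" for i
    by (rule has_field_derivative_subset[OF err_u_derivative[OF that s'] sub])
  show "((\<lambda>s. resid fl (D k s) i) has_real_derivative resid fl (D (k + 2) s) i) (at s within {0..t})" if "i \<in> idx" for i
    by (rule has_field_derivative_subset[OF resid_derivative[OF that s'] sub])
  show "crd (err_q s) i = mv idx (dmat b fl) (crd (err_u s)) i + resid (opp fl) (D (Suc k) s) i" if "i \<in> idx" for i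
    by (rule err_q_eq[OF s' that])
  show "L2_set (resid (opp fl) (D (Suc k) s)) idx \<le> 1296 * (KC * M)"
    using resid_q_bound[OF s', of "opp fl"] KM by linarith
  have "L2_set (\<lambda>i. resid fl (D k t) i - resid fl (D k s) i) idx \<le> KC * (32 * M * sqrt (t - s) + 0)"
  proof (rule resid_diff_L2[OF s'])
    have "k + k = 2 * k + 1 - 1" by simp
    then show "\<bar>(D (k + k) t x - D (k + k) s x) - (D (k + k) t y - D (k + k) s y)\<bar> \<le>
       Af (32 * M * sqrt (t - s)) 0 x - Af (32 * M * sqrt (t - s)) 0 y"
      if "0 \<le> y" "y \<le> x" "x \<le> 2 * pi" for x y
      using D_pred_sqrt[OF s t(2) that] by (simp only:)
  qed (use s t M_nonneg in auto)
  also have "\<dots> = 32 * ((KC * M) * sqrt (t - s))" by simp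
  also have "\<dots> \<le> 1296 * ((KC * M) * sqrt (t - s))" using KM s by (intro mult_right_mono) auto
  finally show "L2_set (\<lambda>i. resid fl (D k s) i - resid fl (D k t) i) idx \<le> 1296 * (KC * M) * sqrt (t - s)"
    by (simp only: L2_set_minus_commute[of "resid fl (D k s)" "resid fl (D k t)"] mult.assoc)
qed

text \<open>Time 0 is separate because the abstract estimate requires a positive time. The factor
  38880 = 30 * 1296 is the one that arises for q, so both errors share a constant; here 5 * 1296
  would come out.\<close>

lemma err_u_bound: 
  assumes t: "t \<in> {0..T}"
  shows "L2_set (crd (err_u t)) idx \<le> 38880 * (KC * M) * (1 + t)"
proof (cases "t = 0")
  case True
  have "crd (err_u 0) i = 0" if "i \<in> idx" for i
    using init[OF idxD(1)[OF that]] uI_eq_Pu[OF idxD(1)[OF that], of 0] T by (simp add: crd_def err_u_def ip_def)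
  then have "L2_set (crd (err_u 0)) idx = 0" by (simp add: L2_set_def)
  then show ?thesis using True KC_nonneg M_nonneg by simp
next
  case False
  then have "0 < t" "t \<le> T" using t by auto
  from ldg_ode.estimate_u[OF ode[OF this]]
  have "L2_set (crd (err_u t)) idx \<le> 6480 * (KC * M) * sqrt t" by simp
  also have "\<dots> \<le> 38880 * (KC * M) * (1 + t)"
  proof (intro mult_mono)
    have "0 \<le> (sqrt t - 1)\<^sup>2" by simp
    then have "2 * sqrt t \<le> 1 + t" using t by (simp add: power2_eq_square algebra_simps)
    moreover have "0 \<le> sqrt t" using t by simp
    ultimately show "sqrt t \<le> 1 + t" by linarith
  qed (use KC_nonneg M_nonneg t in auto)
  finally show ?thesis .
qed

lemma err_q_bound:
  assumes t: "t \<in> {0..T}"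
  shows "L2_set (crd (err_q t)) idx \<le> 38880 * (KC * M) * (1 + sqrt t)"
proof (cases "t = 0")
  case True
  have u0: "crd (err_u 0) i = 0" if "i \<in> idx" for i
    using init[OF idxD(1)[OF that]] uI_eq_Pu[OF idxD(1)[OF that], of 0] T by (simp add: crd_def err_u_def ip_def)
  \<comment> \<open>The error of q does not vanish initially: it equals the residual of its
    equation, of size h^(2k+1).\<close>
  have "crd (err_q 0) i = resid (opp fl) (D (Suc k) 0) i" if "i \<in> idx" for i
    using err_q_eq[of 0 i] that u0 T by (simp add: mv_def)
  then have "L2_set (crd (err_q 0)) idx = L2_set (resid (opp fl) (D (Suc k) 0)) idx" by (intro L2_set_cong) auto
  also have "\<dots> \<le> KC * M" using T by (intro resid_q_bound) auto
  also have "\<dots> \<le> 38880 * (KC * M)" using KC_nonneg M_nonneg by (simp add: mult_nonneg_nonneg)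
  finally show ?thesis using True by simp
next
  case False
  then have t': "0 < t" "t \<le> T" using t by auto
  interpret o: ldg_ode idx "dmat b fl" t "1296 * (KC * M)" "\<lambda>s. crd (err_u s)" "\<lambda>s. crd (err_q s)"
    "\<lambda>s. resid (opp fl) (D (Suc k) s)" "\<lambda>s. resid fl (D k s)" "\<lambda>s. resid fl (D (k + 2) s)"
    by (rule ode[OF t'])
  have "L2_set (crd (err_q t)) idx \<le> 30 * (1296 * (KC * M)) * (1 + sqrt t)"
  proof (rule o.estimate_q)
    fix s assume s: "0 < s" "s < t"
    then have s': "s \<in> {0..T}" using t by auto
    have "L2_set (\<lambda>i. resid (opp fl) (D (Suc k) t) i - resid (opp fl) (D (Suc k) s) i) idx \<le>
        KC * (1296 * M * ((t - s) / s) + 1296 * M * (t - s) powr (1/8))"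
    proof (rule resid_diff_L2[OF s' t])
      have "Suc k + k = 2 * k + 1" by simp
      then show "\<bar>(D (Suc k + k) t x - D (Suc k + k) s x) - (D (Suc k + k) t y - D (Suc k + k) s y)\<bar> \<le>
         Af (1296 * M * ((t - s) / s)) (1296 * M * (t - s) powr (1/8)) x - Af (1296 * M * ((t - s) / s)) (1296 * M * (t - s) powr (1/8)) y"
        if "0 \<le> y" "y \<le> x" "x \<le> 2 * pi" for x y
        using D_increment[OF s t'(2) that] by (simp only:)
    qed (use s M_nonneg in auto)
    then show "L2_set (\<lambda>i. resid (opp fl) (D (Suc k) t) i - resid (opp fl) (D (Suc k) s) i) idx \<le>
        1296 * (KC * M) * ((t - s) / s + (t - s) powr (1/8))" by (simp add: algebra_simps)
    have "L2_set (\<lambda>i. resid fl (D k t) i - resid fl (D k s) i) idx \<le>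
        KC * (32 * M * ((t - s) / sqrt s) + 32 * M * (t - s) powr (5/8))"
    proof (rule resid_diff_L2[OF s' t])
      have "k + k = 2 * k + 1 - 1" by simp
      then show "\<bar>(D (k + k) t x - D (k + k) s x) - (D (k + k) t y - D (k + k) s y)\<bar> \<le>
         Af (32 * M * ((t - s) / sqrt s)) (32 * M * (t - s) powr (5/8)) x - Af (32 * M * ((t - s) / sqrt s)) (32 * M * (t - s) powr (5/8)) y"
        if "0 \<le> y" "y \<le> x" "x \<le> 2 * pi" for x y
        using D_pred_increment[OF s t'(2) that] by (simp only:)
    qed (use s M_nonneg in auto)
    also have "\<dots> = 32 * (KC * M) * ((t - s) / sqrt s + (t - s) powr (5/8))" by (simp add: algebra_simps)
    also have "\<dots> \<le> 1296 * (KC * M) * ((t - s) / sqrt s + (t - s) powr (5/8))"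
      using KC_nonneg M_nonneg s by (intro mult_right_mono) auto
    finally show "L2_set (\<lambda>i. resid fl (D k s) i - resid fl (D k t) i) idx \<le>
        1296 * (KC * M) * ((t - s) / sqrt s + (t - s) powr (5/8))" by (simp only: L2_set_minus_commute[of "resid fl (D k s)" "resid fl (D k t)"])
  qed
  then show ?thesis by simp
qed

lemma uhat_pol_crd:
  assumes "\<And>j. j \<in> {1..N} \<Longrightarrow> degree (p j) \<le> k" "i \<le> N"
  shows "uhat e N X (hom_bc b) 0 (pol (crd p)) i = uhat e N X (hom_bc b) 0 p i"
  using pol_crd[of _ p] assms N1 by (cases e; cases b) (auto simp: trace_minus_def trace_plus_def)

text \<open>The maximum bound pays the factor h^(-1/2) of the trace inequality, which accounts for
  the exponent 2k + 1/2; in the averaged norm this factor has been compensated.\<close>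

lemma node_errors:
  assumes deg: "\<And>j. j \<in> {1..N} \<Longrightarrow> degree (p j) \<le> k"
    and f: "\<And>i. i \<le> N \<Longrightarrow> f (X i) - fh i = uhat e N X (hom_bc b) 0 p i"
    and B: "L2_set (crd p) idx \<le> 38880 * (KC * M) * B"
  shows "node_max_err N X f fh \<le> 38880 * (6 * sqrt (real k + 1) * residC k) * sqrt (traceC * c) *
      (B * h powr (2 * real k + 1 / 2) * M)"
    and "node_l2_err N X f fh \<le> 38880 * (6 * sqrt (real k + 1) * residC k) * sqrt (traceC * c) *
      (B * h ^ (2 * k + 1) * M)"
proof -
  have e: "f (X i) - fh i = uhat e N X (hom_bc b) 0 (pol (crd p)) i" if "i \<le> N" for i
    using f[OF that] uhat_pol_crd[OF deg that] by simp
  have tc: "0 \<le> sqrt (traceC * c)" using traceC_nonneg c_pos by simp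
  have hp: "h ^ (2 * k + 1) / sqrt h = h powr (2 * real k + 1 / 2)"
  proof -
    have "h ^ (2 * k + 1) / sqrt h = h powr real (2 * k + 1) / h powr (1 / 2)"
      using h_pos by (simp only: powr_realpow powr_half_sqrt less_imp_le)
    also have "\<dots> = h powr (real (2 * k + 1) - 1 / 2)" by (rule powr_diff[symmetric])
    also have "real (2 * k + 1) - 1 / 2 = 2 * real k + 1 / 2" by simp
    finally show ?thesis .
  qed
  have "node_max_err N X f fh \<le> sqrt (traceC * c) / sqrt h * (38880 * (KC * M) * B)"
    unfolding node_max_err_def
  proof (rule Max.boundedI)
    fix a assume "a \<in> (\<lambda>j. \<bar>f (X (j - 1)) - fh (j - 1)\<bar>) ` {1..N + 1}"
    then obtain j where "j \<in> {1..N + 1}" "a = \<bar>f (X (j - 1)) - fh (j - 1)\<bar>" by blast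
    then obtain i where i: "i \<le> N" "a = \<bar>f (X i) - fh i\<bar>" by (cases j) auto
    have "a \<le> sqrt (traceC * c) / sqrt h * L2_set (crd p) idx"
      unfolding i(2) e[OF i(1)] by (rule node_error_max[OF i(1)])
    also have "\<dots> \<le> sqrt (traceC * c) / sqrt h * (38880 * (KC * M) * B)"
      using B tc h_pos by (intro mult_left_mono) auto
    finally show "a \<le> sqrt (traceC * c) / sqrt h * (38880 * (KC * M) * B)" .
  qed auto
  also have "\<dots> = 38880 * (6 * sqrt (real k + 1) * residC k) * sqrt (traceC * c) *
      (B * (h ^ (2 * k + 1) / sqrt h) * M)"
    unfolding KC_def by (simp add: mult_ac)
  finally show "node_max_err N X f fh \<le> 38880 * (6 * sqrt (real k + 1) * residC k) * sqrt (traceC * c) *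
      (B * h powr (2 * real k + 1 / 2) * M)" unfolding hp .
  have "node_l2_err N X f fh = sqrt (1 / real (N + 1) * (\<Sum>j=1..N + 1. (uhat e N X (hom_bc b) 0 (pol (crd p)) (j - 1))\<^sup>2))"
    unfolding node_l2_err_def by (intro arg_cong[where f = sqrt] arg_cong2[where f = "(*)"] refl sum.cong) (auto simp: e)
  also have "\<dots> \<le> sqrt (traceC * c) * L2_set (crd p) idx" by (rule node_error_l2)
  also have "\<dots> \<le> sqrt (traceC * c) * (38880 * (KC * M) * B)" using B tc by (intro mult_left_mono)
  also have "\<dots> = 38880 * (6 * sqrt (real k + 1) * residC k) * sqrt (traceC * c) * (B * h ^ (2 * k + 1) * M)"
    unfolding KC_def by (simp add: mult_ac)
  finally show "node_l2_err N X f fh \<le> 38880 * (6 * sqrt (real k + 1) * residC k) * sqrt (traceC * c) *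
      (B * h ^ (2 * k + 1) * M)" .
qed

lemma final_estimates:
  assumes t: "t \<in> {0..T}"
  defines "C \<equiv> 38880 * (6 * sqrt (real k + 1) * residC k) * sqrt (traceC * c)"
  shows "node_max_err N X (u t) (uhat fl N X b t (uh t)) \<le> C * ((1 + t) * h powr (2 * real k + 1 / 2) * M)"
    "node_l2_err N X (u t) (uhat fl N X b t (uh t)) \<le> C * ((1 + t) * h ^ (2 * k + 1) * M)"
    "node_max_err N X (dx (u t)) (qhat fl N X b t (qh t)) \<le> C * ((1 + t powr (1 / 2)) * h powr (2 * real k + 1 / 2) * M)"
    "node_l2_err N X (dx (u t)) (qhat fl N X b t (qh t)) \<le> C * ((1 + t powr (1 / 2)) * h ^ (2 * k + 1) * M)"
proof -
  have nu: "u t (X i) - uhat fl N X b t (uh t) i = uhat fl N X (hom_bc b) 0 (err_u t) i"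
    and nq: "dx (u t) (X i) - qhat fl N X b t (qh t) i = uhat (opp fl) N X (hom_bc b) 0 (err_q t) i" if "i \<le> N" for i
    using node_err[OF t that] u_eq[OF t X_in[OF that]] dx_eq[OF t X_in[OF that]] by (simp_all add: qhat_eq_uhat)
  show "node_max_err N X (u t) (uhat fl N X b t (uh t)) \<le> C * ((1 + t) * h powr (2 * real k + 1 / 2) * M)"
    "node_l2_err N X (u t) (uhat fl N X b t (uh t)) \<le> C * ((1 + t) * h ^ (2 * k + 1) * M)"
    unfolding C_def by (intro node_errors[OF degree_err(1)[OF t] nu err_u_bound[OF t]]; assumption)+
  have s: "sqrt t = t powr (1 / 2)" using t by (simp add: powr_half_sqrt)
  show "node_max_err N X (dx (u t)) (qhat fl N X b t (qh t)) \<le> C * ((1 + t powr (1 / 2)) * h powr (2 * real k + 1 / 2) * M)"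
    "node_l2_err N X (dx (u t)) (qhat fl N X b t (qh t)) \<le> C * ((1 + t powr (1 / 2)) * h ^ (2 * k + 1) * M)"
    unfolding C_def by (intro node_errors[OF degree_err(2)[OF t] nq err_q_bound[OF t, unfolded s]]; assumption)+
qed

end

section \<open>The family of derivatives of the given solution, and the final bounds\<close>

lemma heat_family_exists:
  assumes n: "2 \<le> n" and T: "0 < T" and heat: "heat_solution T u0 u" and W: "Winf_uniform (Suc n) T u"
  obtains D where "heat_family n (Winf_sup_norm (Suc n) T u) T D"
    "\<And>t x. t \<in> {0..T} \<Longrightarrow> x \<in> {0..2 * pi} \<Longrightarrow> u t x = D 0 t x"
    "\<And>t x. t \<in> {0..T} \<Longrightarrow> x \<in> {0..2 * pi} \<Longrightarrow> dx (u t) x = D 1 t x"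
proof -
  let ?I = "{0..2 * pi}" and ?M = "Winf_sup_norm (Suc n) T u"
  have cu: "continuous_on ({0..T} \<times> ?I) (\<lambda>(t, x). u t x)" using heat by (simp add: heat_solution_def)
  have cut: "continuous_on ?I (u t)" if "t \<in> {0..T}" for t
  proof -
    have "continuous_on ?I (\<lambda>x. (t, x))" by (intro continuous_intros)
    moreover have "(\<lambda>x. (t, x)) ` ?I \<subseteq> {0..T} \<times> ?I" using that by auto
    ultimately show ?thesis using continuous_on_compose2[OF cu] by force
  qed
  have inW: "in_Winf (Suc n) (u t)" and MW: "Winf_norm (Suc n) (u t) \<le> ?M" if "t \<in> {0..T}" for t
    using W that unfolding Winf_uniform_def Winf_sup_norm_def by (auto intro: cSUP_upper)
  have "\<forall>t. \<exists>E. t \<in> {0..T} \<longrightarrow> smooth_chain n (Winf_norm (Suc n) (u t)) E \<and> (\<forall>x\<in>?I. E 0 x = u t x)"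
    using Winf_smooth_chain[OF cut inW] by blast
  then obtain E where E: "\<And>t. t \<in> {0..T} \<Longrightarrow> smooth_chain n (Winf_norm (Suc n) (u t)) (E t)"
    "\<And>t x. t \<in> {0..T} \<Longrightarrow> x \<in> ?I \<Longrightarrow> E t 0 x = u t x" by metis
  define D where "D i t = E t i" for i t
  have ch: "smooth_chain n ?M (\<lambda>i. D i t)" if t: "t \<in> {0..T}" for t
  proof -
    note E' = smooth_chainD[OF E(1)[OF t]]
    show ?thesis
      unfolding smooth_chain_def D_def
    proof (intro conjI allI impI ballI)
      fix i x y assume i: "i \<le> n" and x: "x \<in> ?I" and y: "y \<in> ?I"
      show "\<bar>E t i x\<bar> \<le> ?M" using E'(2)[OF i x] MW[OF t] by linarith
      have "Winf_norm (Suc n) (u t) * \<bar>x - y\<bar> \<le> ?M * \<bar>x - y\<bar>" by (rule mult_right_mono[OF MW[OF t]]) simp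
      then show "\<bar>E t i x - E t i y\<bar> \<le> ?M * \<bar>x - y\<bar>" using E'(3)[OF i x y] by linarith
    qed (rule E'(1))
  qed
  have u0: "u t x = D 0 t x" if "t \<in> {0..T}" "x \<in> ?I" for t x using E(2)[OF that] by (simp add: D_def)
  have dD: "(D i t has_real_derivative D (Suc i) t x) (at x within ?I)" if "t \<in> {0..T}" "x \<in> ?I" "i < n" for i t x
    using smooth_chainD(1)[OF ch] that by auto
  \<comment> \<open>The heat equation is stated with the iterated operator \<open>dx\<close>;
    uniqueness of one-sided derivatives at the end points identifies it with the chain up to the
    boundary.\<close>
  have dx_gen: "dx f x = D (Suc i) t x" if "t \<in> {0..T}" "x \<in> ?I" "i < n" "\<And>y. y \<in> ?I \<Longrightarrow> f y = D i t y" for f i t x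
  proof -
    have "(f has_real_derivative D (Suc i) t x) (at x within ?I)"
      by (rule has_field_derivative_transform_within[OF dD[OF that(1-3)] zero_less_one that(2)]) (use that(4) in auto)
    then show ?thesis unfolding dx_def using that(2) by (intro real_vector_derivative_within) auto
  qed
  have d1: "dx (u t) x = D 1 t x" if "t \<in> {0..T}" "x \<in> ?I" for t x
    using dx_gen[OF that, of 0 "u t"] u0[OF that(1)] n by simp
  have d2: "dx (dx (u t)) x = D 2 t x" if "t \<in> {0..T}" "x \<in> ?I" for t x
    using dx_gen[OF that, of 1 "dx (u t)"] d1[OF that(1)] n by (simp add: numeral_2_eq_2)
  have "heat_family n ?M T D"
  proof
    show "2 \<le> n" "0 < T" by fact+
    show "smooth_chain n ?M (\<lambda>i. D i t)" if "t \<in> {0..T}" for t by (rule ch[OF that])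
    show "\<bar>moll p \<epsilon> i (D 0 t) x\<bar> \<le> ?M"
      if "t \<in> {0..T}" "0 < \<epsilon>" "\<epsilon> < x" "x < 2 * pi - \<epsilon>" "i \<le> Suc n" "i < p" for t \<epsilon> x i p
    proof -
      \<comment> \<open>Only values on [0, 2 pi] enter the mollification, and there
        \<open>D 0 t\<close> coincides with \<open>u t\<close>.\<close>
      have "moll p \<epsilon> i (D 0 t) x = moll p \<epsilon> i (u t) x"
        unfolding moll_def using u0[OF that(1)]
        by (intro arg_cong[where f = "\<lambda>a. a / _"] integral_cong) simp
      then show ?thesis using moll_Winf_bound[OF that(2,6,3,4) cut[OF that(1)] inW[OF that(1)] that(5)] MW[OF that(1)] by simp
    qed
    have "continuous_on ({0..T} \<times> ?I) (\<lambda>(t, x). D 0 t x) \<longleftrightarrow> continuous_on ({0..T} \<times> ?I) (\<lambda>(t, x). u t x)"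
      by (rule continuous_on_cong) (auto simp: u0)
    then show "continuous_on ({0..T} \<times> ?I) (\<lambda>(t, x). D 0 t x)" using cu by simp
    fix t x assume t: "0 < t" "t \<le> T" and x: "x \<in> ?I"
    have "((\<lambda>s. u s x) has_vector_derivative dx (dx (u t)) x) (at t within {0..T})"
      using heat t x unfolding heat_solution_def by auto
    then have "((\<lambda>s. u s x) has_real_derivative D 2 t x) (at t within {0..T})"
      using d2[of t x] t x by (simp add: has_real_derivative_iff_has_vector_derivative)
    then show "((\<lambda>s. D 0 s x) has_real_derivative D 2 t x) (at t within {0..T})"
      by (rule has_field_derivative_transform_within[OF _ zero_less_one]) (use t x u0 in auto)
  qed
  then show thesis using that u0 d1 by blast
qed

theorem theorem4p4:
  fixes k :: nat and c :: real
  assumes "1 \<le> k"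
  shows "\<exists>C>0. \<forall>(fl::flux) (b::bc) (T::real) (u0::real \<Rightarrow> real) (u::real \<Rightarrow> real \<Rightarrow> real)
            (N::nat) (X::nat \<Rightarrow> real) (uh::real \<Rightarrow> nat \<Rightarrow> real poly) (qh::real \<Rightarrow> nat \<Rightarrow> real poly).
     0 < T \<longrightarrow>
     heat_solution T u0 u \<longrightarrow>
     Winf_uniform (2 * k + 2) T u \<longrightarrow>
     boundary_cond T fl b u \<longrightarrow>
     quasi_uniform_mesh c N X \<longrightarrow>
     ldg_solution k T fl b N X uh qh \<longrightarrow>
     (\<forall>j\<in>{1..N}. uh 0 j = uI fl k k T X u 0 j) \<longrightarrow>
     (\<forall>t\<in>{0..T}.
        node_max_err N X (u t) (uhat fl N X b t (uh t))
          \<le> C * ((1 + t) * mesh_size N X powr (2 * real k + 1 / 2) * Winf_sup_norm (2 * k + 2) T u) \<and>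
        node_max_err N X (dx (u t)) (qhat fl N X b t (qh t))
          \<le> C * ((1 + t powr (1 / 2)) * mesh_size N X powr (2 * real k + 1 / 2) * Winf_sup_norm (2 * k + 2) T u) \<and>
        node_l2_err N X (u t) (uhat fl N X b t (uh t))
          \<le> C * ((1 + t) * mesh_size N X ^ (2 * k + 1) * Winf_sup_norm (2 * k + 2) T u) \<and>
        node_l2_err N X (dx (u t)) (qhat fl N X b t (qh t))
          \<le> C * ((1 + t powr (1 / 2)) * mesh_size N X ^ (2 * k + 1) * Winf_sup_norm (2 * k + 2) T u))"
proof -
  \<comment> \<open>The constant is fixed before any mesh is given, when the sign of c is still
    open; hence the absolute value. Positivity is obtained by passing to
    \<open>C0 + 1\<close>.\<close>
  define C0 where "C0 = 38880 * (6 * sqrt (real k + 1) * residC k) * sqrt ((2 * real k + 1) * (real k + 1) * \<bar>c\<bar>)"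
  have C0: "0 \<le> C0" unfolding C0_def using residC_nonneg by simp
  show ?thesis
  proof (rule exI[of _ "C0 + 1"], rule conjI, goal_cases)
    case 1
    show ?case using C0 by simp
  next
    case 2
    show ?case
    proof (intro allI impI, rule ballI)
      fix fl b T u0 u N X uh qh t
      assume T: "0 < T" and heat: "heat_solution T u0 u" and W: "Winf_uniform (2 * k + 2) T u"
        and bc: "boundary_cond T fl b u" and mesh: "quasi_uniform_mesh c N X"
        and sol: "ldg_solution k T fl b N X uh qh"
        and init: "\<forall>j\<in>{1..N}. uh 0 j = uI fl k k T X u 0 j" and t: "t \<in> {0..T}"
      let ?M = "Winf_sup_norm (2 * k + 2) T u"
      have n: "2 \<le> 2 * k + 1" "Suc (2 * k + 1) = 2 * k + 2" using assms by auto
      obtain D where D: "heat_family (2 * k + 1) ?M T D"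
        "\<And>t x. t \<in> {0..T} \<Longrightarrow> x \<in> {0..2 * pi} \<Longrightarrow> u t x = D 0 t x"
        "\<And>t x. t \<in> {0..T} \<Longrightarrow> x \<in> {0..2 * pi} \<Longrightarrow> dx (u t) x = D 1 t x"
        using heat_family_exists[OF n(1) T heat, unfolded n(2), OF W] by blast
      have M: "dg_mesh k N X c" using assms mesh by unfold_locales
      interpret ldg_error k N X c ?M T D fl b u uh qh
        using M D(1) by (rule ldg_error.intro, unfold_locales) (use D(2,3) bc sol init in auto)
      have tc: "38880 * (6 * sqrt (real k + 1) * residC k) * sqrt (traceC * c) = C0"
        using c_pos by (simp add: C0_def traceC_def)
      have up: "a \<le> (C0 + 1) * (x * y * ?M)" if "a \<le> C0 * (x * y * ?M)" "0 \<le> x" "0 \<le> y" for a x y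
      proof -
        have "0 \<le> x * y * ?M" using that(2,3) M_nonneg by simp
        then have "C0 * (x * y * ?M) \<le> (C0 + 1) * (x * y * ?M)" by (intro mult_right_mono) auto
        then show ?thesis using that(1) by simp
      qed
      have h0: "0 \<le> mesh_size N X" using h_pos by simp
      show "node_max_err N X (u t) (uhat fl N X b t (uh t))
          \<le> (C0 + 1) * ((1 + t) * mesh_size N X powr (2 * real k + 1 / 2) * ?M) \<and>
        node_max_err N X (dx (u t)) (qhat fl N X b t (qh t))
          \<le> (C0 + 1) * ((1 + t powr (1 / 2)) * mesh_size N X powr (2 * real k + 1 / 2) * ?M) \<and>
        node_l2_err N X (u t) (uhat fl N X b t (uh t))
          \<le> (C0 + 1) * ((1 + t) * mesh_size N X ^ (2 * k + 1) * ?M) \<and>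
        node_l2_err N X (dx (u t)) (qhat fl N X b t (qh t))
          \<le> (C0 + 1) * ((1 + t powr (1 / 2)) * mesh_size N X ^ (2 * k + 1) * ?M)"
        by (intro conjI up final_estimates[OF t, unfolded tc]) (use t h0 in auto)
    qed
  qed
qed

end
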